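(* Let $\alpha\in[0,1)$ and $k\in\mathbb{Z}\setminus\{0\}$, and let $A_\alpha(k)=-\frac{\mathrm{d}^2}{\mathrm{d}x^2}+k^2x^{2\alpha}+\frac{\alpha(2+\alpha)}{4x^2}$ with domain $C^\infty_c(\mathbb{R}^+)$ in $L^2(\mathbb{R}^+)$. Then: (i) $\mathcal{D}(\overline{A_\alpha(k)})=H^2_0(\mathbb{R}^+)\cap L^2(\mathbb{R}^+,\langle x\rangle^{4\alpha}\mathrm{d}x)$. (ii) $\mathcal{D}(A_\alpha(k)^* )=\{g\in L^2(\mathbb{R}^+)\mid (-\frac{\mathrm{d}^2}{\mathrm{d}x^2}+k^2x^{2\alpha}+\frac{\alpha(2+\alpha)}{4x^2})g\in L^2(\mathbb{R}^+)\}=\mathcal{D}(\overline{A_\alpha(k)})\dotplus\mathrm{span}\{\Psi_{\alpha,k}\}\dotplus\mathrm{span}\{\Phi_{\alpha,k}\}$, and $\ker A_\alpha(k)^*=\mathrm{span}\{\Phi_{\alpha,k}\}$. (iii) The Friedrichs extension $A_{\alpha,F}(k)$ of $A_\alpha(k)$ has operator domain $\mathcal{D}(A_{\alpha,F}(k))=\{g\in\mathcal{D}(A_\alpha(k)^* )\mid g(x)=g_1x^{1+\frac{\alpha}{2}}+o(x^{3/2})\text{ as }x\downarrow0\text{ for some }g_1\in\mathbb{C}\}=\mathcal{D}(\overline{A_\alpha(k)})\dotplus\mathrm{span}\{\Psi_{\alpha,k}\}$ and form domain $\mathcal{D}[A_{\alpha,F}(k)]=H^1_0(\mathbb{R}^+)\cap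 L^2(\mathbb{R}^+,\langle x^{2\alpha}\rangle\mathrm{d}x)$. Moreover $A_{\alpha,F}(k)$ is the only self-adjoint extension of $A_\alpha(k)$ whose operator domain is contained in $\mathcal{D}(x^{-1})$, the self-adjointness domain of the operator of multiplication by $x^{-1}$. (iv) The self-adjoint extensions of $A_\alpha(k)$ in $L^2(\mathbb{R}^+)$ form the family $\{A^{[\gamma]}_\alpha(k)\mid\gamma\in\mathbb{R}\cup\{\infty\}\}$, each being the restriction of $A_\alpha(k)^*$ to its domain; $A^{[\infty]}_\alpha(k)=A_{\alpha,F}(k)$, and for $\gamma\in\mathbb{R}$, $\mathcal{D}(A^{[\gamma]}_\alpha(k))=\{g\in\mathcal{D}(A_\alpha(k)^* )\mid g(x)=g_0x^{-\frac{\alpha}{2}}+\gamma g_0x^{1+\frac{\alpha}{2}}+o(x^{3/2})\text{ as }x\downarrow0\text{ for some }g_0\in\mathbb{C}\}$.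
   Context: $\langle x\rangle=\sqrt{1+x^2}$. $H^m_0(\mathbb{R}^+)$ is the closure of $C^\infty_c(\mathbb{R}^+)$ in the $H^m$-norm ($m=1,2$). Derivatives in the description of $\mathcal{D}(A_\alpha(k)^* )$ are weak derivatives. Define on $\mathbb{R}^+$: $\Phi_{\alpha,k}(x)=\sqrt{\frac{\pi(1+\alpha)}{2|k|}}\,x^{-\alpha/2}e^{-\frac{|k|}{1+\alpha}x^{1+\alpha}}$, $F_{\alpha,k}(x)=\sqrt{\frac{2(1+\alpha)}{\pi|k|}}\,x^{-\alpha/2}\sinh\big(\frac{|k|}{1+\alpha}x^{1+\alpha}\big)$, and $\Psi_{\alpha,k}(x)=\frac{1}{1+\alpha}\Big(\Phi_{\alpha,k}(x)\int_0^xF_{\alpha,k}(\rho)\Phi_{\alpha,k}(\rho)\mathrm{d}\rho+F_{\alpha,k}(x)\int_x^{\infty}\Phi_{\alpha,k}(\rho)^2\mathrm{d}\rho\Big)$. *)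

theory Defs
  imports "HOL-Analysis.Analysis" "HOL-Library.Landau_Symbols"
begin

text \<open>Functions on the half line are represented by functions real => complex;
  only values on (0,infinity) matter. L2(R+) is the half line with Lebesgue measure.
  Operators are represented by their graphs (sets of pairs of functions).\<close>

abbreviation Mp :: "real measure" where "Mp \<equiv> lebesgue_on {0<..}"

definition L2 :: "(real \<Rightarrow> complex) \<Rightarrow> bool" where
  "L2 f \<longleftrightarrow> f \<in> borel_measurable Mp \<and> integrable Mp (\<lambda>x. (cmod (f x))^2)"

definition wL2 :: "(real \<Rightarrow> real) \<Rightarrow> (real \<Rightarrow> complex) \<Rightarrow> bool" where
  "wL2 w f \<longleftrightarrow> f \<in> borel_measurable Mp \<and> integrable Mp (\<lambda>x. w x * (cmod (f x))^2)"

definition L2norm :: "(real \<Rightarrow> complex) \<Rightarrow> real" where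
  "L2norm f = sqrt (integral\<^sup>L Mp (\<lambda>x. (cmod (f x))^2))"

definition L2inner :: "(real \<Rightarrow> complex) \<Rightarrow> (real \<Rightarrow> complex) \<Rightarrow> complex" where
  "L2inner f g = integral\<^sup>L Mp (\<lambda>x. cnj (f x) * g x)"

definition L2conv :: "(nat \<Rightarrow> real \<Rightarrow> complex) \<Rightarrow> (real \<Rightarrow> complex) \<Rightarrow> bool" where
  "L2conv s f \<longleftrightarrow> (\<lambda>n. L2norm (\<lambda>x. s n x - f x)) \<longlonglongrightarrow> 0"

definition locL1 :: "(real \<Rightarrow> complex) \<Rightarrow> bool" where
  "locL1 w \<longleftrightarrow> w \<in> borel_measurable Mp \<and>
     (\<forall>a b. 0 < a \<longrightarrow> integrable (lebesgue_on {a..b}) w)"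

definition smooth_real :: "(real \<Rightarrow> real) \<Rightarrow> bool" where
  "smooth_real u \<longleftrightarrow> (\<forall>n x. (deriv ^^ n) u field_differentiable (at x))"

definition Cc_inf :: "(real \<Rightarrow> complex) set" where
  "Cc_inf = {\<phi>. smooth_real (\<lambda>x. Re (\<phi> x)) \<and> smooth_real (\<lambda>x. Im (\<phi> x)) \<and>
     (\<exists>a b. 0 < a \<and> a \<le> b \<and> (\<forall>x. x \<notin> {a..b} \<longrightarrow> \<phi> x = 0))}"

definition cderiv :: "(real \<Rightarrow> complex) \<Rightarrow> real \<Rightarrow> complex" where
  "cderiv \<phi> x = Complex (deriv (\<lambda>t. Re (\<phi> t)) x) (deriv (\<lambda>t. Im (\<phi> t)) x)"

definition H1_0 :: "(real \<Rightarrow> complex) set" where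
  "H1_0 = {f. L2 f \<and> (\<exists>g1 s. L2 g1 \<and> (\<forall>n. s n \<in> Cc_inf) \<and> L2conv s f \<and>
            L2conv (\<lambda>n. cderiv (s n)) g1)}"

definition H2_0 :: "(real \<Rightarrow> complex) set" where
  "H2_0 = {f. L2 f \<and> (\<exists>g1 g2 s. L2 g1 \<and> L2 g2 \<and> (\<forall>n. s n \<in> Cc_inf) \<and> L2conv s f \<and>
            L2conv (\<lambda>n. cderiv (s n)) g1 \<and> L2conv (\<lambda>n. cderiv (cderiv (s n))) g2)}"

definition Vpot :: "real \<Rightarrow> int \<Rightarrow> real \<Rightarrow> real" where
  "Vpot \<alpha> k x = (real_of_int k)^2 * x powr (2*\<alpha>) + \<alpha> * (2 + \<alpha>) / (4 * x^2)"

definition tau :: "real \<Rightarrow> int \<Rightarrow> (real \<Rightarrow> complex) \<Rightarrow> real \<Rightarrow> complex" where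
  "tau \<alpha> k \<phi> x = - cderiv (cderiv \<phi>) x + complex_of_real (Vpot \<alpha> k x) * \<phi> x"

definition Aop :: "real \<Rightarrow> int \<Rightarrow> ((real \<Rightarrow> complex) \<times> (real \<Rightarrow> complex)) set" where
  "Aop \<alpha> k = {(\<phi>, tau \<alpha> k \<phi>) | \<phi>. \<phi> \<in> Cc_inf}"

definition opdom :: "((real \<Rightarrow> complex) \<times> (real \<Rightarrow> complex)) set \<Rightarrow> (real \<Rightarrow> complex) set" where
  "opdom T = fst ` T"

text \<open>Adjoint and closure of an operator (graphs, elements of L2 up to a.e. equality)\<close>
definition adj :: "((real \<Rightarrow> complex) \<times> (real \<Rightarrow> complex)) set \<Rightarrow> ((real \<Rightarrow> complex) \<times> (real \<Rightarrow> complex)) set" where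
  "adj T = {(g, h). L2 g \<and> L2 h \<and> (\<forall>(f, u) \<in> T. L2inner u g = L2inner f h)}"

definition opclosure :: "((real \<Rightarrow> complex) \<times> (real \<Rightarrow> complex)) set \<Rightarrow> ((real \<Rightarrow> complex) \<times> (real \<Rightarrow> complex)) set" where
  "opclosure T = {(f, h). L2 f \<and> L2 h \<and> (\<exists>s. (\<forall>n. s n \<in> T) \<and>
      L2conv (\<lambda>n. fst (s n)) f \<and> L2conv (\<lambda>n. snd (s n)) h)}"

definition sa_ext :: "real \<Rightarrow> int \<Rightarrow> ((real \<Rightarrow> complex) \<times> (real \<Rightarrow> complex)) set \<Rightarrow> bool" where
  "sa_ext \<alpha> k S \<longleftrightarrow> Aop \<alpha> k \<subseteq> S \<and> S = adj S"

definition Dmax :: "real \<Rightarrow> int \<Rightarrow> (real \<Rightarrow> complex) set" where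
  "Dmax \<alpha> k = {g. L2 g \<and> (\<exists>w. locL1 w \<and>
      (\<forall>\<phi>\<in>Cc_inf. integral\<^sup>L Mp (\<lambda>x. g x * cderiv (cderiv \<phi>) x) = integral\<^sup>L Mp (\<lambda>x. w x * \<phi> x)) \<and>
      L2 (\<lambda>x. - w x + complex_of_real (Vpot \<alpha> k x) * g x))}"

text \<open>Friedrichs extension: operator associated with the closure of the form
  q(phi,psi) = <phi, A psi> on C_c^infinity(R+).\<close>
definition form_approx :: "real \<Rightarrow> int \<Rightarrow> (real \<Rightarrow> complex) \<Rightarrow> (nat \<Rightarrow> real \<Rightarrow> complex) \<Rightarrow> bool" where
  "form_approx \<alpha> k f s \<longleftrightarrow> L2 f \<and> (\<forall>n. s n \<in> Cc_inf) \<and> L2conv s f \<and>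
     (\<forall>\<epsilon>>0. \<exists>N. \<forall>m\<ge>N. \<forall>n\<ge>N.
        Re (L2inner (\<lambda>x. s m x - s n x) (tau \<alpha> k (\<lambda>x. s m x - s n x))) < \<epsilon>)"

definition form_dom :: "real \<Rightarrow> int \<Rightarrow> (real \<Rightarrow> complex) set" where
  "form_dom \<alpha> k = {f. \<exists>s. form_approx \<alpha> k f s}"

definition Friedrichs :: "real \<Rightarrow> int \<Rightarrow> ((real \<Rightarrow> complex) \<times> (real \<Rightarrow> complex)) set" where
  "Friedrichs \<alpha> k = {(f, h). f \<in> form_dom \<alpha> k \<and> L2 h \<and>
     (\<forall>g s t. form_approx \<alpha> k g s \<longrightarrow> form_approx \<alpha> k f t \<longrightarrow>
        (\<lambda>n. L2inner (s n) (tau \<alpha> k (t n))) \<longlonglongrightarrow> L2inner g h)}"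

definition Dxinv :: "(real \<Rightarrow> complex) set" where
  "Dxinv = {f. L2 f \<and> L2 (\<lambda>x. f x / complex_of_real x)}"

definition PhiF :: "real \<Rightarrow> int \<Rightarrow> real \<Rightarrow> real" where
  "PhiF \<alpha> k x = sqrt (pi * (1 + \<alpha>) / (2 * \<bar>real_of_int k\<bar>)) * x powr (- \<alpha> / 2) *
     exp (- (\<bar>real_of_int k\<bar> / (1 + \<alpha>)) * x powr (1 + \<alpha>))"

definition FF :: "real \<Rightarrow> int \<Rightarrow> real \<Rightarrow> real" where
  "FF \<alpha> k x = sqrt (2 * (1 + \<alpha>) / (pi * \<bar>real_of_int k\<bar>)) * x powr (- \<alpha> / 2) *
     sinh ((\<bar>real_of_int k\<bar> / (1 + \<alpha>)) * x powr (1 + \<alpha>))"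

definition PsiF :: "real \<Rightarrow> int \<Rightarrow> real \<Rightarrow> real" where
  "PsiF \<alpha> k x = 1 / (1 + \<alpha>) *
     (PhiF \<alpha> k x * integral\<^sup>L (lebesgue_on {0<..x}) (\<lambda>\<rho>. FF \<alpha> k \<rho> * PhiF \<alpha> k \<rho>) +
      FF \<alpha> k x * integral\<^sup>L (lebesgue_on {x<..}) (\<lambda>\<rho>. (PhiF \<alpha> k \<rho>)^2))"

abbreviation Phi :: "real \<Rightarrow> int \<Rightarrow> real \<Rightarrow> complex" where
  "Phi \<alpha> k x \<equiv> complex_of_real (PhiF \<alpha> k x)"
abbreviation Psi :: "real \<Rightarrow> int \<Rightarrow> real \<Rightarrow> complex" where
  "Psi \<alpha> k x \<equiv> complex_of_real (PsiF \<alpha> k x)"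

definition asymp_near0 :: "(real \<Rightarrow> complex) \<Rightarrow> (real \<Rightarrow> complex) \<Rightarrow> bool" where
  "asymp_near0 g p \<longleftrightarrow> (\<exists>g'. (AE x in Mp. g' x = g x) \<and>
     (\<lambda>x. g' x - p x) \<in> o[at_right 0](\<lambda>x. complex_of_real (x powr (3/2))))"

text \<open>domains of the family A^[gamma], gamma in R \<union> {infinity}; None encodes infinity\<close>
definition Dgamma :: "real \<Rightarrow> int \<Rightarrow> real option \<Rightarrow> (real \<Rightarrow> complex) set" where
  "Dgamma \<alpha> k \<gamma> = (case \<gamma> of
      None \<Rightarrow> {g \<in> opdom (adj (Aop \<alpha> k)). \<exists>g1::complex.
                 asymp_near0 g (\<lambda>x. g1 * complex_of_real (x powr (1 + \<alpha>/2)))}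
    | Some c \<Rightarrow> {g \<in> opdom (adj (Aop \<alpha> k)). \<exists>g0::complex.
                 asymp_near0 g (\<lambda>x. g0 * complex_of_real (x powr (- \<alpha>/2)) +
                                    complex_of_real c * g0 * complex_of_real (x powr (1 + \<alpha>/2)))})"

definition Agamma :: "real \<Rightarrow> int \<Rightarrow> real option \<Rightarrow> ((real \<Rightarrow> complex) \<times> (real \<Rightarrow> complex)) set" where
  "Agamma \<alpha> k \<gamma> = {(f, h) \<in> adj (Aop \<alpha> k). f \<in> Dgamma \<alpha> k \<gamma>}"

end

theory Submission
  imports Defs "HOL-Real_Asymp.Real_Asymp"
begin

text \<open>
  For test functions \<open>\<phi>\<close>, expanding squares and integrating by parts (Hardy, Rellich, and a
  sum-of-squares identity for the cross term between the two parts of the potential) bounds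
  \<open>\<phi>\<close>, \<open>\<phi>''\<close>, \<open>\<phi> / x\<^sup>2\<close> and \<open>x powr (2 * \<alpha>) * \<phi>\<close> in \<open>L\<^sup>2\<close> by \<open>A \<phi>\<close>. So the graph norm is
  equivalent to a weighted \<open>H\<^sup>2\<close> norm, which identifies the domain of the closure, and the closure
  has closed range. The factorisation \<open>A (\<Phi> w) = - (\<Phi>\<^sup>2 w')' / \<Phi>\<close> shows that weak solutions of
  \<open>A g = 0\<close> are combinations of \<open>\<Phi>\<close> and \<open>F\<close>, and \<open>F\<close> is not square integrable; hence the kernel of
  \<open>A\<^sup>*\<close> is spanned by \<open>\<Phi>\<close>. As that kernel is the orthogonal complement of the range and
  \<open>A\<^sup>* \<Psi> = \<Phi>\<close>, every element of the domain of \<open>A\<^sup>*\<close> is \<open>f + c \<Psi> + d \<Phi>\<close> with \<open>f\<close> in the domain of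
  the closure.

  Elements of \<open>H\<^sup>2\<^sub>0\<close> are \<open>o(x powr (3/2))\<close> at zero, so \<open>c\<close> and \<open>d\<close> are read off from the asymptotics. The
  boundary form of \<open>A\<^sup>*\<close> is \<open>\<parallel>\<Phi>\<parallel>\<^sup>2 (cnj d * c' - cnj c * d')\<close>, so the self-adjoint extensions are the
  real lines in the \<open>(c, d)\<close> plane. The Friedrichs extension is onto because the form is coercive
  (Riesz), and Hardy's inequality puts its domain into that of \<open>x\<^sup>-\<^sup>1\<close>, which excludes \<open>d \<noteq> 0\<close>.
\<close>

section \<open>Test functions on the half line\<close>

text \<open>Elements of L2 are functions here, not classes, so equality almost everywhere is carried
  along explicitly and closures are expressed by sequences of test functions. Two obstacles shape
  the argument. A weak solution of the equation cannot be differentiated a priori; dividing by the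
  positive solution \<Phi> turns the second-order equation into a statement about a single weak
  derivative, which du Bois-Reymond's lemma settles. And the deficiency spaces at i and -i are not
  explicit; since the form is bounded below by 1/4, the point 0 is of regular type, and the explicit
  kernel at 0 replaces them. The hypothesis \<alpha> < 1 has three faces: \<Phi> is square
  integrable at 0; the coefficient of 1/x^2 stays below 3/4, where the Rellich-type bound
  degenerates; and 1 + \<alpha>/2 stays below 3/2, so both boundary coefficients remain visible
  modulo o(x^(3/2)). The exponents -\<alpha>/2 and 1 + \<alpha>/2 are the roots of s (s - 1) =
  \<alpha> (2 + \<alpha>)/4.\<close>

lemma integrable_Mp_iff:
  "integrable Mp f \<longleftrightarrow> integrable lebesgue (\<lambda>x. indicator {0<..} x *\<^sub>R (f x :: 'b :: euclidean_space))"
  by (simp add: integrable_restrict_space)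

text \<open>Passes from the Lebesgue integral over the half line to the gauge integral over a
  compact interval, to which the fundamental theorem of calculus applies.\<close>

lemma compact_support_integral_Mp:
  fixes f :: "real \<Rightarrow> 'b :: euclidean_space"
  assumes "continuous_on {0<..} f" "0 < a" "\<And>x. x \<notin> {a..b} \<Longrightarrow> f x = 0"
  shows "integrable Mp f" "integral\<^sup>L Mp f = integral {a..b} f"
proof -
  have "continuous_on {a..b} f"
    by (rule continuous_on_subset[OF assms(1)]) (use assms(2) in auto)
  then have i: "integrable (lebesgue_on {a..b}) f"
    by (rule continuous_imp_integrable_real)
  have e: "indicator {0<..} x *\<^sub>R f x = indicator {a..b} x *\<^sub>R f x" for x
    using assms(2) assms(3)[of x] by (auto simp: indicator_def)
  show "integrable Mp f"
    using i unfolding integrable_Mp_iff e by (simp add: integrable_restrict_space)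
  have "integral\<^sup>L Mp f = integral\<^sup>L (lebesgue_on {a..b}) f"
    by (simp add: integral_restrict_space e)
  also have "\<dots> = integral {a..b} f"
    using i by (intro lebesgue_integral_eq_integral) auto
  finally show "integral\<^sup>L Mp f = integral {a..b} f" .
qed

text \<open>Every integration by parts below is an instance: the boundary terms are collected in one
  compactly supported primitive \<open>H\<close>.\<close>

lemma integral_Mp_derivative_eq_0:
  fixes H h :: "real \<Rightarrow> 'b :: euclidean_space"
  assumes d: "\<And>x. 0 < x \<Longrightarrow> (H has_vector_derivative h x) (at x)"
    and c: "continuous_on {0<..} h" and a: "0 < a" and z: "\<And>x. x \<notin> {a..b} \<Longrightarrow> h x = 0"
    "\<And>x. x \<notin> {a..b} \<Longrightarrow> H x = 0"
  shows "integral\<^sup>L Mp h = 0"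
proof -
  \<comment> \<open>Both endpoints lie strictly outside the support, where \<open>H\<close>
    vanishes; \<open>b\<close> may be smaller than \<open>a\<close>, hence the maximum.\<close>
  define a' b' where "a' = a / 2" and "b' = max a b + 1"
  have ab: "0 < a'" "a' < a" "b < b'" "a' \<le> b'"
    using a by (auto simp: a'_def b'_def)
  have "integral\<^sup>L Mp h = integral {a'..b'} h"
    by (rule compact_support_integral_Mp[OF c]) (use ab z in auto)
  also have "(h has_integral (H b' - H a')) {a'..b'}"
    by (rule fundamental_theorem_of_calculus)
       (use ab d in \<open>auto intro: has_vector_derivative_at_within\<close>)
  then have "integral {a'..b'} h = H b' - H a'"
    by (rule integral_unique)
  also have "\<dots> = 0" using ab z by auto
  finally show ?thesis .
qed

section \<open>Smooth functions, closure properties and the flat exponential\<close>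

text \<open>Smoothness is a greatest fixed point: if every member of a class has a derivative in the
  class, then all iterated derivatives stay in the class and are differentiable.\<close>

lemma smooth_real_coinduct:
  assumes "P u"
    and step: "\<And>u. P u \<Longrightarrow> \<exists>u'. (\<forall>x. (u has_real_derivative u' x) (at x)) \<and> P u'"
  shows "smooth_real u"
proof -
  have P: "P ((deriv ^^ n) u)" for n
  proof (induction n)
    case (Suc n)
    from step[OF this] obtain u' where u': "\<And>x. ((deriv ^^ n) u has_real_derivative u' x) (at x)" "P u'"
      by blast
    then have "deriv ((deriv ^^ n) u) = u'" by (auto intro: DERIV_imp_deriv)
    with u' show ?case by simp
  qed (use assms in simp)
  show ?thesis
    unfolding smooth_real_def using step[OF P] field_differentiable_def by blast
qed

lemma smooth_real_deriv:
  assumes "smooth_real u"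
  shows "(u has_real_derivative deriv u x) (at x)" "smooth_real (deriv u)"
proof -
  have "(deriv ^^ 0) u field_differentiable at x" using assms unfolding smooth_real_def by blast
  then show "(u has_real_derivative deriv u x) (at x)"
    by (simp add: DERIV_deriv_iff_field_differentiable)
  have "(deriv ^^ n) (deriv u) field_differentiable at x" for n x
    using assms[unfolded smooth_real_def, rule_format, of "Suc n" x]
    by (simp add: funpow_swap1)
  then show "smooth_real (deriv u)" unfolding smooth_real_def by blast
qed

text \<open>The derivative of a product or of a composite term is a sum of terms of the same kind.
  Closing under addition once and for all lets the class \<open>B\<close> in the coinduction consist
  of single terms.\<close>

inductive fspan :: "(real \<Rightarrow> real) set \<Rightarrow> (real \<Rightarrow> real) \<Rightarrow> bool" for B where
  base: "u \<in> B \<Longrightarrow> fspan B u"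
| add: "fspan B u \<Longrightarrow> fspan B v \<Longrightarrow> fspan B (\<lambda>x. u x + v x)"

lemma smooth_real_fspan:
  assumes B: "\<And>u. u \<in> B \<Longrightarrow> \<exists>u'. (\<forall>x. (u has_real_derivative u' x) (at x)) \<and> fspan B u'"
    and "fspan B u"
  shows "smooth_real u"
proof (rule smooth_real_coinduct[where P = "fspan B"])
  fix u assume "fspan B u"
  then show "\<exists>u'. (\<forall>x. (u has_real_derivative u' x) (at x)) \<and> fspan B u'"
  proof induction
    case (add u v)
    then obtain u' v' where
      *: "\<And>x. (u has_real_derivative u' x) (at x)" "fspan B u'"
         "\<And>x. (v has_real_derivative v' x) (at x)" "fspan B v'" by blast
    have "(\<forall>x. ((\<lambda>x. u x + v x) has_real_derivative u' x + v' x) (at x)) \<and> fspan B (\<lambda>x. u' x + v' x)"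
      by (intro conjI allI DERIV_add * fspan.add)
    then show ?case by (rule exI[of _ "\<lambda>x. u' x + v' x"])
  qed (rule B)
qed fact

lemma smooth_real_mult:
  assumes "smooth_real u" "smooth_real v"
  shows "smooth_real (\<lambda>x. u x * v x)"
proof (rule smooth_real_fspan[where B = "{\<lambda>x. u x * v x | u v. smooth_real u \<and> smooth_real v}"])
  let ?B = "{\<lambda>x. u x * v x | u v. smooth_real u \<and> smooth_real v}"
  fix w assume "w \<in> ?B"
  then obtain u v where w: "w = (\<lambda>x. u x * v x)" "smooth_real u" "smooth_real v" by auto
  have "fspan ?B (\<lambda>x. deriv u x * v x + u x * deriv v x)"
    by (intro fspan.add fspan.base) (use w smooth_real_deriv in blast)+
  moreover have "(w has_real_derivative deriv u x * v x + u x * deriv v x) (at x)" for x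
    unfolding w by (rule derivative_eq_intros smooth_real_deriv w refl)+ simp
  ultimately show "\<exists>u'. (\<forall>x. (w has_real_derivative u' x) (at x)) \<and> fspan ?B u'"
    by (intro exI[of _ "\<lambda>x. deriv u x * v x + u x * deriv v x"]) simp
qed (intro fspan.base, use assms in blast)

lemma smooth_real_add:
  assumes "smooth_real u" "smooth_real v"
  shows "smooth_real (\<lambda>x. u x + v x)"
  by (rule smooth_real_fspan[where B = "Collect smooth_real"])
     (use assms smooth_real_deriv in \<open>blast intro: fspan.base fspan.add\<close>)+

lemma smooth_real_affine:
  assumes "smooth_real u"
  shows "smooth_real (\<lambda>x. a * u (m * x + c))"
\<comment> \<open>The amplitude is quantified because each differentiation multiplies it by
  \<open>m\<close>.\<close>
proof (rule smooth_real_coinduct[where P = "\<lambda>w. \<exists>u a. smooth_real u \<and> w = (\<lambda>x. a * u (m * x + c))"])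
  fix w assume "\<exists>u a. smooth_real u \<and> w = (\<lambda>x. a * u (m * x + c))"
  then obtain u a where w: "smooth_real u" "w = (\<lambda>x. a * u (m * x + c))" by blast
  have "(w has_real_derivative a * m * deriv u (m * x + c)) (at x)" for x
  proof -
    have "((\<lambda>x. m * x + c) has_real_derivative m) (at x)"
      by (auto intro!: derivative_eq_intros)
    from DERIV_chain2[OF smooth_real_deriv(1)[OF w(1)] this, THEN DERIV_cmult, of a]
    show ?thesis unfolding w by (simp add: mult_ac)
  qed
  then show "\<exists>u'. (\<forall>x. (w has_real_derivative u' x) (at x)) \<and>
       (\<exists>u a. smooth_real u \<and> u' = (\<lambda>x. a * u (m * x + c)))"
    using smooth_real_deriv(2)[OF w(1)] by (intro exI[of _ "\<lambda>x. a * m * deriv u (m * x + c)"]) blast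
qed (use assms in blast)

text \<open>The classical flat function at 0; all bumps are products of rescaled copies of
  it.\<close>

definition expinv :: "real \<Rightarrow> real" where
  "expinv x = (if 0 < x then exp (- (1 / x)) else 0)"

text \<open>On the positive side the derivatives are combinations of powers of 1/x times exp (-
  (1/x)); such terms, extended by 0, form a class closed under differentiation because the
  exponential beats every power at 0.\<close>

lemma smooth_real_expinv: "smooth_real expinv"
proof (rule smooth_real_fspan)
  let ?b = "\<lambda>c n x :: real. if 0 < x then c * (1 / x) ^ n * exp (- (1 / x)) else 0"
  let ?B = "{?b c n | c n. True}"
  have B: "?b c n \<in> ?B" for c n by blast
  show "fspan ?B expinv"
  proof (rule fspan.base)
    have "expinv = ?b 1 0" by (auto simp: expinv_def)
    then show "expinv \<in> ?B" by blast
  qed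
  fix u assume "u \<in> ?B"
  then obtain c n where u: "u = ?b c n" by auto
  let ?u' = "\<lambda>x. ?b (- c * n) (Suc n) x + ?b c (Suc (Suc n)) x"
  have sp: "fspan ?B ?u'"
    by (rule fspan.add; rule fspan.base; rule B)
  have "(u has_real_derivative ?u' x) (at x)" for x
  proof -
    consider "x > 0" | "x < 0" | "x = 0" by linarith
    then show ?thesis
    proof cases
      case 1
      have "((\<lambda>x. 1 / x) has_real_derivative - ((1 / x) ^ 2)) (at x)"
        using 1 by (auto intro!: derivative_eq_intros simp: power2_eq_square)
      from DERIV_power[OF this, of n]
      have p: "((\<lambda>x. (1 / x) ^ n) has_real_derivative - (n * (1 / x) ^ Suc n)) (at x)"
        by (rule DERIV_cong) (cases n; simp add: power2_eq_square mult_ac)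
      have "((\<lambda>x. c * (1 / x) ^ n * exp (- (1 / x))) has_real_derivative ?u' x) (at x)"
      proof -
        have "((\<lambda>x. exp (- (1 / x))) has_real_derivative exp (- (1 / x)) * (1 / x) ^ 2) (at x)"
          using 1 by (auto intro!: derivative_eq_intros simp: power2_eq_square)
        from DERIV_mult[OF DERIV_cmult[OF p] this, of c] show ?thesis
          by (rule DERIV_cong) (use 1 in \<open>simp add: algebra_simps power2_eq_square\<close>)
      qed
      then show ?thesis
        by (rule DERIV_cong_ev[THEN iffD1, rotated -1])
           (use 1 in \<open>auto simp: u intro: eventually_mono[OF eventually_gt_at_top] eventually_nhds_in_open[of "{0<..}", THEN eventually_mono]\<close>)
    next
      case 2
      have "((\<lambda>x. 0) has_real_derivative 0) (at x)" by simp
      moreover have "\<forall>\<^sub>F y in nhds x. 0 = u y"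
        using 2 by (intro eventually_nhds_in_open[of "{..<0}", THEN eventually_mono]) (auto simp: u)
      ultimately have "(u has_real_derivative 0) (at x)"
        using DERIV_cong_ev[of x x "\<lambda>x. 0" u 0 0] by simp
      then show ?thesis using 2 by auto
    next
      case 3
      have r: "((\<lambda>h. (u (0 + h) - u 0) / h) \<longlongrightarrow> 0) (at_right 0)"
      proof -
        \<comment> \<open>With y = 1/h the right difference quotient at 0 becomes c y^(n+1) / exp y;
          the extra power of y is the division by h.\<close>
        have "((\<lambda>y::real. c * (y ^ Suc n / exp y)) \<longlongrightarrow> c * 0) at_top"
          by (intro tendsto_intros tendsto_power_div_exp_0)
        then have "((\<lambda>h. c * (inverse h ^ Suc n / exp (inverse h))) \<longlongrightarrow> 0) (at_right (0::real))"
          using filterlim_compose[OF _ filterlim_inverse_at_top_right] by auto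
        then show ?thesis
          by (rule tendsto_cong[THEN iffD1, rotated])
             (auto simp: eventually_at_right_field u exp_minus field_simps intro!: exI[of _ 1])
      qed
      have l: "((\<lambda>h. (u (0 + h) - u 0) / h) \<longlongrightarrow> 0) (at_left 0)"
        by (rule tendsto_cong[THEN iffD1, OF _ tendsto_const])
           (auto simp: eventually_at_left_field u intro!: exI[of _ "-1"])
      have "((\<lambda>h. (u (0 + h) - u 0) / h) \<longlongrightarrow> 0) (at 0)"
        using l r by (simp add: filterlim_split_at)
      then show ?thesis using 3 by (simp add: DERIV_def)
    qed
  qed
  with sp show "\<exists>u'. (\<forall>x. (u has_real_derivative u' x) (at x)) \<and> fspan ?B u'"
    by (intro exI[of _ ?u']) simp
qed

section \<open>Real test functions\<close>

text \<open>The real counterpart of \<open>Cc_inf\<close>: estimates are proved for real functions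
  and lifted to complex ones through real and imaginary parts.\<close>

definition test_fun :: "(real \<Rightarrow> real) \<Rightarrow> bool" where
  "test_fun u \<longleftrightarrow> smooth_real u \<and> (\<exists>a b. 0 < a \<and> a \<le> b \<and> (\<forall>x. x \<notin> {a..b} \<longrightarrow> u x = 0))"

lemma test_fun_deriv:
  assumes "test_fun u"
  shows "(u has_real_derivative deriv u x) (at x)" "test_fun (deriv u)"
proof -
  from assms obtain a b where u: "smooth_real u" "0 < a" "a \<le> b" "\<And>x. x \<notin> {a..b} \<Longrightarrow> u x = 0"
    unfolding test_fun_def by blast
  show "(u has_real_derivative deriv u x) (at x)" by (rule smooth_real_deriv[OF u(1)])
  have "deriv u x = 0" if "x \<notin> {a..b}" for x
  proof -
    have "((\<lambda>x. 0) has_real_derivative 0) (at x)" by simp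
    moreover have "\<forall>\<^sub>F y in nhds x. 0 = u y"
      using that u(4) by (intro eventually_nhds_in_open[of "- {a..b}", THEN eventually_mono]) (auto simp: open_Compl)
    ultimately have "(u has_real_derivative 0) (at x)"
      using DERIV_cong_ev[of x x "\<lambda>x. 0" u 0 0] by simp
    then show ?thesis by (rule DERIV_imp_deriv)
  qed
  then show "test_fun (deriv u)"
    using u smooth_real_deriv(2) unfolding test_fun_def by blast
qed

lemma test_fun_common_support:
  assumes "test_fun u" "test_fun v"
  obtains a b where "0 < a" "a \<le> b" "\<And>x. x \<notin> {a..b} \<Longrightarrow> u x = 0" "\<And>x. x \<notin> {a..b} \<Longrightarrow> v x = 0"
proof -
  from assms obtain a b a' b' where *: "0 < a" "a \<le> b" "\<And>x. x \<notin> {a..b} \<Longrightarrow> u x = 0"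
    "0 < a'" "a' \<le> b'" "\<And>x. x \<notin> {a'..b'} \<Longrightarrow> v x = 0"
    unfolding test_fun_def by metis
  show ?thesis
    by (rule that[of "min a a'" "max b b'"]) (use * in \<open>auto simp: min_def max_def split: if_splits\<close>)
qed

lemma test_fun_mult: "test_fun u \<Longrightarrow> smooth_real v \<Longrightarrow> test_fun (\<lambda>x. v x * u x)"
  unfolding test_fun_def by (metis mult_zero_right smooth_real_mult)

lemma test_fun_add:
  assumes "test_fun u" "test_fun v"
  shows "test_fun (\<lambda>x. u x + v x)"
proof -
  obtain a b where "0 < a" "a \<le> b" "\<And>x. x \<notin> {a..b} \<Longrightarrow> u x = 0" "\<And>x. x \<notin> {a..b} \<Longrightarrow> v x = 0"
    using test_fun_common_support[OF assms] by metis
  then show ?thesis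
    using assms unfolding test_fun_def by (metis add_0 smooth_real_add)
qed

lemma smooth_real_const: "smooth_real (\<lambda>x. c)"
  by (rule smooth_real_coinduct[where P = "\<lambda>u. \<exists>c. u = (\<lambda>x. c)"]) (auto intro!: exI[of _ "\<lambda>x. 0"])

lemma test_fun_cmult: "test_fun u \<Longrightarrow> test_fun (\<lambda>x. c * u x)"
  by (rule test_fun_mult[OF _ smooth_real_const])

lemma test_fun_0: "test_fun (\<lambda>x. 0)"
  unfolding test_fun_def using smooth_real_const by (auto intro: exI[of _ 1])

lemma test_fun_minus: "test_fun u \<Longrightarrow> test_fun (\<lambda>x. - u x)"
  using test_fun_cmult[of u "-1"] by simp

lemma test_fun_continuous: "test_fun u \<Longrightarrow> continuous_on S u"
  by (meson DERIV_atLeastAtMost_imp_continuous_on DERIV_continuous_on DERIV_subset has_field_derivative_at_within test_fun_deriv(1))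

lemma test_fun_integrable:
  assumes "test_fun u" shows "integrable Mp u"
proof -
  obtain a b where "0 < a" "\<And>x. x \<notin> {a..b} \<Longrightarrow> u x = 0"
    using assms unfolding test_fun_def by blast
  then show ?thesis using compact_support_integral_Mp(1)[OF test_fun_continuous[OF assms]] by blast
qed

text \<open>The primitive starting at 0 vanishes to the left of the support, and mean zero makes it
  vanish to the right as well. This solvability is the core of du Bois-Reymond's argument.\<close>

lemma test_fun_antiderivative:
  assumes "test_fun u" "integral\<^sup>L Mp u = 0"
  obtains v where "test_fun v" "\<And>x. (v has_real_derivative u x) (at x)"
proof -
  obtain a b where u: "smooth_real u" "0 < a" "a \<le> b" "\<And>x. x \<notin> {a..b} \<Longrightarrow> u x = 0"
    using assms(1) unfolding test_fun_def by blast
  define v where "v = (\<lambda>x. integral {0..x} u)"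
  have c: "continuous_on S u" for S by (rule test_fun_continuous[OF assms(1)])
  have v0: "v x = 0" if "x < a" for x
  proof -
    have "v x = integral {0..x} (\<lambda>x. 0)"
      unfolding v_def by (rule integral_cong) (use u(4) that in auto)
    then show ?thesis by simp
  qed
  have d: "(v has_real_derivative u x) (at x)" for x
  proof (cases "x > 0")
    case True
    have "(v has_real_derivative u x) (at x within {0..x + 1})"
      unfolding v_def by (rule integral_has_real_derivative) (use True c in auto)
    then show ?thesis
      using True at_within_Icc_at[of 0 x "x + 1"] by simp
  next
    \<comment> \<open>The integral formula does not reach x \<le> 0; there \<open>v\<close> vanishes
      on the whole neighbourhood {..<a}.\<close>
    case False
    have "((\<lambda>x. 0) has_real_derivative 0) (at x)" by simp
    moreover have "\<forall>\<^sub>F y in nhds x. 0 = v y"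
      using False v0 u(2) by (intro eventually_nhds_in_open[of "{..<a}", THEN eventually_mono]) auto
    ultimately have "(v has_real_derivative 0) (at x)"
      using DERIV_cong_ev[of x x "\<lambda>x. 0" v 0 0] by simp
    then show ?thesis using u(2) u(4)[of x] False by auto
  qed
  have v1: "v x = 0" if "x > b" for x
  proof -
    have "integral\<^sup>L Mp u = integral {a..x} u"
      by (rule compact_support_integral_Mp(2)[OF c]) (use u that in auto)
    moreover have "v x = integral {0..a} u + integral {a..x} u"
      unfolding v_def
      by (rule Henstock_Kurzweil_Integration.integral_combine[symmetric]) (use u that c in \<open>auto intro: integrable_continuous_real\<close>)
    moreover have "integral {0..a} u = 0"
    proof -
      have "integral {0..a} u = integral {0..a} (\<lambda>x. 0)"
        by (rule integral_spike[of "{a}"]) (use u(4) in auto)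
      then show ?thesis by simp
    qed
    ultimately show ?thesis using assms(2) by simp
  qed
  have "smooth_real v"
    by (rule smooth_real_coinduct[where P = "\<lambda>w. w = v \<or> smooth_real w"])
       (use d u(1) smooth_real_deriv in blast)+
  then have "test_fun v" unfolding test_fun_def using u(2,3) v0 v1
    by (intro conjI exI[of _ a] exI[of _ b]) auto
  then show ?thesis using d that by blast
qed

text \<open>Prepares multiplication and division of test functions by powers of \<Phi>. With
  \<open>u\<close> and the exponent \<open>s\<close> variable, the derivative is a sum of three
  terms of the same shape, and the support of \<open>u\<close> hides the singularity of the powers
  at 0.\<close>

lemma test_fun_times_powr_exp:
  assumes "test_fun u"
  shows "test_fun (\<lambda>x. u x * x powr s * exp (c * x powr p))"
proof -
  let ?b = "\<lambda>u s (x::real). u x * x powr s * exp (c * x powr p)"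
  let ?B = "{?b u s | u s. test_fun u}"
  have B: "test_fun u \<Longrightarrow> ?b u s \<in> ?B" for u s by blast
  have "smooth_real (?b u s)"
  proof (rule smooth_real_fspan)
    show "fspan ?B (?b u s)" by (rule fspan.base, rule B, fact)
    fix w assume "w \<in> ?B"
    then obtain u s where u: "test_fun u" and w: "w = ?b u s" by auto
    let ?w = "\<lambda>x. ?b (deriv u) s x + (?b (\<lambda>x. s * u x) (s - 1) x + ?b (\<lambda>x. (c * p) * u x) (s + (p - 1)) x)"
    have f: "fspan ?B ?w"
      by (rule fspan.add | rule fspan.base | rule B | rule test_fun_deriv test_fun_cmult | rule u)+
    obtain a b where ab: "0 < a" "\<And>x. x \<notin> {a..b} \<Longrightarrow> u x = 0" "\<And>x. x \<notin> {a..b} \<Longrightarrow> deriv u x = 0"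
      using test_fun_common_support[OF u test_fun_deriv(2)[OF u]] by metis
    have "(w has_real_derivative ?w x) (at x)" for x
    proof (cases "x > 0")
      case True
      then show ?thesis unfolding w
        by (auto intro!: derivative_eq_intros test_fun_deriv(1)[OF u] simp: algebra_simps powr_add[symmetric])
    next
      case False
      have "((\<lambda>x. 0) has_real_derivative 0) (at x)" by simp
      moreover have "\<forall>\<^sub>F y in nhds x. 0 = w y"
        using False ab by (intro eventually_nhds_in_open[of "{..<a}", THEN eventually_mono]) (auto simp: w)
      ultimately have "(w has_real_derivative 0) (at x)"
        using DERIV_cong_ev[of x x "\<lambda>x. 0" w 0 0] by simp
      then show ?thesis using ab(1) ab(2,3)[of x] False by auto
    qed
    with f show "\<exists>u'. (\<forall>x. (w has_real_derivative u' x) (at x)) \<and> fspan ?B u'"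
      by (intro exI[of _ ?w]) simp
  qed
  then show ?thesis using assms unfolding test_fun_def by fastforce
qed

text \<open>The factor \<open>n\<close> inside the flat functions drives both factors to 1 on the
  open interval while the values stay between 0 and 1, so the indicator is reached by dominated
  convergence.\<close>

definition bump :: "real \<Rightarrow> real \<Rightarrow> nat \<Rightarrow> real \<Rightarrow> real" where
  "bump a b n x = expinv (n * (x - a)) * expinv (n * (b - x))"

lemma test_fun_bump:
  assumes "0 < a" "a < b"
  shows "test_fun (bump a b n)"
proof -
  have "smooth_real (\<lambda>x. 1 * expinv (n * x + (- (n * a))))" "smooth_real (\<lambda>x. 1 * expinv ((- n) * x + n * b))"
    by (rule smooth_real_affine[OF smooth_real_expinv])+
  from smooth_real_mult[OF this] have "smooth_real (bump a b n)"
    unfolding bump_def[abs_def] by (simp add: algebra_simps)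
  moreover have "bump a b n x = 0" if "x \<notin> {a..b}" for x
    using that by (auto simp: bump_def expinv_def zero_less_mult_iff)
  ultimately show ?thesis using assms unfolding test_fun_def by (metis less_imp_le)
qed

lemma bump_bounds: "0 \<le> bump a b n x" "bump a b n x \<le> 1"
  by (auto simp: bump_def expinv_def intro!: mult_le_one)

lemma bump_tendsto: "(\<lambda>n. bump a b n x) \<longlonglongrightarrow> indicator {a<..<b} x"
proof -
  have e: "(\<lambda>n. expinv (real n * y)) \<longlonglongrightarrow> (if 0 < y then 1 else 0)" for y
  proof (cases "y > 0")
    case True
    have "(\<lambda>n. exp (- (1 / (real n * y)))) \<longlonglongrightarrow> 1"
      using True by real_asymp
    moreover have "\<forall>\<^sub>F n in sequentially. exp (- (1 / (real n * y))) = expinv (real n * y)"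
      using eventually_gt_at_top[of 0] by eventually_elim (use True in \<open>auto simp: expinv_def\<close>)
    ultimately show ?thesis using True by (simp add: tendsto_cong)
  next
    case False
    then have "expinv (real n * y) = 0" for n
      by (auto simp: expinv_def zero_less_mult_iff)
    then show ?thesis using False by simp
  qed
  have "(\<lambda>n. bump a b n x) \<longlonglongrightarrow> (if 0 < x - a then 1 else 0) * (if 0 < b - x then 1 else 0)"
    unfolding bump_def by (intro tendsto_mult e)
  moreover have "(if 0 < x - a then 1 else 0) * (if 0 < b - x then 1 else 0) = (indicator {a<..<b} x :: real)"
    by (auto simp: indicator_def)
  ultimately show ?thesis by simp
qed

section \<open>Square-integrable functions\<close>

lemma AE_Mp_iff: "(AE x in Mp. P x) \<longleftrightarrow> (AE x in lebesgue. 0 < x \<longrightarrow> P x)"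
  by (simp add: AE_restrict_space_iff)

lemma AE_MpI: "(\<And>x. 0 < x \<Longrightarrow> P x) \<Longrightarrow> AE x in Mp. P x"
  unfolding AE_Mp_iff by (auto intro: AE_I2)

text \<open>Rests on the completeness of Lebesgue measure; extension by 0 transports it to the
  restricted measure.\<close>

lemma borel_measurable_Mp_AE:
  fixes f g :: "real \<Rightarrow> 'b :: euclidean_space"
  assumes "f \<in> borel_measurable Mp" "AE x in Mp. f x = g x"
  shows "g \<in> borel_measurable Mp"
proof -
  have "(\<lambda>x. if x \<in> {0<..} then f x else 0) \<in> borel_measurable lebesgue"
    using assms(1) by (subst (asm) borel_measurable_if[symmetric]) auto
  moreover have "AE x in lebesgue. (if x \<in> {0<..} then f x else 0) = (if x \<in> {0<..} then g x else 0)"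
    using assms(2) unfolding AE_Mp_iff by eventually_elim auto
  ultimately have "(\<lambda>x. if x \<in> {0<..} then g x else 0) \<in> borel_measurable lebesgue"
    by (rule borel_measurable_AE)
  then show ?thesis by (subst borel_measurable_if[symmetric]) auto
qed

lemma borel_measurable_Mp_continuous:
  fixes f :: "real \<Rightarrow> 'b :: euclidean_space"
  shows "continuous_on {0<..} f \<Longrightarrow> f \<in> borel_measurable Mp"
  by (rule continuous_imp_measurable_on_sets_lebesgue) auto

lemma L2_measurable [measurable_dest]: "L2 f \<Longrightarrow> f \<in> borel_measurable Mp"
  by (simp add: L2_def)

lemma L2_integrable: "L2 f \<Longrightarrow> integrable Mp (\<lambda>x. (cmod (f x))\<^sup>2)"
  by (simp add: L2_def)

lemma L2_cong_AE:
  assumes "L2 f" "AE x in Mp. f x = g x"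
  shows "L2 g"
proof -
  have g: "g \<in> borel_measurable Mp"
    using assms borel_measurable_Mp_AE L2_measurable by blast
  have "AE x in Mp. (cmod (f x))\<^sup>2 = (cmod (g x))\<^sup>2"
    using assms(2) by eventually_elim simp
  moreover have "(\<lambda>x. (cmod (f x))\<^sup>2) \<in> borel_measurable Mp" "(\<lambda>x. (cmod (g x))\<^sup>2) \<in> borel_measurable Mp"
    using g L2_measurable[OF assms(1)] by measurable
  ultimately have "integrable Mp (\<lambda>x. (cmod (f x))\<^sup>2) \<longleftrightarrow> integrable Mp (\<lambda>x. (cmod (g x))\<^sup>2)"
    by (intro integrable_cong_AE)
  then show ?thesis using g assms(1) by (auto simp: L2_def)
qed

lemma L2_bound:
  assumes "L2 f" "g \<in> borel_measurable Mp" "\<And>x. 0 < x \<Longrightarrow> cmod (g x) \<le> C * cmod (f x)"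
  shows "L2 g"
  unfolding L2_def
proof
  show "integrable Mp (\<lambda>x. (cmod (g x))\<^sup>2)"
  proof (rule Bochner_Integration.integrable_bound)
    show "integrable Mp (\<lambda>x. C\<^sup>2 * (cmod (f x))\<^sup>2)"
      using assms(1) by (auto intro: L2_integrable)
    show "(\<lambda>x. (cmod (g x))\<^sup>2) \<in> borel_measurable Mp" using assms(2) by measurable
    have "(cmod (g x))\<^sup>2 \<le> C\<^sup>2 * (cmod (f x))\<^sup>2" if "x > 0" for x
      using power_mono[OF assms(3)[OF that], of 2] by (simp add: power_mult_distrib)
    then show "AE x in Mp. norm ((cmod (g x))\<^sup>2) \<le> norm (C\<^sup>2 * (cmod (f x))\<^sup>2)"
      by (intro AE_MpI) simp
  qed
qed fact

lemma L2_cmult: "L2 f \<Longrightarrow> L2 (\<lambda>x. c * f x)"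
  by (rule L2_bound[where C = "cmod c"]) (auto simp: norm_mult dest: L2_measurable)

lemma L2_add:
  assumes "L2 f" "L2 g"
  shows "L2 (\<lambda>x. f x + g x)"
  unfolding L2_def
proof
  have m: "f \<in> borel_measurable Mp" "g \<in> borel_measurable Mp" using assms by (auto dest: L2_measurable)
  then show "(\<lambda>x. f x + g x) \<in> borel_measurable Mp" by measurable
  show "integrable Mp (\<lambda>x. (cmod (f x + g x))\<^sup>2)"
  proof (rule Bochner_Integration.integrable_bound)
    show "integrable Mp (\<lambda>x. 2 * (cmod (f x))\<^sup>2 + 2 * (cmod (g x))\<^sup>2)"
      by (intro Bochner_Integration.integrable_add integrable_mult_right L2_integrable assms)
    show "(\<lambda>x. (cmod (f x + g x))\<^sup>2) \<in> borel_measurable Mp" using m by measurable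
    have "(cmod (a + b))\<^sup>2 \<le> 2 * (cmod a)\<^sup>2 + 2 * (cmod b)\<^sup>2" for a b
    proof -
      have "(cmod (a + b))\<^sup>2 \<le> (cmod a + cmod b)\<^sup>2"
        by (intro power_mono norm_triangle_ineq) auto
      also have "\<dots> \<le> 2 * (cmod a)\<^sup>2 + 2 * (cmod b)\<^sup>2"
        using zero_le_power2[of "cmod a - cmod b"] by (simp add: power2_eq_square algebra_simps)
      finally show ?thesis .
    qed
    then show "AE x in Mp. norm ((cmod (f x + g x))\<^sup>2) \<le> norm (2 * (cmod (f x))\<^sup>2 + 2 * (cmod (g x))\<^sup>2)"
      by simp
  qed
qed

lemma L2_minus: "L2 f \<Longrightarrow> L2 (\<lambda>x. - f x)"
  using L2_cmult[of f "-1"] by simp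

lemma L2_diff: "L2 f \<Longrightarrow> L2 g \<Longrightarrow> L2 (\<lambda>x. f x - g x)"
  using L2_add[of f "\<lambda>x. - g x"] L2_minus by simp

lemma L2_0: "L2 (\<lambda>x. 0)"
  by (simp add: L2_def)

lemma borel_measurable_cnj [measurable (raw)]:
  "f \<in> borel_measurable M \<Longrightarrow> (\<lambda>x. cnj (f x)) \<in> borel_measurable M"
  by (rule measurable_compose[OF _ borel_measurable_continuous_onI, of f M cnj])
     (auto intro: continuous_intros)

lemma L2_cnj: "L2 f \<Longrightarrow> L2 (\<lambda>x. cnj (f x))"
  by (rule L2_bound[where C = 1]) (auto dest: L2_measurable)

lemma L2_integrable_mult:
  assumes "L2 f" "L2 g"
  shows "integrable Mp (\<lambda>x. f x * g x)"
proof (rule Bochner_Integration.integrable_bound)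
  have m: "f \<in> borel_measurable Mp" "g \<in> borel_measurable Mp" using assms by (auto dest: L2_measurable)
  then show "(\<lambda>x. f x * g x) \<in> borel_measurable Mp" by measurable
  show "integrable Mp (\<lambda>x. (cmod (f x))\<^sup>2 + (cmod (g x))\<^sup>2)"
    using assms by (auto intro: L2_integrable)
  have "cmod (a * b) \<le> (cmod a)\<^sup>2 + (cmod b)\<^sup>2" for a b
  proof -
    have "0 \<le> (cmod a - cmod b)\<^sup>2" "0 \<le> (cmod a)\<^sup>2" "0 \<le> (cmod b)\<^sup>2" by auto
    then show ?thesis by (simp only: norm_mult power2_diff)
  qed
  then show "AE x in Mp. norm (f x * g x) \<le> norm ((cmod (f x))\<^sup>2 + (cmod (g x))\<^sup>2)"
    by simp
qed

lemma L2_integrable_inner: "L2 f \<Longrightarrow> L2 g \<Longrightarrow> integrable Mp (\<lambda>x. cnj (f x) * g x)"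
  by (intro L2_integrable_mult L2_cnj)

lemma L2inner_add_left:
  "L2 f \<Longrightarrow> L2 g \<Longrightarrow> L2 h \<Longrightarrow> L2inner (\<lambda>x. f x + g x) h = L2inner f h + L2inner g h"
  using L2_integrable_inner unfolding L2inner_def by (simp add: distrib_right)

lemma L2inner_add_right:
  "L2 f \<Longrightarrow> L2 g \<Longrightarrow> L2 h \<Longrightarrow> L2inner h (\<lambda>x. f x + g x) = L2inner h f + L2inner h g"
  using L2_integrable_inner unfolding L2inner_def by (simp add: distrib_left)

lemma L2inner_diff_left:
  "L2 f \<Longrightarrow> L2 g \<Longrightarrow> L2 h \<Longrightarrow> L2inner (\<lambda>x. f x - g x) h = L2inner f h - L2inner g h"
  using L2_integrable_inner unfolding L2inner_def by (simp add: left_diff_distrib)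

lemma L2inner_diff_right:
  "L2 f \<Longrightarrow> L2 g \<Longrightarrow> L2 h \<Longrightarrow> L2inner h (\<lambda>x. f x - g x) = L2inner h f - L2inner h g"
  using L2_integrable_inner unfolding L2inner_def by (simp add: right_diff_distrib)

lemma L2inner_cmult_right: "L2inner f (\<lambda>x. c * g x) = c * L2inner f g"
  unfolding L2inner_def by (simp add: mult.left_commute)

lemma L2inner_cmult_left: "L2inner (\<lambda>x. c * f x) g = cnj c * L2inner f g"
  unfolding L2inner_def by (simp add: mult.assoc)

lemma L2inner_cnj: "cnj (L2inner f g) = L2inner g f"
  using Bochner_Integration.integral_cnj[of Mp "\<lambda>x. cnj (f x) * g x"]
  by (simp add: L2inner_def mult.commute)

lemma L2inner_cong_AE:
  assumes "L2 f" "L2 g" "AE x in Mp. f x = f' x" "AE x in Mp. g x = g' x"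
  shows "L2inner f g = L2inner f' g'"
  unfolding L2inner_def
proof (rule integral_cong_AE)
  have m: "f \<in> borel_measurable Mp" "g \<in> borel_measurable Mp" "f' \<in> borel_measurable Mp" "g' \<in> borel_measurable Mp"
    using assms L2_cong_AE by (auto dest: L2_measurable)
  then show "(\<lambda>x. cnj (f x) * g x) \<in> borel_measurable Mp" "(\<lambda>x. cnj (f' x) * g' x) \<in> borel_measurable Mp"
    by measurable
  show "AE x in Mp. cnj (f x) * g x = cnj (f' x) * g' x"
    using assms(3,4) by eventually_elim simp
qed

lemma L2norm_nonneg: "0 \<le> L2norm f"
  by (simp add: L2norm_def)

lemma L2norm_power2: "(L2norm f)\<^sup>2 = integral\<^sup>L Mp (\<lambda>x. (cmod (f x))\<^sup>2)"
  by (simp add: L2norm_def)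

lemma L2inner_self: "L2inner f f = complex_of_real ((L2norm f)\<^sup>2)"
  unfolding L2norm_power2 L2inner_def integral_complex_of_real[symmetric]
  by (rule arg_cong[where f = "integral\<^sup>L Mp"]) (auto simp: complex_norm_square mult.commute simp flip: of_real_power)

lemma L2norm_minus_commute: "L2norm (\<lambda>x. f x - g x) = L2norm (\<lambda>x. g x - f x)"
  by (simp add: L2norm_def norm_minus_commute)

lemma L2norm_add_power2:
  assumes "L2 f" "L2 g"
  shows "(L2norm (\<lambda>x. f x + g x))\<^sup>2 = (L2norm f)\<^sup>2 + (L2norm g)\<^sup>2 + 2 * Re (L2inner f g)"
proof -
  have "complex_of_real ((L2norm (\<lambda>x. f x + g x))\<^sup>2) = L2inner f f + L2inner g g + (L2inner f g + L2inner g f)"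
    unfolding L2inner_self[symmetric] using assms by (simp add: L2inner_add_left L2inner_add_right L2_add)
  also have "L2inner f g + L2inner g f = complex_of_real (2 * Re (L2inner f g))"
    unfolding L2inner_cnj[of f g, symmetric] by (rule complex_add_cnj)
  finally have "complex_of_real ((L2norm (\<lambda>x. f x + g x))\<^sup>2) =
      complex_of_real ((L2norm f)\<^sup>2 + (L2norm g)\<^sup>2 + 2 * Re (L2inner f g))"
    by (simp add: L2inner_self)
  then show ?thesis by (simp only: of_real_eq_iff)
qed

lemma L2norm_mono:
  assumes "L2 f" "g \<in> borel_measurable Mp" "\<And>x. 0 < x \<Longrightarrow> cmod (g x) \<le> cmod (f x)"
  shows "L2norm g \<le> L2norm f"
proof -
  have "L2 g" by (rule L2_bound[OF assms(1,2), where C = 1]) (use assms in auto)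
  then have "integral\<^sup>L Mp (\<lambda>x. (cmod (g x))\<^sup>2) \<le> integral\<^sup>L Mp (\<lambda>x. (cmod (f x))\<^sup>2)"
    using assms by (intro integral_mono_AE AE_MpI L2_integrable) (auto intro: power_mono)
  then show ?thesis by (simp add: L2norm_def)
qed

text \<open>Integrate 2 a b \<le> t a^2 + b^2/t. The best t is the quotient of the two norms, either
  of which may vanish; t = (B + e) / (A + e) avoids a case distinction and costs an error that
  disappears with e.\<close>

lemma L2_Cauchy_Schwarz:
  assumes f: "L2 f" and g: "L2 g"
  shows "integral\<^sup>L Mp (\<lambda>x. cmod (f x) * cmod (g x)) \<le> L2norm f * L2norm g" (is "?I \<le> ?A * ?B")
proof -
  have i: "integrable Mp (\<lambda>x. cmod (f x) * cmod (g x))"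
    using integrable_norm[OF L2_integrable_mult[OF f g]] by (simp add: norm_mult)
  have t: "2 * ?I \<le> t * ?A\<^sup>2 + ?B\<^sup>2 / t" if "t > 0" for t
  proof -
    have "2 * (a * b) \<le> t * a\<^sup>2 + b\<^sup>2 / t" for a b :: real
    proof -
      have "0 \<le> (t * a - b)\<^sup>2 / t" using that by simp
      also have "\<dots> = t * a\<^sup>2 + b\<^sup>2 / t - 2 * (a * b)"
        using that by (simp add: power2_eq_square field_simps)
      finally show ?thesis by simp
    qed
    then have "integral\<^sup>L Mp (\<lambda>x. 2 * (cmod (f x) * cmod (g x))) \<le>
        integral\<^sup>L Mp (\<lambda>x. t * (cmod (f x))\<^sup>2 + (cmod (g x))\<^sup>2 / t)"
      using i f g L2_integrable by (intro integral_mono) auto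
    also have "\<dots> = t * ?A\<^sup>2 + ?B\<^sup>2 / t"
      using f g L2_integrable unfolding L2norm_power2 by simp
    finally show ?thesis by simp
  qed
  have AB: "0 \<le> ?A" "0 \<le> ?B" by (rule L2norm_nonneg)+
  have e: "2 * ?I \<le> 2 * (?A * ?B) + e * (?A + ?B)" if "e > 0" for e
  proof -
    have "2 * ?I \<le> (?B + e) / (?A + e) * ?A\<^sup>2 + ?B\<^sup>2 / ((?B + e) / (?A + e))"
      by (rule t) (use that AB in \<open>auto intro!: divide_pos_pos\<close>)
    also have "(?B + e) / (?A + e) * ?A\<^sup>2 \<le> (?B + e) * ?A"
    proof -
      have "?A / (?A + e) \<le> 1" using that AB by (simp add: divide_le_eq_1)
      from mult_left_mono[OF this, of "(?B + e) * ?A"] show ?thesis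
        using that AB by (simp add: power2_eq_square mult_ac)
    qed
    also have "?B\<^sup>2 / ((?B + e) / (?A + e)) \<le> ?B * (?A + e)"
    proof -
      have "?B / (?B + e) \<le> 1" using that AB by (simp add: divide_le_eq_1)
      from mult_left_mono[OF this, of "?B * (?A + e)"] show ?thesis
        using that AB by (simp add: power2_eq_square mult_ac)
    qed
    finally show ?thesis by (simp add: algebra_simps)
  qed
  have "?I \<le> ?A * ?B + d" if "d > 0" for d
  proof -
    have "2 * ?I \<le> 2 * (?A * ?B) + (d / (?A + ?B + 1)) * (?A + ?B)"
      by (rule e) (use that AB in auto)
    also have "(d / (?A + ?B + 1)) * (?A + ?B) \<le> d"
      using that AB by (simp add: field_simps)
    finally show ?thesis using that by simp
  qed
  then show ?thesis by (rule field_le_epsilon)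
qed

lemma cmod_L2inner_le:
  assumes "L2 f" "L2 g"
  shows "cmod (L2inner f g) \<le> L2norm f * L2norm g"
proof -
  have "cmod (L2inner f g) \<le> integral\<^sup>L Mp (\<lambda>x. cmod (cnj (f x) * g x))"
    unfolding L2inner_def by (rule integral_norm_bound)
  also have "\<dots> \<le> L2norm f * L2norm g"
    using L2_Cauchy_Schwarz[OF assms] by (simp add: norm_mult)
  finally show ?thesis .
qed

lemma L2norm_triangle:
  assumes "L2 f" "L2 g"
  shows "L2norm (\<lambda>x. f x + g x) \<le> L2norm f + L2norm g"
proof -
  have "(L2norm (\<lambda>x. f x + g x))\<^sup>2 \<le> (L2norm f + L2norm g)\<^sup>2"
    using cmod_L2inner_le[OF assms] complex_Re_le_cmod[of "L2inner f g"]
    by (simp add: L2norm_add_power2[OF assms] power2_sum)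
  then show ?thesis using L2norm_nonneg by (meson add_nonneg_nonneg power2_le_imp_le)
qed

lemma L2norm_triangle_diff:
  assumes "L2 f" "L2 g" "L2 h"
  shows "L2norm (\<lambda>x. f x - h x) \<le> L2norm (\<lambda>x. f x - g x) + L2norm (\<lambda>x. g x - h x)"
  using L2norm_triangle[OF L2_diff[OF assms(1,2)] L2_diff[OF assms(2,3)]] by simp

lemma L2norm_cong_AE:
  assumes "L2 f" "AE x in Mp. f x = g x"
  shows "L2norm f = L2norm g"
proof -
  have "L2inner f f = L2inner g g" by (rule L2inner_cong_AE) (use assms in auto)
  then have "(L2norm f)\<^sup>2 = (L2norm g)\<^sup>2" by (simp only: L2inner_self of_real_eq_iff)
  then show ?thesis using L2norm_nonneg by (simp add: power2_eq_iff_nonneg)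
qed

section \<open>Limits and completeness\<close>

text \<open>Fatou's lemma: a bound on the norms passes to the almost everywhere limit and brings
  square integrability with it.\<close>

lemma L2_ae_limit:
  assumes s: "\<And>n. L2 (s n)" and f: "f \<in> borel_measurable Mp"
    and lim: "AE x in Mp. (\<lambda>n. s n x) \<longlonglongrightarrow> f x"
    and C: "\<forall>\<^sub>F n in sequentially. L2norm (s n) \<le> C"
  shows "L2 f" "L2norm f \<le> C"
proof -
  have C0: "0 \<le> C"
  proof -
    obtain n where "L2norm (s n) \<le> C" using C eventually_happens by force
    then show ?thesis using L2norm_nonneg[of "s n"] by simp
  qed
  have ns: "(\<integral>\<^sup>+x. ennreal ((cmod (s n x))\<^sup>2) \<partial>Mp) = ennreal ((L2norm (s n))\<^sup>2)" for n
    unfolding L2norm_power2 by (intro nn_integral_eq_integral L2_integrable s) auto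
  have m [measurable]: "s n \<in> borel_measurable Mp" for n using s L2_measurable by blast
  have "(\<integral>\<^sup>+x. ennreal ((cmod (f x))\<^sup>2) \<partial>Mp) = (\<integral>\<^sup>+x. liminf (\<lambda>n. ennreal ((cmod (s n x))\<^sup>2)) \<partial>Mp)"
  proof (rule nn_integral_cong_AE)
    show "AE x in Mp. ennreal ((cmod (f x))\<^sup>2) = liminf (\<lambda>n. ennreal ((cmod (s n x))\<^sup>2))"
      using lim
    proof eventually_elim
      case (elim x)
      then have "(\<lambda>n. ennreal ((cmod (s n x))\<^sup>2)) \<longlonglongrightarrow> ennreal ((cmod (f x))\<^sup>2)"
        by (intro tendsto_ennrealI tendsto_intros)
      then show ?case using lim_imp_Liminf by force
    qed
  qed
  also have "\<dots> \<le> liminf (\<lambda>n. \<integral>\<^sup>+x. ennreal ((cmod (s n x))\<^sup>2) \<partial>Mp)"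
    by (rule nn_integral_liminf) measurable
  also have "\<dots> \<le> liminf (\<lambda>n. ennreal (C\<^sup>2))"
    unfolding ns using C L2norm_nonneg
    by (intro Liminf_mono) (auto elim!: eventually_mono intro!: ennreal_leI power_mono)
  also have "\<dots> = ennreal (C\<^sup>2)" by (simp add: Liminf_const)
  finally have le: "(\<integral>\<^sup>+x. ennreal ((cmod (f x))\<^sup>2) \<partial>Mp) \<le> ennreal (C\<^sup>2)" .
  have "integrable Mp (\<lambda>x. (cmod (f x))\<^sup>2)"
    using le f by (intro integrableI_nonneg) (auto intro: le_less_trans[OF _ ennreal_less_top])
  then show L: "L2 f" using f by (simp add: L2_def)
  have "ennreal ((L2norm f)\<^sup>2) \<le> ennreal (C\<^sup>2)"
    using le unfolding L2norm_power2 by (subst (asm) nn_integral_eq_integral) (auto intro: L2_integrable L)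
  then have "(L2norm f)\<^sup>2 \<le> C\<^sup>2" by simp
  then show "L2norm f \<le> C" using C0 power2_le_imp_le by blast
qed

text \<open>The integrand is the modulus of the Gamma integrand at the argument s + 1, with decay
  rate \<open>a\<close>.\<close>

lemma integrable_powr_exp:
  assumes "s > -1" "a > 0"
  shows "integrable Mp (\<lambda>x. x powr s * exp (- (a * x)))"
proof -
  have "(\<lambda>t. complex_of_real t powr (of_real (s + 1) - 1) / of_real (exp (a * t))) absolutely_integrable_on {0<..}"
    using assms by (intro absolutely_integrable_Gamma_integral) auto
  then have "integrable Mp (\<lambda>t. complex_of_real t powr (of_real (s + 1) - 1) / of_real (exp (a * t)))"
    by (simp add: set_integrable_def integrable_restrict_space)
  from integrable_norm[OF this] show ?thesis
    by (rule integrable_cong_AE[THEN iffD1, rotated -1])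
       (auto intro!: AE_MpI borel_measurable_Mp_continuous continuous_intros
          simp: norm_divide norm_powr_real_powr exp_minus field_simps)
qed

text \<open>Riesz-Fischer: along a fast subsequence the increments sum up almost everywhere, which
  gives a pointwise limit; Fatou applied to the differences \<open>s (r k) x - s n x\<close> then
  turns the Cauchy condition into convergence of the full sequence.\<close>

lemma L2_Cauchy_complete:
  assumes s: "\<And>n. L2 (s n)"
    and cauchy: "\<And>\<epsilon>. 0 < \<epsilon> \<Longrightarrow> \<exists>N. \<forall>m\<ge>N. \<forall>n\<ge>N. L2norm (\<lambda>x. s m x - s n x) < \<epsilon>"
  obtains f where "L2 f" "L2conv s f"
proof -
  obtain N where N: "\<And>k m n. N k \<le> m \<Longrightarrow> N k \<le> n \<Longrightarrow> L2norm (\<lambda>x. s m x - s n x) < (1/2) ^ k"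
    using cauchy[of "(1/2) ^ k" for k] by (metis half_gt_zero_iff zero_less_one zero_less_power)
  \<comment> \<open>Adding up all thresholds makes \<open>r\<close> monotone, at least the index and
    at least \<open>N k\<close>.\<close>
  define r where "r k = k + (\<Sum>i\<le>k. N i)" for k
  have rN: "N k \<le> r k" for k unfolding r_def by (simp add: member_le_sum trans_le_add2)
  have rmono: "r k \<le> r (Suc k)" for k by (simp add: r_def)
  have rge: "k \<le> r k" for k by (simp add: r_def)
  define d where "d k x = s (r (Suc k)) x - s (r k) x" for k x
  have d: "L2 (d k)" "L2norm (d k) \<le> (1/2) ^ k" for k
    unfolding d_def using N[of k "r (Suc k)" "r k"] rN[of k] rmono[of k] by (auto intro: L2_diff s)
  \<comment> \<open>Square integrable functions on the half line need not be integrable. Pairing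
    with an everywhere positive square integrable weight lets Cauchy-Schwarz bound the series of
    increments in L1; afterwards the weight is divided out pointwise.\<close>
  define w where "w x = complex_of_real (exp (- x))" for x
  have w: "L2 w"
    unfolding L2_def
  proof
    show "w \<in> borel_measurable Mp"
      unfolding w_def by (intro borel_measurable_Mp_continuous continuous_intros)
    have "integrable Mp (\<lambda>x. x powr 0 * exp (- (2 * x)))"
      by (rule integrable_powr_exp) auto
    moreover have "integrable Mp (\<lambda>x. x powr 0 * exp (- (2 * x))) = integrable Mp (\<lambda>x. (cmod (w x))\<^sup>2)"
      by (intro Bochner_Integration.integrable_cong) (auto simp: w_def exp_double[symmetric])
    ultimately show "integrable Mp (\<lambda>x. (cmod (w x))\<^sup>2)" by simp
  qed
  have m [measurable]: "s n \<in> borel_measurable Mp" "d n \<in> borel_measurable Mp" for n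
    using s d L2_measurable by blast+
  have mw [measurable]: "w \<in> borel_measurable Mp" using w L2_measurable by blast
  have "AE x in Mp. (\<Sum>k. ennreal (cmod (d k x) * cmod (w x))) \<noteq> \<infinity>"
  proof (rule nn_integral_PInf_AE)
    have "(\<integral>\<^sup>+x. (\<Sum>k. ennreal (cmod (d k x) * cmod (w x))) \<partial>Mp) =
        (\<Sum>k. \<integral>\<^sup>+x. ennreal (cmod (d k x) * cmod (w x)) \<partial>Mp)"
      by (rule nn_integral_suminf) measurable
    also have "\<dots> \<le> (\<Sum>k. ennreal ((1/2) ^ k * L2norm w))"
    proof (intro suminf_le allI)
      fix k
      have "(\<integral>\<^sup>+x. ennreal (cmod (d k x) * cmod (w x)) \<partial>Mp) =
          ennreal (integral\<^sup>L Mp (\<lambda>x. cmod (d k x) * cmod (w x)))"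
        using integrable_norm[OF L2_integrable_mult[OF d(1) w]]
        by (intro nn_integral_eq_integral) (auto simp: norm_mult)
      also have "\<dots> \<le> ennreal ((1/2) ^ k * L2norm w)"
        using d(2)[of k] L2norm_nonneg[of w] L2_Cauchy_Schwarz[OF d(1) w, of k]
        by (intro ennreal_leI) (meson mult_right_mono order_trans)
      finally show "(\<integral>\<^sup>+x. ennreal (cmod (d k x) * cmod (w x)) \<partial>Mp) \<le> ennreal ((1/2) ^ k * L2norm w)" .
    qed auto
    also have "\<dots> = ennreal (\<Sum>k. (1/2) ^ k * L2norm w)"
      using L2norm_nonneg by (intro suminf_ennreal2 summable_mult2 summable_geometric) auto
    finally show "(\<integral>\<^sup>+x. (\<Sum>k. ennreal (cmod (d k x) * cmod (w x))) \<partial>Mp) \<noteq> \<infinity>"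
      by (auto simp: top_unique)
  qed measurable
  then have conv: "AE x in Mp. convergent (\<lambda>n. s (r n) x)"
  proof eventually_elim
    case (elim x)
    then have "summable (\<lambda>k. cmod (d k x) * cmod (w x))"
      by (intro summable_suminf_not_top) auto
    moreover have "cmod (w x) * exp x = 1" by (simp add: w_def exp_minus norm_inverse)
    ultimately have "summable (\<lambda>k. cmod (d k x))"
      using summable_mult2[of "\<lambda>k. cmod (d k x) * cmod (w x)" "exp x"] by (simp add: mult.assoc)
    then have "summable (\<lambda>k. d k x)" by (rule summable_norm_cancel)
    then have "convergent (\<lambda>n. (\<Sum>k<n. d k x) + s (r 0) x)"
      by (intro convergent_add convergent_const) (simp add: summable_iff_convergent)
    moreover have "(\<Sum>k<n. d k x) + s (r 0) x = s (r n) x" for n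
      unfolding d_def using sum_lessThan_telescope[of "\<lambda>k. s (r k) x" n] by simp
    ultimately show ?case by simp
  qed
  define f where "f x = lim (\<lambda>n. s (r n) x)" for x
  have f [measurable]: "f \<in> borel_measurable Mp" unfolding f_def by measurable
  have lim: "AE x in Mp. (\<lambda>n. s (r n) x) \<longlonglongrightarrow> f x"
    using conv by eventually_elim (simp add: f_def convergent_LIMSEQ_iff)
  have est: "L2 (\<lambda>x. f x - s n x) \<and> L2norm (\<lambda>x. f x - s n x) \<le> \<epsilon>"
    if "0 < \<epsilon>" and M: "\<And>m n. m \<ge> M \<Longrightarrow> n \<ge> M \<Longrightarrow> L2norm (\<lambda>x. s m x - s n x) < \<epsilon>" and n: "n \<ge> M" for \<epsilon> M n
  proof -
    have "AE x in Mp. (\<lambda>k. s (r k) x - s n x) \<longlonglongrightarrow> f x - s n x"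
      using lim by eventually_elim (intro tendsto_intros)
    moreover have "\<forall>\<^sub>F k in sequentially. L2norm (\<lambda>x. s (r k) x - s n x) \<le> \<epsilon>"
      using eventually_ge_at_top[of M]
      by eventually_elim (rule less_imp_le, rule M, erule order_trans[OF _ rge], rule n)
    moreover have "(\<lambda>x. f x - s n x) \<in> borel_measurable Mp" by measurable
    moreover have "L2 (\<lambda>x. s (r k) x - s n x)" for k by (intro L2_diff s)
    ultimately show ?thesis using L2_ae_limit[of "\<lambda>k x. s (r k) x - s n x" "\<lambda>x. f x - s n x" \<epsilon>] by blast
  qed
  have Lf: "L2 f"
  proof -
    obtain M where "\<forall>m\<ge>M. \<forall>n\<ge>M. L2norm (\<lambda>x. s m x - s n x) < 1" using cauchy[of 1] by auto
    then have "L2 (\<lambda>x. f x - s M x)" using est[of 1 M M] by auto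
    from L2_add[OF this s[of M]] show ?thesis by simp
  qed
  have "L2conv s f"
    unfolding L2conv_def
  proof (rule LIMSEQ_I)
    fix \<epsilon> :: real assume e: "0 < \<epsilon>"
    then obtain M where M: "\<forall>m\<ge>M. \<forall>n\<ge>M. L2norm (\<lambda>x. s m x - s n x) < \<epsilon> / 2"
      using cauchy[of "\<epsilon> / 2"] by auto
    have "L2norm (\<lambda>x. s n x - f x) < \<epsilon>" if "n \<ge> M" for n
    proof -
      have "L2norm (\<lambda>x. f x - s n x) \<le> \<epsilon> / 2" using est[of "\<epsilon> / 2" M n] M that e by auto
      then show ?thesis using e by (subst L2norm_minus_commute) auto
    qed
    then show "\<exists>no. \<forall>n\<ge>no. norm (L2norm (\<lambda>x. s n x - f x) - 0) < \<epsilon>"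
      using L2norm_nonneg by auto
  qed
  with Lf show ?thesis by (rule that)
qed

lemma L2conv_ae_subseq:
  assumes "L2conv s f" "\<And>n. L2 (s n)" "L2 f"
  obtains r :: "nat \<Rightarrow> nat" where "strict_mono r" "AE x in Mp. (\<lambda>n. s (r n) x) \<longlonglongrightarrow> f x"
proof -
  have "(\<lambda>n. integral\<^sup>L Mp (\<lambda>x. norm ((cmod (s n x - f x))\<^sup>2))) \<longlonglongrightarrow> 0"
    using tendsto_power[OF assms(1)[unfolded L2conv_def], of 2] by (simp add: L2norm_power2)
  moreover have "integrable Mp (\<lambda>x. (cmod (s n x - f x))\<^sup>2)" for n
    by (intro L2_integrable L2_diff assms)
  ultimately obtain r :: "nat \<Rightarrow> nat" where r: "strict_mono r" "AE x in Mp. (\<lambda>n. (cmod (s (r n) x - f x))\<^sup>2) \<longlonglongrightarrow> 0"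
    using tendsto_L1_AE_subseq[of Mp "\<lambda>n x. (cmod (s n x - f x))\<^sup>2"] by blast
  from r(2) have "AE x in Mp. (\<lambda>n. s (r n) x) \<longlonglongrightarrow> f x"
  proof eventually_elim
    case (elim x)
    from tendsto_real_sqrt[OF elim] have "(\<lambda>n. s (r n) x - f x) \<longlonglongrightarrow> 0"
      by (simp add: tendsto_norm_zero_iff)
    then show ?case by (simp add: LIM_zero_iff)
  qed
  with r(1) show ?thesis by (rule that)
qed

lemma L2conv_pointwise:
  assumes "L2conv s f" "\<And>n. L2 (s n)" "L2 f" "\<And>x. 0 < x \<Longrightarrow> (\<lambda>n. s n x) \<longlonglongrightarrow> g x"
  shows "AE x in Mp. f x = g x"
proof -
  obtain r :: "nat \<Rightarrow> nat" where r: "strict_mono r" "AE x in Mp. (\<lambda>n. s (r n) x) \<longlonglongrightarrow> f x"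
    using L2conv_ae_subseq[OF assms(1-3)] by blast
  have "AE x in Mp. (\<lambda>n. s (r n) x) \<longlonglongrightarrow> g x"
    using LIMSEQ_subseq_LIMSEQ[OF assms(4) r(1)] by (intro AE_MpI) (simp add: o_def)
  with r(2) show ?thesis by eventually_elim (rule LIMSEQ_unique)
qed

lemma L2conv_subseq: "L2conv s f \<Longrightarrow> strict_mono (r :: nat \<Rightarrow> nat) \<Longrightarrow> L2conv (\<lambda>n. s (r n)) f"
  unfolding L2conv_def using LIMSEQ_subseq_LIMSEQ by (force simp: o_def)

lemma L2conv_Cauchy:
  assumes "L2conv s f" "\<And>n. L2 (s n)" "L2 f" "0 < \<epsilon>"
  shows "\<exists>N. \<forall>m\<ge>N. \<forall>n\<ge>N. L2norm (\<lambda>x. s m x - s n x) < \<epsilon>"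
proof -
  obtain N where N: "\<forall>n\<ge>N. L2norm (\<lambda>x. s n x - f x) < \<epsilon> / 2"
    using LIMSEQ_D[OF assms(1)[unfolded L2conv_def], of "\<epsilon> / 2"] assms(4) L2norm_nonneg by auto
  have "L2norm (\<lambda>x. s m x - s n x) < \<epsilon>" if "m \<ge> N" "n \<ge> N" for m n
  proof -
    have "L2norm (\<lambda>x. s m x - s n x) \<le> L2norm (\<lambda>x. s m x - f x) + L2norm (\<lambda>x. f x - s n x)"
      by (intro L2norm_triangle_diff assms)
    also have "\<dots> < \<epsilon> / 2 + \<epsilon> / 2"
      using N that L2norm_minus_commute[of f "s n"] by (intro add_strict_mono) auto
    finally show ?thesis by simp
  qed
  then show ?thesis by blast
qed

text \<open>Multiplication operators are closed: the limit of \<open>w x * s n x\<close> exists by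
  completeness and is identified with \<open>w x * f x\<close> along an almost everywhere convergent
  subsequence. Applied below with the weights 1/x, 1/x^2 and powers of the potential.\<close>

lemma L2conv_mult:
  assumes "L2conv s f" "\<And>n. L2 (s n)" "L2 f" "w \<in> borel_measurable Mp" "\<And>n. L2 (\<lambda>x. w x * s n x)"
    and cauchy: "\<And>\<epsilon>. 0 < \<epsilon> \<Longrightarrow> \<exists>N. \<forall>m\<ge>N. \<forall>n\<ge>N. L2norm (\<lambda>x. w x * s m x - w x * s n x) < \<epsilon>"
  shows "L2 (\<lambda>x. w x * f x)" "L2conv (\<lambda>n x. w x * s n x) (\<lambda>x. w x * f x)"
proof -
  obtain v where v: "L2 v" "L2conv (\<lambda>n x. w x * s n x) v"
    using L2_Cauchy_complete[of "\<lambda>n x. w x * s n x", OF assms(5) cauchy] by blast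
  obtain r :: "nat \<Rightarrow> nat" where r: "strict_mono r" "AE x in Mp. (\<lambda>n. s (r n) x) \<longlonglongrightarrow> f x"
    using L2conv_ae_subseq[OF assms(1-3)] by blast
  obtain r' :: "nat \<Rightarrow> nat" where r': "strict_mono r'" "AE x in Mp. (\<lambda>n. w x * s (r (r' n)) x) \<longlonglongrightarrow> v x"
    using L2conv_ae_subseq[OF L2conv_subseq[OF v(2) r(1)] assms(5) v(1)] by blast
  have ae: "AE x in Mp. v x = w x * f x"
    using r(2) r'(2)
  proof eventually_elim
    case (elim x)
    have "(\<lambda>n. w x * s (r (r' n)) x) \<longlonglongrightarrow> w x * f x"
      using LIMSEQ_subseq_LIMSEQ[OF elim(1) r'(1)] by (intro tendsto_intros) (simp add: o_def)
    with elim(2) show ?case by (rule LIMSEQ_unique)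
  qed
  show L: "L2 (\<lambda>x. w x * f x)" by (rule L2_cong_AE[OF v(1) ae])
  have "L2norm (\<lambda>x. w x * s n x - v x) = L2norm (\<lambda>x. w x * s n x - w x * f x)" for n
    by (rule L2norm_cong_AE) (use ae in \<open>auto intro: L2_diff assms v\<close>)
  then show "L2conv (\<lambda>n x. w x * s n x) (\<lambda>x. w x * f x)"
    using v(2) by (simp add: L2conv_def)
qed

lemma L2conv_inner_right:
  assumes "L2conv s f" "\<And>n. L2 (s n)" "L2 f" "L2 g"
  shows "(\<lambda>n. L2inner g (s n)) \<longlonglongrightarrow> L2inner g f"
proof -
  have "(\<lambda>n. L2inner g (s n) - L2inner g f) \<longlonglongrightarrow> 0"
  proof (rule Lim_null_comparison)
    show "\<forall>\<^sub>F n in sequentially. norm (L2inner g (s n) - L2inner g f) \<le> L2norm g * L2norm (\<lambda>x. s n x - f x)"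
      using cmod_L2inner_le[OF assms(4) L2_diff[OF assms(2,3)]]
      by (simp add: L2inner_diff_right assms)
    show "(\<lambda>n. L2norm g * L2norm (\<lambda>x. s n x - f x)) \<longlonglongrightarrow> 0"
      using tendsto_mult_left[OF assms(1)[unfolded L2conv_def], of "L2norm g"] by simp
  qed
  then show ?thesis by (simp add: LIM_zero_iff)
qed

lemma L2conv_inner_left:
  assumes "L2conv s f" "\<And>n. L2 (s n)" "L2 f" "L2 g"
  shows "(\<lambda>n. L2inner (s n) g) \<longlonglongrightarrow> L2inner f g"
  using tendsto_cnj[OF L2conv_inner_right[OF assms]] by (simp add: L2inner_cnj)

lemma L2conv_inner:
  assumes "L2conv s f" "\<And>n. L2 (s n)" "L2 f" "L2conv t g" "\<And>n. L2 (t n)" "L2 g"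
  shows "(\<lambda>n. L2inner (s n) (t n)) \<longlonglongrightarrow> L2inner f g"
proof -
  have "(\<lambda>n. L2inner (s n) (t n) - L2inner (s n) g) \<longlonglongrightarrow> 0"
  proof (rule Lim_null_comparison)
    show "\<forall>\<^sub>F n in sequentially. norm (L2inner (s n) (t n) - L2inner (s n) g) \<le>
        (L2norm (\<lambda>x. s n x - f x) + L2norm f) * L2norm (\<lambda>x. t n x - g x)"
    proof (rule always_eventually, rule allI)
      fix n
      have "norm (L2inner (s n) (t n) - L2inner (s n) g) \<le> L2norm (s n) * L2norm (\<lambda>x. t n x - g x)"
        using cmod_L2inner_le[OF assms(2) L2_diff[OF assms(5,6)]] by (simp add: L2inner_diff_right assms)
      also have "L2norm (s n) \<le> L2norm (\<lambda>x. s n x - f x) + L2norm f"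
        using L2norm_triangle[OF L2_diff[OF assms(2,3)] assms(3)] by simp
      finally show "norm (L2inner (s n) (t n) - L2inner (s n) g) \<le>
          (L2norm (\<lambda>x. s n x - f x) + L2norm f) * L2norm (\<lambda>x. t n x - g x)"
        using L2norm_nonneg by (simp add: mult_right_mono)
    qed
    have "(\<lambda>n. (L2norm (\<lambda>x. s n x - f x) + L2norm f) * L2norm (\<lambda>x. t n x - g x)) \<longlonglongrightarrow> (0 + L2norm f) * 0"
      using assms(1,4) unfolding L2conv_def by (intro tendsto_intros)
    then show "(\<lambda>n. (L2norm (\<lambda>x. s n x - f x) + L2norm f) * L2norm (\<lambda>x. t n x - g x)) \<longlonglongrightarrow> 0"
      by simp
  qed
  from tendsto_add[OF this L2conv_inner_left[OF assms(1-3) assms(6)]] show ?thesis by simp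
qed

lemma L2conv_cong_AE:
  assumes "L2conv s f" "\<And>n. L2 (s n)" "L2 f" "AE x in Mp. f x = g x"
  shows "L2conv s g"
proof -
  have "L2norm (\<lambda>x. s n x - f x) = L2norm (\<lambda>x. s n x - g x)" for n
    by (rule L2norm_cong_AE) (use assms(4) in \<open>auto intro: L2_diff assms\<close>)
  then show ?thesis using assms(1) by (simp add: L2conv_def)
qed

lemma L2conv_const: "L2conv (\<lambda>n. f) f"
  by (simp add: L2conv_def L2norm_def)

section \<open>The fundamental lemma and weak derivatives\<close>

text \<open>The positive and the negative part of \<open>v\<close> are densities of measures with
  the same finite mass on every half-line {x<..}, so the measures coincide. Uniqueness of densities
  makes the two parts equal almost everywhere, and at each point at most one of them is
  nonzero.\<close>

lemma AE_zero_if_tail_integrals_zero: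
  fixes v :: "real \<Rightarrow> real"
  assumes v: "integrable lebesgue v"
    and z: "\<And>x. integral\<^sup>L lebesgue (\<lambda>t. indicator {x<..} t * v t) = 0"
  shows "AE x in lebesgue. v x = 0"
proof -
  \<comment> \<open>Measures are compared on Borel sets, so \<open>v\<close> is replaced by a Borel
    representative.\<close>
  obtain v' where v' [measurable]: "v' \<in> borel_measurable lborel" and ae: "AE x in lborel. v x = v' x"
    using completion_ex_borel_measurable_real[of v lborel] v by auto
  have ae': "AE x in lebesgue. v x = v' x" using ae by (rule AE_completion)
  have ml: "v' \<in> borel_measurable lebesgue" using v' by (rule measurable_completion)
  have "integrable lebesgue v'"
    using integrable_cong_AE[OF _ _ ae'] v ml by auto
  then have i: "integrable lborel v'" using v' by (simp add: integrable_completion)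
  have z': "integral\<^sup>L lborel (\<lambda>t. indicator {x<..} t * v' t) = 0" for x
  proof -
    have "integral\<^sup>L lborel (\<lambda>t. indicator {x<..} t * v' t) = integral\<^sup>L lebesgue (\<lambda>t. indicator {x<..} t * v' t)"
      by (rule integral_completion[symmetric]) measurable
    also have "\<dots> = integral\<^sup>L lebesgue (\<lambda>t. indicator {x<..} t * v t)"
    proof (rule integral_cong_AE)
      show "(\<lambda>t. indicator {x<..} t * v' t) \<in> borel_measurable lebesgue"
        by (rule measurable_completion) measurable
      show "(\<lambda>t. indicator {x<..} t * v t) \<in> borel_measurable lebesgue"
        using v by (intro borel_measurable_times borel_measurable_indicator) auto
      show "AE t in lebesgue. indicator {x<..} t * v' t = indicator {x<..} t * v t"
        using ae' by eventually_elim simp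
    qed
    finally show ?thesis using z by simp
  qed
  have e: "emeasure (density lborel (\<lambda>t. ennreal (c * v' t))) {x<..} =
      ennreal (integral\<^sup>L lborel (\<lambda>t. indicator {x<..} t * max 0 (c * v' t)))" for c x
  proof -
    have "integrable lborel (\<lambda>t. indicator {x<..} t * max 0 (c * v' t))"
      by (rule Bochner_Integration.integrable_bound[OF integrable_mult_right[OF i, of c]])
         (auto simp: indicator_def)
    then have "(\<integral>\<^sup>+t. ennreal (indicator {x<..} t * max 0 (c * v' t)) \<partial>lborel) =
      ennreal (integral\<^sup>L lborel (\<lambda>t. indicator {x<..} t * max 0 (c * v' t)))"
      by (intro nn_integral_eq_integral) auto
    moreover have "emeasure (density lborel (\<lambda>t. ennreal (c * v' t))) {x<..} =
        (\<integral>\<^sup>+t. ennreal (indicator {x<..} t * max 0 (c * v' t)) \<partial>lborel)"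
      by (subst emeasure_density) (auto intro!: nn_integral_cong simp: indicator_def max_def ennreal_neg)
    ultimately show ?thesis by simp
  qed
  \<comment> \<open>\<open>ennreal\<close> truncates negative reals to 0: the two densities are the
    positive and the negative part of \<open>v'\<close>.\<close>
  have "density lborel (\<lambda>t. ennreal (1 * v' t)) = density lborel (\<lambda>t. ennreal (-1 * v' t))"
  proof (rule measure_eqI_lessThan)
    fix x
    have ii: "integrable lborel (\<lambda>t. indicator {x<..} t * max 0 (c * v' t))" for c
      by (rule Bochner_Integration.integrable_bound[OF integrable_mult_right[OF i, of c]])
         (auto simp: indicator_def)
    have "integral\<^sup>L lborel (\<lambda>t. indicator {x<..} t * max 0 (1 * v' t)) -
        integral\<^sup>L lborel (\<lambda>t. indicator {x<..} t * max 0 (-1 * v' t)) =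
        integral\<^sup>L lborel (\<lambda>t. indicator {x<..} t * v' t)"
      by (subst Bochner_Integration.integral_diff[symmetric, OF ii ii])
         (auto intro!: Bochner_Integration.integral_cong simp: indicator_def max_def)
    then show "emeasure (density lborel (\<lambda>t. ennreal (1 * v' t))) {x<..} =
        emeasure (density lborel (\<lambda>t. ennreal (-1 * v' t))) {x<..}"
      unfolding e z' by simp
    show "emeasure (density lborel (\<lambda>t. ennreal (1 * v' t))) {x<..} < \<infinity>"
      unfolding e by simp
  qed auto
  then have "AE x in lborel. ennreal (1 * v' x) = ennreal (-1 * v' x)"
    by (intro sigma_finite_measure.density_unique[OF sigma_finite_lborel]) auto
  with ae have "AE x in lborel. v x = 0"
  proof eventually_elim
    case (elim x)
    then show ?case by (cases "v' x \<ge> 0") (auto simp: ennreal_neg ennreal_eq_0_iff)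
  qed
  then show ?thesis by (rule AE_completion)
qed

lemma test_fun_integrable_mult:
  fixes v :: "real \<Rightarrow> real"
  assumes v: "v \<in> borel_measurable Mp" "\<And>a b. 0 < a \<Longrightarrow> integrable (lebesgue_on {a..b}) v"
    and u: "continuous_on {0<..} u" "0 < a" "\<And>x. x \<notin> {a..b} \<Longrightarrow> u x = 0"
  shows "integrable Mp (\<lambda>x. v x * u x)"
proof -
  have "compact (u ` {a..b})"
    using u(1,2) by (intro compact_continuous_image continuous_on_subset[OF u(1)]) auto
  then obtain C where C: "\<And>x. x \<in> {a..b} \<Longrightarrow> \<bar>u x\<bar> \<le> C"
    using compact_imp_bounded bounded_iff by (metis imageI real_norm_def)
  have i: "integrable lebesgue (\<lambda>x. indicator {a..b} x * v x)"
    using v(2)[OF u(2), of b] by (simp add: integrable_restrict_space)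
  have m: "(\<lambda>x. v x * u x) \<in> borel_measurable Mp"
    using v(1) borel_measurable_Mp_continuous[OF u(1)] by measurable
  have "integrable lebesgue (\<lambda>x. indicator {0<..} x *\<^sub>R (v x * u x))"
  proof (rule Bochner_Integration.integrable_bound[OF integrable_mult_right[OF i, of C]])
    have "(\<lambda>x. if x \<in> {0<..} then v x * u x else 0) \<in> borel_measurable lebesgue"
      using m by (subst (asm) borel_measurable_if[symmetric]) auto
    moreover have "(\<lambda>x. if x \<in> {0<..} then v x * u x else 0) = (\<lambda>x. indicator {0<..} x *\<^sub>R (v x * u x))"
      by (auto simp: indicator_def)
    ultimately show "(\<lambda>x. indicator {0<..} x *\<^sub>R (v x * u x)) \<in> borel_measurable lebesgue" by simp
    have "norm (indicator {0<..} x *\<^sub>R (v x * u x)) \<le> norm (C * (indicator {a..b} x * v x))" for x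
    proof (cases "x \<in> {a..b}")
      case True
      then have "\<bar>v x\<bar> * \<bar>u x\<bar> \<le> \<bar>C\<bar> * \<bar>v x\<bar>"
        using C[OF True] by (simp add: mult.commute mult_right_mono)
      then show ?thesis using True u(2) by (simp add: abs_mult)
    qed (use u(3) in auto)
    then show "AE x in lebesgue. norm (indicator {0<..} x *\<^sub>R (v x * u x)) \<le> norm (C * (indicator {a..b} x * v x))"
      by simp
  qed
  then show ?thesis by (simp add: integrable_Mp_iff)
qed

text \<open>Fundamental lemma of the calculus of variations. Bumps converge to indicators of
  intervals, so every tail integral of \<open>v\<close> cut down to a compact interval
  vanishes.\<close>

lemma AE_zero_if_test_integrals_zero:
  fixes v :: "real \<Rightarrow> real"
  assumes v: "v \<in> borel_measurable Mp" "\<And>a b. 0 < a \<Longrightarrow> integrable (lebesgue_on {a..b}) v"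
    and z: "\<And>u. test_fun u \<Longrightarrow> integral\<^sup>L Mp (\<lambda>x. v x * u x) = 0"
  shows "AE x in Mp. v x = 0"
proof -
  have loc: "AE x in lebesgue. indicator {a..b} x * v x = 0" if a: "0 < a" for a b
  proof (rule AE_zero_if_tail_integrals_zero)
    show i: "integrable lebesgue (\<lambda>x. indicator {a..b} x * v x)"
      using v(2)[OF a, of b] by (simp add: integrable_restrict_space)
    have im: "(\<lambda>x. indicator {a..b} x * v x) \<in> borel_measurable lebesgue"
      using i by (rule borel_measurable_integrable)
    fix y
    define c where "c = max a y"
    have c: "0 < c" "a \<le> c" using a by (auto simp: c_def)
    have "integral\<^sup>L lebesgue (\<lambda>t. indicator {y<..} t * (indicator {a..b} t * v t)) =
        integral\<^sup>L lebesgue (\<lambda>t. indicator {c<..<b} t * (indicator {a..b} t * v t))"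
    proof (rule integral_cong_AE)
      have "AE t in lebesgue. t \<notin> {a, b}"
        by (rule AE_not_in) (auto intro!: finite_imp_null_set_lborel null_sets_completionI)
      then show "AE t in lebesgue. indicator {y<..} t * (indicator {a..b} t * v t) =
          indicator {c<..<b} t * (indicator {a..b} t * v t)"
        by eventually_elim (auto simp: indicator_def c_def)
    qed (intro borel_measurable_times[OF borel_measurable_indicator im]; simp)+
    also have "\<dots> = 0"
    proof (cases "c < b")
      case True
      have "(\<lambda>n. integral\<^sup>L lebesgue (\<lambda>t. bump c b n t * (indicator {a..b} t * v t)))
          \<longlonglongrightarrow> integral\<^sup>L lebesgue (\<lambda>t. indicator {c<..<b} t * (indicator {a..b} t * v t))"
      proof (rule integral_dominated_convergence[where w = "\<lambda>t. norm (indicator {a..b} t * v t)"])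
        show "(\<lambda>t. indicator {c<..<b} t * (indicator {a..b} t * v t)) \<in> borel_measurable lebesgue"
          by (intro borel_measurable_times[OF borel_measurable_indicator im]) simp
        have "bump c b n \<in> borel_measurable borel" for n
          using test_fun_continuous[OF test_fun_bump[OF c(1) True]] by (rule borel_measurable_continuous_onI)
        then have "bump c b n \<in> borel_measurable lebesgue" for n
          by (intro measurable_completion) simp
        then show "(\<lambda>t. bump c b n t * (indicator {a..b} t * v t)) \<in> borel_measurable lebesgue" for n
          by (intro borel_measurable_times[OF _ im])
        show "integrable lebesgue (\<lambda>t. norm (indicator {a..b} t * v t))" by (rule integrable_norm[OF i])
        show "AE t in lebesgue. (\<lambda>n. bump c b n t * (indicator {a..b} t * v t)) \<longlonglongrightarrow>
            indicator {c<..<b} t * (indicator {a..b} t * v t)"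
          by (intro always_eventually allI tendsto_intros bump_tendsto)
        show "AE t in lebesgue. norm (bump c b n t * (indicator {a..b} t * v t)) \<le> norm (indicator {a..b} t * v t)" for n
          using bump_bounds[of c b n] by (intro always_eventually) (simp add: abs_mult mult_left_le_one_le)
      qed
      moreover have "integral\<^sup>L lebesgue (\<lambda>t. bump c b n t * (indicator {a..b} t * v t)) = 0" for n
      proof -
        have "integral\<^sup>L Mp (\<lambda>x. v x * bump c b n x) = 0"
          by (rule z[OF test_fun_bump[OF c(1) True]])
        also have "integral\<^sup>L Mp (\<lambda>x. v x * bump c b n x) =
            integral\<^sup>L lebesgue (\<lambda>x. indicator {0<..} x *\<^sub>R (v x * bump c b n x))"
          by (rule integral_restrict_space) auto
        also have "(\<lambda>x. indicator {0<..} x *\<^sub>R (v x * bump c b n x)) = (\<lambda>t. bump c b n t * (indicator {a..b} t * v t))"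
        proof
          fix t
          have "bump c b n t = 0" if "t \<notin> {c..b}"
            using that by (auto simp: bump_def expinv_def zero_less_mult_iff)
          then show "indicator {0<..} t *\<^sub>R (v t * bump c b n t) = bump c b n t * (indicator {a..b} t * v t)"
            using c by (cases "t \<in> {c..b}") (auto simp: indicator_def)
        qed
        finally show ?thesis .
      qed
      ultimately show ?thesis by (simp add: LIMSEQ_const_iff)
    next
      case False
      then have "{c<..<b} = {}" by auto
      then show ?thesis by simp
    qed
    finally show "integral\<^sup>L lebesgue (\<lambda>t. indicator {y<..} t * (indicator {a..b} t * v t)) = 0" .
  qed
  \<comment> \<open>Countably many compact intervals exhaust the half line; the successor only
    avoids a division by 0.\<close>
  have "AE x in lebesgue. \<forall>n. indicator {1 / real (Suc n)..real n} x * v x = 0"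
    by (intro AE_all_countable[THEN iffD2] allI loc) auto
  then have "AE x in lebesgue. 0 < x \<longrightarrow> v x = 0"
  proof eventually_elim
    case (elim x)
    show ?case
    proof
      assume x: "0 < x"
      obtain n :: nat where n: "real n > max x (1 / x)" using reals_Archimedean2 by blast
      have "1 < x * real n" using n x by (simp add: field_simps)
      then have "1 / real (Suc n) \<le> x" using x by (simp add: field_simps)
      then have "x \<in> {1 / real (Suc n)..real n}" using n by auto
      then show "v x = 0" using elim[rule_format, of n] by simp
    qed
  qed
  then show ?thesis by (simp add: AE_Mp_iff)
qed

text \<open>If every test function had integral 0, the fundamental lemma would apply to the constant
  1; no bump has to be integrated explicitly.\<close>

lemma test_fun_unit_mass: obtains \<eta> where "test_fun \<eta>" "integral\<^sup>L Mp \<eta> = 1"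
proof -
  have "\<exists>u. test_fun u \<and> integral\<^sup>L Mp u \<noteq> 0"
  proof (rule ccontr)
    assume "\<not> ?thesis"
    then have "AE x in Mp. (1::real) = 0"
      by (intro AE_zero_if_test_integrals_zero) auto
    then have "AE x in lebesgue. \<not> 0 < (x::real)" by (simp add: AE_Mp_iff)
    then obtain N where N: "{x \<in> space lebesgue. \<not> \<not> 0 < (x::real)} \<subseteq> N" "emeasure lebesgue N = 0" "N \<in> sets lebesgue"
      by (rule AE_E)
    then have "emeasure lebesgue {0::real<..1} \<le> emeasure lebesgue N"
      by (intro emeasure_mono) auto
    then show False using N(2) by simp
  qed
  then obtain u where u: "test_fun u" "integral\<^sup>L Mp u \<noteq> 0" by blast
  show ?thesis
  proof (rule that)
    show "test_fun (\<lambda>x. (1 / integral\<^sup>L Mp u) * u x)" by (rule test_fun_cmult[OF u(1)])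
  qed (use u in simp)
qed

text \<open>Subtracting from \<open>u\<close> its mean times a fixed \<eta> of mass 1 leaves the
  derivative of a test function. Hence \<open>v\<close> acts on \<open>u\<close> as the constant
  \<open>c\<close>, its pairing with \<eta>, and the fundamental lemma applies to the
  difference.\<close>

lemma du_Bois_Reymond_real:
  fixes v :: "real \<Rightarrow> real"
  assumes v: "v \<in> borel_measurable Mp" "\<And>a b. 0 < a \<Longrightarrow> integrable (lebesgue_on {a..b}) v"
    and z: "\<And>u. test_fun u \<Longrightarrow> integral\<^sup>L Mp (\<lambda>x. v x * deriv u x) = 0"
  obtains c where "AE x in Mp. v x = c"
proof -
  obtain \<eta> where \<eta>: "test_fun \<eta>" "integral\<^sup>L Mp \<eta> = 1" by (rule test_fun_unit_mass)
  define c where "c = integral\<^sup>L Mp (\<lambda>x. v x * \<eta> x)"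
  have vi: "integrable Mp (\<lambda>x. v x * u x)" if "test_fun u" for u
  proof -
    obtain a b where "0 < a" "\<And>x. x \<notin> {a..b} \<Longrightarrow> u x = 0"
      using \<open>test_fun u\<close> unfolding test_fun_def by blast
    then show ?thesis by (intro test_fun_integrable_mult[OF v test_fun_continuous[OF that]])
  qed
  have "AE x in Mp. v x - c = 0"
  proof (rule AE_zero_if_test_integrals_zero)
    show "(\<lambda>x. v x - c) \<in> borel_measurable Mp" using v(1) by measurable
    show "integrable (lebesgue_on {a..b}) (\<lambda>x. v x - c)" if "0 < a" for a b
      by (intro Bochner_Integration.integrable_diff v that continuous_imp_integrable_real continuous_intros)
    fix u assume u: "test_fun u"
    define m where "m = integral\<^sup>L Mp u"
    have w: "test_fun (\<lambda>x. u x + - m * \<eta> x)" by (intro test_fun_add test_fun_cmult u \<eta>)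
    have "integral\<^sup>L Mp (\<lambda>x. u x + - m * \<eta> x) = 0"
      using test_fun_integrable[OF u] test_fun_integrable[OF \<eta>(1)] by (simp add: \<eta> m_def)
    then obtain y where y: "test_fun y" "\<And>x. (y has_real_derivative u x + - m * \<eta> x) (at x)"
      using test_fun_antiderivative[OF w] by blast
    have "deriv y x = u x + - m * \<eta> x" for x using y(2) by (rule DERIV_imp_deriv)
    with z[OF y(1)] have "integral\<^sup>L Mp (\<lambda>x. v x * u x - m * (v x * \<eta> x)) = 0"
      by (simp add: algebra_simps)
    then have "integral\<^sup>L Mp (\<lambda>x. v x * u x) = m * c"
      using vi[OF u] vi[OF \<eta>(1)] by (simp add: c_def)
    then show "integral\<^sup>L Mp (\<lambda>x. (v x - c) * u x) = 0"
      using vi[OF u] test_fun_integrable[OF u] by (simp add: left_diff_distrib m_def)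
  qed
  then show ?thesis by (intro that[of c]) simp
qed

lemma du_Bois_Reymond:
  fixes v :: "real \<Rightarrow> complex"
  assumes v: "locL1 v"
    and z: "\<And>u. test_fun u \<Longrightarrow> integral\<^sup>L Mp (\<lambda>x. v x * of_real (deriv u x)) = 0"
  obtains c where "AE x in Mp. v x = c"
proof -
  have vm: "v \<in> borel_measurable Mp" and vl: "\<And>a b. 0 < a \<Longrightarrow> integrable (lebesgue_on {a..b}) v"
    using v by (auto simp: locL1_def)
  have R: "integrable (lebesgue_on {a..b}) (\<lambda>x. Re (v x))" "integrable (lebesgue_on {a..b}) (\<lambda>x. Im (v x))"
    if "0 < a" for a b using vl[OF that] by auto
  have m: "(\<lambda>x. Re (v x)) \<in> borel_measurable Mp" "(\<lambda>x. Im (v x)) \<in> borel_measurable Mp"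
    using vm by auto
  have i: "integrable Mp (\<lambda>x. v x * of_real (deriv u x))" if u: "test_fun u" for u
  proof -
    obtain a b where ab: "0 < a" "\<And>x. x \<notin> {a..b} \<Longrightarrow> deriv u x = 0"
      using test_fun_deriv(2)[OF u] unfolding test_fun_def by blast
    note c = test_fun_continuous[OF test_fun_deriv(2)[OF u]]
    have "integrable Mp (\<lambda>x. complex_of_real (Re (v x) * deriv u x) + \<i> * complex_of_real (Im (v x) * deriv u x))"
      by (intro Bochner_Integration.integrable_add integrable_mult_right integrable_of_real
          test_fun_integrable_mult[OF m(1) R(1) c ab] test_fun_integrable_mult[OF m(2) R(2) c ab])
    also have "(\<lambda>x. complex_of_real (Re (v x) * deriv u x) + \<i> * complex_of_real (Im (v x) * deriv u x)) =
        (\<lambda>x. v x * of_real (deriv u x))"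
      by (auto simp: complex_eq_iff)
    finally show ?thesis .
  qed
  have "integral\<^sup>L Mp (\<lambda>x. Re (v x) * deriv u x) = 0" "integral\<^sup>L Mp (\<lambda>x. Im (v x) * deriv u x) = 0"
    if u: "test_fun u" for u
    using integral_Re[OF i[OF u]] integral_Im[OF i[OF u]] z[OF u] by auto
  then obtain c d where c: "AE x in Mp. Re (v x) = c" and d: "AE x in Mp. Im (v x) = d"
    using du_Bois_Reymond_real[OF m(1) R(1)] du_Bois_Reymond_real[OF m(2) R(2)] by metis
  then have "AE x in Mp. v x = Complex c d"
    by eventually_elim (simp add: complex_eq_iff)
  then show ?thesis by (rule that)
qed

section \<open>Complex test functions\<close>

lemma cderivI: "(f has_vector_derivative d) (at x) \<Longrightarrow> cderiv f x = d"
  by (auto simp: cderiv_def complex_eq_iff has_vector_derivative_complex_iff intro: DERIV_imp_deriv)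

lemma Cc_inf_iff: "\<phi> \<in> Cc_inf \<longleftrightarrow> test_fun (\<lambda>x. Re (\<phi> x)) \<and> test_fun (\<lambda>x. Im (\<phi> x))"
proof
  assume \<phi>: "\<phi> \<in> Cc_inf"
  then obtain a b where "0 < a" "a \<le> b" "\<And>x. x \<notin> {a..b} \<Longrightarrow> \<phi> x = 0"
    unfolding Cc_inf_def by blast
  then have "0 < a \<and> a \<le> b \<and> (\<forall>x. x \<notin> {a..b} \<longrightarrow> Re (\<phi> x) = 0)"
    "0 < a \<and> a \<le> b \<and> (\<forall>x. x \<notin> {a..b} \<longrightarrow> Im (\<phi> x) = 0)" by auto
  then show "test_fun (\<lambda>x. Re (\<phi> x)) \<and> test_fun (\<lambda>x. Im (\<phi> x))"
    using \<phi> unfolding Cc_inf_def test_fun_def by blast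
next
  assume *: "test_fun (\<lambda>x. Re (\<phi> x)) \<and> test_fun (\<lambda>x. Im (\<phi> x))"
  then obtain a b where "0 < a" "a \<le> b" "\<And>x. x \<notin> {a..b} \<Longrightarrow> Re (\<phi> x) = 0" "\<And>x. x \<notin> {a..b} \<Longrightarrow> Im (\<phi> x) = 0"
    using test_fun_common_support[OF conjunct1[OF *] conjunct2[OF *]] by metis
  then have "\<exists>a b. 0 < a \<and> a \<le> b \<and> (\<forall>x. x \<notin> {a..b} \<longrightarrow> \<phi> x = 0)"
    by (intro exI[of _ a] exI[of _ b]) (auto simp: complex_eq_iff)
  then show "\<phi> \<in> Cc_inf" using * by (simp add: Cc_inf_def test_fun_def)
qed

lemma Cc_inf_support:
  assumes "\<phi> \<in> Cc_inf"
  obtains a b where "0 < a" "a \<le> b" "\<And>x. x \<notin> {a..b} \<Longrightarrow> \<phi> x = 0"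
  using assms unfolding Cc_inf_def by blast

lemma Cc_inf_deriv:
  assumes "\<phi> \<in> Cc_inf"
  shows "(\<phi> has_vector_derivative cderiv \<phi> x) (at x)" "cderiv \<phi> \<in> Cc_inf"
  using assms test_fun_deriv unfolding Cc_inf_iff
  by (auto simp: has_vector_derivative_complex_iff cderiv_def)

lemma Cc_inf_continuous: "\<phi> \<in> Cc_inf \<Longrightarrow> continuous_on S \<phi>"
  by (intro continuous_at_imp_continuous_on ballI has_vector_derivative_continuous[OF Cc_inf_deriv(1)])

lemma Cc_inf_add: "\<phi> \<in> Cc_inf \<Longrightarrow> \<psi> \<in> Cc_inf \<Longrightarrow> (\<lambda>x. \<phi> x + \<psi> x) \<in> Cc_inf"
  by (simp add: Cc_inf_iff test_fun_add)

lemma Cc_inf_cmult: "\<phi> \<in> Cc_inf \<Longrightarrow> (\<lambda>x. c * \<phi> x) \<in> Cc_inf"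
  unfolding Cc_inf_iff
  using test_fun_add[OF test_fun_cmult[of "\<lambda>x. Re (\<phi> x)" "Re c"] test_fun_cmult[of "\<lambda>x. Im (\<phi> x)" "- Im c"]]
    test_fun_add[OF test_fun_cmult[of "\<lambda>x. Im (\<phi> x)" "Re c"] test_fun_cmult[of "\<lambda>x. Re (\<phi> x)" "Im c"]]
  by simp

lemma Cc_inf_minus: "\<phi> \<in> Cc_inf \<Longrightarrow> (\<lambda>x. - \<phi> x) \<in> Cc_inf"
  using Cc_inf_cmult[of \<phi> "-1"] by simp

lemma Cc_inf_diff: "\<phi> \<in> Cc_inf \<Longrightarrow> \<psi> \<in> Cc_inf \<Longrightarrow> (\<lambda>x. \<phi> x - \<psi> x) \<in> Cc_inf"
  using Cc_inf_add[of \<phi> "\<lambda>x. - \<psi> x"] Cc_inf_minus by simp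

lemma Cc_inf_cnj: "\<phi> \<in> Cc_inf \<Longrightarrow> (\<lambda>x. cnj (\<phi> x)) \<in> Cc_inf"
  by (simp add: Cc_inf_iff test_fun_minus)

lemma Cc_inf_of_real: "test_fun u \<Longrightarrow> (\<lambda>x. complex_of_real (u x)) \<in> Cc_inf"
  by (simp add: Cc_inf_iff test_fun_0)

lemma Cc_inf_0: "(\<lambda>x. 0) \<in> Cc_inf"
  using Cc_inf_of_real[OF test_fun_0] by simp

lemma cderiv_add: "\<phi> \<in> Cc_inf \<Longrightarrow> \<psi> \<in> Cc_inf \<Longrightarrow> cderiv (\<lambda>x. \<phi> x + \<psi> x) = (\<lambda>x. cderiv \<phi> x + cderiv \<psi> x)"
  by (intro ext cderivI has_vector_derivative_add Cc_inf_deriv)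

lemma cderiv_cmult: "\<phi> \<in> Cc_inf \<Longrightarrow> cderiv (\<lambda>x. c * \<phi> x) = (\<lambda>x. c * cderiv \<phi> x)"
  by (intro ext cderivI has_vector_derivative_mult_right Cc_inf_deriv)

lemma cderiv_diff: "\<phi> \<in> Cc_inf \<Longrightarrow> \<psi> \<in> Cc_inf \<Longrightarrow> cderiv (\<lambda>x. \<phi> x - \<psi> x) = (\<lambda>x. cderiv \<phi> x - cderiv \<psi> x)"
  by (intro ext cderivI has_vector_derivative_diff Cc_inf_deriv)

lemma cderiv_cnj: "\<phi> \<in> Cc_inf \<Longrightarrow> cderiv (\<lambda>x. cnj (\<phi> x)) = (\<lambda>x. cnj (cderiv \<phi> x))"
  by (intro ext cderivI has_vector_derivative_cnj Cc_inf_deriv)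

lemma Cc_inf_mult_integrable:
  assumes "\<phi> \<in> Cc_inf" "continuous_on {0<..} w"
  shows "integrable Mp (\<lambda>x. w x * \<phi> x)"
proof -
  obtain a b where "0 < a" "\<And>x. x \<notin> {a..b} \<Longrightarrow> \<phi> x = 0" using Cc_inf_support[OF assms(1)] by metis
  then show ?thesis
    by (intro compact_support_integral_Mp(1)[where a = a and b = b] continuous_intros assms Cc_inf_continuous) auto
qed

lemma L2_Cc_inf_mult:
  assumes "\<phi> \<in> Cc_inf" "continuous_on {0<..} w"
  shows "L2 (\<lambda>x. w x * \<phi> x)"
  unfolding L2_def
proof
  note c = continuous_on_mult[OF assms(2) Cc_inf_continuous[OF assms(1)]]
  show "(\<lambda>x. w x * \<phi> x) \<in> borel_measurable Mp" by (rule borel_measurable_Mp_continuous[OF c])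
  obtain a b where "0 < a" "\<And>x. x \<notin> {a..b} \<Longrightarrow> \<phi> x = 0" using Cc_inf_support[OF assms(1)] by metis
  then show "integrable Mp (\<lambda>x. (cmod (w x * \<phi> x))\<^sup>2)"
    by (intro compact_support_integral_Mp(1)[where a = a and b = b] continuous_intros c) auto
qed

lemma L2_Cc_inf: "\<phi> \<in> Cc_inf \<Longrightarrow> L2 \<phi>"
  using L2_Cc_inf_mult[of \<phi> "\<lambda>x. 1"] by simp

section \<open>Hardy and Rellich estimates\<close>

lemma has_real_derivative_powr':
  "0 < x \<Longrightarrow> ((\<lambda>x. x powr a) has_real_derivative a * x powr a / x) (at x)"
  by (auto intro!: derivative_eq_intros simp: powr_diff)

text \<open>The pattern of all estimates for real test functions: \<open>f\<close> is a sum of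
  nonnegative terms plus an exact derivative \<open>h\<close>. Only a pointwise inequality has to be
  checked, and all the content sits in the choice of the primitive \<open>H\<close>.\<close>

lemma integral_nonneg_modulo_derivative:
  fixes f h H :: "real \<Rightarrow> real"
  assumes "continuous_on {0<..} f" "continuous_on {0<..} h"
    and "\<And>x. 0 < x \<Longrightarrow> (H has_real_derivative h x) (at x)"
    and "0 < a" "\<And>x. x \<notin> {a..b} \<Longrightarrow> f x = 0 \<and> h x = 0 \<and> H x = 0"
    and le: "\<And>x. 0 < x \<Longrightarrow> h x \<le> f x"
  shows "0 \<le> integral\<^sup>L Mp f"
proof -
  have "integral\<^sup>L Mp h = 0"
    by (rule integral_Mp_derivative_eq_0[of H h a b])
       (use assms in \<open>auto simp: has_real_derivative_iff_has_vector_derivative\<close>)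
  moreover have "integral\<^sup>L Mp h \<le> integral\<^sup>L Mp f"
    by (rule integral_mono_AE)
       (use assms compact_support_integral_Mp(1)[of f a b] compact_support_integral_Mp(1)[of h a b]
         in \<open>auto intro!: AE_MpI\<close>)
  ultimately show ?thesis by simp
qed

locale half_line_operator =
  fixes \<alpha> :: real and k :: int
  assumes \<alpha>: "0 \<le> \<alpha>" "\<alpha> < 1" and k: "k \<noteq> 0"
begin

definition cpot :: real where "cpot = \<alpha> * (2 + \<alpha>) / 4"

definition Wpot :: "real \<Rightarrow> real" where "Wpot x = (real_of_int k)\<^sup>2 * x powr (2 * \<alpha>)"

lemma Vpot_eq: "Vpot \<alpha> k x = Wpot x + cpot / x\<^sup>2"
  by (simp add: Vpot_def Wpot_def cpot_def)

text \<open>At the value 3/4, reached for \<alpha> = 1, the expression - u'' + c u/x^2 annihilates x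
  powr (3/2), and the constant \<delta> below would be 0.\<close>

lemma cpot: "0 \<le> cpot" "cpot < 3 / 4"
proof -
  have "\<alpha> * (2 + \<alpha>) < 1 * 3" using \<alpha> by (intro mult_strict_mono) auto
  then show "0 \<le> cpot" "cpot < 3 / 4" using \<alpha> by (auto simp: cpot_def)
qed

lemma k2: "1 \<le> (real_of_int k)\<^sup>2"
proof -
  have "1 \<le> \<bar>real_of_int k\<bar>" using k by linarith
  then show ?thesis by (metis one_le_power power2_abs)
qed

lemma Wpot_nonneg: "0 \<le> Wpot x"
  by (simp add: Wpot_def)

lemma Wpot_deriv: "0 < x \<Longrightarrow> (Wpot has_real_derivative 2 * \<alpha> * Wpot x / x) (at x)"
  unfolding Wpot_def[abs_def]
  using DERIV_cmult[OF has_real_derivative_powr', of x "(real_of_int k)\<^sup>2" "2 * \<alpha>"] by (simp add: mult_ac)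

lemma continuous_Wpot: "continuous_on {0<..} Wpot"
  unfolding Wpot_def[abs_def] by (intro continuous_intros) auto

lemma continuous_Vpot: "continuous_on {0<..} (Vpot \<alpha> k)"
  unfolding Vpot_eq[abs_def] by (intro continuous_intros continuous_Wpot) auto

lemma test_fun_support:
  assumes "test_fun u"
  obtains a b where "0 < a" "\<And>x. x \<notin> {a..b} \<Longrightarrow> u x = 0 \<and> deriv u x = 0 \<and> deriv (deriv u) x = 0"
proof -
  note u1 = test_fun_deriv(2)[OF assms] note u2 = test_fun_deriv(2)[OF u1]
  obtain a b where 1: "0 < a" "\<And>x. x \<notin> {a..b} \<Longrightarrow> u x = 0" "\<And>x. x \<notin> {a..b} \<Longrightarrow> deriv u x = 0"
    using test_fun_common_support[OF assms u1] by metis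
  obtain a' b' where 2: "0 < a'" "\<And>x. x \<notin> {a'..b'} \<Longrightarrow> deriv (deriv u) x = 0"
    using test_fun_common_support[OF u2 u2] by metis
  show ?thesis
  proof (rule that[of "min a a'" "max b b'"])
    fix x assume "x \<notin> {min a a'..max b b'}"
    then have "x \<notin> {a..b}" "x \<notin> {a'..b'}" by auto
    then show "u x = 0 \<and> deriv u x = 0 \<and> deriv (deriv u) x = 0" using 1 2 by blast
  qed (use 1 2 in auto)
qed

lemmas test_fun_cont = test_fun_continuous test_fun_continuous[OF test_fun_deriv(2)]
  test_fun_continuous[OF test_fun_deriv(2)[OF test_fun_deriv(2)]]

lemmas test_fun_der = test_fun_deriv(1) test_fun_deriv(1)[OF test_fun_deriv(2)]

text \<open>The integrand is the derivative of - u u' plus the nonnegative inverse-square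
  term.\<close>

lemma energy_form:
  assumes u: "test_fun u"
  shows "0 \<le> integral\<^sup>L Mp (\<lambda>x. u x * (- deriv (deriv u) x + Vpot \<alpha> k x * u x) - (deriv u x)\<^sup>2 - Wpot x * (u x)\<^sup>2)"
proof -
  obtain a b where ab: "0 < a" "\<And>x. x \<notin> {a..b} \<Longrightarrow> u x = 0 \<and> deriv u x = 0 \<and> deriv (deriv u) x = 0"
    using test_fun_support[OF u] by metis
  note c = test_fun_cont[OF u] and d = test_fun_der[OF u]
  show ?thesis
  proof (rule integral_nonneg_modulo_derivative[OF _ _ _ ab(1),
        where H = "\<lambda>x. - (u x * deriv u x)" and h = "\<lambda>x. - (deriv u x)\<^sup>2 - u x * deriv (deriv u) x" and b = b])
    show "((\<lambda>x. - (u x * deriv u x)) has_real_derivative - (deriv u x)\<^sup>2 - u x * deriv (deriv u) x) (at x)" for x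
      by (rule d derivative_eq_intros refl)+ (simp add: power2_eq_square)
    show "- (deriv u x)\<^sup>2 - u x * deriv (deriv u) x
        \<le> u x * (- deriv (deriv u) x + Vpot \<alpha> k x * u x) - (deriv u x)\<^sup>2 - Wpot x * (u x)\<^sup>2" if "0 < x" for x
    proof -
      have "u x * (- deriv (deriv u) x + Vpot \<alpha> k x * u x) - (deriv u x)\<^sup>2 - Wpot x * (u x)\<^sup>2 =
          - (deriv u x)\<^sup>2 - u x * deriv (deriv u) x + cpot / x\<^sup>2 * (u x)\<^sup>2"
        by (simp add: Vpot_eq power2_eq_square algebra_simps)
      then show ?thesis using cpot by simp
    qed
  qed (use ab in \<open>auto intro!: continuous_intros continuous_Vpot continuous_Wpot c\<close>)
qed

text \<open>The square (u' - u/(2x))^2 differs from the integrand by the derivative of u^2/(2x); the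
  quotient 1/(2x) is the logarithmic derivative of the extremal sqrt x.\<close>

lemma hardy_real:
  assumes u: "test_fun u"
  shows "0 \<le> integral\<^sup>L Mp (\<lambda>x. (deriv u x)\<^sup>2 - (u x)\<^sup>2 / (4 * x\<^sup>2))"
proof -
  obtain a b where ab: "0 < a" "\<And>x. x \<notin> {a..b} \<Longrightarrow> u x = 0 \<and> deriv u x = 0 \<and> deriv (deriv u) x = 0"
    using test_fun_support[OF u] by metis
  note c = test_fun_cont[OF u] and d = test_fun_der[OF u]
  show ?thesis
  proof (rule integral_nonneg_modulo_derivative[OF _ _ _ ab(1),
        where H = "\<lambda>x. (u x)\<^sup>2 / (2 * x)" and h = "\<lambda>x. u x * deriv u x / x - (u x)\<^sup>2 / (2 * x\<^sup>2)" and b = b])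
    show "((\<lambda>x. (u x)\<^sup>2 / (2 * x)) has_real_derivative u x * deriv u x / x - (u x)\<^sup>2 / (2 * x\<^sup>2)) (at x)" if "0 < x" for x
      using that by (auto intro!: derivative_eq_intros d simp: power2_eq_square field_simps)
    show "u x * deriv u x / x - (u x)\<^sup>2 / (2 * x\<^sup>2) \<le> (deriv u x)\<^sup>2 - (u x)\<^sup>2 / (4 * x\<^sup>2)" if "0 < x" for x
    proof -
      have "(deriv u x)\<^sup>2 - (u x)\<^sup>2 / (4 * x\<^sup>2) - (u x * deriv u x / x - (u x)\<^sup>2 / (2 * x\<^sup>2)) = (deriv u x - u x / (2 * x))\<^sup>2"
        using that by (simp add: power2_eq_square field_simps)
      then show ?thesis by (metis diff_ge_0_iff_ge zero_le_power2)
    qed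
  qed (use ab in \<open>auto intro!: continuous_intros c\<close>)
qed

text \<open>Up to x = 1 the Hardy weight alone reaches 1/4, beyond it the growing part of the
  potential does, because k^2 \<ge> 1. This covers \<alpha> = 0 too and is the source of the
  spectral gap.\<close>

lemma Wpot_ge:
  assumes "0 < x" shows "1 / 4 \<le> Wpot x + 1 / (4 * x\<^sup>2)"
proof (cases "x \<le> 1")
  case True
  then have "x\<^sup>2 \<le> 1" using assms by (simp add: power_le_one)
  then have "1 / 4 \<le> 1 / (4 * x\<^sup>2)" using assms by (simp add: field_simps)
  then show ?thesis using Wpot_nonneg[of x] by simp
next
  case False
  then have "1 \<le> x powr (2 * \<alpha>)" using \<alpha> by (simp add: ge_one_powr_ge_zero)
  then have "1 * 1 \<le> Wpot x" unfolding Wpot_def using k2 by (intro mult_mono) auto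
  then show ?thesis using assms by (simp add: add_increasing2)
qed

lemma form_lower_bound:
  assumes u: "test_fun u"
  shows "0 \<le> integral\<^sup>L Mp (\<lambda>x. (deriv u x)\<^sup>2 + Wpot x * (u x)\<^sup>2 - (u x)\<^sup>2 / 4)"
proof -
  obtain a b where ab: "0 < a" "\<And>x. x \<notin> {a..b} \<Longrightarrow> u x = 0 \<and> deriv u x = 0 \<and> deriv (deriv u) x = 0"
    using test_fun_support[OF u] by metis
  note c = test_fun_cont[OF u] and d = test_fun_der[OF u]
  have i: "integrable Mp (\<lambda>x. (deriv u x)\<^sup>2 + Wpot x * (u x)\<^sup>2 - (u x)\<^sup>2 / 4)"
    "integrable Mp (\<lambda>x. (deriv u x)\<^sup>2 - (u x)\<^sup>2 / (4 * x\<^sup>2))"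
    by (rule compact_support_integral_Mp(1)[OF _ ab(1), of _ b];
        use ab in \<open>auto intro!: continuous_intros continuous_Wpot c\<close>)+
  have "integral\<^sup>L Mp (\<lambda>x. (deriv u x)\<^sup>2 - (u x)\<^sup>2 / (4 * x\<^sup>2)) \<le>
      integral\<^sup>L Mp (\<lambda>x. (deriv u x)\<^sup>2 + Wpot x * (u x)\<^sup>2 - (u x)\<^sup>2 / 4)"
  proof (rule integral_mono_AE[OF i(2,1)], rule AE_MpI)
    fix x :: real assume "0 < x"
    from mult_right_mono[OF Wpot_ge[OF this], of "(u x)\<^sup>2"]
    show "(deriv u x)\<^sup>2 - (u x)\<^sup>2 / (4 * x\<^sup>2) \<le> (deriv u x)\<^sup>2 + Wpot x * (u x)\<^sup>2 - (u x)\<^sup>2 / 4"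
      by (simp add: algebra_simps)
  qed
  then show ?thesis using hardy_real[OF u] by simp
qed

text \<open>The cross term \<open>2 W u (- u'' + c u / x\<^sup>2)\<close> is, modulo the derivative of
  \<open>W (u\<^sup>2 / x - 2 u u')\<close>, the sum of squares
  \<open>2 W (u' + (\<alpha> - 1/2) u / x)\<^sup>2 + (1 - \<alpha>) (1 + 3 \<alpha>) / 2 \<cdot> W u\<^sup>2 / x\<^sup>2\<close>.\<close>

lemma cross_term:
  assumes u: "test_fun u"
  shows "0 \<le> integral\<^sup>L Mp (\<lambda>x. (- deriv (deriv u) x + Vpot \<alpha> k x * u x)\<^sup>2
      - (- deriv (deriv u) x + cpot / x\<^sup>2 * u x)\<^sup>2 - (Wpot x * u x)\<^sup>2)"
proof -
  obtain a b where ab: "0 < a" "\<And>x. x \<notin> {a..b} \<Longrightarrow> u x = 0 \<and> deriv u x = 0 \<and> deriv (deriv u) x = 0"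
    using test_fun_support[OF u] by metis
  note c = test_fun_cont[OF u] and d = test_fun_der[OF u]
  define h where "h x = Wpot x * (- 4 * \<alpha> * u x * deriv u x / x - 2 * (deriv u x)\<^sup>2 - 2 * u x * deriv (deriv u) x
        + (2 * \<alpha> - 1) * (u x)\<^sup>2 / x\<^sup>2 + 2 * u x * deriv u x / x)" for x
  show ?thesis
  proof (rule integral_nonneg_modulo_derivative[OF _ _ _ ab(1),
        where H = "\<lambda>x. Wpot x * ((u x)\<^sup>2 / x - 2 * (u x * deriv u x))" and h = h and b = b])
    show "((\<lambda>x. Wpot x * ((u x)\<^sup>2 / x - 2 * (u x * deriv u x))) has_real_derivative h x) (at x)" if "0 < x" for x
      using that by (auto intro!: derivative_eq_intros d Wpot_deriv simp: power2_eq_square field_simps h_def)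
    show "h x \<le> (- deriv (deriv u) x + Vpot \<alpha> k x * u x)\<^sup>2
      - (- deriv (deriv u) x + cpot / x\<^sup>2 * u x)\<^sup>2 - (Wpot x * u x)\<^sup>2" if "0 < x" for x
    proof -
      have "(- deriv (deriv u) x + Vpot \<alpha> k x * u x)\<^sup>2
        - (- deriv (deriv u) x + cpot / x\<^sup>2 * u x)\<^sup>2 - (Wpot x * u x)\<^sup>2 =
        2 * Wpot x * u x * (- deriv (deriv u) x + cpot / x\<^sup>2 * u x)"
        unfolding Vpot_eq by (simp add: power2_eq_square algebra_simps)
      also have "\<dots> = h x + Wpot x * (2 * (deriv u x + (\<alpha> - 1/2) * (u x / x))\<^sup>2
          + (1 - \<alpha>) * (1 + 3 * \<alpha>) / 2 * (u x / x)\<^sup>2)"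
        unfolding h_def cpot_def using that by (simp add: power2_eq_square field_simps)
      finally show ?thesis using Wpot_nonneg[of x] \<alpha> by simp
    qed
  qed (use ab in \<open>auto intro!: continuous_intros continuous_Vpot continuous_Wpot c simp: h_def\<close>)
qed

text \<open>The square of the ratio of \<open>- u'' + c u / x\<^sup>2\<close> to \<open>- u''\<close> for \<open>u = x powr (3/2)\<close>, the extremal
  function of Rellich's inequality.\<close>

definition \<delta> :: real where "\<delta> = (1 - 4 * cpot / 3)\<^sup>2"

lemma \<delta>: "0 < \<delta>" "\<delta> \<le> 1"
  using cpot by (auto simp: \<delta>_def power_le_one)

text \<open>In the scale-invariant variables p = u/x^2, q = u'/x, r = u'' the integrand is, modulo a
  derivative, a combination of (r - q/2)^2 and (q - 3p/2)^2 with nonnegative weights. Both squares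
  vanish on x powr (3/2), in accordance with the choice of \<delta>.\<close>

lemma second_order_real:
  assumes u: "test_fun u"
  shows "0 \<le> integral\<^sup>L Mp (\<lambda>x. (- deriv (deriv u) x + cpot / x\<^sup>2 * u x)\<^sup>2 - \<delta> * (deriv (deriv u) x)\<^sup>2)"
proof -
  obtain a b where ab: "0 < a" "\<And>x. x \<notin> {a..b} \<Longrightarrow> u x = 0 \<and> deriv u x = 0 \<and> deriv (deriv u) x = 0"
    using test_fun_support[OF u] by metis
  note c = test_fun_cont[OF u] and d = test_fun_der[OF u]
  \<comment> \<open>Comparing the coefficients of q^2 and of p q in the final identity forces
    \<open>P\<close> and \<open>D\<close>. The coefficient of p^2 is then an equation for \<delta>,
    and \<open>D3\<close> says that \<delta> solves it.\<close>
  define P where "P = (1 - \<delta>) / 4 + 2 * cpot"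
  define D where "D = (3 * P - 4 * cpot) / 2"
  have P0: "0 \<le> P" using \<delta> cpot by (simp add: P_def)
  have D3: "- 3 * D = cpot\<^sup>2 - 9 * P / 4"
    by (simp add: D_def P_def \<delta>_def power2_eq_square field_simps)
  define h where "h x = (1 - \<delta>) * (deriv u x * deriv (deriv u) x / x) - (1 - \<delta>) / 2 * ((deriv u x)\<^sup>2 / x\<^sup>2)
      - 2 * cpot * ((deriv u x)\<^sup>2 / x\<^sup>2 + u x * deriv (deriv u) x / x\<^sup>2 - 2 * u x * deriv u x / x ^ 3)
      + D * (2 * u x * deriv u x / x ^ 3 - 3 * (u x)\<^sup>2 / x ^ 4)" for x
  show ?thesis
  proof (rule integral_nonneg_modulo_derivative[OF _ _ _ ab(1),
        where H = "\<lambda>x. (1 - \<delta>) / 2 * ((deriv u x)\<^sup>2 / x) - 2 * cpot * (u x * deriv u x / x\<^sup>2) + D * ((u x)\<^sup>2 / x ^ 3)"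
          and h = h and b = b])
    show "((\<lambda>x. (1 - \<delta>) / 2 * ((deriv u x)\<^sup>2 / x) - 2 * cpot * (u x * deriv u x / x\<^sup>2) + D * ((u x)\<^sup>2 / x ^ 3))
        has_real_derivative h x) (at x)" if "0 < x" for x
      using that by (auto intro!: derivative_eq_intros d
          simp: h_def power2_eq_square power3_eq_cube power4_eq_xxxx field_simps)
    show "h x \<le> (- deriv (deriv u) x + cpot / x\<^sup>2 * u x)\<^sup>2 - \<delta> * (deriv (deriv u) x)\<^sup>2" if "0 < x" for x
    proof -
      define p q r where "p = u x / x\<^sup>2" and "q = deriv u x / x" and "r = deriv (deriv u) x"
      have *: "u x = p * x\<^sup>2" "deriv u x = q * x" "deriv (deriv u) x = r"
        using that by (auto simp: p_def q_def r_def)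
      have h: "h x = (1 - \<delta>) * (q * r) - (1 - \<delta>) / 2 * q\<^sup>2 - 2 * cpot * (q\<^sup>2 + p * r - 2 * (p * q))
          + D * (2 * (p * q)) + (- 3 * D) * p\<^sup>2"
        unfolding h_def * using that by (simp add: power2_eq_square power3_eq_cube power4_eq_xxxx field_simps)
      have "(- deriv (deriv u) x + cpot / x\<^sup>2 * u x)\<^sup>2 - \<delta> * (deriv (deriv u) x)\<^sup>2 = (- r + cpot * p)\<^sup>2 - \<delta> * r\<^sup>2"
        unfolding * using that by simp
      also have "\<dots> = h x + (1 - \<delta>) * (r - q / 2)\<^sup>2 + P * (q - 3 / 2 * p)\<^sup>2"
        unfolding h D3 by (simp add: D_def P_def power2_eq_square field_simps)
      finally show ?thesis using P0 \<delta> by simp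
    qed
  qed (use ab in \<open>auto intro!: continuous_intros c simp: h_def\<close>)
qed

text \<open>The same two squares as before, now with weights 1 and 1/4. The constant 9/16 is the
  square of 3/4, the factor produced by differentiating x powr (3/2) twice.\<close>

lemma rellich_real:
  assumes u: "test_fun u"
  shows "0 \<le> integral\<^sup>L Mp (\<lambda>x. (deriv (deriv u) x)\<^sup>2 - 9 / 16 * (u x / x\<^sup>2)\<^sup>2)"
proof -
  obtain a b where ab: "0 < a" "\<And>x. x \<notin> {a..b} \<Longrightarrow> u x = 0 \<and> deriv u x = 0 \<and> deriv (deriv u) x = 0"
    using test_fun_support[OF u] by metis
  note c = test_fun_cont[OF u] and d = test_fun_der[OF u]
  define h where "h x = deriv u x * deriv (deriv u) x / x - 1 / 2 * ((deriv u x)\<^sup>2 / x\<^sup>2)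
      + 3 / 8 * (2 * u x * deriv u x / x ^ 3 - 3 * (u x)\<^sup>2 / x ^ 4)" for x
  show ?thesis
  proof (rule integral_nonneg_modulo_derivative[OF _ _ _ ab(1),
        where H = "\<lambda>x. 1 / 2 * ((deriv u x)\<^sup>2 / x) + 3 / 8 * ((u x)\<^sup>2 / x ^ 3)"
          and h = h and b = b])
    show "((\<lambda>x. 1 / 2 * ((deriv u x)\<^sup>2 / x) + 3 / 8 * ((u x)\<^sup>2 / x ^ 3)) has_real_derivative h x) (at x)" if "0 < x" for x
      using that by (auto intro!: derivative_eq_intros d
          simp: h_def power2_eq_square power3_eq_cube power4_eq_xxxx field_simps)
    show "h x \<le> (deriv (deriv u) x)\<^sup>2 - 9 / 16 * (u x / x\<^sup>2)\<^sup>2" if "0 < x" for x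
    proof -
      define p q r where "p = u x / x\<^sup>2" and "q = deriv u x / x" and "r = deriv (deriv u) x"
      have *: "u x = p * x\<^sup>2" "deriv u x = q * x" "deriv (deriv u) x = r"
        using that by (auto simp: p_def q_def r_def)
      have h: "h x = q * r - q\<^sup>2 / 2 + 3 / 4 * (p * q) - 9 / 8 * p\<^sup>2"
        unfolding h_def * using that by (simp add: power2_eq_square power3_eq_cube power4_eq_xxxx field_simps)
      have "(deriv (deriv u) x)\<^sup>2 - 9 / 16 * (u x / x\<^sup>2)\<^sup>2 = r\<^sup>2 - 9 / 16 * p\<^sup>2"
        unfolding * using that by simp
      also have "\<dots> = h x + (r - q / 2)\<^sup>2 + 1 / 4 * (q - 3 / 2 * p)\<^sup>2"
        unfolding h by (simp add: power2_eq_square field_simps)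
      finally show ?thesis by simp
    qed
  qed (use ab in \<open>auto intro!: continuous_intros c simp: h_def\<close>)
qed

section \<open>The estimates for complex test functions\<close>

lemma tau_diff:
  "\<phi> \<in> Cc_inf \<Longrightarrow> \<psi> \<in> Cc_inf \<Longrightarrow> tau \<alpha> k (\<lambda>x. \<phi> x - \<psi> x) = (\<lambda>x. tau \<alpha> k \<phi> x - tau \<alpha> k \<psi> x)"
  by (simp add: tau_def[abs_def] cderiv_diff Cc_inf_deriv(2) algebra_simps)

lemma tau_add:
  "\<phi> \<in> Cc_inf \<Longrightarrow> \<psi> \<in> Cc_inf \<Longrightarrow> tau \<alpha> k (\<lambda>x. \<phi> x + \<psi> x) = (\<lambda>x. tau \<alpha> k \<phi> x + tau \<alpha> k \<psi> x)"
  by (simp add: tau_def[abs_def] cderiv_add Cc_inf_deriv(2) algebra_simps)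

lemma tau_cmult: "\<phi> \<in> Cc_inf \<Longrightarrow> tau \<alpha> k (\<lambda>x. c * \<phi> x) = (\<lambda>x. c * tau \<alpha> k \<phi> x)"
  by (simp add: tau_def[abs_def] cderiv_cmult Cc_inf_deriv(2) algebra_simps)

lemma tau_cnj: "\<phi> \<in> Cc_inf \<Longrightarrow> tau \<alpha> k (\<lambda>x. cnj (\<phi> x)) = (\<lambda>x. cnj (tau \<alpha> k \<phi> x))"
  by (simp add: tau_def[abs_def] cderiv_cnj Cc_inf_deriv(2))

lemma L2_tau: "\<phi> \<in> Cc_inf \<Longrightarrow> L2 (tau \<alpha> k \<phi>)"
  unfolding tau_def[abs_def]
  by (intro L2_add L2_minus L2_Cc_inf L2_Cc_inf_mult Cc_inf_deriv continuous_on_of_real continuous_Vpot)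

text \<open>Lifts a real estimate: the integrands are quadratic forms with real coefficients in u,
  u', u'', so the complex integrand is the sum of the real ones for the real and the imaginary
  part.\<close>

lemma integral_nonneg_Re_Im:
  fixes g :: "real \<Rightarrow> real"
  assumes \<phi>: "\<phi> \<in> Cc_inf"
    and f: "\<And>u. test_fun u \<Longrightarrow> 0 \<le> integral\<^sup>L Mp (\<lambda>x. f (u x) (deriv u x) (deriv (deriv u) x) x)"
    and c: "\<And>u u' u''. continuous_on {0<..} u \<Longrightarrow> continuous_on {0<..} u' \<Longrightarrow> continuous_on {0<..} u'' \<Longrightarrow>
        continuous_on {0<..} (\<lambda>x. f (u x) (u' x) (u'' x) x)"
    and z: "\<And>x. f 0 0 0 x = 0"
    and g: "\<And>x. 0 < x \<Longrightarrow> g x = f (Re (\<phi> x)) (Re (cderiv \<phi> x)) (Re (cderiv (cderiv \<phi>) x)) x +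
        f (Im (\<phi> x)) (Im (cderiv \<phi> x)) (Im (cderiv (cderiv \<phi>) x)) x"
  shows "0 \<le> integral\<^sup>L Mp g"
proof -
  let ?f = "\<lambda>u x. f (u x) (deriv u x) (deriv (deriv u) x) x"
  have i: "integrable Mp (?f u)" if u: "test_fun u" for u
  proof -
    obtain a b where "0 < a" "\<And>x. x \<notin> {a..b} \<Longrightarrow> u x = 0 \<and> deriv u x = 0 \<and> deriv (deriv u) x = 0"
      using test_fun_support[OF u] by metis
    then show ?thesis by (intro compact_support_integral_Mp(1)[OF c[OF test_fun_cont[OF u]], of a b]) (auto simp: z)
  qed
  have t: "test_fun (\<lambda>x. Re (\<phi> x))" "test_fun (\<lambda>x. Im (\<phi> x))" using \<phi> by (auto simp: Cc_inf_iff)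
  have "integral\<^sup>L Mp g = integral\<^sup>L Mp (\<lambda>x. ?f (\<lambda>x. Re (\<phi> x)) x + ?f (\<lambda>x. Im (\<phi> x)) x)"
    by (rule Bochner_Integration.integral_cong) (auto simp: g cderiv_def)
  also have "\<dots> = integral\<^sup>L Mp (?f (\<lambda>x. Re (\<phi> x))) + integral\<^sup>L Mp (?f (\<lambda>x. Im (\<phi> x)))"
    by (intro Bochner_Integration.integral_add i t)
  finally show ?thesis using f[OF t(1)] f[OF t(2)] by simp
qed

lemma L2_weights:
  assumes "\<phi> \<in> Cc_inf"
  shows "L2 (\<lambda>x. of_real (sqrt (Wpot x)) * \<phi> x)" "L2 (\<lambda>x. of_real (1 / x) * \<phi> x)"
    "L2 (\<lambda>x. of_real (Wpot x) * \<phi> x)" "L2 (\<lambda>x. of_real (1 / x\<^sup>2) * \<phi> x)"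
    "L2 (\<lambda>x. - cderiv (cderiv \<phi>) x + of_real (cpot / x\<^sup>2) * \<phi> x)"
  by (intro L2_add L2_minus L2_Cc_inf[OF Cc_inf_deriv(2)[OF Cc_inf_deriv(2)]] L2_Cc_inf_mult assms
      continuous_intros continuous_Wpot; auto)+

lemma energy_estimate:
  assumes \<phi>: "\<phi> \<in> Cc_inf"
  shows "(L2norm (cderiv \<phi>))\<^sup>2 + (L2norm (\<lambda>x. of_real (sqrt (Wpot x)) * \<phi> x))\<^sup>2 \<le> Re (L2inner \<phi> (tau \<alpha> k \<phi>))"
proof -
  note L = L2_Cc_inf[OF \<phi>] L2_tau[OF \<phi>] L2_Cc_inf[OF Cc_inf_deriv(2)[OF \<phi>]] L2_weights[OF \<phi>]
  note i = integrable_Re[OF L2_integrable_inner[OF L(1,2)]] L2_integrable[OF L(3)] L2_integrable[OF L(4)]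
  let ?g = "\<lambda>x. Re (cnj (\<phi> x) * tau \<alpha> k \<phi> x) - (cmod (cderiv \<phi> x))\<^sup>2 - (cmod (of_real (sqrt (Wpot x)) * \<phi> x))\<^sup>2"
  have "0 \<le> integral\<^sup>L Mp ?g"
  proof (rule integral_nonneg_Re_Im[OF \<phi>, where f = "\<lambda>u u' u'' x. u * (- u'' + Vpot \<alpha> k x * u) - u'\<^sup>2 - Wpot x * u\<^sup>2"], goal_cases)
    case (1 u) then show ?case by (rule energy_form)
  next
    case 2 then show ?case by (intro continuous_intros continuous_Wpot continuous_Vpot) auto
  next
    case 4 then show ?case by (simp add: norm_mult power_mult_distrib Wpot_nonneg cmod_power2 tau_def algebra_simps)
  qed simp
  also have "integral\<^sup>L Mp ?g = Re (L2inner \<phi> (tau \<alpha> k \<phi>)) - (L2norm (cderiv \<phi>))\<^sup>2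
      - (L2norm (\<lambda>x. of_real (sqrt (Wpot x)) * \<phi> x))\<^sup>2"
    unfolding L2norm_power2 L2inner_def integral_Re[OF L2_integrable_inner[OF L(1,2)], symmetric]
      Bochner_Integration.integral_diff[OF Bochner_Integration.integrable_diff[OF i(1,2)] i(3)]
      Bochner_Integration.integral_diff[OF i(1,2)] ..
  finally show ?thesis by simp
qed

lemma hardy:
  assumes \<phi>: "\<phi> \<in> Cc_inf"
  shows "L2norm (\<lambda>x. of_real (1 / x) * \<phi> x) \<le> 2 * L2norm (cderiv \<phi>)"
proof -
  note L = L2_Cc_inf[OF Cc_inf_deriv(2)[OF \<phi>]] L2_weights(2)[OF \<phi>]
  let ?g = "\<lambda>x. (cmod (cderiv \<phi> x))\<^sup>2 - (cmod (of_real (1 / x) * \<phi> x))\<^sup>2 / 4"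
  have "0 \<le> integral\<^sup>L Mp ?g"
  proof (rule integral_nonneg_Re_Im[OF \<phi>, where f = "\<lambda>u u' u'' x. u'\<^sup>2 - u\<^sup>2 / (4 * x\<^sup>2)"], goal_cases)
    case (1 u) then show ?case by (rule hardy_real)
  next
    case 2 then show ?case by (intro continuous_intros continuous_Wpot continuous_Vpot) auto
  next
    case 4 then show ?case by (simp add: norm_mult norm_divide power_mult_distrib power_divide cmod_power2 field_simps)
  qed simp
  also have "integral\<^sup>L Mp ?g = (L2norm (cderiv \<phi>))\<^sup>2 - (L2norm (\<lambda>x. of_real (1 / x) * \<phi> x))\<^sup>2 / 4"
    unfolding L2norm_power2 using L2_integrable[OF L(1)] L2_integrable[OF L(2)] by simp
  finally have "(L2norm (\<lambda>x. of_real (1 / x) * \<phi> x))\<^sup>2 \<le> (2 * L2norm (cderiv \<phi>))\<^sup>2"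
    by (simp add: power_mult_distrib)
  then show ?thesis by (rule power2_le_imp_le) (simp add: L2norm_nonneg)
qed

text \<open>The form is bounded below by 1/4. Hence sequences that are Cauchy for the form are
  Cauchy in L2, and 0 is a point of regular type of the operator.\<close>

lemma form_coercive:
  assumes \<phi>: "\<phi> \<in> Cc_inf"
  shows "(L2norm \<phi>)\<^sup>2 \<le> 4 * Re (L2inner \<phi> (tau \<alpha> k \<phi>))"
proof -
  note L = L2_Cc_inf[OF \<phi>] L2_Cc_inf[OF Cc_inf_deriv(2)[OF \<phi>]] L2_weights[OF \<phi>]
  let ?g = "\<lambda>x. (cmod (cderiv \<phi> x))\<^sup>2 + (cmod (of_real (sqrt (Wpot x)) * \<phi> x))\<^sup>2 - (cmod (\<phi> x))\<^sup>2 / 4"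
  have "0 \<le> integral\<^sup>L Mp ?g"
  proof (rule integral_nonneg_Re_Im[OF \<phi>, where f = "\<lambda>u u' u'' x. u'\<^sup>2 + Wpot x * u\<^sup>2 - u\<^sup>2 / 4"], goal_cases)
    case (1 u) then show ?case by (rule form_lower_bound)
  next
    case 2 then show ?case by (intro continuous_intros continuous_Wpot continuous_Vpot) auto
  next
    case 4 then show ?case by (simp add: norm_mult power_mult_distrib Wpot_nonneg cmod_power2 algebra_simps)
  qed simp
  also have "integral\<^sup>L Mp ?g = (L2norm (cderiv \<phi>))\<^sup>2 + (L2norm (\<lambda>x. of_real (sqrt (Wpot x)) * \<phi> x))\<^sup>2 - (L2norm \<phi>)\<^sup>2 / 4"
    unfolding L2norm_power2 using L2_integrable[OF L(1)] L2_integrable[OF L(2)] L2_integrable[OF L(3)] by simp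
  finally show ?thesis using energy_estimate[OF \<phi>] by simp
qed

text \<open>\<open>cross_term\<close> detaches the growing part of the potential and
  \<open>second_order_real\<close> the inverse-square part, so the graph norm controls the second
  derivative and the growing potential term separately.\<close>

lemma operator_estimate:
  assumes \<phi>: "\<phi> \<in> Cc_inf"
  shows "\<delta> * (L2norm (cderiv (cderiv \<phi>)))\<^sup>2 + (L2norm (\<lambda>x. of_real (Wpot x) * \<phi> x))\<^sup>2 \<le> (L2norm (tau \<alpha> k \<phi>))\<^sup>2"
proof -
  define H where "H x = - cderiv (cderiv \<phi>) x + of_real (cpot / x\<^sup>2) * \<phi> x" for x
  have LH: "L2 H" unfolding H_def[abs_def] by (rule L2_weights(5)[OF \<phi>])
  note L = L2_tau[OF \<phi>] L2_Cc_inf[OF Cc_inf_deriv(2)[OF Cc_inf_deriv(2)[OF \<phi>]]] L2_weights(3)[OF \<phi>] LH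
  note I = L[THEN L2_integrable]
  let ?g = "\<lambda>x. (cmod (tau \<alpha> k \<phi> x))\<^sup>2 - (cmod (H x))\<^sup>2 - (cmod (of_real (Wpot x) * \<phi> x))\<^sup>2"
  have "0 \<le> integral\<^sup>L Mp ?g"
  proof (rule integral_nonneg_Re_Im[OF \<phi>, where f = "\<lambda>u u' u'' x. (- u'' + Vpot \<alpha> k x * u)\<^sup>2 - (- u'' + cpot / x\<^sup>2 * u)\<^sup>2 - (Wpot x * u)\<^sup>2"], goal_cases)
    case (1 u) then show ?case by (rule cross_term)
  next
    case 2 then show ?case by (intro continuous_intros continuous_Wpot continuous_Vpot) auto
  next
    case 4 then show ?case by (simp add: cmod_power2 tau_def H_def del: of_real_divide of_real_power)
  qed simp
  also have "integral\<^sup>L Mp ?g = (L2norm (tau \<alpha> k \<phi>))\<^sup>2 - (L2norm H)\<^sup>2 - (L2norm (\<lambda>x. of_real (Wpot x) * \<phi> x))\<^sup>2"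
    unfolding L2norm_power2 using I by simp
  finally have 1: "(L2norm H)\<^sup>2 + (L2norm (\<lambda>x. of_real (Wpot x) * \<phi> x))\<^sup>2 \<le> (L2norm (tau \<alpha> k \<phi>))\<^sup>2" by simp
  let ?g = "\<lambda>x. (cmod (H x))\<^sup>2 - \<delta> * (cmod (cderiv (cderiv \<phi>) x))\<^sup>2"
  have "0 \<le> integral\<^sup>L Mp ?g"
  proof (rule integral_nonneg_Re_Im[OF \<phi>, where f = "\<lambda>u u' u'' x. (- u'' + cpot / x\<^sup>2 * u)\<^sup>2 - \<delta> * u''\<^sup>2"], goal_cases)
    case (1 u) then show ?case by (rule second_order_real)
  next
    case 2 then show ?case by (intro continuous_intros continuous_Wpot continuous_Vpot) auto
  next
    case 4 then show ?case by (simp add: cmod_power2 H_def algebra_simps del: of_real_divide of_real_power)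
  qed simp
  also have "integral\<^sup>L Mp ?g = (L2norm H)\<^sup>2 - \<delta> * (L2norm (cderiv (cderiv \<phi>)))\<^sup>2"
    unfolding L2norm_power2 using I by simp
  finally show ?thesis using 1 by simp
qed

lemma rellich:
  assumes \<phi>: "\<phi> \<in> Cc_inf"
  shows "L2norm (\<lambda>x. of_real (1 / x\<^sup>2) * \<phi> x) \<le> 4 / 3 * L2norm (cderiv (cderiv \<phi>))"
proof -
  note L = L2_Cc_inf[OF Cc_inf_deriv(2)[OF Cc_inf_deriv(2)[OF \<phi>]]] L2_weights(4)[OF \<phi>]
  let ?g = "\<lambda>x. (cmod (cderiv (cderiv \<phi>) x))\<^sup>2 - 9 / 16 * (cmod (of_real (1 / x\<^sup>2) * \<phi> x))\<^sup>2"
  have "0 \<le> integral\<^sup>L Mp ?g"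
  proof (rule integral_nonneg_Re_Im[OF \<phi>, where f = "\<lambda>u u' u'' x. u''\<^sup>2 - 9 / 16 * (u / x\<^sup>2)\<^sup>2"], goal_cases)
    case (1 u) then show ?case by (rule rellich_real)
  next
    case 2 then show ?case by (intro continuous_intros continuous_Wpot continuous_Vpot) auto
  next
    case 4 then show ?case by (simp add: norm_mult norm_divide norm_power power_mult_distrib power_divide cmod_power2 field_simps)
  qed simp
  also have "integral\<^sup>L Mp ?g = (L2norm (cderiv (cderiv \<phi>)))\<^sup>2 - 9 / 16 * (L2norm (\<lambda>x. of_real (1 / x\<^sup>2) * \<phi> x))\<^sup>2"
    unfolding L2norm_power2 using L2_integrable[OF L(1)] L2_integrable[OF L(2)] by simp
  finally have "(L2norm (\<lambda>x. of_real (1 / x\<^sup>2) * \<phi> x))\<^sup>2 \<le> (4 / 3 * L2norm (cderiv (cderiv \<phi>)))\<^sup>2"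
    by (simp add: power_mult_distrib power2_eq_square)
  then show ?thesis by (rule power2_le_imp_le) (simp add: L2norm_nonneg)
qed

end

section \<open>Adjoint, closure and range\<close>

text \<open>A minimising sequence for \<open>Re B(\<phi>, \<phi>) - 2 Re l(\<phi>)\<close> is Cauchy for the form by the
  parallelogram law, and the Euler equation holds in the limit.\<close>

lemma riesz_minimizing_sequence:
  fixes B :: "(real \<Rightarrow> complex) \<Rightarrow> (real \<Rightarrow> complex) \<Rightarrow> complex" and l :: "(real \<Rightarrow> complex) \<Rightarrow> complex"
  assumes E0: "\<phi>0 \<in> E"
    and E: "\<And>\<phi> \<psi> z. \<phi> \<in> E \<Longrightarrow> \<psi> \<in> E \<Longrightarrow> (\<lambda>x. \<phi> x + z * \<psi> x) \<in> E"
    and Badd: "\<And>\<xi> \<phi> \<psi> z. \<xi> \<in> E \<Longrightarrow> \<phi> \<in> E \<Longrightarrow> \<psi> \<in> E \<Longrightarrow> B \<xi> (\<lambda>x. \<phi> x + z * \<psi> x) = B \<xi> \<phi> + z * B \<xi> \<psi>"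
    and Bherm: "\<And>\<phi> \<psi>. \<phi> \<in> E \<Longrightarrow> \<psi> \<in> E \<Longrightarrow> cnj (B \<phi> \<psi>) = B \<psi> \<phi>"
    and Bpos: "\<And>\<phi>. \<phi> \<in> E \<Longrightarrow> 0 \<le> Re (B \<phi> \<phi>)"
    and ladd: "\<And>\<phi> \<psi> z. \<phi> \<in> E \<Longrightarrow> \<psi> \<in> E \<Longrightarrow> l (\<lambda>x. \<phi> x + z * \<psi> x) = l \<phi> + cnj z * l \<psi>"
    and lbound: "\<And>\<phi>. \<phi> \<in> E \<Longrightarrow> (cmod (l \<phi>))\<^sup>2 \<le> C * Re (B \<phi> \<phi>)" and C: "0 \<le> C"
  shows "\<exists>t. (\<forall>n. t n \<in> E) \<and>
    (\<forall>\<epsilon>>0. \<exists>N. \<forall>m\<ge>N. \<forall>n\<ge>N. Re (B (\<lambda>x. t m x - t n x) (\<lambda>x. t m x - t n x)) < \<epsilon>) \<and>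
    (\<forall>\<phi>\<in>E. (\<lambda>n. B \<phi> (t n)) \<longlonglongrightarrow> l \<phi>)"
proof -
  define q where "q \<phi> = Re (B \<phi> \<phi>)" for \<phi>
  define J where "J \<phi> = q \<phi> - 2 * Re (l \<phi>)" for \<phi>
  have qexp: "q (\<lambda>x. a x + z * b x) = q a + 2 * Re (cnj z * B b a) + (cmod z)\<^sup>2 * q b"
    if a: "a \<in> E" and b: "b \<in> E" for a b z
  proof -
    have left: "B (\<lambda>x. a x + z * b x) c = B a c + cnj z * B b c" if "c \<in> E" for c
      using Bherm[OF that E[OF a b, of z]] Badd[OF that a b, of z] Bherm[OF that a] Bherm[OF that b] by simp
    have "B (\<lambda>x. a x + z * b x) (\<lambda>x. a x + z * b x) = B a a + z * B a b + (cnj z * B b a + (cnj z * z) * B b b)"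
      by (simp add: left E a b Badd algebra_simps)
    also have "z * B a b = cnj (cnj z * B b a)" using Bherm[OF b a] by simp
    finally show ?thesis
      by (simp add: q_def complex_norm_square[symmetric] mult.commute[of "cnj z" z] del: complex_cnj_mult)
  qed
  have Jexp: "J (\<lambda>x. a x + z * b x) = J a + 2 * Re (cnj z * (B b a - l b)) + (cmod z)\<^sup>2 * q b"
    if "a \<in> E" "b \<in> E" for a b z
    unfolding J_def qexp[OF that] ladd[OF that] by (simp add: algebra_simps)
  have Jbound: "- C \<le> J \<phi>" if "\<phi> \<in> E" for \<phi>
  proof -
    have "(2 * Re (l \<phi>))\<^sup>2 \<le> 4 * (cmod (l \<phi>))\<^sup>2"
      using abs_Re_le_cmod[of "l \<phi>"] by (simp add: power_mult_distrib abs_le_square_iff[symmetric])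
    also have "\<dots> \<le> 4 * (C * q \<phi>)" using lbound[OF that] by (simp add: q_def)
    also have "\<dots> \<le> (C + q \<phi>)\<^sup>2"
      using zero_le_power2[of "C - q \<phi>"] by (simp add: power2_eq_square algebra_simps)
    finally have "2 * Re (l \<phi>) \<le> C + q \<phi>"
      by (rule power2_le_imp_le) (use C Bpos[OF that] in \<open>simp add: q_def\<close>)
    then show ?thesis by (simp add: J_def)
  qed
  define m where "m = Inf (J ` E)"
  have bdd: "bdd_below (J ` E)" using Jbound by (auto intro!: bdd_belowI[of _ "- C"])
  have m: "m \<le> J \<phi>" if "\<phi> \<in> E" for \<phi>
    unfolding m_def using bdd that by (intro cInf_lower) auto
  have "\<exists>\<phi>\<in>E. J \<phi> < m + 1 / real (Suc n)" for n
    using cInf_lessD[of "J ` E" "m + 1 / real (Suc n)"] E0 by (auto simp: m_def)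
  then obtain t where t: "\<And>n. t n \<in> E" "\<And>n. J (t n) < m + 1 / real (Suc n)" by metis
  have par: "q (\<lambda>x. t i x - t j x) \<le> 2 / real (Suc i) + 2 / real (Suc j)" for i j
  proof -
    define c where "c = (\<lambda>x. t i x + (-1) * t j x)"
    have c: "c \<in> E" unfolding c_def by (intro E t)
    have cd: "c = (\<lambda>x. t i x - t j x)" by (simp add: c_def)
    \<comment> \<open>The midpoint of \<open>t i\<close> and \<open>t j\<close>, written from either
      end; adding the two expansions of \<open>J\<close> makes the linear terms combine to - q
      c.\<close>
    have half: "(\<lambda>x. t j x + (1/2) * c x) = (\<lambda>x. t i x + (- 1/2) * c x)"
      by (simp add: cd field_simps)
    have 1: "J (\<lambda>x. t j x + (1/2) * c x) = J (t j) + Re (B c (t j) - l c) + q c / 4"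
      unfolding Jexp[OF t(1) c] by (simp add: power_divide)
    have 2: "J (\<lambda>x. t i x + (- 1/2) * c x) = J (t i) - Re (B c (t i) - l c) + q c / 4"
      unfolding Jexp[OF t(1) c] by (simp add: power_divide norm_divide field_simps)
    have 3: "q c = Re (B c (t i)) - Re (B c (t j))"
      using Badd[OF c t(1) t(1), of i "-1" j] by (simp add: q_def c_def)
    have "2 * m \<le> J (\<lambda>x. t j x + (1/2) * c x) + J (\<lambda>x. t i x + (- 1/2) * c x)"
      using m[OF E[OF t(1) c, of i "-1/2"]] half by simp
    also have "\<dots> = J (t j) + J (t i) - q c / 2" unfolding 1 2 using 3 by (simp add: field_simps)
    finally show ?thesis using t(2)[of i] t(2)[of j] unfolding cd by simp
  qed
  show ?thesis
  proof (intro exI[of _ t] conjI allI impI ballI)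
    show "t n \<in> E" for n by (rule t)
    show "\<exists>N. \<forall>m\<ge>N. \<forall>n\<ge>N. Re (B (\<lambda>x. t m x - t n x) (\<lambda>x. t m x - t n x)) < \<epsilon>" if e: "0 < \<epsilon>" for \<epsilon>
    proof -
      have "0 < \<epsilon> / 4" using e by simp
      then obtain N where N: "1 / real (Suc N) < \<epsilon> / 4" by (metis nat_approx_posE)
      have "Re (B (\<lambda>x. t i x - t j x) (\<lambda>x. t i x - t j x)) < \<epsilon>" if "i \<ge> N" "j \<ge> N" for i j
      proof -
        have "1 / real (Suc i) \<le> 1 / real (Suc N)" "1 / real (Suc j) \<le> 1 / real (Suc N)"
          using that by (auto simp: field_simps)
        then show ?thesis using par[of i j] N by (simp add: q_def)
      qed
      then show ?thesis by blast
    qed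
    fix \<phi> assume \<phi>: "\<phi> \<in> E"
    have est: "(cmod (B \<phi> (t n) - l \<phi>))\<^sup>2 \<le> (1 + q \<phi>) * (1 / real (Suc n))" for n
    proof -
      define d where "d = B \<phi> (t n) - l \<phi>"
      \<comment> \<open>Step length along - d \<phi>. The optimal value is the reciprocal of
        \<open>q \<phi>\<close>; the added 1 keeps it finite when \<open>q \<phi>\<close> is
        0.\<close>
      define \<tau> where "\<tau> = 1 / (1 + q \<phi>)"
      have q0: "0 \<le> q \<phi>" using Bpos[OF \<phi>] by (simp add: q_def)
      have \<tau>: "0 < \<tau>" "\<tau> * q \<phi> \<le> 1" "\<tau> * (1 + q \<phi>) = 1" using q0 by (auto simp: \<tau>_def field_simps)
      have "m \<le> J (\<lambda>x. t n x + (- of_real \<tau> * d) * \<phi> x)" by (rule m[OF E[OF t(1) \<phi>]])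
      also have "\<dots> = J (t n) - 2 * \<tau> * (cmod d)\<^sup>2 + \<tau>\<^sup>2 * (cmod d)\<^sup>2 * q \<phi>"
        unfolding Jexp[OF t(1) \<phi>] d_def[symmetric]
        by (simp add: norm_mult power_mult_distrib cmod_power2) (simp add: power2_eq_square algebra_simps)
      also have "\<dots> < m + 1 / real (Suc n) - 2 * \<tau> * (cmod d)\<^sup>2 + \<tau> * (\<tau> * q \<phi>) * (cmod d)\<^sup>2"
        using t(2)[of n] by (simp add: power2_eq_square mult_ac)
      also have "\<tau> * (\<tau> * q \<phi>) * (cmod d)\<^sup>2 \<le> \<tau> * 1 * (cmod d)\<^sup>2"
        using \<tau> by (intro mult_right_mono mult_left_mono) auto
      finally have "\<tau> * (cmod d)\<^sup>2 \<le> 1 / real (Suc n)" by simp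
      then have "(1 + q \<phi>) * (\<tau> * (cmod d)\<^sup>2) \<le> (1 + q \<phi>) * (1 / real (Suc n))"
        using q0 by (intro mult_left_mono) auto
      moreover have "(1 + q \<phi>) * (\<tau> * (cmod d)\<^sup>2) = (cmod d)\<^sup>2"
        using \<tau>(3) by (metis mult.assoc mult.commute mult_1)
      ultimately show ?thesis unfolding d_def by (simp only:)
    qed
    have "(\<lambda>n. (1 + q \<phi>) * (1 / real (Suc n))) \<longlonglongrightarrow> (1 + q \<phi>) * 0"
      by (rule tendsto_mult_left[OF LIMSEQ_Suc[OF lim_1_over_n]])
    then have lim: "(\<lambda>n. (1 + q \<phi>) * (1 / real (Suc n))) \<longlonglongrightarrow> 0" by (simp only: mult_zero_right)
    have "(\<lambda>n. (cmod (B \<phi> (t n) - l \<phi>))\<^sup>2) \<longlonglongrightarrow> 0"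
      by (rule Lim_null_comparison[OF _ lim], rule always_eventually, rule allI)
         (simp only: real_norm_def abs_power2 est)
    from tendsto_real_sqrt[OF this] have "(\<lambda>n. B \<phi> (t n) - l \<phi>) \<longlonglongrightarrow> 0"
      by (simp add: tendsto_norm_zero_iff)
    then show "(\<lambda>n. B \<phi> (t n)) \<longlonglongrightarrow> l \<phi>" by (simp add: LIM_zero_iff)
  qed
qed

context half_line_operator
begin

lemma adj_iff:
  "(g, h) \<in> adj (Aop \<alpha> k) \<longleftrightarrow> L2 g \<and> L2 h \<and> (\<forall>\<phi>\<in>Cc_inf. L2inner (tau \<alpha> k \<phi>) g = L2inner \<phi> h)"
  unfolding adj_def Aop_def by blast

lemma opclosure_iff:
  "(f, h) \<in> opclosure (Aop \<alpha> k) \<longleftrightarrow> L2 f \<and> L2 h \<and>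
     (\<exists>t. (\<forall>n. t n \<in> Cc_inf) \<and> L2conv t f \<and> L2conv (\<lambda>n. tau \<alpha> k (t n)) h)"
proof
  assume "(f, h) \<in> opclosure (Aop \<alpha> k)"
  then obtain s where "L2 f" "L2 h" and s: "\<And>n. s n \<in> Aop \<alpha> k" "L2conv (\<lambda>n. fst (s n)) f" "L2conv (\<lambda>n. snd (s n)) h"
    unfolding opclosure_def by blast
  moreover have "fst (s n) \<in> Cc_inf" "snd (s n) = tau \<alpha> k (fst (s n))" for n
    using s(1)[of n] by (auto simp: Aop_def)
  ultimately show "L2 f \<and> L2 h \<and> (\<exists>t. (\<forall>n. t n \<in> Cc_inf) \<and> L2conv t f \<and> L2conv (\<lambda>n. tau \<alpha> k (t n)) h)"
    by (intro conjI exI[of _ "\<lambda>n. fst (s n)"]) auto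
next
  assume *: "L2 f \<and> L2 h \<and> (\<exists>t. (\<forall>n. t n \<in> Cc_inf) \<and> L2conv t f \<and> L2conv (\<lambda>n. tau \<alpha> k (t n)) h)"
  then obtain t where "\<forall>n. t n \<in> Cc_inf" "L2conv t f" "L2conv (\<lambda>n. tau \<alpha> k (t n)) h" by blast
  then show "(f, h) \<in> opclosure (Aop \<alpha> k)"
    using * unfolding opclosure_def Aop_def
    by (auto intro!: exI[of _ "\<lambda>n. (t n, tau \<alpha> k (t n))"])
qed

text \<open>The support of \<phi> removes all boundary terms, so nothing is asked of
  \<open>u\<close> at 0 or at infinity. This admits \<Phi> and \<Psi>, which do not satisfy the
  boundary conditions of the closure.\<close>

lemma tau_by_parts:
  assumes \<phi>: "\<phi> \<in> Cc_inf"
    and d: "\<And>x. 0 < x \<Longrightarrow> (u has_vector_derivative u1 x) (at x)"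
      "\<And>x. 0 < x \<Longrightarrow> (u1 has_vector_derivative u2 x) (at x)"
    and c: "continuous_on {0<..} u2"
  shows "L2inner (tau \<alpha> k \<phi>) u = L2inner \<phi> (\<lambda>x. - u2 x + of_real (Vpot \<alpha> k x) * u x)"
proof -
  note \<phi>1 = Cc_inf_deriv(2)[OF \<phi>] and \<phi>2 = Cc_inf_deriv(2)[OF Cc_inf_deriv(2)[OF \<phi>]]
  have cu: "continuous_on {0<..} u" "continuous_on {0<..} u1"
    using d by (auto intro!: continuous_at_imp_continuous_on has_vector_derivative_continuous)
  obtain a b where ab: "0 < a" "\<And>x. x \<notin> {a..b} \<Longrightarrow> \<phi> x = 0 \<and> cderiv \<phi> x = 0 \<and> cderiv (cderiv \<phi>) x = 0"
  proof -
    have R: "test_fun (\<lambda>x. Re (\<phi> x))" "test_fun (\<lambda>x. Im (\<phi> x))" using \<phi> by (auto simp: Cc_inf_iff)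
    obtain a b where 1: "0 < a" "\<And>x. x \<notin> {a..b} \<Longrightarrow> Re (\<phi> x) = 0 \<and> deriv (\<lambda>x. Re (\<phi> x)) x = 0 \<and> deriv (deriv (\<lambda>x. Re (\<phi> x))) x = 0"
      using test_fun_support[OF R(1)] by metis
    obtain a' b' where 2: "0 < a'" "\<And>x. x \<notin> {a'..b'} \<Longrightarrow> Im (\<phi> x) = 0 \<and> deriv (\<lambda>x. Im (\<phi> x)) x = 0 \<and> deriv (deriv (\<lambda>x. Im (\<phi> x))) x = 0"
      using test_fun_support[OF R(2)] by metis
    show ?thesis
    proof (rule that[of "min a a'" "max b b'"])
      fix x assume "x \<notin> {min a a'..max b b'}"
      then have x: "x \<notin> {a..b}" "x \<notin> {a'..b'}" by auto
      show "\<phi> x = 0 \<and> cderiv \<phi> x = 0 \<and> cderiv (cderiv \<phi>) x = 0"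
        using 1(2)[OF x(1)] 2(2)[OF x(2)] by (simp add: complex_eq_iff cderiv_def)
    qed (use 1 2 in auto)
  qed
  have z: "integral\<^sup>L Mp (\<lambda>x. cnj (cderiv (cderiv \<phi>) x) * u x - cnj (\<phi> x) * u2 x) = 0"
  proof (rule integral_Mp_derivative_eq_0[where H = "\<lambda>x. cnj (cderiv \<phi> x) * u x - cnj (\<phi> x) * u1 x", OF _ _ ab(1), where b = b])
    show "((\<lambda>x. cnj (cderiv \<phi> x) * u x - cnj (\<phi> x) * u1 x) has_vector_derivative
        cnj (cderiv (cderiv \<phi>) x) * u x - cnj (\<phi> x) * u2 x) (at x)" if "0 < x" for x
      using has_vector_derivative_diff[OF
          has_vector_derivative_mult[OF has_vector_derivative_cnj[OF Cc_inf_deriv(1)[OF \<phi>1]] d(1)[OF that]]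
          has_vector_derivative_mult[OF has_vector_derivative_cnj[OF Cc_inf_deriv(1)[OF \<phi>]] d(2)[OF that]]]
      by simp
  qed (use ab in \<open>auto intro!: continuous_intros c cu Cc_inf_continuous[OF \<phi>] Cc_inf_continuous[OF \<phi>1] Cc_inf_continuous[OF \<phi>2]\<close>)
  have i: "integrable Mp (\<lambda>x. cnj (cderiv (cderiv \<phi>) x) * u x)" "integrable Mp (\<lambda>x. cnj (\<phi> x) * u2 x)"
    "integrable Mp (\<lambda>x. cnj (\<phi> x) * (of_real (Vpot \<alpha> k x) * u x))"
    using Cc_inf_mult_integrable[OF Cc_inf_cnj[OF \<phi>2] cu(1)] Cc_inf_mult_integrable[OF Cc_inf_cnj[OF \<phi>] c]
      Cc_inf_mult_integrable[OF Cc_inf_cnj[OF \<phi>] continuous_on_mult[OF continuous_on_of_real[OF continuous_Vpot] cu(1)]]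
    by (simp_all add: mult.commute)
  have "L2inner (tau \<alpha> k \<phi>) u =
      integral\<^sup>L Mp (\<lambda>x. cnj (\<phi> x) * (of_real (Vpot \<alpha> k x) * u x) - cnj (cderiv (cderiv \<phi>) x) * u x)"
    unfolding L2inner_def tau_def by (simp add: algebra_simps)
  also have "\<dots> = integral\<^sup>L Mp (\<lambda>x. cnj (\<phi> x) * (of_real (Vpot \<alpha> k x) * u x) - cnj (\<phi> x) * u2 x)"
    using z i by simp
  also have "\<dots> = L2inner \<phi> (\<lambda>x. - u2 x + of_real (Vpot \<alpha> k x) * u x)"
    unfolding L2inner_def by (simp add: algebra_simps)
  finally show ?thesis .
qed

lemma classical_in_adj:
  assumes "\<And>x. 0 < x \<Longrightarrow> (u has_vector_derivative u1 x) (at x)"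
      "\<And>x. 0 < x \<Longrightarrow> (u1 has_vector_derivative u2 x) (at x)"
    and "continuous_on {0<..} u2" "L2 u" "L2 h"
    and h: "\<And>x. 0 < x \<Longrightarrow> h x = - u2 x + of_real (Vpot \<alpha> k x) * u x"
  shows "(u, h) \<in> adj (Aop \<alpha> k)"
proof -
  have "L2inner \<phi> (\<lambda>x. - u2 x + of_real (Vpot \<alpha> k x) * u x) = L2inner \<phi> h" for \<phi>
    unfolding L2inner_def by (rule Bochner_Integration.integral_cong) (auto simp: h)
  then show ?thesis
    unfolding adj_iff using assms tau_by_parts[OF _ assms(1-3)] by simp
qed

lemma tau_symmetric:
  assumes "\<phi> \<in> Cc_inf" "\<psi> \<in> Cc_inf"
  shows "L2inner (tau \<alpha> k \<phi>) \<psi> = L2inner \<phi> (tau \<alpha> k \<psi>)"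
  unfolding tau_def[of \<alpha> k \<psi>, abs_def]
  by (intro tau_by_parts[where ?u1.0 = "cderiv \<psi>"] Cc_inf_deriv Cc_inf_continuous assms)

lemma tau_lin: "\<phi> \<in> Cc_inf \<Longrightarrow> \<psi> \<in> Cc_inf \<Longrightarrow> tau \<alpha> k (\<lambda>x. \<phi> x + z * \<psi> x) = (\<lambda>x. tau \<alpha> k \<phi> x + z * tau \<alpha> k \<psi> x)"
  by (simp add: tau_add Cc_inf_cmult tau_cmult)

lemma Cc_inf_lin: "\<phi> \<in> Cc_inf \<Longrightarrow> \<psi> \<in> Cc_inf \<Longrightarrow> (\<lambda>x. \<phi> x + z * \<psi> x) \<in> Cc_inf"
  by (intro Cc_inf_add Cc_inf_cmult)

section \<open>Coercivity and two applications of the minimising sequence\<close>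

lemma form_nonneg: "\<phi> \<in> Cc_inf \<Longrightarrow> 0 \<le> Re (L2inner \<phi> (tau \<alpha> k \<phi>))"
  using form_coercive[of \<phi>] zero_le_power2[of "L2norm \<phi>"] by linarith

lemma norm_le_tau:
  assumes "\<phi> \<in> Cc_inf"
  shows "L2norm \<phi> \<le> 4 * L2norm (tau \<alpha> k \<phi>)"
proof -
  have "(L2norm \<phi>)\<^sup>2 \<le> 4 * Re (L2inner \<phi> (tau \<alpha> k \<phi>))" by (rule form_coercive[OF assms])
  also have "\<dots> \<le> 4 * (L2norm \<phi> * L2norm (tau \<alpha> k \<phi>))"
    using order_trans[OF complex_Re_le_cmod cmod_L2inner_le[OF L2_Cc_inf[OF assms] L2_tau[OF assms]]] by simp
  finally have "L2norm \<phi> * L2norm \<phi> \<le> L2norm \<phi> * (4 * L2norm (tau \<alpha> k \<phi>))"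
    by (simp add: power2_eq_square)
  then show ?thesis
    using L2norm_nonneg[of \<phi>] L2norm_nonneg[of "tau \<alpha> k \<phi>"] by (cases "0 < L2norm \<phi>") (auto simp: mult_le_cancel_left)
qed

text \<open>Riesz representation in the form domain. The closed form is not introduced as an object;
  its value against the representing element \<open>p\<close> is the limit along the approximating
  sequence \<open>t\<close>.\<close>

lemma form_riesz:
  assumes ladd: "\<And>\<phi> \<psi> z. \<phi> \<in> Cc_inf \<Longrightarrow> \<psi> \<in> Cc_inf \<Longrightarrow> l (\<lambda>x. \<phi> x + z * \<psi> x) = l \<phi> + cnj z * l \<psi>"
    and lbound: "\<And>\<phi>. \<phi> \<in> Cc_inf \<Longrightarrow> (cmod (l \<phi>))\<^sup>2 \<le> C * Re (L2inner \<phi> (tau \<alpha> k \<phi>))" and C: "0 \<le> C"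
  obtains t p where "form_approx \<alpha> k p t" "\<And>\<phi>. \<phi> \<in> Cc_inf \<Longrightarrow> (\<lambda>n. L2inner \<phi> (tau \<alpha> k (t n))) \<longlonglongrightarrow> l \<phi>"
proof -
  have "\<exists>t. (\<forall>n. t n \<in> Cc_inf) \<and>
    (\<forall>\<epsilon>>0. \<exists>N. \<forall>m\<ge>N. \<forall>n\<ge>N. Re (L2inner (\<lambda>x. t m x - t n x) (tau \<alpha> k (\<lambda>x. t m x - t n x))) < \<epsilon>) \<and>
    (\<forall>\<phi>\<in>Cc_inf. (\<lambda>n. L2inner \<phi> (tau \<alpha> k (t n))) \<longlonglongrightarrow> l \<phi>)"
  proof (rule riesz_minimizing_sequence[where E = Cc_inf and B = "\<lambda>\<phi> \<psi>. L2inner \<phi> (tau \<alpha> k \<psi>)" and l = l and C = C])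
    show "L2inner \<xi> (tau \<alpha> k (\<lambda>x. \<phi> x + z * \<psi> x)) = L2inner \<xi> (tau \<alpha> k \<phi>) + z * L2inner \<xi> (tau \<alpha> k \<psi>)"
      if "\<xi> \<in> Cc_inf" "\<phi> \<in> Cc_inf" "\<psi> \<in> Cc_inf" for \<xi> \<phi> \<psi> z
      using that by (simp add: tau_lin L2inner_add_right L2_tau L2_cmult L2_Cc_inf L2inner_cmult_right)
    show "cnj (L2inner \<phi> (tau \<alpha> k \<psi>)) = L2inner \<psi> (tau \<alpha> k \<phi>)" if "\<phi> \<in> Cc_inf" "\<psi> \<in> Cc_inf" for \<phi> \<psi>
      using tau_symmetric[OF that(2,1)] by (simp add: L2inner_cnj)
  qed (rule Cc_inf_0 Cc_inf_lin form_nonneg ladd lbound C | assumption)+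
  then obtain t where t: "\<And>n. t n \<in> Cc_inf"
    "\<And>\<epsilon>. 0 < \<epsilon> \<Longrightarrow> \<exists>N. \<forall>m\<ge>N. \<forall>n\<ge>N. Re (L2inner (\<lambda>x. t m x - t n x) (tau \<alpha> k (\<lambda>x. t m x - t n x))) < \<epsilon>"
    "\<And>\<phi>. \<phi> \<in> Cc_inf \<Longrightarrow> (\<lambda>n. L2inner \<phi> (tau \<alpha> k (t n))) \<longlonglongrightarrow> l \<phi>"
    by blast
  have "\<exists>N. \<forall>m\<ge>N. \<forall>n\<ge>N. L2norm (\<lambda>x. t m x - t n x) < \<epsilon>" if e: "0 < \<epsilon>" for \<epsilon>
  proof -
    obtain N where N: "\<forall>m\<ge>N. \<forall>n\<ge>N. Re (L2inner (\<lambda>x. t m x - t n x) (tau \<alpha> k (\<lambda>x. t m x - t n x))) < \<epsilon>\<^sup>2 / 4"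
      using t(2)[OF divide_pos_pos[OF zero_less_power[OF e, of 2], of 4]] by auto
    have "L2norm (\<lambda>x. t m x - t n x) < \<epsilon>" if "m \<ge> N" "n \<ge> N" for m n
    proof -
      have "(L2norm (\<lambda>x. t m x - t n x))\<^sup>2 < \<epsilon>\<^sup>2"
        by (rule le_less_trans[OF form_coercive[OF Cc_inf_diff[OF t(1) t(1)]]])
           (use N[rule_format, OF that] in simp)
      then show ?thesis by (rule power2_less_imp_less) (use e in simp)
    qed
    then show ?thesis by blast
  qed
  then obtain p where p: "L2 p" "L2conv t p"
    using L2_Cauchy_complete[of t] L2_Cc_inf[OF t(1)] by blast
  have "form_approx \<alpha> k p t" unfolding form_approx_def using p t(1,2) by blast
  then show ?thesis using t(3) by (rule that)
qed

text \<open>The Riesz argument for the inner product of images: the functional being minimised is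
  the squared distance from \<open>tau \<alpha> k \<phi>\<close> to \<open>h\<close>, up to a
  constant. So \<open>h'\<close> is the projection of \<open>h\<close> onto the range of the
  closure, and coercivity makes the preimages converge as well.\<close>

lemma range_projection:
  assumes h: "L2 h"
  obtains f h' where "(f, h') \<in> opclosure (Aop \<alpha> k)"
    "\<And>\<phi>. \<phi> \<in> Cc_inf \<Longrightarrow> L2inner (tau \<alpha> k \<phi>) h' = L2inner (tau \<alpha> k \<phi>) h"
proof -
  have l: "(cmod (L2inner (tau \<alpha> k \<phi>) h))\<^sup>2 \<le> (L2norm h)\<^sup>2 * Re (L2inner (tau \<alpha> k \<phi>) (tau \<alpha> k \<phi>))"
    if "\<phi> \<in> Cc_inf" for \<phi>
    using power_mono[OF cmod_L2inner_le[OF L2_tau[OF that] h], of 2]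
    by (simp only: L2inner_self Re_complex_of_real power_mult_distrib mult.commute norm_ge_zero)
  have "\<exists>t. (\<forall>n. t n \<in> Cc_inf) \<and>
    (\<forall>\<epsilon>>0. \<exists>N. \<forall>m\<ge>N. \<forall>n\<ge>N.
      Re (L2inner (tau \<alpha> k (\<lambda>x. t m x - t n x)) (tau \<alpha> k (\<lambda>x. t m x - t n x))) < \<epsilon>) \<and>
    (\<forall>\<phi>\<in>Cc_inf. (\<lambda>n. L2inner (tau \<alpha> k \<phi>) (tau \<alpha> k (t n))) \<longlonglongrightarrow> L2inner (tau \<alpha> k \<phi>) h)"
  proof (rule riesz_minimizing_sequence[where E = Cc_inf and B = "\<lambda>\<phi> \<psi>. L2inner (tau \<alpha> k \<phi>) (tau \<alpha> k \<psi>)"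
        and l = "\<lambda>\<phi>. L2inner (tau \<alpha> k \<phi>) h" and C = "(L2norm h)\<^sup>2"])
    show "L2inner (tau \<alpha> k \<xi>) (tau \<alpha> k (\<lambda>x. \<phi> x + z * \<psi> x)) =
        L2inner (tau \<alpha> k \<xi>) (tau \<alpha> k \<phi>) + z * L2inner (tau \<alpha> k \<xi>) (tau \<alpha> k \<psi>)"
      if "\<xi> \<in> Cc_inf" "\<phi> \<in> Cc_inf" "\<psi> \<in> Cc_inf" for \<xi> \<phi> \<psi> z
      using that by (simp add: tau_lin L2inner_add_right L2_tau L2_cmult L2inner_cmult_right)
    show "L2inner (tau \<alpha> k (\<lambda>x. \<phi> x + z * \<psi> x)) h = L2inner (tau \<alpha> k \<phi>) h + cnj z * L2inner (tau \<alpha> k \<psi>) h"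
      if "\<phi> \<in> Cc_inf" "\<psi> \<in> Cc_inf" for \<phi> \<psi> z
      using that h by (simp add: tau_lin L2inner_add_left L2_tau L2_cmult L2inner_cmult_left)
    show "0 \<le> Re (L2inner (tau \<alpha> k \<phi>) (tau \<alpha> k \<phi>))" for \<phi> by (simp add: L2inner_self)
  qed (rule Cc_inf_0 Cc_inf_lin l L2inner_cnj zero_le_power2 | assumption)+
  then obtain t where t: "\<And>n. t n \<in> Cc_inf"
    "\<And>\<epsilon>. 0 < \<epsilon> \<Longrightarrow> \<exists>N. \<forall>m\<ge>N. \<forall>n\<ge>N. Re (L2inner (tau \<alpha> k (\<lambda>x. t m x - t n x)) (tau \<alpha> k (\<lambda>x. t m x - t n x))) < \<epsilon>"
    "\<And>\<phi>. \<phi> \<in> Cc_inf \<Longrightarrow> (\<lambda>n. L2inner (tau \<alpha> k \<phi>) (tau \<alpha> k (t n))) \<longlonglongrightarrow> L2inner (tau \<alpha> k \<phi>) h"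
    by blast
  have c: "\<exists>N. \<forall>m\<ge>N. \<forall>n\<ge>N. L2norm (\<lambda>x. tau \<alpha> k (t m) x - tau \<alpha> k (t n) x) < \<epsilon>" if e: "0 < \<epsilon>" for \<epsilon>
  proof -
    obtain N where N: "\<forall>m\<ge>N. \<forall>n\<ge>N. Re (L2inner (tau \<alpha> k (\<lambda>x. t m x - t n x)) (tau \<alpha> k (\<lambda>x. t m x - t n x))) < \<epsilon>\<^sup>2"
      using t(2)[OF zero_less_power[OF e, of 2]] by blast
    have "L2norm (\<lambda>x. tau \<alpha> k (t m) x - tau \<alpha> k (t n) x) < \<epsilon>" if "m \<ge> N" "n \<ge> N" for m n
    proof -
      have "(L2norm (tau \<alpha> k (\<lambda>x. t m x - t n x)))\<^sup>2 < \<epsilon>\<^sup>2"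
        using N[rule_format, OF that] by (simp only: L2inner_self Re_complex_of_real)
      then show ?thesis unfolding tau_diff[OF t(1) t(1)]
        by (rule power2_less_imp_less) (use e in simp)
    qed
    then show ?thesis by blast
  qed
  have c': "\<exists>N. \<forall>m\<ge>N. \<forall>n\<ge>N. L2norm (\<lambda>x. t m x - t n x) < \<epsilon>" if e: "0 < \<epsilon>" for \<epsilon>
  proof -
    obtain N where N: "\<forall>m\<ge>N. \<forall>n\<ge>N. L2norm (\<lambda>x. tau \<alpha> k (t m) x - tau \<alpha> k (t n) x) < \<epsilon> / 4"
      using c[OF divide_pos_pos[OF e, of 4]] by auto
    have "L2norm (\<lambda>x. t m x - t n x) < \<epsilon>" if "m \<ge> N" "n \<ge> N" for m n
      using norm_le_tau[OF Cc_inf_diff[OF t(1) t(1)], of m n] N[rule_format, OF that] unfolding tau_diff[OF t(1) t(1)] by linarith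
    then show ?thesis by blast
  qed
  obtain h' where h': "L2 h'" "L2conv (\<lambda>n. tau \<alpha> k (t n)) h'"
    using L2_Cauchy_complete[of "\<lambda>n. tau \<alpha> k (t n)", OF L2_tau[OF t(1)] c] by blast
  obtain f where f: "L2 f" "L2conv t f"
    using L2_Cauchy_complete[of t, OF L2_Cc_inf[OF t(1)] c'] by blast
  show ?thesis
  proof (rule that[of f h'])
    show "(f, h') \<in> opclosure (Aop \<alpha> k)" unfolding opclosure_iff using f h' t(1) by blast
    fix \<phi> assume \<phi>: "\<phi> \<in> Cc_inf"
    show "L2inner (tau \<alpha> k \<phi>) h' = L2inner (tau \<alpha> k \<phi>) h"
      by (rule LIMSEQ_unique[OF L2conv_inner_right[OF h'(2) L2_tau[OF t(1)] h'(1) L2_tau[OF \<phi>]] t(3)[OF \<phi>]])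
  qed
qed

end

section \<open>The functions \<open>\<Phi>\<close>, \<open>F\<close> and \<open>\<Psi>\<close>\<close>

text \<open>A Chebyshev-type bound, used to refute square integrability and to see that \<Phi> has
  positive norm.\<close>

lemma L2_lower_bound:
  assumes f: "L2 f" and ab: "0 < a" "a \<le> b" and c: "0 \<le> c" "\<And>x. x \<in> {a..b} \<Longrightarrow> c \<le> cmod (f x)"
  shows "c\<^sup>2 * (b - a) \<le> (L2norm f)\<^sup>2"
proof -
  have i: "integrable lebesgue (\<lambda>x. indicator {a..b} x *\<^sub>R c\<^sup>2)"
    by (intro integrable_scaleR_left integrable_real_indicator) (use ab in auto)
  have "c\<^sup>2 * (b - a) = integral\<^sup>L lebesgue (\<lambda>x. indicator {a..b} x *\<^sub>R c\<^sup>2)"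
    using ab by simp
  also have "\<dots> \<le> integral\<^sup>L lebesgue (\<lambda>x. indicator {0<..} x *\<^sub>R (cmod (f x))\<^sup>2)"
  proof (rule integral_mono[OF i])
    show "integrable lebesgue (\<lambda>x. indicator {0<..} x *\<^sub>R (cmod (f x))\<^sup>2)"
      using L2_integrable[OF f] by (simp add: integrable_Mp_iff)
    show "indicator {a..b} x *\<^sub>R c\<^sup>2 \<le> indicator {0<..} x *\<^sub>R (cmod (f x))\<^sup>2" for x
      using ab(1) c(1) power_mono[OF c(2), of x 2] by (auto simp: indicator_def)
  qed
  also have "\<dots> = (L2norm f)\<^sup>2"
    unfolding L2norm_power2 by (simp add: integral_restrict_space)
  finally show ?thesis .
qed

lemma integrable_on_subset_Mp:
  fixes f :: "real \<Rightarrow> 'b :: euclidean_space"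
  assumes "integrable Mp f" "A \<in> sets lebesgue" "A \<subseteq> {0<..}"
  shows "integrable (lebesgue_on A) f"
proof -
  have "set_integrable lebesgue {0<..} f"
    using assms(1) by (simp add: integrable_Mp_iff set_integrable_def)
  then have "set_integrable lebesgue A f"
    by (rule set_integrable_subset) (use assms in auto)
  then show ?thesis using assms(2) by (simp add: integrable_restrict_space set_integrable_def)
qed

lemma integral_Mp_split:
  fixes f :: "real \<Rightarrow> real"
  assumes "integrable Mp f" "0 \<le> x"
  shows "integral\<^sup>L (lebesgue_on {x<..}) f = integral\<^sup>L Mp f - integral\<^sup>L (lebesgue_on {0<..x}) f"
proof -
  have i: "integrable (lebesgue_on {x<..}) f" "integrable (lebesgue_on {0<..x}) f"
    using assms by (auto intro!: integrable_on_subset_Mp)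
  then have i': "integrable lebesgue (\<lambda>t. indicator {x<..} t *\<^sub>R f t)" "integrable lebesgue (\<lambda>t. indicator {0<..x} t *\<^sub>R f t)"
    by (simp_all add: integrable_restrict_space)
  have "integral\<^sup>L Mp f = integral\<^sup>L lebesgue (\<lambda>t. indicator {0<..} t *\<^sub>R f t)"
    by (simp add: integral_restrict_space)
  also have "\<dots> = integral\<^sup>L lebesgue (\<lambda>t. indicator {x<..} t *\<^sub>R f t + indicator {0<..x} t *\<^sub>R f t)"
    using assms(2) by (intro Bochner_Integration.integral_cong) (auto simp: indicator_def)
  also have "\<dots> = integral\<^sup>L (lebesgue_on {x<..}) f + integral\<^sup>L (lebesgue_on {0<..x}) f"
    using i' by (simp add: integral_restrict_space)
  finally show ?thesis by simp
qed

text \<open>The integrand may be unbounded at 0, as \<Phi>^2 is for \<alpha> > 0; integrability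
  there and continuity on the open half line are enough.\<close>

lemma has_real_derivative_integral_from_0:
  fixes f :: "real \<Rightarrow> real"
  assumes c: "continuous_on {0<..} f" and i: "\<And>b. integrable (lebesgue_on {0<..b}) f" and x: "0 < x"
  shows "((\<lambda>y. integral\<^sup>L (lebesgue_on {0<..y}) f) has_real_derivative f x) (at x)"
proof -
  have n: "negligible {x \<in> {0<..y} - {0..y}. f x \<noteq> 0}" "negligible {x \<in> {0..y} - {0<..y}. f x \<noteq> 0}" for y
    by (rule negligible_subset[of "{0}"]; auto)+
  have eq: "integral\<^sup>L (lebesgue_on {0<..y}) f = integral {0..y} f" for y
    using lebesgue_integral_eq_integral[OF i, of y] integral_spike_set[OF n, of y] by simp
  have "f integrable_on {0<..x + 1}" by (rule integrable_on_lebesgue_on[OF i]) simp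
  then have int: "f integrable_on {0..x + 1}" by (rule integrable_spike_set[OF _ n])
  have "isCont f x" using c x by (simp add: continuous_on_eq_continuous_at)
  then have "continuous (at x within {0..x + 1} - {}) f" by (rule continuous_at_imp_continuous_at_within)
  from integral_has_vector_derivative_continuous_at[OF int _ _ this]
  have "((\<lambda>u. integral {0..u} f) has_vector_derivative f x) (at x within {0..x + 1})" using x by simp
  then show ?thesis
    unfolding eq using x at_within_Icc_at[of 0 x "x + 1"] by (simp add: has_real_derivative_iff_has_vector_derivative)
qed

lemma integrable_const_Ioc: "integrable (lebesgue_on {0<..b :: real}) (\<lambda>x. c :: real)"
proof -
  have "{0<..b} \<in> lmeasurable"
    by (rule bounded_set_imp_lmeasurable[OF bounded_subset[of "{0..b}"]]) auto
  then have "integrable lebesgue (\<lambda>x. indicator {0<..b} x *\<^sub>R c)"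
    by (intro integrable_scaleR_left integrable_real_indicator) (auto simp: fmeasurable_def)
  then show ?thesis by (subst integrable_restrict_space) auto
qed

context half_line_operator
begin

definition \<kappa> :: real where "\<kappa> = \<bar>real_of_int k\<bar>"
definition \<beta> :: real where "\<beta> = \<kappa> / (1 + \<alpha>)"
definition CPhi :: real where "CPhi = sqrt (pi * (1 + \<alpha>) / (2 * \<kappa>))"
definition CF :: real where "CF = sqrt (2 * (1 + \<alpha>) / (pi * \<kappa>))"

lemma \<kappa>: "0 < \<kappa>" using k by (simp add: \<kappa>_def)
lemma \<beta>: "0 < \<beta>" using \<kappa> \<alpha> by (simp add: \<beta>_def)
lemma CPhi: "0 < CPhi" using \<kappa> \<alpha> by (simp add: CPhi_def)
lemma CF: "0 < CF" using \<kappa> \<alpha> by (simp add: CF_def)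

lemma CPhi_CF: "CPhi * CF = 1 / \<beta>"
proof -
  have "CPhi * CF = sqrt ((pi * (1 + \<alpha>) / (2 * \<kappa>)) * (2 * (1 + \<alpha>) / (pi * \<kappa>)))"
    unfolding CPhi_def CF_def by (rule real_sqrt_mult[symmetric])
  also have "(pi * (1 + \<alpha>) / (2 * \<kappa>)) * (2 * (1 + \<alpha>) / (pi * \<kappa>)) = (1 / \<beta>)\<^sup>2"
    using \<kappa> \<alpha> by (simp add: \<beta>_def power2_eq_square field_simps)
  finally show ?thesis using \<beta> by simp
qed

lemma PhiF_eq: "PhiF \<alpha> k x = CPhi * x powr (- \<alpha> / 2) * exp (- \<beta> * x powr (1 + \<alpha>))"
  by (simp add: PhiF_def CPhi_def \<beta>_def \<kappa>_def)

lemma FF_eq: "FF \<alpha> k x = CF * x powr (- \<alpha> / 2) * sinh (\<beta> * x powr (1 + \<alpha>))"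
  by (simp add: FF_def CF_def \<beta>_def \<kappa>_def)

definition PhiF' :: "real \<Rightarrow> real" where
  "PhiF' x = (- \<alpha> / 2 - \<kappa> * x powr (1 + \<alpha>)) / x * PhiF \<alpha> k x"

definition FF' :: "real \<Rightarrow> real" where
  "FF' x = CF * x powr (- \<alpha> / 2) / x *
     (- \<alpha> / 2 * sinh (\<beta> * x powr (1 + \<alpha>)) + \<kappa> * x powr (1 + \<alpha>) * cosh (\<beta> * x powr (1 + \<alpha>)))"

lemma \<beta>\<kappa>: "\<beta> * (1 + \<alpha>) = \<kappa>" "(1 + \<alpha>) * \<beta> = \<kappa>"
  using \<alpha> by (simp_all add: \<beta>_def)

text \<open>With T = x powr (1 + \<alpha>) the potential times x^2 is quadratic in T, and x times
  the logarithmic derivative of \<Phi> is affine in T. The differential equations of \<Phi> and F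
  become algebraic identities in T and in sinh and cosh of \<beta> T.\<close>

lemma Vpot_powr:
  assumes "0 < x"
  shows "Vpot \<alpha> k x = ((\<kappa> * x powr (1 + \<alpha>))\<^sup>2 + \<alpha> / 2 + \<alpha>\<^sup>2 / 4) / x\<^sup>2"
proof -
  have "x powr (2 * \<alpha>) = (x powr (1 + \<alpha>))\<^sup>2 / x\<^sup>2"
    using assms powr_add[of x 2 "2 * \<alpha>"] by (simp add: power2_eq_square powr_numeral flip: powr_add)
  moreover have "(real_of_int k)\<^sup>2 = \<kappa>\<^sup>2" by (simp add: \<kappa>_def)
  ultimately show ?thesis using assms
    by (simp add: Vpot_def power_mult_distrib add_divide_distrib) (simp add: power2_eq_square field_simps)
qed

lemma T_deriv: "0 < x \<Longrightarrow> ((\<lambda>x. x powr (1 + \<alpha>)) has_real_derivative (1 + \<alpha>) * x powr (1 + \<alpha>) / x) (at x)"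
  by (rule has_real_derivative_powr')

lemma PhiF_deriv:
  assumes x: "0 < x"
  shows "(PhiF \<alpha> k has_real_derivative PhiF' x) (at x)"
    "(PhiF' has_real_derivative Vpot \<alpha> k x * PhiF \<alpha> k x) (at x)"
proof -
  have "((\<lambda>x. CPhi * x powr (- \<alpha> / 2) * exp (- \<beta> * x powr (1 + \<alpha>))) has_real_derivative
     CPhi * (- \<alpha> / 2 * x powr (- \<alpha> / 2) / x) * exp (- \<beta> * x powr (1 + \<alpha>)) +
     CPhi * x powr (- \<alpha> / 2) * (exp (- \<beta> * x powr (1 + \<alpha>)) * (- \<beta> * ((1 + \<alpha>) * x powr (1 + \<alpha>) / x)))) (at x)"
    by (rule DERIV_cong, rule DERIV_mult[OF DERIV_cmult[OF has_real_derivative_powr'[OF x]]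
          DERIV_chain2[OF DERIV_exp DERIV_cmult[OF T_deriv[OF x]]]]) simp
  then show d: "(PhiF \<alpha> k has_real_derivative PhiF' x) (at x)"
    unfolding PhiF_eq[abs_def] PhiF'_def
    by (rule DERIV_cong) (simp only: \<beta>\<kappa>[symmetric] PhiF_eq, use x in \<open>simp add: field_simps\<close>)
  have "((\<lambda>x. (- \<alpha> / 2 - \<kappa> * x powr (1 + \<alpha>)) / x) has_real_derivative
      ((- (\<kappa> * ((1 + \<alpha>) * x powr (1 + \<alpha>) / x))) * x - (- \<alpha> / 2 - \<kappa> * x powr (1 + \<alpha>)) * 1) / (x * x)) (at x)"
    by (rule DERIV_cong, rule DERIV_divide[OF DERIV_diff[OF DERIV_const DERIV_cmult[OF T_deriv[OF x]]] DERIV_ident])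
       (use x in simp_all)
  from DERIV_mult[OF this d]
  show "(PhiF' has_real_derivative Vpot \<alpha> k x * PhiF \<alpha> k x) (at x)"
    unfolding PhiF'_def[abs_def]
    by (rule DERIV_cong) (use x in \<open>simp add: Vpot_powr[OF x] power2_eq_square field_simps\<close>)
qed

lemma FF_deriv:
  assumes x: "0 < x"
  shows "(FF \<alpha> k has_real_derivative FF' x) (at x)"
    "(FF' has_real_derivative Vpot \<alpha> k x * FF \<alpha> k x) (at x)"
proof -
  define y where "y = \<beta> * x powr (1 + \<alpha>)"
  have dy: "((\<lambda>x. \<beta> * x powr (1 + \<alpha>)) has_real_derivative \<kappa> * x powr (1 + \<alpha>) / x) (at x)"
    using DERIV_cmult[OF T_deriv[OF x], of \<beta>] by (simp add: \<beta>\<kappa>[symmetric] mult_ac)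
  have ds: "((\<lambda>x. sinh (\<beta> * x powr (1 + \<alpha>))) has_real_derivative cosh y * (\<kappa> * x powr (1 + \<alpha>) / x)) (at x)"
    and dc: "((\<lambda>x. cosh (\<beta> * x powr (1 + \<alpha>))) has_real_derivative sinh y * (\<kappa> * x powr (1 + \<alpha>) / x)) (at x)"
    unfolding y_def by (rule derivative_eq_intros dy refl | simp)+
  have dp: "((\<lambda>x. CF * x powr (- \<alpha> / 2)) has_real_derivative CF * (- \<alpha> / 2 * x powr (- \<alpha> / 2) / x)) (at x)"
    by (rule DERIV_cmult[OF has_real_derivative_powr'[OF x]])
  show "(FF \<alpha> k has_real_derivative FF' x) (at x)"
    unfolding FF_eq[abs_def] FF'_def
    by (rule DERIV_cong[OF DERIV_mult[OF dp ds]]) (use x in \<open>simp add: y_def field_simps\<close>)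
  have dT: "((\<lambda>x. \<kappa> * x powr (1 + \<alpha>)) has_real_derivative \<kappa> * ((1 + \<alpha>) * x powr (1 + \<alpha>) / x)) (at x)"
    by (rule DERIV_cmult[OF T_deriv[OF x]])
  have nz: "x \<noteq> 0" using x by simp
  from DERIV_mult[OF DERIV_divide[OF dp DERIV_ident nz] DERIV_add[OF DERIV_cmult[OF ds, of "- \<alpha> / 2"] DERIV_mult[OF dT dc]]]
  show "(FF' has_real_derivative Vpot \<alpha> k x * FF \<alpha> k x) (at x)"
    unfolding FF'_def[abs_def]
    by (rule DERIV_cong)
       (use x in \<open>simp add: Vpot_powr[OF x] FF_eq y_def[symmetric] power2_eq_square field_simps\<close>)
qed

lemma continuous_PhiF: "continuous_on {0<..} (PhiF \<alpha> k)" "continuous_on {0<..} PhiF'"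
  using PhiF_deriv by (auto intro!: continuous_at_imp_continuous_on DERIV_isCont)

lemma continuous_FF: "continuous_on {0<..} (FF \<alpha> k)" "continuous_on {0<..} FF'"
  using FF_deriv by (auto intro!: continuous_at_imp_continuous_on DERIV_isCont)

lemma PhiF_pos: "0 < x \<Longrightarrow> 0 < PhiF \<alpha> k x"
  using CPhi by (simp add: PhiF_eq)

lemma FF_nonneg: "0 < x \<Longrightarrow> 0 \<le> FF \<alpha> k x"
  using CF \<beta> by (simp add: FF_eq)

text \<open>The exponentials cancel because sinh y + cosh y = exp y and the powers of x multiply to
  x, leaving \<open>CPhi * CF * \<kappa>\<close>. This constant is the origin of the prefactor in
  \<open>PsiF\<close>.\<close>

lemma Wronskian:
  assumes x: "0 < x"
  shows "PhiF \<alpha> k x * FF' x - PhiF' x * FF \<alpha> k x = 1 + \<alpha>"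
proof -
  define y where "y = \<beta> * x powr (1 + \<alpha>)"
  have p: "x powr (- \<alpha> / 2) * x powr (- \<alpha> / 2) * x powr (1 + \<alpha>) = x"
    using x by (simp flip: powr_add)
  have "PhiF \<alpha> k x * FF' x - PhiF' x * FF \<alpha> k x =
      CPhi * CF * \<kappa> * (x powr (- \<alpha> / 2) * x powr (- \<alpha> / 2) * x powr (1 + \<alpha>)) / x * (exp (- y) * (sinh y + cosh y))"
    unfolding PhiF'_def FF'_def PhiF_eq FF_eq y_def using x by (simp add: field_simps)
  also have "exp (- y) * (sinh y + cosh y) = 1"
    by (simp add: sinh_plus_cosh flip: exp_add)
  finally show ?thesis unfolding p CPhi_CF using x \<alpha> \<kappa> by (simp add: \<beta>_def)
qed

text \<open>Replaces the exponent by a linear one so that Gamma integrals dominate; the shift by 1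
  takes care of the interval (0, 1], where the power is at most x.\<close>

lemma T_ge: "0 < x \<Longrightarrow> x - 1 \<le> x powr (1 + \<alpha>)"
proof (cases "x \<le> 1")
  case False
  then have "x powr 1 \<le> x powr (1 + \<alpha>)" using \<alpha> by (intro powr_mono) auto
  then show ?thesis using False by simp
qed (use powr_ge_zero[of x "1 + \<alpha>"] in linarith)

lemma exp_T_le:
  assumes "0 < x" "0 \<le> b"
  shows "exp (- b * x powr (1 + \<alpha>)) \<le> exp b * exp (- (b * x))"
proof -
  have "b * (x - 1) \<le> b * x powr (1 + \<alpha>)" using T_ge[OF assms(1)] assms(2) by (rule mult_left_mono)
  then show ?thesis by (simp add: algebra_simps flip: exp_add)
qed

lemma integrable_powr_exp_T:
  assumes "-1 < s" "0 < b"
  shows "integrable Mp (\<lambda>x. x powr s * exp (- b * x powr (1 + \<alpha>)))"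
proof (rule Bochner_Integration.integrable_bound[OF integrable_mult_right[OF integrable_powr_exp[OF assms], of "exp b"]])
  show "(\<lambda>x. x powr s * exp (- b * x powr (1 + \<alpha>))) \<in> borel_measurable Mp"
    by (intro borel_measurable_Mp_continuous continuous_intros) auto
  have "x powr s * exp (- b * x powr (1 + \<alpha>)) \<le> exp b * (x powr s * exp (- (b * x)))" if "0 < x" for x
    using mult_left_mono[OF exp_T_le[OF that, of b], of "x powr s"] assms by (simp add: mult_ac)
  then show "AE x in Mp. norm (x powr s * exp (- b * x powr (1 + \<alpha>))) \<le> norm (exp b * (x powr s * exp (- (b * x))))"
    by (intro AE_MpI) simp
qed

lemma L2_powr_exp_T:
  assumes "-1/2 < s" "0 < b"
  shows "L2 (\<lambda>x. complex_of_real (x powr s * exp (- b * x powr (1 + \<alpha>))))"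
  unfolding L2_def
proof
  show "(\<lambda>x. complex_of_real (x powr s * exp (- b * x powr (1 + \<alpha>)))) \<in> borel_measurable Mp"
    by (intro borel_measurable_Mp_continuous continuous_intros) auto
  have "integrable Mp (\<lambda>x. x powr (2 * s) * exp (- (2 * b) * x powr (1 + \<alpha>)))"
    using assms by (intro integrable_powr_exp_T) auto
  moreover have "(cmod (complex_of_real (x powr s * exp (- b * x powr (1 + \<alpha>)))))\<^sup>2 =
      x powr (2 * s) * exp (- (2 * b) * x powr (1 + \<alpha>))" for x
  proof -
    have "x powr (2 * s) = x powr s * x powr s"
      "exp (- (2 * b) * x powr (1 + \<alpha>)) = exp (- b * x powr (1 + \<alpha>)) * exp (- b * x powr (1 + \<alpha>))"
      by (simp_all flip: powr_add exp_add)
    then show ?thesis unfolding norm_of_real by (simp add: power2_eq_square)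
  qed
  ultimately show "integrable Mp (\<lambda>x. (cmod (complex_of_real (x powr s * exp (- b * x powr (1 + \<alpha>)))))\<^sup>2)"
    by simp
qed

text \<open>Integrability at 0 is the condition - \<alpha>/2 > - 1/2, the limit circle case.\<close>

lemma L2_Phi: "L2 (Phi \<alpha> k)"
  using L2_cmult[OF L2_powr_exp_T[of "- \<alpha> / 2" \<beta>], of "complex_of_real CPhi"] \<alpha> \<beta>
  by (simp add: PhiF_eq[abs_def] mult.assoc)

lemma Phi_norm_pos: "0 < L2norm (Phi \<alpha> k)"
proof -
  have "continuous_on {1..2} (PhiF \<alpha> k)" by (rule continuous_on_subset[OF continuous_PhiF(1)]) auto
  then obtain y where y: "y \<in> {1..2}" "\<And>x. x \<in> {1..2} \<Longrightarrow> PhiF \<alpha> k y \<le> PhiF \<alpha> k x"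
    using continuous_attains_inf[of "{1..2::real}" "PhiF \<alpha> k"] by auto
  have "(PhiF \<alpha> k y)\<^sup>2 * (2 - 1) \<le> (L2norm (Phi \<alpha> k))\<^sup>2"
  proof (rule L2_lower_bound[OF L2_Phi])
    fix x :: real assume "x \<in> {1..2}"
    then show "PhiF \<alpha> k y \<le> cmod (Phi \<alpha> k x)"
      using y(2)[of x] PhiF_pos[of x] by simp
  qed (use y(1) PhiF_pos[of y] in auto)
  then have "L2norm (Phi \<alpha> k) \<noteq> 0" using PhiF_pos[of y] y(1) by auto
  then show ?thesis using L2norm_nonneg by (metis less_eq_real_def)
qed

lemma exp_T_ge: "0 < x \<Longrightarrow> x \<le> 1 \<Longrightarrow> exp (- \<beta>) \<le> exp (- \<beta> * x powr (1 + \<alpha>))"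
  using \<alpha> \<beta> powr_mono2[of "1 + \<alpha>" x 1] by simp

text \<open>Near 0 the function \<Phi> stays above a positive constant, so the square of \<Phi>/x
  integrates over {e..2 * e} to at least a multiple of 1/e.\<close>

lemma Phi_not_Dxinv: "\<not> L2 (\<lambda>x. Phi \<alpha> k x / of_real x)"
proof
  assume L: "L2 (\<lambda>x. Phi \<alpha> k x / of_real x)"
  define c where "c = CPhi * exp (- \<beta>)"
  have c: "0 < c" using CPhi by (simp add: c_def)
  define I where "I = (L2norm (\<lambda>x. Phi \<alpha> k x / of_real x))\<^sup>2"
  have le: "c\<^sup>2 / (4 * e) \<le> I" if e: "0 < e" "e \<le> 1/2" for e
  proof -
    have "(c / (2 * e))\<^sup>2 * (2 * e - e) \<le> I"
      unfolding I_def
    proof (rule L2_lower_bound[OF L])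
      fix x assume x: "x \<in> {e..2 * e}"
      have x01: "0 < x" "x \<le> 1" using x e by auto
      have "1 \<le> x powr (- \<alpha> / 2)"
        using x01 \<alpha> powr_mono2'[of "- \<alpha> / 2" x 1] by simp
      then have "CPhi * 1 * exp (- \<beta>) \<le> CPhi * x powr (- \<alpha> / 2) * exp (- \<beta> * x powr (1 + \<alpha>))"
        using CPhi exp_T_ge[OF x01] by (intro mult_mono) auto
      then have "c \<le> PhiF \<alpha> k x" by (simp add: c_def PhiF_eq)
      then have "c / (2 * e) \<le> PhiF \<alpha> k x / x" using x e c by (intro frac_le) auto
      also have "\<dots> = cmod (Phi \<alpha> k x / of_real x)"
        using x e PhiF_pos[of x] by (simp add: norm_divide)
      finally show "c / (2 * e) \<le> cmod (Phi \<alpha> k x / of_real x)" .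
    qed (use e c in auto)
    then show ?thesis using e by (simp add: power2_eq_square field_simps)
  qed
  \<comment> \<open>Small enough that the lower bound c^2/(4 e) exceeds \<open>I\<close> by at least
    1.\<close>
  define e where "e = min (1/2) (c\<^sup>2 / (4 * (I + 1)))"
  have I: "0 \<le> I" by (simp add: I_def)
  have e: "0 < e" "e \<le> 1/2" "e \<le> c\<^sup>2 / (4 * (I + 1))"
  proof -
    show "0 < e" using I c by (simp add: e_def)
  qed (unfold e_def, rule min.cobounded1, rule min.cobounded2)
  have "I + 1 \<le> c\<^sup>2 / (4 * e)" using e I by (simp add: field_simps)
  then show False using le[OF e(1,2)] by simp
qed

lemma sinh_ge: "0 \<le> y \<Longrightarrow> y / 2 \<le> sinh (y::real)"
proof -
  assume "0 \<le> y"
  then have "exp (- y) \<le> 1" by simp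
  then have "y \<le> exp y - exp (- y)" using exp_ge_add_one_self[of y] by linarith
  then show ?thesis by (simp add: sinh_def)
qed

text \<open>The linear bound on sinh already keeps F above a positive constant on [1, \<infinity>),
  since the remaining power x powr (1 + \<alpha>/2) is at least 1 there.\<close>

lemma FF_not_L2: "\<not> L2 (\<lambda>x. complex_of_real (FF \<alpha> k x))"
proof
  assume L: "L2 (\<lambda>x. complex_of_real (FF \<alpha> k x))"
  define c where "c = CF * (\<beta> / 2)"
  have c: "0 < c" using CF \<beta> by (simp add: c_def)
  have le: "c\<^sup>2 * b \<le> (L2norm (\<lambda>x. complex_of_real (FF \<alpha> k x)))\<^sup>2" if b: "0 \<le> b" for b
  proof -
    have "c\<^sup>2 * ((1 + b) - 1) \<le> (L2norm (\<lambda>x. complex_of_real (FF \<alpha> k x)))\<^sup>2"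
    proof (rule L2_lower_bound[OF L])
      fix x assume x: "x \<in> {1..1 + b}"
      have "x powr (- \<alpha> / 2) * x powr (1 + \<alpha>) = x powr (1 + \<alpha> / 2)" by (simp flip: powr_add add: add.commute)
      then have "1 \<le> x powr (- \<alpha> / 2) * x powr (1 + \<alpha>)" using x \<alpha> by (simp add: ge_one_powr_ge_zero)
      then have "c * 1 \<le> c * (x powr (- \<alpha> / 2) * x powr (1 + \<alpha>))" using c by (intro mult_left_mono) auto
      also have "\<dots> = CF * x powr (- \<alpha> / 2) * (\<beta> * x powr (1 + \<alpha>) / 2)" by (simp add: c_def)
      also have "\<dots> \<le> FF \<alpha> k x"
        unfolding FF_eq using CF \<beta> by (intro mult_left_mono sinh_ge) auto
      finally show "c \<le> cmod (complex_of_real (FF \<alpha> k x))" using FF_nonneg[of x] x by simp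
    qed (use b c in auto)
    then show ?thesis by simp
  qed
  define I where "I = (L2norm (\<lambda>x. complex_of_real (FF \<alpha> k x)))\<^sup>2"
  have "0 \<le> I" by (simp add: I_def)
  then have "c\<^sup>2 * ((I + 1) / c\<^sup>2) \<le> I" unfolding I_def using c by (intro le) auto
  then show False using c by simp
qed

lemma Phi_adj: "(Phi \<alpha> k, (\<lambda>x. 0)) \<in> adj (Aop \<alpha> k)"
proof (rule classical_in_adj)
  show "(Phi \<alpha> k has_vector_derivative complex_of_real (PhiF' x)) (at x)" if "0 < x" for x
    using PhiF_deriv(1)[OF that] by (simp add: has_vector_derivative_complex_iff)
  show "((\<lambda>x. complex_of_real (PhiF' x)) has_vector_derivative complex_of_real (Vpot \<alpha> k x * PhiF \<alpha> k x)) (at x)"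
    if "0 < x" for x
    using PhiF_deriv(2)[OF that] by (simp add: has_vector_derivative_complex_iff)
qed (auto intro!: L2_Phi L2_0 continuous_intros continuous_Vpot continuous_PhiF)

section \<open>Variation of parameters for \<Psi>\<close>

text \<open>The growth of F and the decay of \<Phi> cancel: exp (- y) sinh y = (1 - exp (- 2 y))/2
  \<le> y for y = \<beta> T, and \<open>CPhi * CF\<close> is the reciprocal of \<beta>.\<close>

lemma FPhi_le:
  assumes x: "0 < x"
  shows "FF \<alpha> k x * PhiF \<alpha> k x \<le> x"
proof -
  define y where "y = \<beta> * x powr (1 + \<alpha>)"
  have p: "x powr (- \<alpha> / 2) * x powr (- \<alpha> / 2) * x powr (1 + \<alpha>) = x"
    using x by (simp flip: powr_add)
  have "FF \<alpha> k x * PhiF \<alpha> k x = (CPhi * CF) * (x powr (- \<alpha> / 2) * x powr (- \<alpha> / 2)) * (exp (- y) * sinh y)"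
    unfolding PhiF_eq FF_eq y_def by simp
  also have "exp (- y) * sinh y \<le> y"
  proof -
    have "exp (- y) * sinh y = (1 - exp (- (2 * y))) / 2"
      by (simp add: sinh_def field_simps flip: exp_add)
    then show ?thesis using exp_ge_add_one_self[of "- (2 * y)"] by simp
  qed
  then have "(CPhi * CF) * (x powr (- \<alpha> / 2) * x powr (- \<alpha> / 2)) * (exp (- y) * sinh y) \<le>
      (CPhi * CF) * (x powr (- \<alpha> / 2) * x powr (- \<alpha> / 2)) * y"
    using CPhi CF by (intro mult_left_mono) auto
  also have "\<dots> = x powr (- \<alpha> / 2) * x powr (- \<alpha> / 2) * x powr (1 + \<alpha>)"
    unfolding CPhi_CF y_def using \<beta> by simp
  finally show ?thesis using p by simp
qed

lemma integrable_FPhi: "integrable (lebesgue_on {0<..b}) (\<lambda>x. FF \<alpha> k x * PhiF \<alpha> k x)"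
proof (rule Bochner_Integration.integrable_bound)
  show "integrable (lebesgue_on {0<..b}) (\<lambda>x. b)" by (rule integrable_const_Ioc)
  have "continuous_on {0<..b} (\<lambda>x. FF \<alpha> k x * PhiF \<alpha> k x)"
    by (rule continuous_on_subset[OF continuous_on_mult[OF continuous_FF(1) continuous_PhiF(1)]]) auto
  then show "(\<lambda>x. FF \<alpha> k x * PhiF \<alpha> k x) \<in> borel_measurable (lebesgue_on {0<..b})"
    by (rule continuous_imp_measurable_on_sets_lebesgue) auto
  have "norm (FF \<alpha> k x * PhiF \<alpha> k x) \<le> norm b" if "x \<in> {0<..b}" for x
    using FPhi_le[of x] FF_nonneg[of x] PhiF_pos[of x] that by (simp add: abs_mult)
  then show "AE x in lebesgue_on {0<..b}. norm (FF \<alpha> k x * PhiF \<alpha> k x) \<le> norm b"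
    by (intro AE_I2) auto
qed

lemma integrable_PhiF2: "integrable Mp (\<lambda>x. (PhiF \<alpha> k x)\<^sup>2)"
  using L2_integrable[OF L2_Phi] by (simp add: norm_of_real)

text \<open>The integrals inside \<open>PsiF\<close>. \<open>J\<close> complements \<open>I2\<close>
  to the constant \<open>N\<close>, so that the derivative of \<open>I2\<close> and its behaviour at
  0 come from an integral starting at 0.\<close>

definition I1 :: "real \<Rightarrow> real" where "I1 x = integral\<^sup>L (lebesgue_on {0<..x}) (\<lambda>\<rho>. FF \<alpha> k \<rho> * PhiF \<alpha> k \<rho>)"
definition I2 :: "real \<Rightarrow> real" where "I2 x = integral\<^sup>L (lebesgue_on {x<..}) (\<lambda>\<rho>. (PhiF \<alpha> k \<rho>)\<^sup>2)"
definition J :: "real \<Rightarrow> real" where "J x = integral\<^sup>L (lebesgue_on {0<..x}) (\<lambda>\<rho>. (PhiF \<alpha> k \<rho>)\<^sup>2)"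
definition N :: real where "N = (L2norm (Phi \<alpha> k))\<^sup>2"

lemma PsiF_eq: "PsiF \<alpha> k x = (PhiF \<alpha> k x * I1 x + FF \<alpha> k x * I2 x) / (1 + \<alpha>)"
  by (simp add: PsiF_def I1_def I2_def)

lemma I2_eq: "0 \<le> x \<Longrightarrow> I2 x = N - J x"
  unfolding I2_def J_def N_def L2norm_power2 using integral_Mp_split[OF integrable_PhiF2, of x] by simp

lemma I1_deriv: "0 < x \<Longrightarrow> (I1 has_real_derivative FF \<alpha> k x * PhiF \<alpha> k x) (at x)"
  unfolding I1_def[abs_def]
  by (intro has_real_derivative_integral_from_0 integrable_FPhi continuous_intros continuous_FF continuous_PhiF)

lemma J_deriv: "0 < x \<Longrightarrow> (J has_real_derivative (PhiF \<alpha> k x)\<^sup>2) (at x)"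
  unfolding J_def[abs_def]
  by (intro has_real_derivative_integral_from_0 integrable_on_subset_Mp[OF integrable_PhiF2] continuous_intros continuous_PhiF) auto

lemma I2_deriv:
  assumes "0 < x" shows "(I2 has_real_derivative - (PhiF \<alpha> k x)\<^sup>2) (at x)"
proof -
  have "((\<lambda>x. N - J x) has_real_derivative - (PhiF \<alpha> k x)\<^sup>2) (at x)"
    using DERIV_diff[OF DERIV_const[of N] J_deriv[OF assms]] by simp
  moreover have "\<forall>\<^sub>F y in nhds x. N - J y = I2 y"
    using assms by (intro eventually_nhds_in_open[of "{0<..}", THEN eventually_mono]) (auto simp: I2_eq)
  ultimately show ?thesis using DERIV_cong_ev[of x x "\<lambda>x. N - J x" I2] by blast
qed

definition PsiF' :: "real \<Rightarrow> real" where "PsiF' x = (PhiF' x * I1 x + FF' x * I2 x) / (1 + \<alpha>)"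

text \<open>Variation of parameters: the derivatives of the two integrals cancel in the first
  derivative, and in the second they leave - \<Phi> times the Wronskian, which the prefactor 1/(1 +
  \<alpha>) normalises.\<close>

lemma PsiF_deriv:
  assumes x: "0 < x"
  shows "(PsiF \<alpha> k has_real_derivative PsiF' x) (at x)"
    "(PsiF' has_real_derivative Vpot \<alpha> k x * PsiF \<alpha> k x - PhiF \<alpha> k x) (at x)"
proof -
  note d = PhiF_deriv[OF x] FF_deriv[OF x] I1_deriv[OF x] I2_deriv[OF x]
  show "(PsiF \<alpha> k has_real_derivative PsiF' x) (at x)"
    unfolding PsiF_eq[abs_def]
    by (rule DERIV_cong[OF DERIV_cdivide[OF DERIV_add[OF DERIV_mult[OF d(1,5)] DERIV_mult[OF d(3,6)]]]])
       (simp add: PsiF'_def power2_eq_square algebra_simps)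
  have "PhiF \<alpha> k x * (PhiF \<alpha> k x * FF' x - PhiF' x * FF \<alpha> k x) = PhiF \<alpha> k x * (1 + \<alpha>)"
    by (simp add: Wronskian[OF x])
  then have e: "PhiF' x * (FF \<alpha> k x * PhiF \<alpha> k x) - FF' x * (PhiF \<alpha> k x)\<^sup>2 = - PhiF \<alpha> k x * (1 + \<alpha>)"
    by (simp add: power2_eq_square algebra_simps)
  have "Vpot \<alpha> k x * PhiF \<alpha> k x * I1 x + (FF \<alpha> k x * PhiF \<alpha> k x) * PhiF' x +
      (Vpot \<alpha> k x * FF \<alpha> k x * I2 x + - (PhiF \<alpha> k x)\<^sup>2 * FF' x) =
      Vpot \<alpha> k x * (PhiF \<alpha> k x * I1 x + FF \<alpha> k x * I2 x) +
      (PhiF' x * (FF \<alpha> k x * PhiF \<alpha> k x) - FF' x * (PhiF \<alpha> k x)\<^sup>2)"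
    by (simp add: algebra_simps)
  also have "\<dots> = (1 + \<alpha>) * (Vpot \<alpha> k x * PsiF \<alpha> k x - PhiF \<alpha> k x)"
    unfolding e PsiF_eq using \<alpha> by (simp add: field_simps)
  finally have e2: "(Vpot \<alpha> k x * PhiF \<alpha> k x * I1 x + (FF \<alpha> k x * PhiF \<alpha> k x) * PhiF' x +
      (Vpot \<alpha> k x * FF \<alpha> k x * I2 x + - (PhiF \<alpha> k x)\<^sup>2 * FF' x)) / (1 + \<alpha>) = Vpot \<alpha> k x * PsiF \<alpha> k x - PhiF \<alpha> k x"
    using \<alpha> by simp
  show "(PsiF' has_real_derivative Vpot \<alpha> k x * PsiF \<alpha> k x - PhiF \<alpha> k x) (at x)"
    unfolding PsiF'_def[abs_def]
    by (rule DERIV_cong[OF DERIV_cdivide[OF DERIV_add[OF DERIV_mult[OF d(2,5)] DERIV_mult[OF d(4,6)]]] e2])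
qed

lemma continuous_PsiF: "continuous_on {0<..} (PsiF \<alpha> k)"
  using PsiF_deriv by (auto intro!: continuous_at_imp_continuous_on DERIV_isCont)

lemma I1_bound:
  assumes x: "0 < x"
  shows "0 \<le> I1 x" "I1 x \<le> x\<^sup>2"
proof -
  show "0 \<le> I1 x"
    unfolding I1_def by (rule integral_nonneg_AE, rule AE_I2)
      (auto intro!: mult_nonneg_nonneg FF_nonneg less_imp_le[OF PhiF_pos])
  have "I1 x \<le> integral\<^sup>L (lebesgue_on {0<..x}) (\<lambda>\<rho>. x)"
    unfolding I1_def
    by (rule integral_mono_AE[OF integrable_FPhi integrable_const_Ioc], rule AE_I2) (use FPhi_le in force)
  also have "\<dots> = x\<^sup>2"
    using x by (simp add: measure_restrict_space power2_eq_square)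
  finally show "I1 x \<le> x\<^sup>2" .
qed

text \<open>Of the decay exp (- 2 \<beta> T) of \<Phi>^2, three quarters are frozen at the lower
  limit x and one quarter is kept for integrability. Three quarters suffice to beat F, which grows
  at most like exp (\<beta> T).\<close>

lemma I2_bound:
  obtains M where "0 \<le> M" "\<And>x. 0 < x \<Longrightarrow> 0 \<le> I2 x \<and> I2 x \<le> M * exp (- (3/2 * \<beta>) * x powr (1 + \<alpha>))"
proof -
  let ?g = "\<lambda>x. x powr (- \<alpha>) * exp (- (\<beta> / 2) * x powr (1 + \<alpha>))"
  have g: "integrable Mp ?g" using \<alpha> \<beta> by (intro integrable_powr_exp_T) auto
  define M where "M = CPhi\<^sup>2 * integral\<^sup>L Mp ?g"
  have M0: "0 \<le> M" unfolding M_def by (intro mult_nonneg_nonneg integral_nonneg_AE AE_I2) auto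
  have "0 \<le> I2 x \<and> I2 x \<le> M * exp (- (3/2 * \<beta>) * x powr (1 + \<alpha>))" if x: "0 < x" for x
  proof
    show "0 \<le> I2 x" unfolding I2_def by (rule integral_nonneg_AE, rule AE_I2) simp
    let ?E = "exp (- (3/2 * \<beta>) * x powr (1 + \<alpha>))"
    have le: "(PhiF \<alpha> k y)\<^sup>2 \<le> CPhi\<^sup>2 * ?E * ?g y" if y: "x < y" for y
    proof -
      have "x powr (1 + \<alpha>) \<le> y powr (1 + \<alpha>)" using x y \<alpha> by (intro powr_mono2) auto
      then have "3/2 * \<beta> * x powr (1 + \<alpha>) \<le> 3/2 * \<beta> * y powr (1 + \<alpha>)" using \<beta> by simp
      then have "exp (- (2 * \<beta>) * y powr (1 + \<alpha>)) \<le> ?E * exp (- (\<beta> / 2) * y powr (1 + \<alpha>))"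
        by (simp add: algebra_simps flip: exp_add)
      then have "CPhi\<^sup>2 * y powr (- \<alpha>) * exp (- (2 * \<beta>) * y powr (1 + \<alpha>)) \<le>
          CPhi\<^sup>2 * y powr (- \<alpha>) * (?E * exp (- (\<beta> / 2) * y powr (1 + \<alpha>)))"
        by (intro mult_left_mono) auto
      moreover have "(PhiF \<alpha> k y)\<^sup>2 = CPhi\<^sup>2 * y powr (- \<alpha>) * exp (- (2 * \<beta>) * y powr (1 + \<alpha>))"
        unfolding PhiF_eq by (simp add: power_mult_distrib power2_eq_square mult_ac flip: powr_add exp_add)
      ultimately show ?thesis by (simp add: mult_ac)
    qed
    have gx: "integrable (lebesgue_on {x<..}) ?g" by (rule integrable_on_subset_Mp[OF g]) (use x in auto)
    have "I2 x \<le> integral\<^sup>L (lebesgue_on {x<..}) (\<lambda>y. CPhi\<^sup>2 * ?E * ?g y)"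
      unfolding I2_def
    proof (rule integral_mono_AE)
      show "integrable (lebesgue_on {x<..}) (\<lambda>\<rho>. (PhiF \<alpha> k \<rho>)\<^sup>2)"
        by (rule integrable_on_subset_Mp[OF integrable_PhiF2]) (use x in auto)
      show "integrable (lebesgue_on {x<..}) (\<lambda>y. CPhi\<^sup>2 * ?E * ?g y)" by (rule integrable_mult_right[OF gx])
      show "AE y in lebesgue_on {x<..}. (PhiF \<alpha> k y)\<^sup>2 \<le> CPhi\<^sup>2 * ?E * ?g y"
        by (rule AE_I2) (use le in simp)
    qed
    also have "\<dots> = CPhi\<^sup>2 * ?E * integral\<^sup>L (lebesgue_on {x<..}) ?g" by simp
    also have "\<dots> \<le> CPhi\<^sup>2 * ?E * integral\<^sup>L Mp ?g"
    proof (rule mult_left_mono)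
      show "integral\<^sup>L (lebesgue_on {x<..}) ?g \<le> integral\<^sup>L Mp ?g"
        by (rule integral_mono_lebesgue_on_AE[OF g]) (use x in auto)
    qed simp
    finally show "I2 x \<le> M * ?E" by (simp add: M_def mult_ac)
  qed
  with M0 show ?thesis by (rule that)
qed

text \<open>The first summand is at most x^2 \<Phi>, and the second inherits the decay exp (-
  \<beta> T/2) left over by \<open>I2_bound\<close>.\<close>

lemma L2_Psi: "L2 (Psi \<alpha> k)"
proof -
  obtain M where M: "0 \<le> M" "\<And>x. 0 < x \<Longrightarrow> 0 \<le> I2 x \<and> I2 x \<le> M * exp (- (3/2 * \<beta>) * x powr (1 + \<alpha>))"
    using I2_bound by metis
  let ?u = "\<lambda>x. x powr (2 - \<alpha> / 2) * exp (- \<beta> * x powr (1 + \<alpha>))"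
  let ?v = "\<lambda>x. x powr (- \<alpha> / 2) * exp (- (\<beta> / 2) * x powr (1 + \<alpha>))"
  have L: "L2 (\<lambda>x. complex_of_real (CPhi / (1 + \<alpha>)) * complex_of_real (?u x) + complex_of_real (CF * M / (1 + \<alpha>)) * complex_of_real (?v x))"
    using \<alpha> \<beta> by (intro L2_add L2_cmult L2_powr_exp_T) auto
  show ?thesis
  proof (rule L2_bound[OF L, where C = 1])
    show "Psi \<alpha> k \<in> borel_measurable Mp"
      by (intro borel_measurable_Mp_continuous continuous_intros continuous_PsiF)
    fix x :: real assume x: "0 < x"
    have 1: "0 \<le> PhiF \<alpha> k x * I1 x" "PhiF \<alpha> k x * I1 x \<le> CPhi * ?u x"
    proof -
      show "0 \<le> PhiF \<alpha> k x * I1 x" using PhiF_pos[OF x] I1_bound[OF x] by simp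
      have "PhiF \<alpha> k x * I1 x \<le> PhiF \<alpha> k x * x\<^sup>2"
        using PhiF_pos[OF x] I1_bound[OF x] by (intro mult_left_mono) auto
      also have "x powr (- \<alpha> / 2) * x\<^sup>2 = x powr (2 - \<alpha> / 2)"
        using x powr_add[of x "- \<alpha> / 2" 2] by (simp add: powr_numeral)
      then have "PhiF \<alpha> k x * x\<^sup>2 = CPhi * ?u x" unfolding PhiF_eq by (metis mult.assoc mult.commute)
      finally show "PhiF \<alpha> k x * I1 x \<le> CPhi * ?u x" .
    qed
    have 2: "0 \<le> FF \<alpha> k x * I2 x" "FF \<alpha> k x * I2 x \<le> CF * M * ?v x"
    proof -
      show "0 \<le> FF \<alpha> k x * I2 x" using FF_nonneg[OF x] M(2)[OF x] by simp
      have "sinh (\<beta> * x powr (1 + \<alpha>)) \<le> exp (\<beta> * x powr (1 + \<alpha>))"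
        using sinh_plus_cosh[of "\<beta> * x powr (1 + \<alpha>)"] cosh_real_pos[of "\<beta> * x powr (1 + \<alpha>)"] by linarith
      then have "FF \<alpha> k x \<le> CF * x powr (- \<alpha> / 2) * exp (\<beta> * x powr (1 + \<alpha>))"
        unfolding FF_eq using CF by (intro mult_left_mono) auto
      then have "FF \<alpha> k x * I2 x \<le> CF * x powr (- \<alpha> / 2) * exp (\<beta> * x powr (1 + \<alpha>)) *
          (M * exp (- (3/2 * \<beta>) * x powr (1 + \<alpha>)))"
        using M(2)[OF x] CF by (intro mult_mono) auto
      also have "\<dots> = CF * M * (x powr (- \<alpha> / 2) * (exp (\<beta> * x powr (1 + \<alpha>)) * exp (- (3/2 * \<beta>) * x powr (1 + \<alpha>))))"
        by (simp only: mult_ac)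
      also have "exp (\<beta> * x powr (1 + \<alpha>)) * exp (- (3/2 * \<beta>) * x powr (1 + \<alpha>)) = exp (- (\<beta> / 2) * x powr (1 + \<alpha>))"
        by (simp add: algebra_simps flip: exp_add)
      finally show "FF \<alpha> k x * I2 x \<le> CF * M * ?v x" .
    qed
    have "cmod (Psi \<alpha> k x) = (PhiF \<alpha> k x * I1 x + FF \<alpha> k x * I2 x) / (1 + \<alpha>)"
      unfolding PsiF_eq norm_of_real using 1 2 \<alpha> by simp
    also have "\<dots> \<le> (CPhi * ?u x + CF * M * ?v x) / (1 + \<alpha>)"
      using 1 2 \<alpha> by (intro divide_right_mono add_mono) auto
    also have "\<dots> = CPhi / (1 + \<alpha>) * ?u x + CF * M / (1 + \<alpha>) * ?v x"
      by (simp add: add_divide_distrib)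
    also have "\<dots> \<le> \<bar>CPhi / (1 + \<alpha>) * ?u x + CF * M / (1 + \<alpha>) * ?v x\<bar>" by (rule abs_ge_self)
    also have "\<dots> = cmod (complex_of_real (CPhi / (1 + \<alpha>) * ?u x + CF * M / (1 + \<alpha>) * ?v x))"
      by (simp only: norm_of_real)
    finally show "cmod (Psi \<alpha> k x) \<le> 1 * cmod (complex_of_real (CPhi / (1 + \<alpha>)) * complex_of_real (?u x) +
        complex_of_real (CF * M / (1 + \<alpha>)) * complex_of_real (?v x))"
      by (simp only: of_real_add of_real_mult mult_1)
  qed
qed

lemma Psi_adj: "(Psi \<alpha> k, Phi \<alpha> k) \<in> adj (Aop \<alpha> k)"
proof (rule classical_in_adj)
  show "(Psi \<alpha> k has_vector_derivative complex_of_real (PsiF' x)) (at x)" if "0 < x" for x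
    using PsiF_deriv(1)[OF that] by (simp add: has_vector_derivative_complex_iff)
  show "((\<lambda>x. complex_of_real (PsiF' x)) has_vector_derivative
      complex_of_real (Vpot \<alpha> k x * PsiF \<alpha> k x - PhiF \<alpha> k x)) (at x)" if "0 < x" for x
    using PsiF_deriv(2)[OF that] by (simp add: has_vector_derivative_complex_iff)
qed (auto intro!: L2_Phi L2_Psi continuous_intros continuous_Vpot continuous_PhiF continuous_PsiF)

end

section \<open>Asymptotics at zero\<close>

lemma integral_Ioc_eq:
  fixes f :: "real \<Rightarrow> 'b :: euclidean_space"
  assumes "integrable (lebesgue_on {0<..y}) f"
  shows "integral\<^sup>L (lebesgue_on {0<..y}) f = integral {0..y} f"
proof -
  have n: "negligible {x \<in> {0<..y} - {0..y}. f x \<noteq> 0}" "negligible {x \<in> {0..y} - {0<..y}. f x \<noteq> 0}"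
    by (rule negligible_subset[of "{0}"]; auto)+
  show ?thesis
    using lebesgue_integral_eq_integral[OF assms] integral_spike_set[OF n] by simp
qed

lemma integrable_on_Icc_if_Ioc:
  fixes f :: "real \<Rightarrow> 'b :: euclidean_space"
  assumes "integrable (lebesgue_on {0<..y}) f"
  shows "f integrable_on {0..y}"
proof -
  have n: "negligible {x \<in> {0<..y} - {0..y}. f x \<noteq> 0}" "negligible {x \<in> {0..y} - {0<..y}. f x \<noteq> 0}"
    by (rule negligible_subset[of "{0}"]; auto)+
  have "f integrable_on {0<..y}" by (rule integrable_on_lebesgue_on[OF assms]) simp
  then show ?thesis by (rule integrable_spike_set[OF _ n])
qed

lemma powr_smallo_at_right_0:
  fixes p q :: real
  assumes "q < p"
  shows "(\<lambda>x. x powr p) \<in> o[at_right 0](\<lambda>x. x powr q)"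
proof (rule smalloI_tendsto)
  have "((\<lambda>x::real. x powr (p - q)) \<longlongrightarrow> 0) (at_right 0)"
    using assms by real_asymp
  then show "((\<lambda>x. x powr p / x powr q) \<longlongrightarrow> 0) (at_right 0)"
    by (simp add: powr_diff)
  show "\<forall>\<^sub>F x in at_right 0. x powr q \<noteq> 0"
    by (auto simp: eventually_at_right_field intro!: exI[of _ 1])
qed

text \<open>Cutting off at \<open>x\<close> while keeping a function on the half line makes
  \<open>L2norm\<close> and Cauchy-Schwarz available for integrals over (0, x].\<close>

definition restrict0 :: "real \<Rightarrow> (real \<Rightarrow> complex) \<Rightarrow> real \<Rightarrow> complex" where
  "restrict0 x u t = of_real (indicator {0<..x} t) * u t"

lemma indicator_Ioc_measurable: "(\<lambda>t. complex_of_real (indicator {0<..x} t)) \<in> borel_measurable Mp"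
proof -
  have "(\<lambda>t. complex_of_real (indicator {0<..x} t)) \<in> borel_measurable lborel" by measurable
  then have "(\<lambda>t. complex_of_real (indicator {0<..x} t)) \<in> borel_measurable lebesgue"
    by (rule measurable_completion)
  then show ?thesis by (rule measurable_restrict_space1)
qed

lemma L2_restrict0: "L2 u \<Longrightarrow> L2 (restrict0 x u)"
proof (rule L2_bound[where C = 1])
  assume "L2 u"
  then show "restrict0 x u \<in> borel_measurable Mp"
    unfolding restrict0_def[abs_def] using L2_measurable[of u]
    by (intro borel_measurable_times indicator_Ioc_measurable)
qed (auto simp: restrict0_def norm_mult indicator_def)

lemma L2norm_restrict0_le: "L2 u \<Longrightarrow> L2norm (restrict0 x u) \<le> L2norm u"
  by (rule L2norm_mono[OF _ L2_measurable[OF L2_restrict0]]) (auto simp: restrict0_def norm_mult indicator_def)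

lemma L2norm_restrict0: "0 \<le> x \<Longrightarrow> (L2norm (restrict0 x u))\<^sup>2 = integral\<^sup>L (lebesgue_on {0<..x}) (\<lambda>t. (cmod (u t))\<^sup>2)"
  unfolding L2norm_power2
  by (auto simp: integral_restrict_space restrict0_def norm_mult indicator_def intro!: Bochner_Integration.integral_cong)

text \<open>Continuity of the indefinite integral at 0. This vanishing factor is what improves
  O(x^(3/2)) to o(x^(3/2)).\<close>

lemma L2norm_restrict0_tendsto:
  assumes "L2 u"
  shows "((\<lambda>x. L2norm (restrict0 x u)) \<longlongrightarrow> 0) (at_right 0)"
proof -
  let ?f = "\<lambda>t. (cmod (u t))\<^sup>2"
  have i: "integrable (lebesgue_on {0<..x}) ?f" for x
    by (rule integrable_on_subset_Mp[OF L2_integrable[OF assms]]) auto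
  have "continuous_on {0..1} (\<lambda>x. integral {0..x} ?f)"
    by (rule indefinite_integral_continuous_1[OF integrable_on_Icc_if_Ioc[OF i]])
  then have "((\<lambda>x. integral {0..x} ?f) \<longlongrightarrow> integral {0..0} ?f) (at 0 within {0..1})"
    unfolding continuous_on_def by (rule bspec) simp
  then have "((\<lambda>x. integral {0..x} ?f) \<longlongrightarrow> 0) (at_right 0)"
    by (simp add: at_within_Icc_at_right)
  from tendsto_real_sqrt[OF this] have "((\<lambda>x. sqrt (integral {0..x} ?f)) \<longlongrightarrow> 0) (at_right 0)" by simp
  moreover have "\<forall>\<^sub>F x in at_right 0. sqrt (integral {0..x} ?f) = L2norm (restrict0 x u)"
  proof -
    have "sqrt (integral {0..x} ?f) = L2norm (restrict0 x u)" if "0 < x" for x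
      using L2norm_restrict0[of x u] integral_Ioc_eq[OF i, of x] that L2norm_nonneg
      by (metis less_imp_le real_sqrt_unique)
    then show ?thesis by (auto simp: eventually_at_right_field intro!: exI[of _ 1])
  qed
  ultimately show ?thesis by (rule Lim_transform_eventually)
qed

text \<open>Cauchy-Schwarz bounds the first derivative on (0, x] by sqrt x times the cut-off norm of
  the second, and the mean value inequality contributes another factor x. The norm is cut off at x
  because the bound must retain a factor that tends to 0.\<close>

lemma Cc_inf_pointwise_bound:
  assumes \<phi>: "\<phi> \<in> Cc_inf" and x: "0 < x"
  shows "cmod (\<phi> x) \<le> x powr (3/2) * L2norm (restrict0 x (cderiv (cderiv \<phi>)))"
proof -
  note \<phi>1 = Cc_inf_deriv(2)[OF \<phi>] and \<phi>2 = Cc_inf_deriv(2)[OF Cc_inf_deriv(2)[OF \<phi>]]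
  let ?m = "L2norm (restrict0 x (cderiv (cderiv \<phi>)))"
  have z: "\<psi> 0 = 0" if "\<psi> \<in> Cc_inf" for \<psi> using Cc_inf_support[OF that] by (metis atLeastAtMost_iff not_le)
  have d: "cmod (cderiv \<phi> t) \<le> sqrt x * ?m" if t: "t \<in> {0..x}" for t
  proof (cases "t = 0")
    case True
    then show ?thesis using z[OF \<phi>1] x L2norm_nonneg by simp
  next
    case False
    then have t0: "0 < t" using t by simp
    define w where "w = restrict0 t (\<lambda>_. 1)"
    have wL: "L2 w"
      unfolding L2_def
    proof
      show wm: "w \<in> borel_measurable Mp"
        unfolding w_def restrict0_def
        by (intro borel_measurable_times indicator_Ioc_measurable) simp
      have "integrable lebesgue (\<lambda>s. indicator {0<..t} s *\<^sub>R (1::real))"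
        using integrable_const_Ioc[of t 1] by (simp add: integrable_restrict_space)
      moreover have "(\<lambda>s. indicator {0<..t} s *\<^sub>R (1::real)) = (\<lambda>s. indicator {0<..} s *\<^sub>R (cmod (w s))\<^sup>2)"
        by (auto simp: w_def restrict0_def indicator_def)
      ultimately show "integrable Mp (\<lambda>s. (cmod (w s))\<^sup>2)" by (simp add: integrable_Mp_iff)
    qed
    have wn: "L2norm w = sqrt t"
      using L2norm_restrict0[of t "\<lambda>_. 1"] t0 L2norm_nonneg[of w]
      by (simp add: w_def[symmetric] measure_restrict_space real_sqrt_unique)
    have i: "integrable (lebesgue_on {0<..t}) (cderiv (cderiv \<phi>))"
      by (rule integrable_on_subset_Mp) (use Cc_inf_mult_integrable[OF \<phi>2, of "\<lambda>_. 1"] in auto)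
    have "(cderiv (cderiv \<phi>) has_integral (cderiv \<phi> t - cderiv \<phi> 0)) {0..t}"
      by (rule fundamental_theorem_of_calculus)
         (use t0 Cc_inf_deriv(1)[OF \<phi>1] in \<open>auto intro: has_vector_derivative_at_within\<close>)
    then have "cderiv \<phi> t = integral {0..t} (cderiv (cderiv \<phi>))"
      using z[OF \<phi>1] by (simp add: integral_unique)
    also have "\<dots> = integral\<^sup>L (lebesgue_on {0<..t}) (cderiv (cderiv \<phi>))"
      by (rule integral_Ioc_eq[OF i, symmetric])
    also have "\<dots> = L2inner w (restrict0 x (cderiv (cderiv \<phi>)))"
      unfolding L2inner_def
      by (auto simp: integral_restrict_space w_def restrict0_def indicator_def intro!: Bochner_Integration.integral_cong)
         (use t in auto)
    finally have "cmod (cderiv \<phi> t) \<le> L2norm w * ?m"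
      using cmod_L2inner_le[OF wL L2_restrict0[OF L2_Cc_inf[OF \<phi>2]]] by simp
    also have "\<dots> \<le> sqrt x * ?m"
      unfolding wn using t L2norm_nonneg by (intro mult_right_mono) auto
    finally show ?thesis .
  qed
  have "cmod (\<phi> x - \<phi> 0) \<le> sqrt x * ?m * cmod (of_real (x - 0))"
  proof -
    have "norm (\<phi> x - \<phi> 0) \<le> sqrt x * ?m * norm (x - 0)"
    proof (rule differentiable_bound[where S = "{0..x}" and f' = "\<lambda>t h. h *\<^sub>R cderiv \<phi> t"])
      show "(\<phi> has_derivative (\<lambda>h. h *\<^sub>R cderiv \<phi> t)) (at t within {0..x})" for t
        using has_vector_derivative_at_within[OF Cc_inf_deriv(1)[OF \<phi>]] by (simp add: has_vector_derivative_def)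
      show "onorm (\<lambda>h. h *\<^sub>R cderiv \<phi> t) \<le> sqrt x * ?m" if "t \<in> {0..x}" for t
        by (rule onorm_le) (use mult_left_mono[OF d[OF that]] in \<open>simp add: mult.commute\<close>)
    qed (use x in auto)
    then show ?thesis by simp
  qed
  then have "cmod (\<phi> x) \<le> (sqrt x * x) * ?m" using z[OF \<phi>] x by (simp add: mult_ac)
  also have "sqrt x * x = x powr (3/2)"
    using x powr_add[of x "1/2" 1] by (simp add: powr_half_sqrt)
  finally show ?thesis .
qed

lemma cderiv2_diff: "\<phi> \<in> Cc_inf \<Longrightarrow> \<psi> \<in> Cc_inf \<Longrightarrow>
    cderiv (cderiv (\<lambda>x. \<phi> x - \<psi> x)) = (\<lambda>x. cderiv (cderiv \<phi>) x - cderiv (cderiv \<psi>) x)"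
  by (simp add: cderiv_diff Cc_inf_deriv(2))

text \<open>By the pointwise bound the approximating test functions converge at every point. Their
  limit \<open>h\<close> is a representative of \<open>f\<close> that satisfies the same bound with
  \<open>g2\<close> as second derivative.\<close>

lemma H2_0_asymp:
  assumes "f \<in> H2_0"
  shows "asymp_near0 f (\<lambda>x. 0)"
proof -
  obtain g2 s where f: "L2 f" and g2: "L2 g2" and s: "\<And>n. s n \<in> Cc_inf" "L2conv s f"
    "L2conv (\<lambda>n. cderiv (cderiv (s n))) g2"
    using assms unfolding H2_0_def by blast
  define s2 where "s2 n = cderiv (cderiv (s n))" for n
  have s2: "L2 (s2 n)" for n unfolding s2_def by (intro L2_Cc_inf Cc_inf_deriv(2) s)
  have c2: "L2conv s2 g2" using s(3) by (simp add: s2_def[abs_def])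
  have "Cauchy (\<lambda>n. s n x)" if x: "0 < x" for x
  proof (rule metric_CauchyI)
    fix e :: real assume e: "0 < e"
    have xp: "0 < x powr (3/2)" using x by simp
    obtain M where M: "\<forall>m\<ge>M. \<forall>n\<ge>M. L2norm (\<lambda>x. s2 m x - s2 n x) < e / x powr (3/2)"
      using L2conv_Cauchy[OF c2 s2 g2 divide_pos_pos[OF e xp]] by blast
    have "dist (s m x) (s n x) < e" if mn: "m \<ge> M" "n \<ge> M" for m n
    proof -
      have "cmod (s m x - s n x) \<le> x powr (3/2) * L2norm (restrict0 x (\<lambda>t. s2 m t - s2 n t))"
        using Cc_inf_pointwise_bound[OF Cc_inf_diff[OF s(1) s(1)] x, of m n]
        unfolding cderiv2_diff[OF s(1) s(1)] s2_def .
      also have "\<dots> \<le> x powr (3/2) * L2norm (\<lambda>t. s2 m t - s2 n t)"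
        by (intro mult_left_mono L2norm_restrict0_le L2_diff s2) simp
      also have "\<dots> < e" using M[rule_format, OF mn] xp by (simp add: field_simps)
      finally show ?thesis by (simp add: dist_norm)
    qed
    then show "\<exists>M. \<forall>m\<ge>M. \<forall>n\<ge>M. dist (s m x) (s n x) < e" by blast
  qed
  then have lim: "(\<lambda>n. s n x) \<longlonglongrightarrow> lim (\<lambda>n. s n x)" if "0 < x" for x
    using that Cauchy_convergent_iff convergent_LIMSEQ_iff by blast
  define h where "h x = lim (\<lambda>n. s n x)" for x
  have "AE x in Mp. f x = h x"
    by (rule L2conv_pointwise[OF s(2) L2_Cc_inf[OF s(1)] f]) (use lim in \<open>simp add: h_def\<close>)
  then have ae: "AE x in Mp. h x = f x" by eventually_elim simp
  have bound: "cmod (h x) \<le> x powr (3/2) * L2norm (restrict0 x g2)" if x: "0 < x" for x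
  proof (rule LIMSEQ_le)
    show "(\<lambda>n. cmod (s n x)) \<longlonglongrightarrow> cmod (h x)" using lim[OF x] unfolding h_def by (rule tendsto_norm)
    have "(\<lambda>n. x powr (3/2) * (L2norm (restrict0 x g2) + L2norm (\<lambda>t. s2 n t - g2 t)))
        \<longlonglongrightarrow> x powr (3/2) * (L2norm (restrict0 x g2) + 0)"
      using c2 unfolding L2conv_def by (intro tendsto_intros)
    then show "(\<lambda>n. x powr (3/2) * (L2norm (restrict0 x g2) + L2norm (\<lambda>t. s2 n t - g2 t)))
        \<longlonglongrightarrow> x powr (3/2) * L2norm (restrict0 x g2)" by simp
    have "cmod (s n x) \<le> x powr (3/2) * (L2norm (restrict0 x g2) + L2norm (\<lambda>t. s2 n t - g2 t))" for n
    proof -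
      have "restrict0 x (s2 n) = (\<lambda>t. restrict0 x g2 t + restrict0 x (\<lambda>t. s2 n t - g2 t) t)"
        by (auto simp: restrict0_def algebra_simps)
      then have "L2norm (restrict0 x (s2 n)) \<le> L2norm (restrict0 x g2) + L2norm (restrict0 x (\<lambda>t. s2 n t - g2 t))"
        using L2norm_triangle[OF L2_restrict0[OF g2] L2_restrict0[OF L2_diff[OF s2 g2]]] by simp
      also have "L2norm (restrict0 x (\<lambda>t. s2 n t - g2 t)) \<le> L2norm (\<lambda>t. s2 n t - g2 t)"
        by (intro L2norm_restrict0_le L2_diff s2 g2)
      finally have "x powr (3/2) * L2norm (restrict0 x (s2 n)) \<le>
          x powr (3/2) * (L2norm (restrict0 x g2) + L2norm (\<lambda>t. s2 n t - g2 t))"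
        by (intro mult_left_mono) auto
      then show ?thesis using Cc_inf_pointwise_bound[OF s(1) x, of n] unfolding s2_def by (rule order_trans[rotated])
    qed
    then show "\<exists>N. \<forall>n\<ge>N. cmod (s n x) \<le> x powr (3/2) * (L2norm (restrict0 x g2) + L2norm (\<lambda>t. s2 n t - g2 t))"
      by blast
  qed
  have "h \<in> o[at_right 0](\<lambda>x. complex_of_real (x powr (3/2)))"
  proof (rule landau_o.smallI)
    fix c :: real assume c: "0 < c"
    have "\<forall>\<^sub>F x in at_right 0. L2norm (restrict0 x g2) < c"
      by (rule order_tendstoD(2)[OF L2norm_restrict0_tendsto[OF g2] c])
    moreover have "\<forall>\<^sub>F x in at_right (0::real). 0 < x" by (simp add: eventually_at_right_less)
    ultimately show "\<forall>\<^sub>F x in at_right 0. norm (h x) \<le> c * norm (complex_of_real (x powr (3/2)))"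
    proof eventually_elim
      case (elim x)
      have "norm (h x) \<le> x powr (3/2) * L2norm (restrict0 x g2)" by (rule bound[OF elim(2)])
      also have "\<dots> \<le> x powr (3/2) * c" using elim by (intro mult_left_mono) auto
      finally show ?case by (simp add: mult.commute)
    qed
  qed
  then show ?thesis unfolding asymp_near0_def using ae by (intro exI[of _ h]) simp
qed

text \<open>Two representatives of \<open>g\<close> agree only almost everywhere, so the estimate
  for p - p' is first known only almost everywhere near 0. As p and p' are continuous, the set where
  it holds is closed and therefore contains every point of the interval.\<close>

lemma asymp_near0_unique:
  assumes "asymp_near0 g p" "asymp_near0 g p'" "continuous_on {0<..} p" "continuous_on {0<..} p'"
  shows "(\<lambda>x. p x - p' x) \<in> o[at_right 0](\<lambda>x. complex_of_real (x powr (3/2)))"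
proof -
  obtain u u' where u: "AE x in Mp. u x = g x" "(\<lambda>x. u x - p x) \<in> o[at_right 0](\<lambda>x. complex_of_real (x powr (3/2)))"
    "AE x in Mp. u' x = g x" "(\<lambda>x. u' x - p' x) \<in> o[at_right 0](\<lambda>x. complex_of_real (x powr (3/2)))"
    using assms(1,2) unfolding asymp_near0_def by blast
  define v where "v = (\<lambda>x. (u' x - p' x) - (u x - p x))"
  have v: "v \<in> o[at_right 0](\<lambda>x. complex_of_real (x powr (3/2)))"
    unfolding v_def by (rule sum_in_smallo(2)[OF u(4,2)])
  have ae: "AE x in Mp. v x = p x - p' x"
    using u(1,3) by eventually_elim (simp add: v_def)
  show ?thesis
  proof (rule landau_o.smallI)
    fix c :: real assume c: "0 < c"
    obtain b where b: "0 < b" "\<And>y. 0 < y \<Longrightarrow> y < b \<Longrightarrow> norm (v y) \<le> c * norm (complex_of_real (y powr (3/2)))"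
      using landau_o.smallD[OF v c] by (auto simp: eventually_at_right_field)
    have "norm (p x - p' x) \<le> c * norm (complex_of_real (x powr (3/2)))" if x: "0 < x" "x < b" for x
    proof -
      let ?C = "{y \<in> {x/2..b}. norm (p y - p' y) \<le> c * norm (complex_of_real (y powr (3/2)))}"
      have "continuous_on {x/2..b} p" "continuous_on {x/2..b} p'"
        by (rule continuous_on_subset[OF assms(3)] continuous_on_subset[OF assms(4)]; use x in auto)+
      then have cl: "closed ?C"
        by (intro continuous_on_closed_Collect_le continuous_intros) (use x in auto)
      have "AE y \<in> {x/2<..<b} in lebesgue. y \<in> ?C"
        using ae unfolding AE_Mp_iff
      proof eventually_elim
        case (elim y)
        then show ?case using b(2)[of y] x by auto
      qed
      from mem_closed_if_AE_lebesgue_open[OF open_greaterThanLessThan cl this, of x]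
      have "x \<in> ?C" using x by simp
      then show ?thesis by simp
    qed
    then show "\<forall>\<^sub>F x in at_right 0. norm (p x - p' x) \<le> c * norm (complex_of_real (x powr (3/2)))"
      using b(1) by (auto simp: eventually_at_right_field)
  qed
qed

context half_line_operator
begin

section \<open>Boundary coefficients\<close>

text \<open>The exponents are the indicial roots of the inverse-square part, so \<open>a\<close> and
  \<open>b\<close> play the role of the two boundary values at 0.\<close>

definition asym :: "(real \<Rightarrow> complex) \<Rightarrow> complex \<Rightarrow> complex \<Rightarrow> bool" where
  "asym g a b \<longleftrightarrow> asymp_near0 g (\<lambda>x. a * complex_of_real (x powr (- \<alpha>/2)) + b * complex_of_real (x powr (1 + \<alpha>/2)))"

text \<open>All terms but the first are o(x powr (- \<alpha>/2)), which kills \<open>a\<close>; then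
  \<open>b\<close> vanishes because 1 + \<alpha>/2 < 3/2.\<close>

lemma coefficients_zero:
  assumes "(\<lambda>x. a * complex_of_real (x powr (- \<alpha>/2)) + b * complex_of_real (x powr (1 + \<alpha>/2)))
     \<in> o[at_right 0](\<lambda>x. complex_of_real (x powr (3/2)))"
  shows "a = 0 \<and> b = 0"
proof -
  let ?g = "\<lambda>x. a * complex_of_real (x powr (- \<alpha>/2)) + b * complex_of_real (x powr (1 + \<alpha>/2))"
  have sm: "(\<lambda>x. complex_of_real (x powr p)) \<in> o[at_right 0](\<lambda>x. complex_of_real (x powr q))" if "q < p" for p q :: real
    using powr_smallo_at_right_0[OF that] by (simp add: landau_o.small.of_real_iff)
  have pos: "\<forall>\<^sub>F x in at_right (0::real). 0 < x" by (simp add: eventually_at_right_less)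
  have 0: "c = 0" if "(\<lambda>x. c * complex_of_real (x powr q)) \<in> o[at_right 0](\<lambda>x. complex_of_real (x powr q))" for c q
  proof (rule ccontr)
    assume "c \<noteq> 0"
    then have "(\<lambda>x. complex_of_real (x powr q)) \<in> o[at_right 0](\<lambda>x. complex_of_real (x powr q))"
      using that by simp
    then have "\<forall>\<^sub>F x in at_right 0. complex_of_real (x powr q) = 0"
      by (simp add: landau_o.small_refl_iff)
    with pos have "\<forall>\<^sub>F x in at_right (0::real). False" by eventually_elim auto
    then show False by simp
  qed
  have "(\<lambda>x. ?g x - b * complex_of_real (x powr (1 + \<alpha>/2))) \<in> o[at_right 0](\<lambda>x. complex_of_real (x powr (- \<alpha>/2)))"
  proof (rule sum_in_smallo(2))
    show "?g \<in> o[at_right 0](\<lambda>x. complex_of_real (x powr (- \<alpha>/2)))"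
      by (rule landau_o.small_trans[OF assms sm]) (use \<alpha> in simp)
    show "(\<lambda>x. b * complex_of_real (x powr (1 + \<alpha>/2))) \<in> o[at_right 0](\<lambda>x. complex_of_real (x powr (- \<alpha>/2)))"
      using \<alpha> sm[of "- \<alpha>/2" "1 + \<alpha>/2"] by (cases "b = 0") simp_all
  qed
  then have a: "a = 0" using 0[of a "- \<alpha>/2"] by simp
  have "(\<lambda>x. b * complex_of_real (x powr (1 + \<alpha>/2))) \<in> o[at_right 0](\<lambda>x. complex_of_real (x powr (1 + \<alpha>/2)))"
    using landau_o.small_trans[OF assms sm[of "1 + \<alpha>/2" "3/2"]] \<alpha> unfolding a by simp
  then have "b = 0" using 0 by blast
  with a show ?thesis by simp
qed

lemma asym_unique:
  assumes "asym g a b" "asym g a' b'"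
  shows "a = a' \<and> b = b'"
proof -
  have "(\<lambda>x. (a * complex_of_real (x powr (- \<alpha>/2)) + b * complex_of_real (x powr (1 + \<alpha>/2))) -
      (a' * complex_of_real (x powr (- \<alpha>/2)) + b' * complex_of_real (x powr (1 + \<alpha>/2))))
      \<in> o[at_right 0](\<lambda>x. complex_of_real (x powr (3/2)))"
    by (rule asymp_near0_unique[OF assms[unfolded asym_def]]) (auto intro!: continuous_intros)
  then have "(\<lambda>x. (a - a') * complex_of_real (x powr (- \<alpha>/2)) + (b - b') * complex_of_real (x powr (1 + \<alpha>/2)))
      \<in> o[at_right 0](\<lambda>x. complex_of_real (x powr (3/2)))"
    by (simp add: algebra_simps)
  then show ?thesis using coefficients_zero by fastforce
qed

lemma asym_lin:
  assumes "asym g a b" "asym g' a' b'"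
  shows "asym (\<lambda>x. g x + c * g' x) (a + c * a') (b + c * b')"
proof -
  let ?P = "\<lambda>a b x. a * complex_of_real (x powr (- \<alpha>/2)) + b * complex_of_real (x powr (1 + \<alpha>/2))"
  obtain u u' where u: "AE x in Mp. u x = g x" "(\<lambda>x. u x - ?P a b x) \<in> o[at_right 0](\<lambda>x. complex_of_real (x powr (3/2)))"
    "AE x in Mp. u' x = g' x" "(\<lambda>x. u' x - ?P a' b' x) \<in> o[at_right 0](\<lambda>x. complex_of_real (x powr (3/2)))"
    using assms unfolding asym_def asymp_near0_def by blast
  have ae: "AE x in Mp. u x + c * u' x = g x + c * g' x"
    using u(1,3) by eventually_elim simp
  have "(\<lambda>x. c * (u' x - ?P a' b' x)) \<in> o[at_right 0](\<lambda>x. complex_of_real (x powr (3/2)))"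
    using u(4) by (cases "c = 0") auto
  from sum_in_smallo(1)[OF u(2) this]
  have "(\<lambda>x. u x + c * u' x - ?P (a + c * a') (b + c * b') x) \<in> o[at_right 0](\<lambda>x. complex_of_real (x powr (3/2)))"
    by (simp add: algebra_simps)
  with ae show ?thesis unfolding asym_def asymp_near0_def by (intro exI[of _ "\<lambda>x. u x + c * u' x"]) simp
qed

lemma asym_H2_0: "f \<in> H2_0 \<Longrightarrow> asym f 0 0"
  using H2_0_asymp by (simp add: asym_def)

lemma asym_of_real:
  assumes "(\<lambda>x. f x - (a * x powr (- \<alpha>/2) + b * x powr (1 + \<alpha>/2))) \<in> o[at_right 0](\<lambda>x. x powr (3/2))"
  shows "asym (\<lambda>x. complex_of_real (f x)) (of_real a) (of_real b)"
proof -
  have "(\<lambda>x. complex_of_real (f x - (a * x powr (- \<alpha>/2) + b * x powr (1 + \<alpha>/2))))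
      \<in> o[at_right 0](\<lambda>x. complex_of_real (x powr (3/2)))"
    using assms by (simp only: landau_o.small.of_real_iff)
  then show ?thesis unfolding asym_def asymp_near0_def
    by (intro exI[of _ "\<lambda>x. complex_of_real (f x)"]) simp
qed

lemma T_filterlim: "filterlim (\<lambda>x. \<beta> * x powr (1 + \<alpha>)) (at_right 0) (at_right 0)"
proof (rule filterlim_at_withinI)
  have "((\<lambda>x::real. x powr (1 + \<alpha>)) \<longlongrightarrow> 0) (at_right 0)" using \<alpha> by real_asymp
  from tendsto_mult_left[OF this, of \<beta>] show "((\<lambda>x. \<beta> * x powr (1 + \<alpha>)) \<longlongrightarrow> 0) (at_right 0)" by simp
  show "\<forall>\<^sub>F x in at_right 0. \<beta> * x powr (1 + \<alpha>) \<in> {0<..} - {0}"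
    using \<beta> by (auto simp: eventually_at_right_field intro!: exI[of _ 1])
qed

text \<open>Second-order Taylor remainders in y = \<beta> T are negligible: x powr (- \<alpha>/2)
  T^2 = x powr (2 + 3/2 \<alpha>). So expansions of exp and sinh to first order suffice.\<close>

lemma T2_smallo:
  assumes "h \<in> O[at_right 0](\<lambda>y::real. y ^ 2)"
  shows "(\<lambda>x. x powr (- \<alpha>/2) * h (\<beta> * x powr (1 + \<alpha>))) \<in> o[at_right 0](\<lambda>x. x powr (3/2))"
proof -
  have "(\<lambda>x. h (\<beta> * x powr (1 + \<alpha>))) \<in> O[at_right 0](\<lambda>x. (\<beta> * x powr (1 + \<alpha>)) ^ 2)"
    by (rule landau_o.big.compose[OF assms T_filterlim])
  also have "(\<lambda>x. (\<beta> * x powr (1 + \<alpha>)) ^ 2) \<in> O[at_right 0](\<lambda>x. x powr (2 + 2 * \<alpha>))"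
  proof (rule bigoI[where c = "\<beta>\<^sup>2"], rule always_eventually, rule allI)
    fix x :: real
    have "(x powr (1 + \<alpha>))\<^sup>2 = x powr (2 + 2 * \<alpha>)" by (simp add: power2_eq_square flip: powr_add)
    then show "norm ((\<beta> * x powr (1 + \<alpha>)) ^ 2) \<le> \<beta>\<^sup>2 * norm (x powr (2 + 2 * \<alpha>))"
      by (simp add: power_mult_distrib)
  qed
  finally have "(\<lambda>x. x powr (- \<alpha>/2) * h (\<beta> * x powr (1 + \<alpha>))) \<in> O[at_right 0](\<lambda>x. x powr (- \<alpha>/2) * x powr (2 + 2 * \<alpha>))"
    by (intro landau_o.big.mult) auto
  also have "(\<lambda>x::real. x powr (- \<alpha>/2) * x powr (2 + 2 * \<alpha>)) = (\<lambda>x. x powr (2 + 3/2 * \<alpha>))"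
    by (auto simp flip: powr_add intro!: arg_cong2[where f = "(powr)"])
  also have "(\<lambda>x. x powr (2 + 3/2 * \<alpha>)) \<in> o[at_right 0](\<lambda>x. x powr (3/2))"
    by (rule powr_smallo_at_right_0) (use \<alpha> in simp)
  finally show ?thesis .
qed

lemma powr_T: "x powr (- \<alpha>/2) * x powr (1 + \<alpha>) = x powr (1 + \<alpha>/2)"
  by (simp flip: powr_add add: add.commute)

lemma Phi_asym: "asym (Phi \<alpha> k) (of_real CPhi) (of_real (- CPhi * \<beta>))"
proof (rule asym_of_real)
  have "(\<lambda>y::real. exp (- y) - 1 + y) \<in> O[at_right 0](\<lambda>y. y ^ 2)" by real_asymp
  then have "(\<lambda>x. CPhi * (x powr (- \<alpha>/2) * (exp (- (\<beta> * x powr (1 + \<alpha>))) - 1 + \<beta> * x powr (1 + \<alpha>)))) \<in> o[at_right 0](\<lambda>x. x powr (3/2))"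
    using T2_smallo CPhi by simp
  moreover have "CPhi * (x powr (- \<alpha>/2) * (exp (- (\<beta> * x powr (1 + \<alpha>))) - 1 + \<beta> * x powr (1 + \<alpha>))) =
      PhiF \<alpha> k x - (CPhi * x powr (- \<alpha>/2) + - CPhi * \<beta> * x powr (1 + \<alpha>/2))" for x
    unfolding PhiF_eq powr_T[symmetric] by (simp add: algebra_simps)
  ultimately show "(\<lambda>x. PhiF \<alpha> k x - (CPhi * x powr (- \<alpha>/2) + - CPhi * \<beta> * x powr (1 + \<alpha>/2))) \<in> o[at_right 0](\<lambda>x. x powr (3/2))"
    by (simp only:)
qed

text \<open>The leading coefficient of \<Psi> at x powr (1 + \<alpha>/2): that of F is
  \<open>CF * \<beta>\<close>, the integral \<open>I2\<close> tends to \<open>N\<close>, and the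
  Wronskian divides.\<close>

definition CPsi :: real where "CPsi = CF * \<beta> * N / (1 + \<alpha>)"

lemma N_pos: "0 < N" using Phi_norm_pos by (simp add: N_def)

lemma CPsi: "0 < CPsi" using CF \<beta> N_pos \<alpha> by (simp add: CPsi_def)

lemma FF_le:
  assumes "0 < x" "x \<le> 1"
  shows "FF \<alpha> k x \<le> CF * \<beta> * exp \<beta> * x powr (1 + \<alpha>/2)"
proof -
  define y where "y = \<beta> * x powr (1 + \<alpha>)"
  have y: "0 \<le> y" "y \<le> \<beta>" using \<beta> assms \<alpha> powr_mono2[of "1 + \<alpha>" x 1] by (auto simp: y_def)
  have "sinh y = exp y * (1 - exp (- (2 * y))) / 2"
    by (simp add: sinh_def field_simps flip: exp_add)
  also have "\<dots> \<le> exp y * y" using exp_ge_add_one_self[of "- (2 * y)"] by simp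
  also have "\<dots> \<le> exp \<beta> * y" using y by (intro mult_right_mono) auto
  finally have "FF \<alpha> k x \<le> CF * x powr (- \<alpha>/2) * (exp \<beta> * y)"
    unfolding FF_eq y_def[symmetric] using CF by (intro mult_left_mono) auto
  also have "\<dots> = CF * \<beta> * exp \<beta> * (x powr (- \<alpha>/2) * x powr (1 + \<alpha>))" by (simp add: y_def)
  finally show ?thesis unfolding powr_T .
qed

lemma J_bound:
  assumes x: "0 < x"
  shows "0 \<le> J x" "J x \<le> CPhi\<^sup>2 / (1 - \<alpha>) * x powr (1 - \<alpha>)"
proof -
  show "0 \<le> J x" unfolding J_def by (rule integral_nonneg_AE, rule AE_I2) simp
  have i: "integrable (lebesgue_on {0<..x}) (\<lambda>\<rho>. (PhiF \<alpha> k \<rho>)\<^sup>2)"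
    by (rule integrable_on_subset_Mp[OF integrable_PhiF2]) auto
  have "J x = integral {0..x} (\<lambda>\<rho>. (PhiF \<alpha> k \<rho>)\<^sup>2)" unfolding J_def by (rule integral_Ioc_eq[OF i])
  also have "\<dots> \<le> CPhi\<^sup>2 * (x powr (- \<alpha> + 1) / (- \<alpha> + 1))"
  proof (rule has_integral_le)
    show "((\<lambda>\<rho>. (PhiF \<alpha> k \<rho>)\<^sup>2) has_integral integral {0..x} (\<lambda>\<rho>. (PhiF \<alpha> k \<rho>)\<^sup>2)) {0..x}"
      by (rule integrable_integral[OF integrable_on_Icc_if_Ioc[OF i]])
    show "((\<lambda>\<rho>. CPhi\<^sup>2 * \<rho> powr (- \<alpha>)) has_integral CPhi\<^sup>2 * (x powr (- \<alpha> + 1) / (- \<alpha> + 1))) {0..x}"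
      by (rule has_integral_mult_right, rule has_integral_powr_from_0) (use \<alpha> x in auto)
    fix y assume "y \<in> {0..x}"
    have "(PhiF \<alpha> k y)\<^sup>2 = CPhi\<^sup>2 * y powr (- \<alpha>) * (exp (- \<beta> * y powr (1 + \<alpha>)))\<^sup>2"
      unfolding PhiF_eq by (simp add: power_mult_distrib power2_eq_square mult_ac flip: powr_add)
    also have "\<dots> \<le> CPhi\<^sup>2 * y powr (- \<alpha>) * 1"
      using \<beta> by (intro mult_left_mono power_le_one) auto
    finally show "(PhiF \<alpha> k y)\<^sup>2 \<le> CPhi\<^sup>2 * y powr (- \<alpha>)" by simp
  qed
  finally show "J x \<le> CPhi\<^sup>2 / (1 - \<alpha>) * x powr (1 - \<alpha>)" by simp
qed

text \<open>Writing \<open>I2\<close> as N - J isolates the leading term N F. What remains, \<Phi>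
  \<open>I1\<close> and F \<open>J\<close>, is O(x powr (2 - \<alpha>/2)), which is o(x^(3/2))
  because \<alpha> < 1.\<close>

lemma Psi_asym: "asym (Psi \<alpha> k) 0 (of_real CPsi)"
proof -
  have p2: "(\<lambda>x. x powr (2 - \<alpha>/2)) \<in> o[at_right 0](\<lambda>x. x powr (3/2))"
    by (rule powr_smallo_at_right_0) (use \<alpha> in simp)
  have "(\<lambda>y::real. sinh y - y) \<in> O[at_right 0](\<lambda>y. y ^ 2)" by real_asymp
  then have 1: "(\<lambda>x. CF * N * (x powr (- \<alpha>/2) * (sinh (\<beta> * x powr (1 + \<alpha>)) - \<beta> * x powr (1 + \<alpha>)))) \<in> o[at_right 0](\<lambda>x. x powr (3/2))"
    using T2_smallo CF N_pos by simp
  have 2: "(\<lambda>x. PhiF \<alpha> k x * I1 x) \<in> o[at_right 0](\<lambda>x. x powr (3/2))"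
  proof (rule landau_o.big_small_trans[OF _ p2], rule bigoI[where c = CPhi])
    have "norm (PhiF \<alpha> k x * I1 x) \<le> CPhi * norm (x powr (2 - \<alpha>/2))" if x: "0 < x" for x
    proof -
      have "PhiF \<alpha> k x \<le> CPhi * x powr (- \<alpha>/2) * 1"
        unfolding PhiF_eq using CPhi \<beta> by (intro mult_left_mono) auto
      then have "PhiF \<alpha> k x * I1 x \<le> (CPhi * x powr (- \<alpha>/2)) * x\<^sup>2"
        using I1_bound[OF x] PhiF_pos[OF x] CPhi by (intro mult_mono) auto
      also have "\<dots> = CPhi * x powr (2 - \<alpha>/2)"
        using x powr_add[of x "- \<alpha> / 2" 2] by (simp add: powr_numeral)
      finally show ?thesis using I1_bound[OF x] PhiF_pos[OF x] by simp
    qed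
    then show "\<forall>\<^sub>F x in at_right 0. norm (PhiF \<alpha> k x * I1 x) \<le> CPhi * norm (x powr (2 - \<alpha>/2))"
      by (auto simp: eventually_at_right_field intro!: exI[of _ 1])
  qed
  define C where "C = CF * \<beta> * exp \<beta> * (CPhi\<^sup>2 / (1 - \<alpha>))"
  have 3: "(\<lambda>x. FF \<alpha> k x * J x) \<in> o[at_right 0](\<lambda>x. x powr (3/2))"
  proof (rule landau_o.big_small_trans[OF _ p2], rule bigoI[where c = C])
    have "norm (FF \<alpha> k x * J x) \<le> C * norm (x powr (2 - \<alpha>/2))" if x: "0 < x" "x < 1" for x
    proof -
      have "FF \<alpha> k x * J x \<le> (CF * \<beta> * exp \<beta> * x powr (1 + \<alpha>/2)) * (CPhi\<^sup>2 / (1 - \<alpha>) * x powr (1 - \<alpha>))"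
        using FF_le[of x] FF_nonneg[of x] J_bound[OF x(1)] x CF \<beta> by (intro mult_mono) auto
      also have "\<dots> = C * (x powr (1 + \<alpha>/2) * x powr (1 - \<alpha>))" by (simp only: C_def mult_ac)
      also have "x powr (1 + \<alpha>/2) * x powr (1 - \<alpha>) = x powr (2 - \<alpha>/2)"
        by (auto simp flip: powr_add intro!: arg_cong2[where f = "(powr)"])
      finally show ?thesis using FF_nonneg[of x] J_bound[OF x(1)] x by simp
    qed
    then show "\<forall>\<^sub>F x in at_right 0. norm (FF \<alpha> k x * J x) \<le> C * norm (x powr (2 - \<alpha>/2))"
      by (auto simp: eventually_at_right_field intro!: exI[of _ 1])
  qed
  have sm: "(\<lambda>x. 1 / (1 + \<alpha>) * (PhiF \<alpha> k x * I1 x + (CF * N * (x powr (- \<alpha>/2) * (sinh (\<beta> * x powr (1 + \<alpha>)) - \<beta> * x powr (1 + \<alpha>)))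
      - FF \<alpha> k x * J x))) \<in> o[at_right 0](\<lambda>x. x powr (3/2))"
    by (rule landau_o.small.cmult_in_iff[THEN iffD2, OF _ sum_in_smallo(1)[OF 2 sum_in_smallo(2)[OF 1 3]]])
       (use \<alpha> in simp)
  have ev: "\<forall>\<^sub>F x in at_right 0. 1 / (1 + \<alpha>) * (PhiF \<alpha> k x * I1 x + (CF * N * (x powr (- \<alpha>/2) * (sinh (\<beta> * x powr (1 + \<alpha>)) - \<beta> * x powr (1 + \<alpha>)))
      - FF \<alpha> k x * J x)) = PsiF \<alpha> k x - (0 * x powr (- \<alpha>/2) + CPsi * x powr (1 + \<alpha>/2))"
  proof -
    have "1 / (1 + \<alpha>) * (PhiF \<alpha> k x * I1 x + (CF * N * (x powr (- \<alpha>/2) * (sinh (\<beta> * x powr (1 + \<alpha>)) - \<beta> * x powr (1 + \<alpha>)))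
      - FF \<alpha> k x * J x)) = PsiF \<alpha> k x - (0 * x powr (- \<alpha>/2) + CPsi * x powr (1 + \<alpha>/2))" if "0 < x" for x
    proof -
      have I2: "I2 x = N - J x" using that by (simp add: I2_eq)
      have "PhiF \<alpha> k x * I1 x + (CF * N * (x powr (- \<alpha>/2) * (sinh (\<beta> * x powr (1 + \<alpha>)) - \<beta> * x powr (1 + \<alpha>)))
          - FF \<alpha> k x * J x) = (PhiF \<alpha> k x * I1 x + FF \<alpha> k x * I2 x) - CF * \<beta> * N * (x powr (- \<alpha>/2) * x powr (1 + \<alpha>))"
        unfolding I2 FF_eq by (simp add: algebra_simps)
      then show ?thesis unfolding PsiF_eq CPsi_def powr_T by (simp add: add_divide_distrib diff_divide_distrib)
    qed
    then show ?thesis by (auto simp: eventually_at_right_field intro!: exI[of _ 1])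
  qed
  have "(\<lambda>x. PsiF \<alpha> k x - (0 * x powr (- \<alpha>/2) + CPsi * x powr (1 + \<alpha>/2))) \<in> o[at_right 0](\<lambda>x. x powr (3/2))"
    by (rule iffD1[OF landau_o.small.in_cong[OF ev] sm])
  from asym_of_real[OF this] show ?thesis by simp
qed

end

section \<open>The domains of the adjoint and of the closure\<close>

lemma locL1_continuous_mult:
  assumes g: "L2 g" and w: "continuous_on {0<..} w"
  shows "locL1 (\<lambda>x. w x * g x)"
  unfolding locL1_def
proof (intro conjI allI impI)
  show m: "(\<lambda>x. w x * g x) \<in> borel_measurable Mp"
    using L2_measurable[OF g] borel_measurable_Mp_continuous[OF w] by measurable
  fix a b :: real assume a: "0 < a"
  have "compact (w ` {a..b})"
    by (rule compact_continuous_image[OF continuous_on_subset[OF w]]) (use a in auto)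
  then obtain C where C: "\<And>x. x \<in> {a..b} \<Longrightarrow> cmod (w x) \<le> C"
    using compact_imp_bounded bounded_iff by (metis imageI)
  show "integrable (lebesgue_on {a..b}) (\<lambda>x. w x * g x)"
  proof (rule Bochner_Integration.integrable_bound)
    show "integrable (lebesgue_on {a..b}) (\<lambda>x. C * (1 + (cmod (g x))\<^sup>2))"
      by (intro integrable_mult_right Bochner_Integration.integrable_add continuous_imp_integrable_real continuous_intros
          integrable_on_subset_Mp[OF L2_integrable[OF g]]) (use a in auto)
    show "(\<lambda>x. w x * g x) \<in> borel_measurable (lebesgue_on {a..b})"
      by (rule measurable_restrict_mono[OF m]) (use a in auto)
    have "norm (w x * g x) \<le> norm (C * (1 + (cmod (g x))\<^sup>2))" if "x \<in> {a..b}" for x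
    proof -
      have c: "0 \<le> C" using C[OF that] norm_ge_zero order_trans by blast
      have "cmod (g x) \<le> 1 + (cmod (g x))\<^sup>2"
        using zero_le_power2[of "cmod (g x) - 1/2"] by (simp add: power2_eq_square algebra_simps)
      then have "cmod (w x) * cmod (g x) \<le> C * (1 + (cmod (g x))\<^sup>2)"
        using C[OF that] c by (intro mult_mono) auto
      then show ?thesis using c by (simp add: norm_mult)
    qed
    then show "AE x in lebesgue_on {a..b}. norm (w x * g x) \<le> norm (C * (1 + (cmod (g x))\<^sup>2))"
      by (intro AE_I2) simp
  qed
qed

context half_line_operator
begin

lemma test_fun_PhiF_mult:
  assumes "test_fun u"
  shows "test_fun (\<lambda>x. PhiF \<alpha> k x * u x)" "test_fun (\<lambda>x. (PhiF \<alpha> k x)\<^sup>2 * u x)" "test_fun (\<lambda>x. u x / (PhiF \<alpha> k x)\<^sup>2)"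
proof -
  have "test_fun (\<lambda>x. CPhi * (u x * x powr (- \<alpha>/2) * exp (- \<beta> * x powr (1 + \<alpha>))))"
    by (intro test_fun_cmult test_fun_times_powr_exp assms)
  then show "test_fun (\<lambda>x. PhiF \<alpha> k x * u x)" by (simp add: PhiF_eq mult_ac)
  have sq: "(PhiF \<alpha> k x)\<^sup>2 = CPhi\<^sup>2 * x powr (- \<alpha>) * exp (- (2 * \<beta>) * x powr (1 + \<alpha>))" for x
    unfolding PhiF_eq by (simp add: power_mult_distrib power2_eq_square mult_ac flip: powr_add exp_add)
  have "test_fun (\<lambda>x. CPhi\<^sup>2 * (u x * x powr (- \<alpha>) * exp (- (2 * \<beta>) * x powr (1 + \<alpha>))))"
    by (intro test_fun_cmult test_fun_times_powr_exp assms)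
  then show "test_fun (\<lambda>x. (PhiF \<alpha> k x)\<^sup>2 * u x)" by (simp add: sq mult_ac)
  have "test_fun (\<lambda>x. (1 / CPhi\<^sup>2) * (u x * x powr \<alpha> * exp ((2 * \<beta>) * x powr (1 + \<alpha>))))"
    by (intro test_fun_cmult test_fun_times_powr_exp assms)
  moreover have "(1 / CPhi\<^sup>2) * (u x * x powr \<alpha> * exp ((2 * \<beta>) * x powr (1 + \<alpha>))) = u x / (PhiF \<alpha> k x)\<^sup>2" for x
    unfolding sq by (simp add: powr_minus exp_minus field_simps)
  ultimately show "test_fun (\<lambda>x. u x / (PhiF \<alpha> k x)\<^sup>2)" by simp
qed

text \<open>On \<open>\<Phi> w\<close> the operator factorises: \<open>A (\<Phi> w) = - (\<Phi>\<^sup>2 w')' / \<Phi>\<close>.\<close>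

lemma tau_PhiF_mult:
  assumes w: "test_fun w" and x: "0 < x"
  shows "tau \<alpha> k (\<lambda>x. complex_of_real (PhiF \<alpha> k x * w x)) x =
    - complex_of_real (2 * PhiF' x * deriv w x + PhiF \<alpha> k x * deriv (deriv w) x)"
proof -
  let ?\<phi> = "\<lambda>x. complex_of_real (PhiF \<alpha> k x * w x)"
  note w1 = test_fun_der[OF w]
  have 1: "cderiv ?\<phi> y = complex_of_real (PhiF' y * w y + deriv w y * PhiF \<alpha> k y)" if "0 < y" for y
    by (rule cderivI)
       (use DERIV_mult[OF PhiF_deriv(1)[OF that] w1(1)] in \<open>simp add: has_vector_derivative_complex_iff\<close>)
  have d: "((\<lambda>y. PhiF' y * w y + deriv w y * PhiF \<alpha> k y) has_real_derivative
      (Vpot \<alpha> k x * PhiF \<alpha> k x * w x + deriv w x * PhiF' x) + (deriv (deriv w) x * PhiF \<alpha> k x + PhiF' x * deriv w x)) (at x)"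
    by (rule DERIV_add[OF DERIV_mult[OF PhiF_deriv(2)[OF x] w1(1)] DERIV_mult[OF w1(2) PhiF_deriv(1)[OF x]]])
  have "((\<lambda>y. complex_of_real (PhiF' y * w y + deriv w y * PhiF \<alpha> k y)) has_vector_derivative
     complex_of_real ((Vpot \<alpha> k x * PhiF \<alpha> k x * w x + deriv w x * PhiF' x) + (deriv (deriv w) x * PhiF \<alpha> k x + PhiF' x * deriv w x))) (at x)"
    using d by (simp add: has_vector_derivative_complex_iff)
  then have "(cderiv ?\<phi> has_vector_derivative
     complex_of_real ((Vpot \<alpha> k x * PhiF \<alpha> k x * w x + deriv w x * PhiF' x) + (deriv (deriv w) x * PhiF \<alpha> k x + PhiF' x * deriv w x))) (at x)"
    by (rule has_vector_derivative_transform_within_open[of _ _ _ "{0<..}"]) (use x 1 in auto)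
  from cderivI[OF this] show ?thesis
    unfolding tau_def by (simp add: algebra_simps)
qed

text \<open>Testing with \<Phi> w and putting u = \<Phi>^2 w', the factorisation says that u'/\<Phi>
  is orthogonal to g for every test function u with u/\<Phi>^2 of mean zero. A multiple of F removes
  the mean condition, since the derivative of F/\<Phi> is the Wronskian divided by \<Phi>^2. Thus
  g/\<Phi> plus a multiple of F/\<Phi> has weak derivative 0 and is constant.\<close>

lemma kernel:
  assumes g0: "(g, (\<lambda>x. 0)) \<in> adj (Aop \<alpha> k)"
  obtains d where "AE x in Mp. g x = d * Phi \<alpha> k x"
proof -
  have g: "L2 g" and orth: "\<And>\<phi>. \<phi> \<in> Cc_inf \<Longrightarrow> L2inner (tau \<alpha> k \<phi>) g = 0"
    using g0 unfolding adj_iff by (auto simp: L2inner_def)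
  let ?P = "PhiF \<alpha> k"
  have cP: "continuous_on {0<..} (\<lambda>x. complex_of_real (1 / ?P x))"
    using PhiF_pos by (intro continuous_intros continuous_PhiF) force
  have gi: "integrable Mp (\<lambda>x. complex_of_real (u x / ?P x) * g x)" if u: "test_fun u" for u
    using L2_integrable_mult[OF L2_Cc_inf_mult[OF Cc_inf_of_real[OF u] cP] g] by simp
  \<comment> \<open>Mean zero of u/\<Phi>^2 is what makes its primitive w a test function.\<close>
  have step1: "integral\<^sup>L Mp (\<lambda>x. complex_of_real (deriv u x / ?P x) * g x) = 0"
    if u: "test_fun u" and m: "integral\<^sup>L Mp (\<lambda>x. u x / (?P x)\<^sup>2) = 0" for u
  proof -
    note v = test_fun_PhiF_mult(3)[OF u]
    obtain w where w: "test_fun w" "\<And>x. (w has_real_derivative u x / (?P x)\<^sup>2) (at x)"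
      using test_fun_antiderivative[OF v m] by blast
    have dw: "deriv w = (\<lambda>x. u x / (?P x)\<^sup>2)" using w(2) by (auto intro: DERIV_imp_deriv)
    have "L2inner (tau \<alpha> k (\<lambda>x. complex_of_real (?P x * w x))) g = 0"
      by (intro orth Cc_inf_of_real test_fun_PhiF_mult w)
    also have "L2inner (tau \<alpha> k (\<lambda>x. complex_of_real (?P x * w x))) g =
        integral\<^sup>L Mp (\<lambda>x. - (complex_of_real (deriv u x / ?P x) * g x))"
      unfolding L2inner_def
    proof (rule Bochner_Integration.integral_cong[OF refl])
      fix x assume "x \<in> space Mp"
      then have x: "0 < x" by simp
      have "(u has_real_derivative deriv u x) (at x)" by (rule test_fun_deriv(1)[OF u])
      from DERIV_divide[OF this DERIV_power[OF PhiF_deriv(1)[OF x], of 2]] PhiF_pos[OF x]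
      have "deriv (deriv w) x = (deriv u x * (?P x)\<^sup>2 - u x * (2 * (PhiF' x * ?P x))) / ((?P x)\<^sup>2 * (?P x)\<^sup>2)"
        unfolding dw by (intro DERIV_imp_deriv) simp
      then have "2 * PhiF' x * deriv w x + ?P x * deriv (deriv w) x = deriv u x / ?P x"
        unfolding dw using PhiF_pos[OF x] by (simp add: field_simps power2_eq_square)
      then show "cnj (tau \<alpha> k (\<lambda>x. complex_of_real (?P x * w x)) x) * g x = - (complex_of_real (deriv u x / ?P x) * g x)"
        unfolding tau_PhiF_mult[OF w(1) x] by simp
    qed
    finally show ?thesis by simp
  qed
  obtain \<eta> where \<eta>: "test_fun \<eta>" "integral\<^sup>L Mp \<eta> = 1" by (rule test_fun_unit_mass)
  \<comment> \<open>Normalised so that dividing by \<Phi>^2 gives back a function of mass 1;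
    multiples of it correct the mean of an arbitrary u.\<close>
  define \<eta>1 where "\<eta>1 = (\<lambda>x. (?P x)\<^sup>2 * \<eta> x)"
  have \<eta>1: "test_fun \<eta>1" unfolding \<eta>1_def by (rule test_fun_PhiF_mult[OF \<eta>(1)])
  have "integral\<^sup>L Mp (\<lambda>x. \<eta>1 x / (?P x)\<^sup>2) = integral\<^sup>L Mp \<eta>"
    by (rule Bochner_Integration.integral_cong[OF refl]) (use PhiF_pos in \<open>force simp: \<eta>1_def\<close>)
  then have \<eta>1m: "integral\<^sup>L Mp (\<lambda>x. \<eta>1 x / (?P x)\<^sup>2) = 1" by (simp add: \<eta>)
  define K where "K = integral\<^sup>L Mp (\<lambda>x. complex_of_real (deriv \<eta>1 x / ?P x) * g x)"
  have step2: "integral\<^sup>L Mp (\<lambda>x. complex_of_real (deriv u x / ?P x) * g x) = of_real (integral\<^sup>L Mp (\<lambda>x. u x / (?P x)\<^sup>2)) * K"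
    if u: "test_fun u" for u
  proof -
    define m where "m = integral\<^sup>L Mp (\<lambda>x. u x / (?P x)\<^sup>2)"
    have t: "test_fun (\<lambda>x. u x + - m * \<eta>1 x)" by (intro test_fun_add test_fun_cmult u \<eta>1)
    have i: "integrable Mp (\<lambda>x. u x / (?P x)\<^sup>2)" "integrable Mp (\<lambda>x. \<eta>1 x / (?P x)\<^sup>2)"
      by (intro test_fun_integrable test_fun_PhiF_mult u \<eta>1)+
    have "integral\<^sup>L Mp (\<lambda>x. (u x + - m * \<eta>1 x) / (?P x)\<^sup>2) =
        integral\<^sup>L Mp (\<lambda>x. u x / (?P x)\<^sup>2 - m * (\<eta>1 x / (?P x)\<^sup>2))"
      by (simp add: diff_divide_distrib)
    also have "\<dots> = integral\<^sup>L Mp (\<lambda>x. u x / (?P x)\<^sup>2) - integral\<^sup>L Mp (\<lambda>x. m * (\<eta>1 x / (?P x)\<^sup>2))"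
      by (rule Bochner_Integration.integral_diff[OF i(1) integrable_mult_right[OF i(2)]])
    also have "\<dots> = 0" unfolding integral_mult_right_zero \<eta>1m m_def by simp
    finally have z: "integral\<^sup>L Mp (\<lambda>x. complex_of_real (deriv (\<lambda>x. u x + - m * \<eta>1 x) x / ?P x) * g x) = 0"
      by (rule step1[OF t])
    have "deriv (\<lambda>x. u x + - m * \<eta>1 x) x = deriv u x + - m * deriv \<eta>1 x" for x
      by (intro DERIV_imp_deriv DERIV_add DERIV_cmult test_fun_deriv u \<eta>1)
    then have e: "complex_of_real (deriv (\<lambda>x. u x + - m * \<eta>1 x) x / ?P x) * g x =
        complex_of_real (deriv u x / ?P x) * g x - of_real m * (complex_of_real (deriv \<eta>1 x / ?P x) * g x)" for x
      by (simp only: of_real_add of_real_mult of_real_minus of_real_divide add_divide_distrib) (simp add: algebra_simps)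
    have "0 = integral\<^sup>L Mp (\<lambda>x. complex_of_real (deriv u x / ?P x) * g x - of_real m * (complex_of_real (deriv \<eta>1 x / ?P x) * g x))"
      using z unfolding e by (rule sym)
    also have "\<dots> = integral\<^sup>L Mp (\<lambda>x. complex_of_real (deriv u x / ?P x) * g x) - of_real m * K"
      unfolding K_def integral_mult_right_zero[symmetric]
      by (intro Bochner_Integration.integral_diff integrable_mult_right gi test_fun_deriv u \<eta>1)
    finally show ?thesis by (simp add: m_def)
  qed
  \<comment> \<open>The weak derivative of F/\<Phi>, obtained from the Wronskian.\<close>
  have step3: "integral\<^sup>L Mp (\<lambda>x. deriv u x * FF \<alpha> k x / ?P x) = - (1 + \<alpha>) * integral\<^sup>L Mp (\<lambda>x. u x / (?P x)\<^sup>2)"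
    "integrable Mp (\<lambda>x. deriv u x * FF \<alpha> k x / ?P x)"
    if u: "test_fun u" for u
  proof -
    obtain a b where ab: "0 < a" "\<And>x. x \<notin> {a..b} \<Longrightarrow> u x = 0 \<and> deriv u x = 0 \<and> deriv (deriv u) x = 0"
      using test_fun_support[OF u] by metis
    note c = test_fun_cont[OF u] continuous_PhiF continuous_FF
    have P0: "\<And>x. x \<in> {0<..} \<Longrightarrow> ?P x \<noteq> 0" using PhiF_pos by force
    have z: "integral\<^sup>L Mp (\<lambda>x. deriv u x * FF \<alpha> k x / ?P x + (1 + \<alpha>) * (u x / (?P x)\<^sup>2)) = 0"
    proof (rule integral_Mp_derivative_eq_0[where H = "\<lambda>x. u x * FF \<alpha> k x / ?P x", OF _ _ ab(1), where b = b])
      fix x :: real assume x: "0 < x"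
      have P: "?P x \<noteq> 0" using PhiF_pos[OF x] by simp
      have "u x * (?P x * FF' x - PhiF' x * FF \<alpha> k x) = u x * (1 + \<alpha>)" by (simp add: Wronskian[OF x])
      then have e: "((deriv u x * FF \<alpha> k x + FF' x * u x) * ?P x - u x * FF \<alpha> k x * PhiF' x) / (?P x * ?P x) =
          deriv u x * FF \<alpha> k x / ?P x + (1 + \<alpha>) * (u x / (?P x)\<^sup>2)"
        using P by (simp add: field_simps power2_eq_square)
      show "((\<lambda>x. u x * FF \<alpha> k x / ?P x) has_vector_derivative deriv u x * FF \<alpha> k x / ?P x + (1 + \<alpha>) * (u x / (?P x)\<^sup>2)) (at x)"
        using DERIV_divide[OF DERIV_mult[OF test_fun_deriv(1)[OF u] FF_deriv(1)[OF x]] PhiF_deriv(1)[OF x] P]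
        unfolding e[symmetric] by (simp add: has_real_derivative_iff_has_vector_derivative)
    qed (use ab P0 in \<open>auto intro!: continuous_intros c\<close>)
    show i: "integrable Mp (\<lambda>x. deriv u x * FF \<alpha> k x / ?P x)"
      by (rule compact_support_integral_Mp(1)[OF _ ab(1), of _ b]) (use ab P0 in \<open>auto intro!: continuous_intros c\<close>)
    have i2: "integrable Mp (\<lambda>x. u x / (?P x)\<^sup>2)" by (intro test_fun_integrable test_fun_PhiF_mult u)
    have "integral\<^sup>L Mp (\<lambda>x. deriv u x * FF \<alpha> k x / ?P x + (1 + \<alpha>) * (u x / (?P x)\<^sup>2)) =
        integral\<^sup>L Mp (\<lambda>x. deriv u x * FF \<alpha> k x / ?P x) + (1 + \<alpha>) * integral\<^sup>L Mp (\<lambda>x. u x / (?P x)\<^sup>2)"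
      unfolding integral_mult_right_zero[symmetric]
      by (rule Bochner_Integration.integral_add[OF i integrable_mult_right[OF i2]])
    then have zz: "integral\<^sup>L Mp (\<lambda>x. deriv u x * FF \<alpha> k x / ?P x) + (1 + \<alpha>) * integral\<^sup>L Mp (\<lambda>x. u x / (?P x)\<^sup>2) = 0"
      using z by (simp only:)
    show "integral\<^sup>L Mp (\<lambda>x. deriv u x * FF \<alpha> k x / ?P x) = - (1 + \<alpha>) * integral\<^sup>L Mp (\<lambda>x. u x / (?P x)\<^sup>2)"
      using zz by (simp only: minus_mult_left[symmetric] eq_neg_iff_add_eq_0)
  qed
  \<comment> \<open>With this constant the functional produced by F/\<Phi> cancels the one left over
    in \<open>step2\<close>.\<close>
  define K' where "K' = K / of_real (1 + \<alpha>)"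
  define v where "v x = complex_of_real (1 / ?P x) * g x + complex_of_real (FF \<alpha> k x / ?P x) * K'" for x
  have cF: "continuous_on {0<..} (\<lambda>x. complex_of_real (FF \<alpha> k x / ?P x) * K')"
    using PhiF_pos by (intro continuous_intros continuous_PhiF continuous_FF) force
  have "locL1 v"
  proof -
    have 1: "locL1 (\<lambda>x. complex_of_real (1 / ?P x) * g x)" by (rule locL1_continuous_mult[OF g cP])
    have "(\<lambda>x. complex_of_real (FF \<alpha> k x / ?P x) * K') \<in> borel_measurable Mp" by (rule borel_measurable_Mp_continuous[OF cF])
    moreover have "integrable (lebesgue_on {a..b}) (\<lambda>x. complex_of_real (FF \<alpha> k x / ?P x) * K')" if "0 < a" for a b
      by (rule continuous_imp_integrable_real, rule continuous_on_subset[OF cF]) (use that in auto)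
    ultimately show ?thesis
      using 1 unfolding locL1_def v_def
      by (intro conjI allI impI borel_measurable_add Bochner_Integration.integrable_add; blast)
  qed
  moreover have "integral\<^sup>L Mp (\<lambda>x. v x * of_real (deriv u x)) = 0" if u: "test_fun u" for u
  proof -
    have "integral\<^sup>L Mp (\<lambda>x. v x * of_real (deriv u x)) =
        integral\<^sup>L Mp (\<lambda>x. complex_of_real (deriv u x / ?P x) * g x + K' * complex_of_real (deriv u x * FF \<alpha> k x / ?P x))"
      unfolding v_def by (simp add: algebra_simps)
    also have "\<dots> = integral\<^sup>L Mp (\<lambda>x. complex_of_real (deriv u x / ?P x) * g x) +
        integral\<^sup>L Mp (\<lambda>x. K' * complex_of_real (deriv u x * FF \<alpha> k x / ?P x))"
      by (rule Bochner_Integration.integral_add[OF gi[OF test_fun_deriv(2)[OF u]]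
            integrable_mult_right[OF integrable_of_real[OF step3(2)[OF u]]]])
    also have "\<dots> = of_real (integral\<^sup>L Mp (\<lambda>x. u x / (?P x)\<^sup>2)) * K +
        K' * of_real (- (1 + \<alpha>) * integral\<^sup>L Mp (\<lambda>x. u x / (?P x)\<^sup>2))"
      unfolding integral_mult_right_zero integral_complex_of_real step2[OF u] step3(1)[OF u] ..
    also have "\<dots> = 0"
    proof -
      have gen: "M * K + K' * (- a * M) = 0" if "K' * a = K" for M a :: complex
        using that by (auto simp: algebra_simps)
      have "complex_of_real (1 + \<alpha>) \<noteq> 0" using \<alpha> by (simp only: of_real_eq_0_iff)
      then have "K' * complex_of_real (1 + \<alpha>) = K" by (simp add: K'_def del: of_real_add)
      from gen[OF this] show ?thesis by (simp only: of_real_mult of_real_minus)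
    qed
    finally show ?thesis .
  qed
  ultimately obtain d where d: "AE x in Mp. v x = d" using du_Bois_Reymond[of v] by blast
  have gd: "AE x in Mp. g x = d * Phi \<alpha> k x - K' * complex_of_real (FF \<alpha> k x)"
    using d AE_space
  proof eventually_elim
    case (elim x)
    then have "complex_of_real (?P x) \<noteq> 0" using PhiF_pos[of x] by simp
    then show ?case using elim(1) by (simp add: v_def field_simps)
  qed
  have "K' = 0"
  proof (rule ccontr)
    assume K: "K' \<noteq> 0"
    have "L2 (\<lambda>x. (1 / K') * (d * Phi \<alpha> k x - g x))" by (intro L2_cmult L2_diff L2_Phi g)
    moreover have "AE x in Mp. (1 / K') * (d * Phi \<alpha> k x - g x) = complex_of_real (FF \<alpha> k x)"
      using gd by eventually_elim (simp add: K)
    ultimately have "L2 (\<lambda>x. complex_of_real (FF \<alpha> k x))" by (rule L2_cong_AE)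
    then show False using FF_not_L2 by simp
  qed
  with gd show ?thesis by (intro that[of d]) simp
qed

section \<open>Decomposition of the domain of the adjoint\<close>

lemma adj_lin:
  assumes "(g, h) \<in> adj (Aop \<alpha> k)" "(g', h') \<in> adj (Aop \<alpha> k)"
  shows "((\<lambda>x. g x + c * g' x), (\<lambda>x. h x + c * h' x)) \<in> adj (Aop \<alpha> k)"
  using assms unfolding adj_iff
  by (auto intro!: L2_add L2_cmult simp: L2inner_add_right L2inner_cmult_right L2_tau L2_Cc_inf L2_cmult)

lemma adj_AE:
  assumes "(g, h) \<in> adj (Aop \<alpha> k)" "AE x in Mp. g x = g' x" "AE x in Mp. h x = h' x"
  shows "(g', h') \<in> adj (Aop \<alpha> k)"
proof -
  have g: "L2 g" "L2 h" using assms(1) by (auto simp: adj_iff)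
  have "L2inner (tau \<alpha> k \<phi>) g' = L2inner \<phi> h'" if "\<phi> \<in> Cc_inf" for \<phi>
    using assms(1) that L2inner_cong_AE[OF L2_tau[OF that] g(1) AE_I2[OF refl] assms(2)]
      L2inner_cong_AE[OF L2_Cc_inf[OF that] g(2) AE_I2[OF refl] assms(3)] by (auto simp: adj_iff)
  then show ?thesis unfolding adj_iff using L2_cong_AE[OF g(1) assms(2)] L2_cong_AE[OF g(2) assms(3)] by blast
qed

lemma closure_AE:
  assumes "(g, h) \<in> opclosure (Aop \<alpha> k)" "AE x in Mp. g x = g' x" "AE x in Mp. h x = h' x"
  shows "(g', h') \<in> opclosure (Aop \<alpha> k)"
proof -
  obtain t where g: "L2 g" "L2 h" and t: "\<And>n. t n \<in> Cc_inf" "L2conv t g" "L2conv (\<lambda>n. tau \<alpha> k (t n)) h"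
    using assms(1) unfolding opclosure_iff by blast
  show ?thesis unfolding opclosure_iff
    using L2_cong_AE[OF g(1) assms(2)] L2_cong_AE[OF g(2) assms(3)] t(1)
      L2conv_cong_AE[OF t(2) L2_Cc_inf[OF t(1)] g(1) assms(2)]
      L2conv_cong_AE[OF t(3) L2_tau[OF t(1)] g(2) assms(3)] by (intro conjI exI[of _ t]) auto
qed

lemma closure_adj_inner:
  assumes "(f, h) \<in> opclosure (Aop \<alpha> k)" "(g, l) \<in> adj (Aop \<alpha> k)"
  shows "L2inner h g = L2inner f l"
proof -
  obtain t where f: "L2 f" "L2 h" and t: "\<And>n. t n \<in> Cc_inf" "L2conv t f" "L2conv (\<lambda>n. tau \<alpha> k (t n)) h"
    using assms(1) unfolding opclosure_iff by blast
  have g: "L2 g" "L2 l" "\<And>\<phi>. \<phi> \<in> Cc_inf \<Longrightarrow> L2inner (tau \<alpha> k \<phi>) g = L2inner \<phi> l"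
    using assms(2) by (auto simp: adj_iff)
  have "(\<lambda>n. L2inner (tau \<alpha> k (t n)) g) \<longlonglongrightarrow> L2inner h g"
    by (rule L2conv_inner_left[OF t(3) L2_tau[OF t(1)] f(2) g(1)])
  moreover have "(\<lambda>n. L2inner (tau \<alpha> k (t n)) g) \<longlonglongrightarrow> L2inner f l"
    using L2conv_inner_left[OF t(2) L2_Cc_inf[OF t(1)] f(1) g(2)] g(3)[OF t(1)] by simp
  ultimately show ?thesis by (rule LIMSEQ_unique)
qed

lemma Aop_closure: "\<phi> \<in> Cc_inf \<Longrightarrow> (\<phi>, tau \<alpha> k \<phi>) \<in> opclosure (Aop \<alpha> k)"
  unfolding opclosure_iff by (auto intro!: L2_Cc_inf L2_tau exI[of _ "\<lambda>n. \<phi>"] L2conv_const)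

lemma Aop_adj: "\<phi> \<in> Cc_inf \<Longrightarrow> (\<phi>, tau \<alpha> k \<phi>) \<in> adj (Aop \<alpha> k)"
  unfolding adj_iff by (auto intro!: L2_Cc_inf L2_tau tau_symmetric)

lemma closure_adj:
  assumes "(f, h) \<in> opclosure (Aop \<alpha> k)"
  shows "(f, h) \<in> adj (Aop \<alpha> k)"
  unfolding adj_iff
proof (intro conjI ballI)
  show "L2 f" "L2 h" using assms by (auto simp: opclosure_iff)
  fix \<phi> assume "\<phi> \<in> Cc_inf"
  from closure_adj_inner[OF assms Aop_adj[OF this]]
  have "cnj (L2inner h \<phi>) = cnj (L2inner f (tau \<alpha> k \<phi>))" by simp
  then show "L2inner (tau \<alpha> k \<phi>) f = L2inner \<phi> h" by (simp add: L2inner_cnj)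
qed

text \<open>Equality is pointwise for \<open>g\<close> and only almost everywhere for
  \<open>h\<close>: a null set error in \<open>g\<close> can be moved into \<open>f\<close>, since
  the closure is invariant under changes on null sets.\<close>

definition decomp :: "(real \<Rightarrow> complex) \<Rightarrow> (real \<Rightarrow> complex) \<Rightarrow> complex \<Rightarrow> complex \<Rightarrow> bool" where
  "decomp g h c d \<longleftrightarrow> (\<exists>f hf. (f, hf) \<in> opclosure (Aop \<alpha> k) \<and>
     g = (\<lambda>x. f x + c * Psi \<alpha> k x + d * Phi \<alpha> k x) \<and> (AE x in Mp. h x = hf x + c * Phi \<alpha> k x))"

text \<open>\<open>c\<close> is the Fourier coefficient of \<open>h\<close> along \<Phi>. The rest
  of \<open>h\<close> is orthogonal to the kernel of the adjoint, hence in the closed range, say the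
  image of \<open>f\<close>. Then g - f - c \<Psi> is annihilated by the adjoint, which yields
  \<open>d\<close>.\<close>

lemma decomp_exists:
  assumes gh: "(g, h) \<in> adj (Aop \<alpha> k)"
  obtains c d where "decomp g h c d"
proof -
  have L: "L2 g" "L2 h" using gh by (auto simp: adj_iff)
  have N: "L2inner (Phi \<alpha> k) (Phi \<alpha> k) = of_real N" unfolding N_def by (rule L2inner_self)
  define c where "c = L2inner (Phi \<alpha> k) h / of_real N"
  define h0 where "h0 = (\<lambda>x. h x - c * Phi \<alpha> k x)"
  have h0: "L2 h0" unfolding h0_def by (intro L2_diff L2_cmult L L2_Phi)
  have perp: "L2inner (Phi \<alpha> k) h0 = 0"
    unfolding h0_def L2inner_diff_right[OF L(2) L2_cmult[OF L2_Phi] L2_Phi] L2inner_cmult_right N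
    using N_pos by (simp add: c_def)
  obtain f h' where f: "(f, h') \<in> opclosure (Aop \<alpha> k)"
    and fh: "\<And>\<phi>. \<phi> \<in> Cc_inf \<Longrightarrow> L2inner (tau \<alpha> k \<phi>) h' = L2inner (tau \<alpha> k \<phi>) h0"
    using range_projection[OF h0] by metis
  have h': "L2 h'" using f by (auto simp: opclosure_iff)
  have "((\<lambda>x. h0 x - h' x), (\<lambda>x. 0)) \<in> adj (Aop \<alpha> k)"
    unfolding adj_iff using h0 h' by (auto intro: L2_diff L2_0 simp: L2inner_diff_right L2_tau fh) (simp add: L2inner_def)
  then obtain e where e: "AE x in Mp. h0 x - h' x = e * Phi \<alpha> k x" by (rule kernel)
  \<comment> \<open>The difference of \<open>h0\<close> and its projection lies in the span of
    \<Phi> and is orthogonal to \<Phi>, so \<open>e\<close> is 0.\<close>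
  have "L2inner h' (Phi \<alpha> k) = 0"
    using closure_adj_inner[OF f Phi_adj] by (simp add: L2inner_def)
  then have "L2inner (Phi \<alpha> k) h' = 0" by (metis L2inner_cnj complex_cnj_zero)
  then have "0 = L2inner (Phi \<alpha> k) (\<lambda>x. h0 x - h' x)"
    using perp h0 h' L2_Phi by (simp add: L2inner_diff_right)
  also have "\<dots> = L2inner (Phi \<alpha> k) (\<lambda>x. e * Phi \<alpha> k x)"
    by (rule L2inner_cong_AE) (use e h0 h' L2_Phi in \<open>auto intro: L2_diff\<close>)
  also have "\<dots> = e * of_real N" by (simp add: L2inner_cmult_right N)
  finally have "e = 0" using N_pos by simp
  have hh: "AE x in Mp. h x = h' x + c * Phi \<alpha> k x"
    using e unfolding h0_def
  proof eventually_elim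
    case (elim x)
    then show ?case using \<open>e = 0\<close> by (simp add: algebra_simps)
  qed
  have "((\<lambda>x. (g x + (-1) * f x) + (- c) * Psi \<alpha> k x), (\<lambda>x. (h x + (-1) * h' x) + (- c) * Phi \<alpha> k x)) \<in> adj (Aop \<alpha> k)"
    by (intro adj_lin gh closure_adj[OF f] Psi_adj)
  then have "((\<lambda>x. (g x + (-1) * f x) + (- c) * Psi \<alpha> k x), (\<lambda>x. 0)) \<in> adj (Aop \<alpha> k)"
    by (rule adj_AE) (use hh in auto)
  then obtain d where d: "AE x in Mp. (g x + (-1) * f x) + (- c) * Psi \<alpha> k x = d * Phi \<alpha> k x" by (rule kernel)
  \<comment> \<open>\<open>f\<close> is redefined as the exact difference, so that the decomposition
    of \<open>g\<close> holds at every point.\<close>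
  have "((\<lambda>x. g x - c * Psi \<alpha> k x - d * Phi \<alpha> k x), h') \<in> opclosure (Aop \<alpha> k)"
  proof (rule closure_AE[OF f])
    show "AE x in Mp. f x = g x - c * Psi \<alpha> k x - d * Phi \<alpha> k x"
      using d by eventually_elim (simp add: algebra_simps)
  qed simp
  then have "decomp g h c d" unfolding decomp_def using hh
    by (intro exI[of _ "\<lambda>x. g x - c * Psi \<alpha> k x - d * Phi \<alpha> k x"] exI[of _ h']) auto
  then show ?thesis by (rule that)
qed

lemma decomp_adj:
  assumes "decomp g h c d"
  shows "(g, h) \<in> adj (Aop \<alpha> k)"
proof -
  obtain f hf where f: "(f, hf) \<in> opclosure (Aop \<alpha> k)" "g = (\<lambda>x. f x + c * Psi \<alpha> k x + d * Phi \<alpha> k x)"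
    "AE x in Mp. h x = hf x + c * Phi \<alpha> k x" using assms unfolding decomp_def by blast
  have "((\<lambda>x. (f x + c * Psi \<alpha> k x) + d * Phi \<alpha> k x), (\<lambda>x. (hf x + c * Phi \<alpha> k x) + d * 0)) \<in> adj (Aop \<alpha> k)"
    by (intro adj_lin closure_adj f Psi_adj Phi_adj)
  then show ?thesis by (rule adj_AE) (use f in auto)
qed

text \<open>\<open>P\<close> stands for the linear maps bounded by the graph norm: the first
  derivative, the second derivative and multiplication by \<open>Wpot\<close>.\<close>

lemma L2_Cauchy_dominated:
  assumes h: "L2conv (\<lambda>n. tau \<alpha> k (t n)) h" "L2 h" and t: "\<And>n. t n \<in> Cc_inf"
    and le: "\<And>\<phi>. \<phi> \<in> Cc_inf \<Longrightarrow> L2norm (P \<phi>) \<le> C * L2norm (tau \<alpha> k \<phi>)" and C: "0 < C"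
    and P: "\<And>\<phi> \<psi>. \<phi> \<in> Cc_inf \<Longrightarrow> \<psi> \<in> Cc_inf \<Longrightarrow> P (\<lambda>x. \<phi> x - \<psi> x) = (\<lambda>x. P \<phi> x - P \<psi> x)"
    and e: "0 < (e::real)"
  shows "\<exists>M. \<forall>m\<ge>M. \<forall>n\<ge>M. L2norm (\<lambda>x. P (t m) x - P (t n) x) < e"
proof -
  obtain M where M: "\<forall>m\<ge>M. \<forall>n\<ge>M. L2norm (\<lambda>x. tau \<alpha> k (t m) x - tau \<alpha> k (t n) x) < e / C"
    using L2conv_Cauchy[OF h(1) L2_tau[OF t] h(2) divide_pos_pos[OF e C]] by blast
  have "L2norm (\<lambda>x. P (t m) x - P (t n) x) < e" if "m \<ge> M" "n \<ge> M" for m n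
  proof -
    have "L2norm (\<lambda>x. P (t m) x - P (t n) x) \<le> C * L2norm (\<lambda>x. tau \<alpha> k (t m) x - tau \<alpha> k (t n) x)"
      using le[OF Cc_inf_diff[OF t t], of m n] unfolding P[OF t t] tau_diff[OF t t] .
    also have "\<dots> < e" using M[rule_format, OF that] C by (simp add: field_simps)
    finally show ?thesis .
  qed
  then show ?thesis by blast
qed

lemma operator_bounds:
  assumes \<phi>: "\<phi> \<in> Cc_inf"
  shows "L2norm (cderiv \<phi>) \<le> 2 * L2norm (tau \<alpha> k \<phi>)"
    "L2norm (cderiv (cderiv \<phi>)) \<le> (1 / sqrt \<delta>) * L2norm (tau \<alpha> k \<phi>)"
    "L2norm (\<lambda>x. of_real (Wpot x) * \<phi> x) \<le> 1 * L2norm (tau \<alpha> k \<phi>)"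
proof -
  let ?T = "L2norm (tau \<alpha> k \<phi>)"
  have T: "0 \<le> ?T" by (rule L2norm_nonneg)
  have "(L2norm (cderiv \<phi>))\<^sup>2 \<le> Re (L2inner \<phi> (tau \<alpha> k \<phi>))"
    using energy_estimate[OF \<phi>] zero_le_power2[of "L2norm (\<lambda>x. of_real (sqrt (Wpot x)) * \<phi> x)"] by linarith
  also have "\<dots> \<le> L2norm \<phi> * ?T"
    by (rule order_trans[OF complex_Re_le_cmod cmod_L2inner_le[OF L2_Cc_inf[OF \<phi>] L2_tau[OF \<phi>]]])
  also have "\<dots> \<le> (4 * ?T) * ?T" by (rule mult_right_mono[OF norm_le_tau[OF \<phi>] T])
  also have "\<dots> = (2 * ?T)\<^sup>2" by (simp add: power2_eq_square)
  finally show "L2norm (cderiv \<phi>) \<le> 2 * ?T" by (rule power2_le_imp_le) (use T in simp)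
  note E = operator_estimate[OF \<phi>]
  have "\<delta> * (L2norm (cderiv (cderiv \<phi>)))\<^sup>2 \<le> ?T\<^sup>2"
    using E zero_le_power2[of "L2norm (\<lambda>x. of_real (Wpot x) * \<phi> x)"] by linarith
  then have "(L2norm (cderiv (cderiv \<phi>)))\<^sup>2 \<le> ((1 / sqrt \<delta>) * ?T)\<^sup>2"
    using \<delta> by (simp add: power_mult_distrib power_divide field_simps)
  then show "L2norm (cderiv (cderiv \<phi>)) \<le> (1 / sqrt \<delta>) * ?T"
    by (rule power2_le_imp_le) (use T \<delta> in simp)
  have "0 \<le> \<delta> * (L2norm (cderiv (cderiv \<phi>)))\<^sup>2" using \<delta> by simp
  then have "(L2norm (\<lambda>x. of_real (Wpot x) * \<phi> x))\<^sup>2 \<le> ?T\<^sup>2" using E by linarith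
  then show "L2norm (\<lambda>x. of_real (Wpot x) * \<phi> x) \<le> 1 * ?T"
    using power2_le_imp_le[OF _ T] by simp
qed

lemma closure_in_H2_0:
  assumes "(f, h) \<in> opclosure (Aop \<alpha> k)"
  shows "f \<in> H2_0" "L2 (\<lambda>x. of_real (Wpot x) * f x)"
proof -
  obtain t where f: "L2 f" "L2 h" and t: "\<And>n. t n \<in> Cc_inf" "L2conv t f" "L2conv (\<lambda>n. tau \<alpha> k (t n)) h"
    using assms unfolding opclosure_iff by blast
  have L1: "L2 (cderiv (t n))" "L2 (cderiv (cderiv (t n)))" for n
    by (intro L2_Cc_inf Cc_inf_deriv(2) t(1))+
  have "\<exists>M. \<forall>m\<ge>M. \<forall>n\<ge>M. L2norm (\<lambda>x. cderiv (t m) x - cderiv (t n) x) < e" if "0 < e" for e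
    by (rule L2_Cauchy_dominated[OF t(3) f(2) t(1) operator_bounds(1) zero_less_numeral cderiv_diff that])
  then obtain g1 where g1: "L2 g1" "L2conv (\<lambda>n. cderiv (t n)) g1"
    using L2_Cauchy_complete[of "\<lambda>n. cderiv (t n)", OF L1(1)] by metis
  have "\<exists>M. \<forall>m\<ge>M. \<forall>n\<ge>M. L2norm (\<lambda>x. cderiv (cderiv (t m)) x - cderiv (cderiv (t n)) x) < e" if "0 < e" for e
    by (rule L2_Cauchy_dominated[OF t(3) f(2) t(1) operator_bounds(2) _ cderiv2_diff that]) (use \<delta> in simp_all)
  then obtain g2 where g2: "L2 g2" "L2conv (\<lambda>n. cderiv (cderiv (t n))) g2"
    using L2_Cauchy_complete[of "\<lambda>n. cderiv (cderiv (t n))", OF L1(2)] by metis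
  show "f \<in> H2_0" unfolding H2_0_def
    by (intro CollectI conjI exI[of _ g1] exI[of _ g2] exI[of _ t] allI f g1 g2 t)
  have W: "\<exists>M. \<forall>m\<ge>M. \<forall>n\<ge>M. L2norm (\<lambda>x. of_real (Wpot x) * t m x - of_real (Wpot x) * t n x) < e" if "0 < e" for e
    by (rule L2_Cauchy_dominated[OF t(3) f(2) t(1) operator_bounds(3)]) (use that in \<open>auto simp: algebra_simps\<close>)
  show "L2 (\<lambda>x. of_real (Wpot x) * f x)"
    by (rule L2conv_mult(1)[OF t(2) L2_Cc_inf[OF t(1)] f(1) _ L2_weights(3)[OF t(1)] W])
       (auto intro!: borel_measurable_Mp_continuous continuous_intros continuous_Wpot)
qed

text \<open>The passage from (c, d) to the boundary coefficients is triangular with the positive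
  diagonal entries \<open>CPsi\<close> and \<open>CPhi\<close>; this is why the coefficients can be
  read off.\<close>

lemma decomp_asym:
  assumes "decomp g h c d"
  shows "asym g (d * of_real CPhi) (c * of_real CPsi - d * of_real (CPhi * \<beta>))"
proof -
  obtain f hf where f: "(f, hf) \<in> opclosure (Aop \<alpha> k)" "g = (\<lambda>x. f x + c * Psi \<alpha> k x + d * Phi \<alpha> k x)"
    using assms unfolding decomp_def by blast
  have "asym (\<lambda>x. (f x + c * Psi \<alpha> k x) + d * Phi \<alpha> k x) ((0 + c * 0) + d * of_real CPhi) ((0 + c * of_real CPsi) + d * of_real (- CPhi * \<beta>))"
    by (intro asym_lin asym_H2_0[OF closure_in_H2_0(1)[OF f(1)]] Psi_asym Phi_asym)
  then show ?thesis unfolding f(2) by simp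
qed

lemma asym_AE:
  assumes "asym g a b" "AE x in Mp. g x = g' x"
  shows "asym g' a b"
proof -
  obtain u where u: "AE x in Mp. u x = g x"
    "(\<lambda>x. u x - (a * complex_of_real (x powr (- \<alpha>/2)) + b * complex_of_real (x powr (1 + \<alpha>/2)))) \<in> o[at_right 0](\<lambda>x. complex_of_real (x powr (3/2)))"
    using assms(1) unfolding asym_def asymp_near0_def by blast
  have "AE x in Mp. u x = g' x" using u(1) assms(2) by eventually_elim simp
  with u(2) show ?thesis unfolding asym_def asymp_near0_def by blast
qed

lemma decomp_zero:
  assumes "decomp g h c d" "asym g 0 0"
  shows "c = 0" "d = 0"
  using asym_unique[OF decomp_asym[OF assms(1)] assms(2)] CPhi CPsi by auto

lemma direct_sum:
  assumes "f \<in> opdom (opclosure (Aop \<alpha> k))" "AE x in Mp. f x + c * Psi \<alpha> k x + d * Phi \<alpha> k x = 0"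
  shows "c = 0" "d = 0"
proof -
  obtain hf where "(f, hf) \<in> opclosure (Aop \<alpha> k)" using assms(1) unfolding opdom_def by auto
  then have D: "decomp (\<lambda>x. f x + c * Psi \<alpha> k x + d * Phi \<alpha> k x) (\<lambda>x. hf x + c * Phi \<alpha> k x) c d"
    unfolding decomp_def by blast
  have "(\<lambda>x. 0) \<in> H2_0"
    unfolding H2_0_def
  proof (intro CollectI conjI exI)
    show "L2conv (\<lambda>n x. 0) (\<lambda>x. 0)" by (rule L2conv_const)
    have z: "cderiv (\<lambda>x. 0) = (\<lambda>x. 0)" by (auto simp: cderiv_def complex_eq_iff)
    show "L2conv (\<lambda>n. cderiv (\<lambda>x. 0)) (\<lambda>x. 0)" "L2conv (\<lambda>n. cderiv (cderiv (\<lambda>x. 0))) (\<lambda>x. 0)"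
      unfolding z by (rule L2conv_const)+
  qed (auto intro: L2_0 Cc_inf_0)
  then have "asym (\<lambda>x. 0) 0 0" by (rule asym_H2_0)
  then have "asym (\<lambda>x. f x + c * Psi \<alpha> k x + d * Phi \<alpha> k x) 0 0"
  proof (rule asym_AE)
    show "AE x in Mp. 0 = f x + c * Psi \<alpha> k x + d * Phi \<alpha> k x"
      using assms(2) by eventually_elim simp
  qed
  from decomp_zero[OF D this] show "c = 0" "d = 0" .
qed

section \<open>Comparison of weights; the domains of the closure and of the adjoint\<close>

text \<open>For \<open>f\<close> already square integrable only the growth of the weight matters, so
  an additive constant is allowed when \<open>w\<close> is bounded by v^2.\<close>

lemma wL2_iff:
  assumes f: "L2 f" and v: "continuous_on {0<..} v" and w: "continuous_on {0<..} w"
    and wv: "\<And>x. 0 < x \<Longrightarrow> 0 \<le> w x \<and> w x \<le> A * (1 + (v x)\<^sup>2) \<and> (v x)\<^sup>2 \<le> B * w x"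
  shows "wL2 w f \<longleftrightarrow> L2 (\<lambda>x. complex_of_real (v x) * f x)"
proof
  note m = L2_measurable[OF f] borel_measurable_Mp_continuous[OF w] borel_measurable_Mp_continuous[OF v]
  assume "wL2 w f"
  then have i: "integrable Mp (\<lambda>x. w x * (cmod (f x))\<^sup>2)" by (simp add: wL2_def)
  show "L2 (\<lambda>x. complex_of_real (v x) * f x)"
    unfolding L2_def
  proof
    show "(\<lambda>x. complex_of_real (v x) * f x) \<in> borel_measurable Mp" using m by measurable
    show "integrable Mp (\<lambda>x. (cmod (complex_of_real (v x) * f x))\<^sup>2)"
    proof (rule Bochner_Integration.integrable_bound[OF integrable_mult_right[OF i, of B]])
      show "(\<lambda>x. (cmod (complex_of_real (v x) * f x))\<^sup>2) \<in> borel_measurable Mp" using m by measurable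
      have "norm ((cmod (complex_of_real (v x) * f x))\<^sup>2) \<le> norm (B * (w x * (cmod (f x))\<^sup>2))" if "0 < x" for x
      proof -
        have "(v x)\<^sup>2 * (cmod (f x))\<^sup>2 \<le> (B * w x) * (cmod (f x))\<^sup>2"
          using wv[OF that] by (intro mult_right_mono) auto
        also have "\<dots> \<le> \<bar>(B * w x) * (cmod (f x))\<^sup>2\<bar>" by (rule abs_ge_self)
        finally show ?thesis by (simp add: norm_mult power_mult_distrib mult.assoc)
      qed
      then show "AE x in Mp. norm ((cmod (complex_of_real (v x) * f x))\<^sup>2) \<le> norm (B * (w x * (cmod (f x))\<^sup>2))"
        by (rule AE_MpI)
    qed
  qed
next
  note m = L2_measurable[OF f] borel_measurable_Mp_continuous[OF w] borel_measurable_Mp_continuous[OF v]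
  assume vf: "L2 (\<lambda>x. complex_of_real (v x) * f x)"
  show "wL2 w f"
    unfolding wL2_def
  proof
    show "integrable Mp (\<lambda>x. w x * (cmod (f x))\<^sup>2)"
    proof (rule Bochner_Integration.integrable_bound)
      show "integrable Mp (\<lambda>x. A * ((cmod (f x))\<^sup>2 + (cmod (complex_of_real (v x) * f x))\<^sup>2))"
        by (intro integrable_mult_right Bochner_Integration.integrable_add L2_integrable f vf)
      show "(\<lambda>x. w x * (cmod (f x))\<^sup>2) \<in> borel_measurable Mp" using m by measurable
      have "norm (w x * (cmod (f x))\<^sup>2) \<le> norm (A * ((cmod (f x))\<^sup>2 + (cmod (complex_of_real (v x) * f x))\<^sup>2))" if "0 < x" for x
      proof -
        have "w x * (cmod (f x))\<^sup>2 \<le> (A * (1 + (v x)\<^sup>2)) * (cmod (f x))\<^sup>2"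
          using wv[OF that] by (intro mult_right_mono) auto
        also have "\<dots> = A * ((cmod (f x))\<^sup>2 + (cmod (complex_of_real (v x) * f x))\<^sup>2)"
          by (simp add: norm_mult power_mult_distrib algebra_simps)
        also have "\<dots> \<le> norm (A * ((cmod (f x))\<^sup>2 + (cmod (complex_of_real (v x) * f x))\<^sup>2))"
          unfolding real_norm_def by (rule abs_ge_self)
        finally show ?thesis using wv[OF that] by simp
      qed
      then show "AE x in Mp. norm (w x * (cmod (f x))\<^sup>2) \<le> norm (A * ((cmod (f x))\<^sup>2 + (cmod (complex_of_real (v x) * f x))\<^sup>2))"
        by (rule AE_MpI)
    qed
  qed (rule m)
qed

lemma wL2_operator_weight:
  assumes "L2 f"
  shows "wL2 (\<lambda>x. (sqrt (1 + x\<^sup>2)) powr (4 * \<alpha>)) f \<longleftrightarrow> L2 (\<lambda>x. of_real (Wpot x) * f x)"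
\<comment> \<open>\<open>A\<close> is 2 powr 2, which bounds the factor 2 powr (2 \<alpha>) lost in
  1 + x^2 \<le> 2 max 1 (x^2); \<open>B\<close> is the factor of x powr (4 \<alpha>) in the square
  of \<open>Wpot\<close>.\<close>
proof (rule wL2_iff[OF assms, where A = 4 and B = "(real_of_int k) ^ 4"])
  show "continuous_on {0<..} (\<lambda>x. sqrt (1 + x\<^sup>2) powr (4 * \<alpha>))"
    by (intro continuous_intros) (auto simp: add_nonneg_eq_0_iff)
  fix x :: real assume x: "0 < x"
  have s: "sqrt (1 + x\<^sup>2) powr (4 * \<alpha>) = (1 + x\<^sup>2) powr (2 * \<alpha>)"
    by (simp add: powr_half_sqrt[symmetric] powr_powr)
  have W2: "(Wpot x)\<^sup>2 = (real_of_int k) ^ 4 * x powr (4 * \<alpha>)"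
    unfolding Wpot_def by (simp add: power_mult_distrib power2_eq_square power4_eq_xxxx flip: powr_add)
  have x4: "x powr (4 * \<alpha>) = (x\<^sup>2) powr (2 * \<alpha>)"
    using x by (simp add: powr_powr flip: powr_numeral)
  have k4: "1 \<le> (real_of_int k) ^ 4" using power_mono[OF k2, of 2] by (simp flip: power_mult)
  have le1: "x powr (4 * \<alpha>) \<le> (1 + x\<^sup>2) powr (2 * \<alpha>)"
    unfolding x4 using \<alpha> by (intro powr_mono2) auto
  have le2: "(1 + x\<^sup>2) powr (2 * \<alpha>) \<le> 4 * (1 + x powr (4 * \<alpha>))"
  proof -
    have "(1 + x\<^sup>2) powr (2 * \<alpha>) \<le> (2 * max 1 (x\<^sup>2)) powr (2 * \<alpha>)"
      using \<alpha> by (intro powr_mono2) auto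
    also have "\<dots> = 2 powr (2 * \<alpha>) * (max 1 (x\<^sup>2)) powr (2 * \<alpha>)" by (simp add: powr_mult)
    also have "\<dots> \<le> 2 powr 2 * (1 + x powr (4 * \<alpha>))"
    proof (rule mult_mono)
      show "2 powr (2 * \<alpha>) \<le> (2::real) powr 2" using \<alpha> by (intro powr_mono) auto
      show "(max 1 (x\<^sup>2)) powr (2 * \<alpha>) \<le> 1 + x powr (4 * \<alpha>)"
        unfolding x4 by (cases "1 \<le> x\<^sup>2") (auto simp: max_def)
    qed auto
    finally show ?thesis by simp
  qed
  have "4 * (1 + x powr (4 * \<alpha>)) \<le> 4 * (1 + (Wpot x)\<^sup>2)"
    unfolding W2 using mult_right_mono[OF k4, of "x powr (4 * \<alpha>)"] by simp
  then show "0 \<le> sqrt (1 + x\<^sup>2) powr (4 * \<alpha>) \<and> sqrt (1 + x\<^sup>2) powr (4 * \<alpha>) \<le> 4 * (1 + (Wpot x)\<^sup>2) \<and>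
      (Wpot x)\<^sup>2 \<le> (real_of_int k) ^ 4 * sqrt (1 + x\<^sup>2) powr (4 * \<alpha>)"
    unfolding s using le2 mult_left_mono[OF le1, of "(real_of_int k) ^ 4"] W2 by simp
qed (rule continuous_Wpot)

text \<open>Rellich's inequality survives the limit and puts f/x^2 into L2. So the potential times
  \<open>f\<close>, minus the limit \<open>g2\<close> of the second derivatives, is square
  integrable and serves as the image of \<open>f\<close>.\<close>

lemma H2_0_in_adj:
  assumes f: "f \<in> H2_0" and W: "L2 (\<lambda>x. of_real (Wpot x) * f x)"
  obtains h where "(f, h) \<in> adj (Aop \<alpha> k)"
proof -
  obtain g2 s where L: "L2 f" "L2 g2" and s: "\<And>n. s n \<in> Cc_inf" "L2conv s f" "L2conv (\<lambda>n. cderiv (cderiv (s n))) g2"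
    using f unfolding H2_0_def by blast
  have L2s: "L2 (cderiv (cderiv (s n)))" for n by (intro L2_Cc_inf Cc_inf_deriv(2) s)
  have "\<exists>M. \<forall>m\<ge>M. \<forall>n\<ge>M. L2norm (\<lambda>x. of_real (1 / x\<^sup>2) * s m x - of_real (1 / x\<^sup>2) * s n x) < e" if e: "0 < e" for e
  proof -
    obtain M where M: "\<forall>m\<ge>M. \<forall>n\<ge>M. L2norm (\<lambda>x. cderiv (cderiv (s m)) x - cderiv (cderiv (s n)) x) < e / (4/3)"
      using L2conv_Cauchy[OF s(3) L2s L(2) divide_pos_pos[OF e, of "4/3"]] by auto
    have "L2norm (\<lambda>x. of_real (1 / x\<^sup>2) * s m x - of_real (1 / x\<^sup>2) * s n x) < e" if "m \<ge> M" "n \<ge> M" for m n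
    proof -
      have "L2norm (\<lambda>x. of_real (1 / x\<^sup>2) * s m x - of_real (1 / x\<^sup>2) * s n x) \<le>
          4/3 * L2norm (\<lambda>x. cderiv (cderiv (s m)) x - cderiv (cderiv (s n)) x)"
        using rellich[OF Cc_inf_diff[OF s(1) s(1)], of m n] unfolding cderiv2_diff[OF s(1) s(1)]
        by (simp only: right_diff_distrib)
      then show ?thesis using M[rule_format, OF that] by simp
    qed
    then show ?thesis by blast
  qed
  then have x2: "L2 (\<lambda>x. of_real (1 / x\<^sup>2) * f x)"
    by (intro L2conv_mult(1)[OF s(2) L2_Cc_inf[OF s(1)] L(1) _ L2_weights(4)[OF s(1)]])
       (auto intro!: borel_measurable_Mp_continuous continuous_intros)
  have VL: "L2 (\<lambda>x. of_real (Vpot \<alpha> k x) * f x)"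
    using L2_add[OF W L2_cmult[OF x2, of "of_real cpot"]] by (simp add: Vpot_eq algebra_simps)
  have "(f, (\<lambda>x. of_real (Vpot \<alpha> k x) * f x - g2 x)) \<in> adj (Aop \<alpha> k)"
    unfolding adj_iff
  proof (intro conjI ballI L L2_diff VL)
    fix \<phi> assume \<phi>: "\<phi> \<in> Cc_inf"
    have V\<phi>: "L2 (\<lambda>x. of_real (Vpot \<alpha> k x) * \<phi> x)"
      by (intro L2_Cc_inf_mult \<phi> continuous_intros continuous_Vpot)
    have sw: "L2inner \<phi> (\<lambda>x. of_real (Vpot \<alpha> k x) * u x) = L2inner (\<lambda>x. of_real (Vpot \<alpha> k x) * \<phi> x) u" for u
      unfolding L2inner_def by (simp add: mult_ac)
    have "L2inner (tau \<alpha> k \<phi>) (s n) = L2inner (\<lambda>x. of_real (Vpot \<alpha> k x) * \<phi> x) (s n) - L2inner \<phi> (cderiv (cderiv (s n)))" for n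
    proof -
      have V: "L2 (\<lambda>x. of_real (Vpot \<alpha> k x) * s n x)" by (intro L2_Cc_inf_mult s continuous_intros continuous_Vpot)
      have "L2inner (tau \<alpha> k \<phi>) (s n) = L2inner \<phi> (tau \<alpha> k (s n))" by (rule tau_symmetric[OF \<phi> s(1)])
      also have "tau \<alpha> k (s n) = (\<lambda>x. of_real (Vpot \<alpha> k x) * s n x - cderiv (cderiv (s n)) x)"
        by (auto simp: tau_def)
      finally show ?thesis using L2inner_diff_right[OF V L2s L2_Cc_inf[OF \<phi>]] by (simp add: sw)
    qed
    then have "(\<lambda>n. L2inner (tau \<alpha> k \<phi>) (s n)) \<longlonglongrightarrow> L2inner (\<lambda>x. of_real (Vpot \<alpha> k x) * \<phi> x) f - L2inner \<phi> g2"
      using tendsto_diff[OF L2conv_inner_right[OF s(2) L2_Cc_inf[OF s(1)] L(1) V\<phi>] L2conv_inner_right[OF s(3) L2s L(2) L2_Cc_inf[OF \<phi>]]]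
      by simp
    with L2conv_inner_right[OF s(2) L2_Cc_inf[OF s(1)] L(1) L2_tau[OF \<phi>]]
    have "L2inner (tau \<alpha> k \<phi>) f = L2inner (\<lambda>x. of_real (Vpot \<alpha> k x) * \<phi> x) f - L2inner \<phi> g2"
      by (rule LIMSEQ_unique)
    then show "L2inner (tau \<alpha> k \<phi>) f = L2inner \<phi> (\<lambda>x. of_real (Vpot \<alpha> k x) * f x - g2 x)"
      using L2inner_diff_right[OF VL L(2) L2_Cc_inf[OF \<phi>]] by (simp add: sw)
  qed
  then show ?thesis by (rule that)
qed

text \<open>The inclusion from right to left constructs no approximation in the graph norm. Such an
  \<open>f\<close> lies in the domain of the adjoint, and being o(x^(3/2)) it has c = d = 0 in its
  decomposition.\<close>

lemma closure_domain:
  "opdom (opclosure (Aop \<alpha> k)) = H2_0 \<inter> {f. wL2 (\<lambda>x. (sqrt (1 + x^2)) powr (4*\<alpha>)) f}"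
proof (intro set_eqI iffI)
  fix f assume "f \<in> opdom (opclosure (Aop \<alpha> k))"
  then obtain h where f: "(f, h) \<in> opclosure (Aop \<alpha> k)" unfolding opdom_def by auto
  then have "L2 f" by (simp add: opclosure_iff)
  then show "f \<in> H2_0 \<inter> {f. wL2 (\<lambda>x. (sqrt (1 + x^2)) powr (4*\<alpha>)) f}"
    using closure_in_H2_0[OF f] wL2_operator_weight by simp
next
  fix f assume f: "f \<in> H2_0 \<inter> {f. wL2 (\<lambda>x. (sqrt (1 + x^2)) powr (4*\<alpha>)) f}"
  then have "L2 f" by (auto simp: H2_0_def)
  then have W: "L2 (\<lambda>x. of_real (Wpot x) * f x)" using f wL2_operator_weight by simp
  obtain h where "(f, h) \<in> adj (Aop \<alpha> k)" using H2_0_in_adj[OF _ W] f by blast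
  then obtain c d where D: "decomp f h c d" by (rule decomp_exists)
  have "c = 0" "d = 0" using decomp_zero[OF D asym_H2_0] f by auto
  then show "f \<in> opdom (opclosure (Aop \<alpha> k))"
    using D unfolding decomp_def opdom_def by force
qed

text \<open>The weak second derivative is the potential times \<open>g\<close> minus
  \<open>h\<close>. \<open>Dmax\<close> pairs bilinearly and \<open>adj\<close> sesquilinearly,
  hence the conjugated test functions.\<close>

lemma adj_domain_eq_Dmax: "opdom (adj (Aop \<alpha> k)) = Dmax \<alpha> k"
proof (intro set_eqI iffI)
  fix g assume "g \<in> opdom (adj (Aop \<alpha> k))"
  then obtain h where gh: "(g, h) \<in> adj (Aop \<alpha> k)" unfolding opdom_def by auto
  then have L: "L2 g" "L2 h" by (auto simp: adj_iff)
  define w where "w x = of_real (Vpot \<alpha> k x) * g x - h x" for x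
  have "locL1 (\<lambda>x. of_real (Vpot \<alpha> k x) * g x)" "locL1 (\<lambda>x. 1 * h x)"
    by (intro locL1_continuous_mult L continuous_intros continuous_Vpot)+
  then have wl: "locL1 w"
    unfolding locL1_def w_def by (auto intro!: Bochner_Integration.integrable_diff borel_measurable_diff)
  have "integral\<^sup>L Mp (\<lambda>x. g x * cderiv (cderiv \<phi>) x) = integral\<^sup>L Mp (\<lambda>x. w x * \<phi> x)" if \<phi>: "\<phi> \<in> Cc_inf" for \<phi>
  proof -
    note \<phi>2 = Cc_inf_deriv(2)[OF Cc_inf_deriv(2)[OF \<phi>]]
    have i: "integrable Mp (\<lambda>x. of_real (Vpot \<alpha> k x) * \<phi> x * g x)" "integrable Mp (\<lambda>x. cderiv (cderiv \<phi>) x * g x)"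
      "integrable Mp (\<lambda>x. \<phi> x * h x)"
      by (intro L2_integrable_mult L L2_Cc_inf_mult L2_Cc_inf \<phi> \<phi>2 continuous_intros continuous_Vpot)+
    have "L2inner (tau \<alpha> k (\<lambda>x. cnj (\<phi> x))) g = L2inner (\<lambda>x. cnj (\<phi> x)) h"
      using gh Cc_inf_cnj[OF \<phi>] by (simp add: adj_iff)
    moreover have "L2inner (tau \<alpha> k (\<lambda>x. cnj (\<phi> x))) g = integral\<^sup>L Mp (\<lambda>x. of_real (Vpot \<alpha> k x) * \<phi> x * g x - cderiv (cderiv \<phi>) x * g x)"
      unfolding tau_cnj[OF \<phi>] L2inner_def by (simp add: tau_def algebra_simps)
    ultimately have "integral\<^sup>L Mp (\<lambda>x. cderiv (cderiv \<phi>) x * g x) = integral\<^sup>L Mp (\<lambda>x. of_real (Vpot \<alpha> k x) * \<phi> x * g x - \<phi> x * h x)"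
      using i by (simp add: L2inner_def)
    then show ?thesis by (simp add: w_def algebra_simps)
  qed
  moreover have "L2 (\<lambda>x. - w x + complex_of_real (Vpot \<alpha> k x) * g x)" using L by (simp add: w_def)
  ultimately show "g \<in> Dmax \<alpha> k" unfolding Dmax_def using L wl by blast
next
  fix g assume "g \<in> Dmax \<alpha> k"
  then obtain w where L: "L2 g" and w: "\<And>\<phi>. \<phi> \<in> Cc_inf \<Longrightarrow> integral\<^sup>L Mp (\<lambda>x. g x * cderiv (cderiv \<phi>) x) = integral\<^sup>L Mp (\<lambda>x. w x * \<phi> x)"
    "L2 (\<lambda>x. - w x + complex_of_real (Vpot \<alpha> k x) * g x)"
    unfolding Dmax_def by blast
  define h where "h x = - w x + complex_of_real (Vpot \<alpha> k x) * g x" for x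
  have h: "L2 h" using w(2) by (simp add: h_def[abs_def])
  have "L2inner (tau \<alpha> k \<psi>) g = L2inner \<psi> h" if \<psi>: "\<psi> \<in> Cc_inf" for \<psi>
  proof -
    define \<phi> where "\<phi> = (\<lambda>x. cnj (\<psi> x))"
    have \<phi>: "\<phi> \<in> Cc_inf" unfolding \<phi>_def by (rule Cc_inf_cnj[OF \<psi>])
    have \<psi>_eq: "\<psi> = (\<lambda>x. cnj (\<phi> x))" by (simp add: \<phi>_def)
    note \<phi>2 = Cc_inf_deriv(2)[OF Cc_inf_deriv(2)[OF \<phi>]]
    have i: "integrable Mp (\<lambda>x. of_real (Vpot \<alpha> k x) * \<phi> x * g x)" "integrable Mp (\<lambda>x. cderiv (cderiv \<phi>) x * g x)"
      "integrable Mp (\<lambda>x. \<phi> x * h x)"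
      by (intro L2_integrable_mult L h L2_Cc_inf_mult L2_Cc_inf \<phi> \<phi>2 continuous_intros continuous_Vpot)+
    have "L2inner (tau \<alpha> k \<psi>) g = integral\<^sup>L Mp (\<lambda>x. of_real (Vpot \<alpha> k x) * \<phi> x * g x - cderiv (cderiv \<phi>) x * g x)"
      unfolding \<psi>_eq tau_cnj[OF \<phi>] L2inner_def by (simp add: tau_def algebra_simps)
    also have "\<dots> = integral\<^sup>L Mp (\<lambda>x. of_real (Vpot \<alpha> k x) * \<phi> x * g x) - integral\<^sup>L Mp (\<lambda>x. w x * \<phi> x)"
      using i w(1)[OF \<phi>] by (simp add: mult.commute)
    also have "(\<lambda>x. w x * \<phi> x) = (\<lambda>x. of_real (Vpot \<alpha> k x) * \<phi> x * g x - \<phi> x * h x)"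
      by (auto simp: h_def algebra_simps)
    finally show ?thesis using i by (simp add: L2inner_def \<psi>_eq)
  qed
  then have "(g, h) \<in> adj (Aop \<alpha> k)" unfolding adj_iff using L h by blast
  then show "g \<in> opdom (adj (Aop \<alpha> k))" unfolding opdom_def by force
qed

end

section \<open>The form and the Friedrichs extension\<close>

text \<open>Density of the test functions in L2; real test functions already detect the real and the
  imaginary part separately.\<close>

lemma AE_zero_if_orthogonal_Cc_inf:
  assumes u: "L2 u" and z: "\<And>\<phi>. \<phi> \<in> Cc_inf \<Longrightarrow> L2inner \<phi> u = 0"
  shows "AE x in Mp. u x = 0"
proof -
  have "locL1 (\<lambda>x. 1 * u x)" by (rule locL1_continuous_mult[OF u continuous_on_const])
  then have l: "integrable (lebesgue_on {a..b}) u" if "0 < a" for a b using that by (simp add: locL1_def)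
  have m: "u \<in> borel_measurable Mp" by (rule L2_measurable[OF u])
  have 0: "integral\<^sup>L Mp (\<lambda>x. of_real (w x) * u x) = 0" "integrable Mp (\<lambda>x. of_real (w x) * u x)" if w: "test_fun w" for w
    using z[OF Cc_inf_of_real[OF w]] L2_integrable_mult[OF L2_Cc_inf[OF Cc_inf_of_real[OF w]] u] by (simp_all add: L2inner_def)
  have "AE x in Mp. Re (u x) = 0"
  proof (rule AE_zero_if_test_integrals_zero)
    show "integral\<^sup>L Mp (\<lambda>x. Re (u x) * w x) = 0" if w: "test_fun w" for w
      using integral_Re[OF 0(2)[OF w]] 0(1)[OF w] by (simp add: mult.commute)
  qed (use m l in auto)
  moreover have "AE x in Mp. Im (u x) = 0"
  proof (rule AE_zero_if_test_integrals_zero)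
    show "integral\<^sup>L Mp (\<lambda>x. Im (u x) * w x) = 0" if w: "test_fun w" for w
      using integral_Im[OF 0(2)[OF w]] 0(1)[OF w] by (simp add: mult.commute)
  qed (use m l in auto)
  ultimately show ?thesis by eventually_elim (simp add: complex_eq_iff)
qed

lemma L2inner_by_parts:
  assumes \<phi>: "\<phi> \<in> Cc_inf" and \<psi>: "\<psi> \<in> Cc_inf"
  shows "L2inner \<phi> (cderiv \<psi>) = - L2inner (cderiv \<phi>) \<psi>"
proof -
  obtain a b where a: "0 < a" and b: "\<And>x. x \<notin> {a..b} \<Longrightarrow> \<psi> x = 0" using Cc_inf_support[OF \<psi>] by metis
  obtain a' b' where a': "0 < a'" and b': "\<And>x. x \<notin> {a'..b'} \<Longrightarrow> \<phi> x = 0" using Cc_inf_support[OF \<phi>] by metis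
  obtain a'' b'' where a'': "0 < a''" and b'': "\<And>x. x \<notin> {a''..b''} \<Longrightarrow> cderiv \<phi> x = 0"
    using Cc_inf_support[OF Cc_inf_deriv(2)[OF \<phi>]] by metis
  have z: "integral\<^sup>L Mp (\<lambda>x. cnj (\<phi> x) * cderiv \<psi> x + cnj (cderiv \<phi> x) * \<psi> x) = 0"
  proof (rule integral_Mp_derivative_eq_0[where H = "\<lambda>x. cnj (\<phi> x) * \<psi> x" and a = "min a' a''" and b = "max b' b''"])
    show "((\<lambda>x. cnj (\<phi> x) * \<psi> x) has_vector_derivative cnj (\<phi> x) * cderiv \<psi> x + cnj (cderiv \<phi> x) * \<psi> x) (at x)" for x
      by (rule has_vector_derivative_mult[OF has_vector_derivative_cnj[OF Cc_inf_deriv(1)[OF \<phi>]] Cc_inf_deriv(1)[OF \<psi>]])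
    show "continuous_on {0<..} (\<lambda>x. cnj (\<phi> x) * cderiv \<psi> x + cnj (cderiv \<phi> x) * \<psi> x)"
      by (intro continuous_intros Cc_inf_continuous Cc_inf_deriv \<phi> \<psi>)
    fix x assume "x \<notin> {min a' a''..max b' b''}"
    then have x: "x \<notin> {a'..b'}" "x \<notin> {a''..b''}" by auto
    show "cnj (\<phi> x) * cderiv \<psi> x + cnj (cderiv \<phi> x) * \<psi> x = 0" "cnj (\<phi> x) * \<psi> x = 0"
      using b'[OF x(1)] b''[OF x(2)] by simp_all
  qed (use a' a'' in auto)
  have "integral\<^sup>L Mp (\<lambda>x. cnj (\<phi> x) * cderiv \<psi> x + cnj (cderiv \<phi> x) * \<psi> x) = L2inner \<phi> (cderiv \<psi>) + L2inner (cderiv \<phi>) \<psi>"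
    unfolding L2inner_def
    by (intro Bochner_Integration.integral_add L2_integrable_inner L2_Cc_inf Cc_inf_deriv \<phi> \<psi>)
  with z show ?thesis by (simp add: eq_neg_iff_add_eq_0)
qed

context half_line_operator
begin

text \<open>The square root of the whole potential as a multiplication operator; with it the form is
  the sum of the squared norms of the derivative and of \<open>rV u\<close>.\<close>

definition rV :: "(real \<Rightarrow> complex) \<Rightarrow> real \<Rightarrow> complex" where
  "rV u x = of_real (sqrt (Vpot \<alpha> k x)) * u x"

lemma Vpot_nonneg: "0 \<le> Vpot \<alpha> k x"
  unfolding Vpot_eq using Wpot_nonneg cpot by simp

lemma continuous_rV: "continuous_on {0<..} (\<lambda>x. complex_of_real (sqrt (Vpot \<alpha> k x)))"
  by (intro continuous_intros continuous_Vpot)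

lemma L2_rV: "\<phi> \<in> Cc_inf \<Longrightarrow> L2 (rV \<phi>)"
  unfolding rV_def[abs_def] by (rule L2_Cc_inf_mult[OF _ continuous_rV])

lemma rV_inner: "L2inner (rV u) (rV v) = L2inner u (\<lambda>x. of_real (Vpot \<alpha> k x) * v x)"
proof -
  have "cnj (rV u x) * rV v x = cnj (u x) * (of_real (Vpot \<alpha> k x) * v x)" for x
  proof -
    have "complex_of_real (sqrt (Vpot \<alpha> k x)) * complex_of_real (sqrt (Vpot \<alpha> k x)) = of_real (Vpot \<alpha> k x)"
      using Vpot_nonneg[of x] by (simp flip: of_real_mult)
    then show ?thesis unfolding rV_def by (simp add: mult_ac)
  qed
  then show ?thesis by (simp add: L2inner_def)
qed

lemma rV_inner': "L2inner (rV u) (rV v) = L2inner (\<lambda>x. of_real (Vpot \<alpha> k x) * u x) v"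
  unfolding rV_inner by (simp add: L2inner_def mult_ac)

lemma form_identity:
  assumes \<phi>: "\<phi> \<in> Cc_inf" and \<psi>: "\<psi> \<in> Cc_inf"
  shows "L2inner \<phi> (tau \<alpha> k \<psi>) = L2inner (cderiv \<phi>) (cderiv \<psi>) + L2inner (rV \<phi>) (rV \<psi>)"
proof -
  have t: "tau \<alpha> k \<psi> = (\<lambda>x. of_real (Vpot \<alpha> k x) * \<psi> x - cderiv (cderiv \<psi>) x)" by (auto simp: tau_def)
  have "L2inner \<phi> (tau \<alpha> k \<psi>) = L2inner \<phi> (\<lambda>x. of_real (Vpot \<alpha> k x) * \<psi> x) - L2inner \<phi> (cderiv (cderiv \<psi>))"
    unfolding t
    by (intro L2inner_diff_right L2_Cc_inf_mult L2_Cc_inf Cc_inf_deriv \<phi> \<psi> continuous_intros continuous_Vpot)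
  then show ?thesis unfolding rV_inner L2inner_by_parts[OF \<phi> Cc_inf_deriv(2)[OF \<psi>]] by simp
qed

lemma form_norm:
  assumes \<phi>: "\<phi> \<in> Cc_inf"
  shows "Re (L2inner \<phi> (tau \<alpha> k \<phi>)) = (L2norm (cderiv \<phi>))\<^sup>2 + (L2norm (rV \<phi>))\<^sup>2"
  unfolding form_identity[OF \<phi> \<phi>] L2inner_self by simp

lemma form_Cauchy_dominated:
  assumes f: "form_approx \<alpha> k f t"
    and le: "\<And>\<phi>. \<phi> \<in> Cc_inf \<Longrightarrow> (L2norm (P \<phi>))\<^sup>2 \<le> Re (L2inner \<phi> (tau \<alpha> k \<phi>))"
    and P: "\<And>\<phi> \<psi>. \<phi> \<in> Cc_inf \<Longrightarrow> \<psi> \<in> Cc_inf \<Longrightarrow> P (\<lambda>x. \<phi> x - \<psi> x) = (\<lambda>x. P \<phi> x - P \<psi> x)"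
    and e: "0 < (e::real)"
  shows "\<exists>M. \<forall>m\<ge>M. \<forall>n\<ge>M. L2norm (\<lambda>x. P (t m) x - P (t n) x) < e"
proof -
  have t: "t n \<in> Cc_inf" for n using f by (auto simp: form_approx_def)
  obtain M where M: "\<forall>m\<ge>M. \<forall>n\<ge>M. Re (L2inner (\<lambda>x. t m x - t n x) (tau \<alpha> k (\<lambda>x. t m x - t n x))) < e\<^sup>2"
    using f zero_less_power[OF e, of 2] unfolding form_approx_def by blast
  have "L2norm (\<lambda>x. P (t m) x - P (t n) x) < e" if "m \<ge> M" "n \<ge> M" for m n
  proof (rule power2_less_imp_less)
    show "(L2norm (\<lambda>x. P (t m) x - P (t n) x))\<^sup>2 < e\<^sup>2"
      unfolding P[OF t t, symmetric]
      by (rule le_less_trans[OF le[OF Cc_inf_diff[OF t t]]]) (use M[rule_format, OF that] in simp)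
  qed (use e in simp)
  then show ?thesis by blast
qed

text \<open>Convergence in the form means convergence of the derivatives and of the potential terms.
  The last clause identifies \<open>f1\<close> as the weak derivative of \<open>f\<close>, so up to
  null sets it depends on \<open>f\<close> and not on the sequence \<open>t\<close>.\<close>

lemma form_approxE:
  assumes f: "form_approx \<alpha> k f t"
  obtains f1 where "L2 f1" "L2conv (\<lambda>n. cderiv (t n)) f1" "L2 (rV f)" "L2conv (\<lambda>n. rV (t n)) (rV f)"
    "\<forall>\<phi>\<in>Cc_inf. L2inner \<phi> f1 = - L2inner (cderiv \<phi>) f"
proof -
  have t: "\<And>n. t n \<in> Cc_inf" "L2conv t f" "L2 f" using f by (auto simp: form_approx_def)
  have L1: "L2 (cderiv (t n))" for n by (intro L2_Cc_inf Cc_inf_deriv t)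
  have le1: "(L2norm (cderiv \<phi>))\<^sup>2 \<le> Re (L2inner \<phi> (tau \<alpha> k \<phi>))" "(L2norm (rV \<phi>))\<^sup>2 \<le> Re (L2inner \<phi> (tau \<alpha> k \<phi>))"
    if "\<phi> \<in> Cc_inf" for \<phi> unfolding form_norm[OF that] by simp_all
  have "\<exists>M. \<forall>m\<ge>M. \<forall>n\<ge>M. L2norm (\<lambda>x. cderiv (t m) x - cderiv (t n) x) < e" if "0 < e" for e
    by (rule form_Cauchy_dominated[OF f le1(1) cderiv_diff that])
  then obtain f1 where f1: "L2 f1" "L2conv (\<lambda>n. cderiv (t n)) f1"
    using L2_Cauchy_complete[of "\<lambda>n. cderiv (t n)", OF L1] by metis
  have c: "\<exists>M. \<forall>m\<ge>M. \<forall>n\<ge>M. L2norm (\<lambda>x. of_real (sqrt (Vpot \<alpha> k x)) * t m x - of_real (sqrt (Vpot \<alpha> k x)) * t n x) < e"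
    if "0 < e" for e
    using form_Cauchy_dominated[OF f le1(2) _ that] unfolding rV_def[abs_def] by (simp add: right_diff_distrib)
  have m: "(\<lambda>x. complex_of_real (sqrt (Vpot \<alpha> k x))) \<in> borel_measurable Mp"
    by (rule borel_measurable_Mp_continuous[OF continuous_rV])
  note r = L2conv_mult[OF t(2) L2_Cc_inf[OF t(1)] t(3) m L2_rV[OF t(1), unfolded rV_def[abs_def]] c]
  show ?thesis
  proof (rule that[OF f1])
    show "L2 (rV f)" "L2conv (\<lambda>n. rV (t n)) (rV f)" using r unfolding rV_def[abs_def] by simp_all
    show "\<forall>\<phi>\<in>Cc_inf. L2inner \<phi> f1 = - L2inner (cderiv \<phi>) f"
    proof
      fix \<phi> assume \<phi>: "\<phi> \<in> Cc_inf"
      have "(\<lambda>n. L2inner \<phi> (cderiv (t n))) \<longlonglongrightarrow> L2inner \<phi> f1"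
        by (rule L2conv_inner_right[OF f1(2) L1 f1(1) L2_Cc_inf[OF \<phi>]])
      moreover have "(\<lambda>n. L2inner \<phi> (cderiv (t n))) \<longlonglongrightarrow> - L2inner (cderiv \<phi>) f"
        unfolding L2inner_by_parts[OF \<phi> t(1)]
        by (intro tendsto_minus L2conv_inner_right[OF t(2) L2_Cc_inf[OF t(1)] t(3) L2_Cc_inf[OF Cc_inf_deriv(2)[OF \<phi>]]])
      ultimately show "L2inner \<phi> f1 = - L2inner (cderiv \<phi>) f" by (rule LIMSEQ_unique)
    qed
  qed
qed

lemma AE_eq_if_L2inner_Cc_inf_eq:
  assumes "L2 f1" "L2 f2" "\<And>\<phi>. \<phi> \<in> Cc_inf \<Longrightarrow> L2inner \<phi> f1 = L2inner \<phi> f2"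
  shows "AE x in Mp. f1 x = f2 x"
proof -
  have "AE x in Mp. f1 x - f2 x = 0"
    by (rule AE_zero_if_orthogonal_Cc_inf)
       (use assms in \<open>simp_all add: L2_diff L2inner_diff_right L2_Cc_inf\<close>)
  then show ?thesis by simp
qed

lemma form_limit:
  assumes g: "form_approx \<alpha> k g s" and s: "L2 g1" "L2conv (\<lambda>n. cderiv (s n)) g1" "L2 (rV g)" "L2conv (\<lambda>n. rV (s n)) (rV g)"
    and f: "form_approx \<alpha> k f t" and t: "L2 f1" "L2conv (\<lambda>n. cderiv (t n)) f1" "L2 (rV f)" "L2conv (\<lambda>n. rV (t n)) (rV f)"
  shows "(\<lambda>n. L2inner (s n) (tau \<alpha> k (t n))) \<longlonglongrightarrow> L2inner g1 f1 + L2inner (rV g) (rV f)"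
proof -
  have c: "s n \<in> Cc_inf" "t n \<in> Cc_inf" for n using f g by (auto simp: form_approx_def)
  have L: "L2 (cderiv (s n))" "L2 (cderiv (t n))" for n by (intro L2_Cc_inf Cc_inf_deriv c)+
  show ?thesis
    unfolding form_identity[OF c]
    by (intro tendsto_add L2conv_inner s t L L2_rV c)
qed

lemma form_approx_const: "\<phi> \<in> Cc_inf \<Longrightarrow> form_approx \<alpha> k \<phi> (\<lambda>n. \<phi>)"
proof -
  assume \<phi>: "\<phi> \<in> Cc_inf"
  have z: "Re (L2inner (\<lambda>x. 0) (tau \<alpha> k (\<lambda>x. 0))) = 0" by (simp add: L2inner_def)
  show ?thesis unfolding form_approx_def using \<phi> by (simp add: z L2_Cc_inf L2conv_const)
qed

lemma form_approx_AE:
  assumes "form_approx \<alpha> k f t" "AE x in Mp. f x = g x"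
  shows "form_approx \<alpha> k g t"
proof -
  have t: "\<And>n. t n \<in> Cc_inf" "L2conv t f" "L2 f" using assms by (auto simp: form_approx_def)
  have "L2conv t g" by (rule L2conv_cong_AE[OF t(2) L2_Cc_inf[OF t(1)] t(3) assms(2)])
  moreover have "L2 g" by (rule L2_cong_AE[OF t(3) assms(2)])
  ultimately show ?thesis using assms(1) unfolding form_approx_def by simp
qed

lemma H1_0_Dxinv:
  assumes "f \<in> H1_0"
  shows "f \<in> Dxinv"
proof -
  obtain f1 s where f: "L2 f" and f1: "L2 f1" and s: "\<And>n. s n \<in> Cc_inf" "L2conv s f" "L2conv (\<lambda>n. cderiv (s n)) f1"
    using assms unfolding H1_0_def by blast
  have L1: "L2 (cderiv (s n))" for n by (intro L2_Cc_inf Cc_inf_deriv s)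
  have "\<exists>M. \<forall>m\<ge>M. \<forall>n\<ge>M. L2norm (\<lambda>x. of_real (1 / x) * s m x - of_real (1 / x) * s n x) < e" if e: "0 < e" for e
  proof -
    obtain M where M: "\<forall>m\<ge>M. \<forall>n\<ge>M. L2norm (\<lambda>x. cderiv (s m) x - cderiv (s n) x) < e / 2"
      using L2conv_Cauchy[OF s(3) L1 f1 divide_pos_pos[OF e zero_less_numeral]] by blast
    have "L2norm (\<lambda>x. of_real (1 / x) * s m x - of_real (1 / x) * s n x) < e" if "m \<ge> M" "n \<ge> M" for m n
    proof -
      have "L2norm (\<lambda>x. of_real (1 / x) * s m x - of_real (1 / x) * s n x) \<le> 2 * L2norm (\<lambda>x. cderiv (s m) x - cderiv (s n) x)"
        using hardy[OF Cc_inf_diff[OF s(1) s(1)], of m n] unfolding cderiv_diff[OF s(1) s(1)]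
        by (simp only: right_diff_distrib)
      then show ?thesis using M[rule_format, OF that] by simp
    qed
    then show ?thesis by blast
  qed
  then have "L2 (\<lambda>x. of_real (1 / x) * f x)"
    by (intro L2conv_mult(1)[OF s(2) L2_Cc_inf[OF s(1)] f _ L2_weights(2)[OF s(1)]])
       (auto intro!: borel_measurable_Mp_continuous continuous_intros)
  then show ?thesis using f by (simp add: Dxinv_def)
qed

lemma form_approx_H1_0: "form_approx \<alpha> k f t \<Longrightarrow> f \<in> H1_0"
proof -
  assume f: "form_approx \<alpha> k f t"
  then have t: "\<And>n. t n \<in> Cc_inf" "L2conv t f" "L2 f" by (auto simp: form_approx_def)
  obtain f1 where f1: "L2 f1" "L2conv (\<lambda>n. cderiv (t n)) f1" using form_approxE[OF f] by metis
  show ?thesis unfolding H1_0_def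
    by (intro CollectI conjI exI[of _ f1] exI[of _ t] allI f1 t)
qed

text \<open>If f/x is square integrable, the inverse-square part of the potential costs nothing, as
  its coefficient is below 1; only the growing part decides.\<close>

lemma rV_L2_iff:
  assumes f: "f \<in> Dxinv"
  shows "L2 (rV f) \<longleftrightarrow> L2 (\<lambda>x. of_real (sqrt (Wpot x)) * f x)"
proof
  have fm: "f \<in> borel_measurable Mp" using f by (auto simp: Dxinv_def dest: L2_measurable)
  have wm: "(\<lambda>x. complex_of_real (sqrt (Wpot x)) * f x) \<in> borel_measurable Mp" "rV f \<in> borel_measurable Mp"
    unfolding rV_def[abs_def]
    by (intro borel_measurable_times fm borel_measurable_Mp_continuous continuous_intros continuous_Wpot continuous_Vpot)+
  have x: "L2 (\<lambda>x. of_real (1 / x) * f x)" using f by (simp add: Dxinv_def)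
  {
    assume "L2 (rV f)"
    then show "L2 (\<lambda>x. of_real (sqrt (Wpot x)) * f x)"
    proof (rule L2_bound[OF _ wm(1), where C = 1])
      fix x :: real assume "0 < x"
      have "sqrt (Wpot x) \<le> sqrt (Vpot \<alpha> k x)" unfolding Vpot_eq using cpot by simp
      then show "cmod (of_real (sqrt (Wpot x)) * f x) \<le> 1 * cmod (rV f x)"
        unfolding rV_def using Wpot_nonneg[of x] Vpot_nonneg[of x] by (simp add: norm_mult mult_right_mono)
    qed
  next
    assume w: "L2 (\<lambda>x. of_real (sqrt (Wpot x)) * f x)"
    let ?b = "\<lambda>x. complex_of_real (cmod (of_real (sqrt (Wpot x)) * f x) + cmod (of_real (1 / x) * f x))"
    have abs: "L2 (\<lambda>x. complex_of_real (cmod (u x)))" if "L2 u" for u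
    proof (rule L2_bound[OF that, where C = 1])
      show "(\<lambda>x. complex_of_real (cmod (u x))) \<in> borel_measurable Mp" using L2_measurable[OF that] by measurable
    qed simp
    have "L2 ?b" unfolding of_real_add by (intro L2_add abs w x)
    then show "L2 (rV f)"
    proof (rule L2_bound[OF _ wm(2), where C = 1])
      fix x :: real assume x: "0 < x"
      have "sqrt (Vpot \<alpha> k x) \<le> sqrt (Wpot x) + sqrt (cpot / x\<^sup>2)"
        unfolding Vpot_eq by (rule sqrt_add_le_add_sqrt) (use Wpot_nonneg cpot in auto)
      also have "sqrt (cpot / x\<^sup>2) \<le> 1 / x"
        using x cpot by (simp add: real_sqrt_divide divide_right_mono)
      finally have "sqrt (Vpot \<alpha> k x) * cmod (f x) \<le> (sqrt (Wpot x) + 1 / x) * cmod (f x)"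
        by (intro mult_right_mono) auto
      then show "cmod (rV f x) \<le> 1 * cmod (?b x)"
        unfolding rV_def using Wpot_nonneg[of x] Vpot_nonneg[of x] x
        by (simp add: norm_mult norm_divide algebra_simps del: of_real_add)
    qed
  }
qed

text \<open>Beyond 1 division by x only helps. On (0, 1] the quotient is bounded, and the factor exp
  \<beta> in \<open>K\<close> compensates for the smallest value there of exp (- \<beta> T), a
  majorant that is square integrable on the whole half line.\<close>

lemma Psi_Dxinv: "L2 (\<lambda>x. of_real (1 / x) * Psi \<alpha> k x)"
proof -
  define K where "K = (CPhi + CF * \<beta> * exp \<beta> * N) * exp \<beta>"
  have K: "0 \<le> K" using CPhi CF \<beta> N_pos by (simp add: K_def)
  let ?b = "\<lambda>x. complex_of_real (\<bar>PsiF \<alpha> k x\<bar>) + of_real K * complex_of_real (x powr 0 * exp (- \<beta> * x powr (1 + \<alpha>)))"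
  have "L2 (\<lambda>x. complex_of_real (\<bar>PsiF \<alpha> k x\<bar>))"
    by (rule L2_bound[OF L2_Psi, where C = 1])
       (auto intro!: borel_measurable_Mp_continuous continuous_intros continuous_PsiF)
  then have b: "L2 ?b" using \<beta> by (intro L2_add L2_cmult L2_powr_exp_T) auto
  show ?thesis
  proof (rule L2_bound[OF b, where C = 1])
    show "(\<lambda>x. complex_of_real (1 / x) * Psi \<alpha> k x) \<in> borel_measurable Mp"
      by (intro borel_measurable_Mp_continuous continuous_intros continuous_PsiF) auto
    fix x :: real assume x: "0 < x"
    have nb: "cmod (?b x) = \<bar>PsiF \<alpha> k x\<bar> + K * exp (- \<beta> * x powr (1 + \<alpha>))"
    proof -
      have "?b x = complex_of_real (\<bar>PsiF \<alpha> k x\<bar> + K * exp (- \<beta> * x powr (1 + \<alpha>)))" using x by simp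
      then show ?thesis using K by (simp only: norm_of_real) simp
    qed
    have n: "cmod (complex_of_real (1 / x) * Psi \<alpha> k x) = \<bar>PsiF \<alpha> k x\<bar> / x"
      using x by (simp add: norm_mult norm_divide)
    show "cmod (complex_of_real (1 / x) * Psi \<alpha> k x) \<le> 1 * cmod (?b x)"
    proof (cases "1 \<le> x")
      case True
      then have "\<bar>PsiF \<alpha> k x\<bar> / x \<le> \<bar>PsiF \<alpha> k x\<bar>" by (simp add: divide_le_eq mult_le_cancel_left1)
      moreover have "0 \<le> K * exp (- \<beta> * x powr (1 + \<alpha>))" using K by simp
      ultimately show ?thesis unfolding n nb by simp
    next
      case False
      then have x1: "x \<le> 1" by simp
      have P: "PhiF \<alpha> k x * I1 x \<le> CPhi * x"
      proof -
        have "PhiF \<alpha> k x \<le> CPhi * x powr (- \<alpha>/2) * 1"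
          unfolding PhiF_eq using CPhi \<beta> by (intro mult_left_mono) auto
        then have "PhiF \<alpha> k x * I1 x \<le> (CPhi * x powr (- \<alpha>/2)) * x\<^sup>2"
          using I1_bound[OF x] PhiF_pos[OF x] CPhi by (intro mult_mono) auto
        also have "\<dots> = CPhi * x powr (2 - \<alpha>/2)"
          using x powr_add[of x "- \<alpha> / 2" 2] by (simp add: powr_numeral)
        also have "\<dots> \<le> CPhi * x powr 1"
          using x x1 \<alpha> CPhi by (intro mult_left_mono powr_mono') auto
        finally show ?thesis using x by simp
      qed
      have F: "FF \<alpha> k x * I2 x \<le> CF * \<beta> * exp \<beta> * N * x"
      proof -
        have "I2 x \<le> N" using I2_eq[of x] J_bound(1)[OF x] x by simp
        moreover have "0 \<le> I2 x" using I2_bound x by metis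
        moreover have "FF \<alpha> k x \<le> CF * \<beta> * exp \<beta> * x"
        proof -
          have "x powr (1 + \<alpha>/2) \<le> x powr 1" using x x1 \<alpha> by (intro powr_mono') auto
          then have "CF * \<beta> * exp \<beta> * x powr (1 + \<alpha>/2) \<le> CF * \<beta> * exp \<beta> * x powr 1"
            using CF \<beta> by (intro mult_left_mono) auto
          then show ?thesis using FF_le[OF x x1] x by simp
        qed
        ultimately have "FF \<alpha> k x * I2 x \<le> (CF * \<beta> * exp \<beta> * x) * N"
          using CF \<beta> x by (intro mult_mono) auto
        then show ?thesis by (simp add: mult_ac)
      qed
      have p: "0 \<le> PhiF \<alpha> k x * I1 x" "0 \<le> FF \<alpha> k x * I2 x"
        using PhiF_pos[OF x] I1_bound[OF x] FF_nonneg[OF x] I2_bound x by (auto intro!: mult_nonneg_nonneg)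
      have "\<bar>PsiF \<alpha> k x\<bar> = (PhiF \<alpha> k x * I1 x + FF \<alpha> k x * I2 x) / (1 + \<alpha>)" unfolding PsiF_eq using p \<alpha> by simp
      also have "\<dots> \<le> PhiF \<alpha> k x * I1 x + FF \<alpha> k x * I2 x"
        using p \<alpha> by (simp add: divide_le_eq mult_le_cancel_left1)
      also have "\<dots> \<le> (CPhi + CF * \<beta> * exp \<beta> * N) * x" using P F by (simp add: algebra_simps)
      finally have "\<bar>PsiF \<alpha> k x\<bar> / x \<le> CPhi + CF * \<beta> * exp \<beta> * N" using x by (simp add: divide_le_eq)
      also have "\<dots> = K * exp (- \<beta>)" by (simp add: K_def mult.assoc flip: exp_add)
      also have "\<dots> \<le> K * exp (- \<beta> * x powr (1 + \<alpha>))" using K exp_T_ge[OF x x1] by (intro mult_left_mono)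
      finally show ?thesis unfolding n nb by simp
    qed
  qed
qed

text \<open>The closure part (by Hardy) and \<Psi> both lie in \<open>Dxinv\<close>, so a nonzero
  \<open>d\<close> would force \<Phi> into it.\<close>

lemma decomp_Dxinv:
  assumes D: "decomp g h c d" and g: "g \<in> Dxinv"
  shows "d = 0"
proof (rule ccontr)
  assume d: "d \<noteq> 0"
  obtain f hf where f: "(f, hf) \<in> opclosure (Aop \<alpha> k)" "g = (\<lambda>x. f x + c * Psi \<alpha> k x + d * Phi \<alpha> k x)"
    using D unfolding decomp_def by blast
  have "f \<in> H1_0" using closure_in_H2_0(1)[OF f(1)] unfolding H2_0_def H1_0_def by blast
  from H1_0_Dxinv[OF this] have 1: "L2 (\<lambda>x. of_real (1 / x) * f x)" by (simp add: Dxinv_def)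
  have 2: "L2 (\<lambda>x. of_real (1 / x) * g x)" using g by (simp add: Dxinv_def)
  have "L2 (\<lambda>x. (1 / d) * (of_real (1 / x) * g x - of_real (1 / x) * f x - c * (of_real (1 / x) * Psi \<alpha> k x)))"
    by (intro L2_cmult L2_diff 1 2 Psi_Dxinv)
  also have "(\<lambda>x. (1 / d) * (of_real (1 / x) * g x - of_real (1 / x) * f x - c * (of_real (1 / x) * Psi \<alpha> k x))) =
      (\<lambda>x. Phi \<alpha> k x / of_real x)"
  proof
    fix x
    show "(1 / d) * (of_real (1 / x) * g x - of_real (1 / x) * f x - c * (of_real (1 / x) * Psi \<alpha> k x)) = Phi \<alpha> k x / of_real x"
      unfolding f(2) using d by (cases "x = 0") (simp_all add: field_simps)
  qed
  finally show False using Phi_not_Dxinv by simp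
qed

section \<open>Range and form domain of the Friedrichs extension\<close>

lemma Friedrichs_adj:
  assumes "(f, h) \<in> Friedrichs \<alpha> k"
  shows "(f, h) \<in> adj (Aop \<alpha> k)" "f \<in> Dxinv"
proof -
  obtain t where t: "form_approx \<alpha> k f t" using assms unfolding Friedrichs_def form_dom_def by blast
  then have c: "\<And>n. t n \<in> Cc_inf" "L2conv t f" "L2 f" by (auto simp: form_approx_def)
  have h: "L2 h" "\<And>g s. form_approx \<alpha> k g s \<Longrightarrow> (\<lambda>n. L2inner (s n) (tau \<alpha> k (t n))) \<longlonglongrightarrow> L2inner g h"
    using assms t unfolding Friedrichs_def by blast+
  show "(f, h) \<in> adj (Aop \<alpha> k)"
    unfolding adj_iff
  proof (intro conjI ballI c h)
    fix \<phi> assume \<phi>: "\<phi> \<in> Cc_inf"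
    have "(\<lambda>n. L2inner (tau \<alpha> k \<phi>) (t n)) \<longlonglongrightarrow> L2inner \<phi> h"
      unfolding tau_symmetric[OF \<phi> c(1)] by (rule h(2)[OF form_approx_const[OF \<phi>]])
    with L2conv_inner_right[OF c(2) L2_Cc_inf[OF c(1)] c(3) L2_tau[OF \<phi>]]
    show "L2inner (tau \<alpha> k \<phi>) f = L2inner \<phi> h" by (rule LIMSEQ_unique)
  qed
  show "f \<in> Dxinv" by (rule H1_0_Dxinv[OF form_approx_H1_0[OF t]])
qed

text \<open>By coercivity, pairing with \<open>h\<close> is bounded in the form norm, and Riesz
  provides the weak solution \<open>p\<close>. It remains to pass from test functions to all
  approximating sequences in the definition of \<open>Friedrichs\<close>.\<close>

lemma Friedrichs_surjective:
  assumes h: "L2 h"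
  obtains p where "(p, h) \<in> Friedrichs \<alpha> k"
proof -
  have l: "(cmod (L2inner \<phi> h))\<^sup>2 \<le> (4 * (L2norm h)\<^sup>2) * Re (L2inner \<phi> (tau \<alpha> k \<phi>))" if \<phi>: "\<phi> \<in> Cc_inf" for \<phi>
  proof -
    have "(cmod (L2inner \<phi> h))\<^sup>2 \<le> (L2norm \<phi> * L2norm h)\<^sup>2"
      by (rule power_mono[OF cmod_L2inner_le[OF L2_Cc_inf[OF \<phi>] h]]) simp
    also have "\<dots> = (L2norm h)\<^sup>2 * (L2norm \<phi>)\<^sup>2" by (simp add: power_mult_distrib)
    also have "\<dots> \<le> (L2norm h)\<^sup>2 * (4 * Re (L2inner \<phi> (tau \<alpha> k \<phi>)))"
      by (rule mult_left_mono[OF form_coercive[OF \<phi>]]) simp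
    finally show ?thesis by simp
  qed
  have la: "L2inner (\<lambda>x. \<phi> x + z * \<psi> x) h = L2inner \<phi> h + cnj z * L2inner \<psi> h" if "\<phi> \<in> Cc_inf" "\<psi> \<in> Cc_inf" for \<phi> \<psi> z
    using that h by (simp add: L2inner_add_left L2_Cc_inf L2_cmult L2inner_cmult_left)
  have "\<exists>t p. form_approx \<alpha> k p t \<and> (\<forall>\<phi>\<in>Cc_inf. (\<lambda>n. L2inner \<phi> (tau \<alpha> k (t n))) \<longlonglongrightarrow> L2inner \<phi> h)"
  proof (rule form_riesz[where l = "\<lambda>\<phi>. L2inner \<phi> h" and C = "4 * (L2norm h)\<^sup>2"])
    fix t p
    assume "form_approx \<alpha> k p t" "\<And>\<phi>. \<phi> \<in> Cc_inf \<Longrightarrow> (\<lambda>n. L2inner \<phi> (tau \<alpha> k (t n))) \<longlonglongrightarrow> L2inner \<phi> h"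
    then show ?thesis by blast
  next
    show "0 \<le> 4 * (L2norm h)\<^sup>2" by simp
  qed (fact la l)+
  then obtain t p where t: "form_approx \<alpha> k p t" and lim: "\<And>\<phi>. \<phi> \<in> Cc_inf \<Longrightarrow> (\<lambda>n. L2inner \<phi> (tau \<alpha> k (t n))) \<longlonglongrightarrow> L2inner \<phi> h"
    by blast
  obtain p1 where p1: "L2 p1" "L2conv (\<lambda>n. cderiv (t n)) p1" "L2 (rV p)" "L2conv (\<lambda>n. rV (t n)) (rV p)"
    "\<forall>\<phi>\<in>Cc_inf. L2inner \<phi> p1 = - L2inner (cderiv \<phi>) p"
    using form_approxE[OF t] .
  have weak: "L2inner (cderiv \<phi>) p1 + L2inner (rV \<phi>) (rV p) = L2inner \<phi> h" if \<phi>: "\<phi> \<in> Cc_inf" for \<phi>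
  proof -
    have "(\<lambda>n. L2inner \<phi> (tau \<alpha> k (t n))) \<longlonglongrightarrow> L2inner (cderiv \<phi>) p1 + L2inner (rV \<phi>) (rV p)"
      by (rule form_limit[OF form_approx_const[OF \<phi>] L2_Cc_inf[OF Cc_inf_deriv(2)[OF \<phi>]] L2conv_const L2_rV[OF \<phi>] L2conv_const t p1(1-4)])
    from LIMSEQ_unique[OF this lim[OF \<phi>]] show ?thesis .
  qed
  have "(\<lambda>n. L2inner (s n) (tau \<alpha> k (t' n))) \<longlonglongrightarrow> L2inner g h"
    if g: "form_approx \<alpha> k g s" and t': "form_approx \<alpha> k p t'" for g s t'
  proof -
    have s: "\<And>n. s n \<in> Cc_inf" "L2conv s g" "L2 g" using g by (auto simp: form_approx_def)
    obtain g1 where g1: "L2 g1" "L2conv (\<lambda>n. cderiv (s n)) g1" "L2 (rV g)" "L2conv (\<lambda>n. rV (s n)) (rV g)"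
      using form_approxE[OF g] by metis
    \<comment> \<open>The definition quantifies over every sequence for \<open>p\<close>, not just
      the minimising one; both have the same derivative limit because it is the weak derivative of
      \<open>p\<close>.\<close>
    obtain p2 where p2: "L2 p2" "L2conv (\<lambda>n. cderiv (t' n)) p2" "L2 (rV p)" "L2conv (\<lambda>n. rV (t' n)) (rV p)"
      "\<forall>\<phi>\<in>Cc_inf. L2inner \<phi> p2 = - L2inner (cderiv \<phi>) p"
      using form_approxE[OF t'] .
    have ae: "AE x in Mp. p2 x = p1 x"
      by (rule AE_eq_if_L2inner_Cc_inf_eq[OF p2(1) p1(1)]) (use p1(5) p2(5) in simp)
    have "(\<lambda>n. L2inner (cderiv (s n)) p1 + L2inner (rV (s n)) (rV p)) \<longlonglongrightarrow> L2inner g1 p1 + L2inner (rV g) (rV p)"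
      by (intro tendsto_add L2conv_inner_left g1 p1(1,3) L2_Cc_inf Cc_inf_deriv s L2_rV)
    moreover have "(\<lambda>n. L2inner (s n) h) \<longlonglongrightarrow> L2inner g h"
      by (rule L2conv_inner_left[OF s(2) L2_Cc_inf[OF s(1)] s(3) h])
    ultimately have e: "L2inner g1 p1 + L2inner (rV g) (rV p) = L2inner g h"
      unfolding weak[OF s(1)] by (rule LIMSEQ_unique)
    have "L2inner g1 p2 = L2inner g1 p1" by (rule L2inner_cong_AE[OF g1(1) p2(1) AE_I2[OF refl] ae])
    then show ?thesis
      using form_limit[OF g g1 t' p2(1-4)] e by simp
  qed
  then have "(p, h) \<in> Friedrichs \<alpha> k"
    unfolding Friedrichs_def form_dom_def using t h by blast
  then show ?thesis by (rule that)
qed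

lemma Friedrichs_AE:
  assumes "(f, h) \<in> Friedrichs \<alpha> k" "AE x in Mp. f x = g x"
  shows "(g, h) \<in> Friedrichs \<alpha> k"
proof -
  have ae: "AE x in Mp. g x = f x" using assms(2) by eventually_elim simp
  have i: "form_approx \<alpha> k g = form_approx \<alpha> k f"
    using form_approx_AE[OF _ assms(2)] form_approx_AE[OF _ ae] by blast
  show ?thesis using assms(1) unfolding Friedrichs_def form_dom_def by (simp add: i)
qed

text \<open>A sequence converging to \<open>f\<close> in the H1 norm need not converge in the
  weighted norm. For the converse inclusion Riesz therefore represents the form pairing with
  \<open>f\<close> by some \<open>p\<close> of the form domain; f - p is in the kernel of the
  adjoint and in \<open>Dxinv\<close>, so it vanishes.\<close>

lemma form_domain:
  "form_dom \<alpha> k = H1_0 \<inter> {f. wL2 (\<lambda>x. sqrt (1 + (x powr (2*\<alpha>))^2)) f}"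
proof -
  have iff: "wL2 (\<lambda>x. sqrt (1 + (x powr (2*\<alpha>))\<^sup>2)) f \<longleftrightarrow> L2 (\<lambda>x. of_real (sqrt (Wpot x)) * f x)" if "L2 f" for f
  proof (rule wL2_iff[OF that, where A = 1 and B = "(real_of_int k)\<^sup>2"])
    show "continuous_on {0<..} (\<lambda>x. sqrt (Wpot x))" by (intro continuous_intros continuous_Wpot)
    show "continuous_on {0<..} (\<lambda>x. sqrt (1 + (x powr (2*\<alpha>))\<^sup>2))" by (intro continuous_intros) auto
    fix x :: real assume "0 < x"
    define y where "y = x powr (2 * \<alpha>)"
    have y: "0 \<le> y" by (simp add: y_def)
    have W: "(sqrt (Wpot x))\<^sup>2 = (real_of_int k)\<^sup>2 * y" using Wpot_nonneg[of x] by (simp add: Wpot_def y_def)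
    have 1: "sqrt (1 + y\<^sup>2) \<le> 1 + y" using y by (intro real_le_lsqrt) (auto simp: power2_eq_square algebra_simps)
    have 2: "y \<le> sqrt (1 + y\<^sup>2)" by (intro real_le_rsqrt) simp
    have "1 * y \<le> (real_of_int k)\<^sup>2 * y" by (rule mult_right_mono[OF k2 y])
    then show "0 \<le> sqrt (1 + (x powr (2*\<alpha>))\<^sup>2) \<and> sqrt (1 + (x powr (2*\<alpha>))\<^sup>2) \<le> 1 * (1 + (sqrt (Wpot x))\<^sup>2) \<and>
        (sqrt (Wpot x))\<^sup>2 \<le> (real_of_int k)\<^sup>2 * sqrt (1 + (x powr (2*\<alpha>))\<^sup>2)"
      unfolding W y_def[symmetric] using 1 mult_left_mono[OF 2, of "(real_of_int k)\<^sup>2"] by simp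
  qed
  show ?thesis
  proof (intro set_eqI iffI)
    fix f assume "f \<in> form_dom \<alpha> k"
    then obtain t where t: "form_approx \<alpha> k f t" by (auto simp: form_dom_def)
    have f: "f \<in> H1_0" by (rule form_approx_H1_0[OF t])
    have "L2 (rV f)" using form_approxE[OF t] by metis
    then have "L2 (\<lambda>x. of_real (sqrt (Wpot x)) * f x)" using rV_L2_iff[OF H1_0_Dxinv[OF f]] by simp
    moreover have "L2 f" using t by (simp add: form_approx_def)
    ultimately show "f \<in> H1_0 \<inter> {f. wL2 (\<lambda>x. sqrt (1 + (x powr (2*\<alpha>))^2)) f}" using f iff by simp
  next
    fix f assume f0: "f \<in> H1_0 \<inter> {f. wL2 (\<lambda>x. sqrt (1 + (x powr (2*\<alpha>))^2)) f}"
    then obtain f1 s where L: "L2 f" "L2 f1" and s: "\<And>n. s n \<in> Cc_inf" "L2conv s f" "L2conv (\<lambda>n. cderiv (s n)) f1"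
      unfolding H1_0_def by blast
    have fx: "f \<in> Dxinv" using f0 H1_0_Dxinv by blast
    have rf: "L2 (rV f)" using f0 iff[OF L(1)] rV_L2_iff[OF fx] by simp
    define l where "l \<phi> = L2inner (cderiv \<phi>) f1 + L2inner (rV \<phi>) (rV f)" for \<phi>
    \<comment> \<open>Moving both derivatives onto \<phi> shows that \<open>l\<close> is linear and
      that \<open>p\<close> and \<open>f\<close> have the same pairings with the range.\<close>
    have lA: "l \<phi> = L2inner (tau \<alpha> k \<phi>) f" if \<phi>: "\<phi> \<in> Cc_inf" for \<phi>
    proof -
      note \<phi>1 = Cc_inf_deriv(2)[OF \<phi>] and \<phi>2 = Cc_inf_deriv(2)[OF Cc_inf_deriv(2)[OF \<phi>]]
      have "(\<lambda>n. L2inner (cderiv \<phi>) (cderiv (s n))) \<longlonglongrightarrow> L2inner (cderiv \<phi>) f1"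
        by (intro L2conv_inner_right s L L2_Cc_inf Cc_inf_deriv \<phi>1)
      moreover have "(\<lambda>n. L2inner (cderiv \<phi>) (cderiv (s n))) \<longlonglongrightarrow> - L2inner (cderiv (cderiv \<phi>)) f"
        unfolding L2inner_by_parts[OF \<phi>1 s(1)]
        by (intro tendsto_minus L2conv_inner_right s L L2_Cc_inf \<phi>2)
      ultimately have e: "L2inner (cderiv \<phi>) f1 = - L2inner (cderiv (cderiv \<phi>)) f" by (rule LIMSEQ_unique)
      have t: "tau \<alpha> k \<phi> = (\<lambda>x. of_real (Vpot \<alpha> k x) * \<phi> x - cderiv (cderiv \<phi>) x)" by (auto simp: tau_def)
      have "L2inner (tau \<alpha> k \<phi>) f = L2inner (\<lambda>x. of_real (Vpot \<alpha> k x) * \<phi> x) f - L2inner (cderiv (cderiv \<phi>)) f"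
        unfolding t by (intro L2inner_diff_left L2_Cc_inf_mult L2_Cc_inf \<phi> \<phi>2 L continuous_intros continuous_Vpot)
      then show ?thesis unfolding l_def e rV_inner' by simp
    qed
    have la: "l (\<lambda>x. \<phi> x + z * \<psi> x) = l \<phi> + cnj z * l \<psi>" if \<phi>: "\<phi> \<in> Cc_inf" and \<psi>: "\<psi> \<in> Cc_inf" for \<phi> \<psi> z
      unfolding lA[OF Cc_inf_lin[OF \<phi> \<psi>]] lA[OF \<phi>] lA[OF \<psi>] tau_lin[OF \<phi> \<psi>]
      using L2inner_add_left[OF L2_tau[OF \<phi>] L2_cmult[OF L2_tau[OF \<psi>]] L(1)] by (simp add: L2inner_cmult_left)
    define C where "C = 2 * ((L2norm f1)\<^sup>2 + (L2norm (rV f))\<^sup>2)"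
    have C: "0 \<le> C" by (simp add: C_def)
    have lb: "(cmod (l \<phi>))\<^sup>2 \<le> C * Re (L2inner \<phi> (tau \<alpha> k \<phi>))" if \<phi>: "\<phi> \<in> Cc_inf" for \<phi>
    proof -
      define a b a' b' where "a = L2norm (cderiv \<phi>)" and "b = L2norm (rV \<phi>)" and "a' = L2norm f1" and "b' = L2norm (rV f)"
      have "cmod (l \<phi>) \<le> cmod (L2inner (cderiv \<phi>) f1) + cmod (L2inner (rV \<phi>) (rV f))"
        unfolding l_def by (rule norm_triangle_ineq)
      also have "\<dots> \<le> a * a' + b * b'"
        unfolding a_def b_def a'_def b'_def
        by (intro add_mono cmod_L2inner_le L2_rV L2_Cc_inf Cc_inf_deriv \<phi> L rf)
      finally have "(cmod (l \<phi>))\<^sup>2 \<le> (a * a' + b * b')\<^sup>2" by (intro power_mono) auto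
      also have "\<dots> \<le> (2 * (a'\<^sup>2 + b'\<^sup>2)) * (a\<^sup>2 + b\<^sup>2)"
      proof -
        have "(2 * (a'\<^sup>2 + b'\<^sup>2)) * (a\<^sup>2 + b\<^sup>2) - (a * a' + b * b')\<^sup>2 = (a * a' - b * b')\<^sup>2 + 2 * (a * b')\<^sup>2 + 2 * (b * a')\<^sup>2"
          by (simp add: power2_eq_square algebra_simps)
        moreover have "0 \<le> (a * a' - b * b')\<^sup>2 + 2 * (a * b')\<^sup>2 + 2 * (b * a')\<^sup>2" by simp
        ultimately show ?thesis by linarith
      qed
      finally show ?thesis unfolding form_norm[OF \<phi>] C_def a_def b_def a'_def b'_def .
    qed
    have "\<exists>t p. form_approx \<alpha> k p t \<and> (\<forall>\<phi>\<in>Cc_inf. (\<lambda>n. L2inner \<phi> (tau \<alpha> k (t n))) \<longlonglongrightarrow> l \<phi>)"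
    proof (rule form_riesz[where l = l and C = C])
      fix t p
      assume "form_approx \<alpha> k p t" "\<And>\<phi>. \<phi> \<in> Cc_inf \<Longrightarrow> (\<lambda>n. L2inner \<phi> (tau \<alpha> k (t n))) \<longlonglongrightarrow> l \<phi>"
      then show ?thesis by blast
    qed (fact la lb C)+
    then obtain t p where t: "form_approx \<alpha> k p t" and lim: "\<And>\<phi>. \<phi> \<in> Cc_inf \<Longrightarrow> (\<lambda>n. L2inner \<phi> (tau \<alpha> k (t n))) \<longlonglongrightarrow> l \<phi>"
      by blast
    have c: "\<And>n. t n \<in> Cc_inf" "L2conv t p" "L2 p" using t by (auto simp: form_approx_def)
    have pf: "L2inner (tau \<alpha> k \<phi>) p = L2inner (tau \<alpha> k \<phi>) f" if \<phi>: "\<phi> \<in> Cc_inf" for \<phi>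
    proof -
      have "(\<lambda>n. L2inner (tau \<alpha> k \<phi>) (t n)) \<longlonglongrightarrow> L2inner (tau \<alpha> k \<phi>) f"
        using lim[OF \<phi>] unfolding tau_symmetric[OF \<phi> c(1)] lA[OF \<phi>] .
      with L2conv_inner_right[OF c(2) L2_Cc_inf[OF c(1)] c(3) L2_tau[OF \<phi>]] show ?thesis by (rule LIMSEQ_unique)
    qed
    have "((\<lambda>x. f x - p x), (\<lambda>x. 0)) \<in> adj (Aop \<alpha> k)"
      unfolding adj_iff
    proof (intro conjI ballI L2_diff L c L2_0)
      fix \<phi> assume "\<phi> \<in> Cc_inf"
      then have "L2inner (tau \<alpha> k \<phi>) (\<lambda>x. f x - p x) = 0"
        by (simp add: L2inner_diff_right L2_tau L c pf)
      then show "L2inner (tau \<alpha> k \<phi>) (\<lambda>x. f x - p x) = L2inner \<phi> (\<lambda>x. 0)" by (simp add: L2inner_def)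
    qed
    then obtain d where d: "AE x in Mp. f x - p x = d * Phi \<alpha> k x" by (rule kernel)
    have "d = 0"
    proof (rule ccontr)
      assume d0: "d \<noteq> 0"
      have px: "p \<in> Dxinv" by (rule H1_0_Dxinv[OF form_approx_H1_0[OF t]])
      have "L2 (\<lambda>x. (1 / d) * (f x / of_real x - p x / of_real x))"
        using fx px unfolding Dxinv_def by (intro L2_cmult L2_diff) auto
      moreover have "AE x in Mp. (1 / d) * (f x / of_real x - p x / of_real x) = Phi \<alpha> k x / of_real x"
        using d
      proof eventually_elim
        case (elim x)
        have "(1 / d) * (f x / of_real x - p x / of_real x) = (1 / d) * ((f x - p x) / of_real x)"
          by (simp add: diff_divide_distrib)
        then show ?case unfolding elim using d0 by simp
      qed
      ultimately have "L2 (\<lambda>x. Phi \<alpha> k x / of_real x)" by (rule L2_cong_AE)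
      then show False using Phi_not_Dxinv by simp
    qed
    have "AE x in Mp. p x = f x" using d by eventually_elim (simp add: \<open>d = 0\<close>)
    from form_approx_AE[OF t this] show "f \<in> form_dom \<alpha> k" unfolding form_dom_def by blast
  qed
qed

section \<open>Self-adjoint extensions\<close>

definition bform :: "(real \<Rightarrow> complex) \<Rightarrow> (real \<Rightarrow> complex) \<Rightarrow> (real \<Rightarrow> complex) \<Rightarrow> (real \<Rightarrow> complex) \<Rightarrow> complex" where
  "bform g h g' h' = L2inner g h' - L2inner h g'"

text \<open>The closure is annihilated by the boundary form. Since \<Psi> is mapped to \<Phi> and
  \<Phi> to 0, only pairings among these two survive, and those of \<Psi> with \<Phi> cancel because
  both functions are real.\<close>

lemma bform_decomp:
  assumes D: "decomp g h c d" and D': "decomp g' h' c' d'"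
  shows "bform g h g' h' = of_real N * (cnj d * c' - cnj c * d')"
proof -
  obtain f hf where f: "(f, hf) \<in> opclosure (Aop \<alpha> k)" "g = (\<lambda>x. f x + c * Psi \<alpha> k x + d * Phi \<alpha> k x)"
    "AE x in Mp. h x = hf x + c * Phi \<alpha> k x" using D unfolding decomp_def by blast
  obtain f' hf' where f': "(f', hf') \<in> opclosure (Aop \<alpha> k)" "g' = (\<lambda>x. f' x + c' * Psi \<alpha> k x + d' * Phi \<alpha> k x)"
    "AE x in Mp. h' x = hf' x + c' * Phi \<alpha> k x" using D' unfolding decomp_def by blast
  have L: "L2 f" "L2 hf" "L2 f'" "L2 hf'" using f(1) f'(1) by (auto simp: opclosure_iff)
  have Lg: "L2 g" "L2 h" "L2 g'" "L2 h'" using decomp_adj[OF D] decomp_adj[OF D'] by (auto simp: adj_iff)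
  note P = L2_Psi L2_Phi
  have 1: "L2inner g h' = L2inner g (\<lambda>x. hf' x + c' * Phi \<alpha> k x)"
    by (rule L2inner_cong_AE[OF Lg(1,4) AE_I2[OF refl] f'(3)])
  have 2: "L2inner h g' = L2inner (\<lambda>x. hf x + c * Phi \<alpha> k x) g'"
    by (rule L2inner_cong_AE[OF Lg(2,3) f(3) AE_I2[OF refl]])
  have z: "L2inner u (\<lambda>x. 0) = 0" for u by (simp add: L2inner_def)
  have N: "L2inner (Phi \<alpha> k) (Phi \<alpha> k) = of_real N" unfolding N_def by (rule L2inner_self)
  have ff: "L2inner hf f' = L2inner f hf'" by (rule closure_adj_inner[OF f(1) closure_adj[OF f'(1)]])
  have fp: "L2inner hf (Psi \<alpha> k) = L2inner f (Phi \<alpha> k)" "L2inner hf (Phi \<alpha> k) = 0"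
    using closure_adj_inner[OF f(1) Psi_adj] closure_adj_inner[OF f(1) Phi_adj] by (simp_all add: z)
  have "L2inner hf' (Psi \<alpha> k) = L2inner f' (Phi \<alpha> k)" "L2inner hf' (Phi \<alpha> k) = 0"
    using closure_adj_inner[OF f'(1) Psi_adj] closure_adj_inner[OF f'(1) Phi_adj] by (simp_all add: z)
  then have pf: "L2inner (Psi \<alpha> k) hf' = L2inner (Phi \<alpha> k) f'" "L2inner (Phi \<alpha> k) hf' = 0"
    by (metis L2inner_cnj, metis L2inner_cnj complex_cnj_zero)
  have pp: "L2inner (Psi \<alpha> k) (Phi \<alpha> k) = L2inner (Phi \<alpha> k) (Psi \<alpha> k)"
    by (simp add: L2inner_def mult.commute)
  have a: "L2inner g (\<lambda>x. hf' x + c' * Phi \<alpha> k x) =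
      L2inner f hf' + cnj c * L2inner (Psi \<alpha> k) hf' + cnj d * L2inner (Phi \<alpha> k) hf' +
      c' * (L2inner f (Phi \<alpha> k) + cnj c * L2inner (Psi \<alpha> k) (Phi \<alpha> k) + cnj d * L2inner (Phi \<alpha> k) (Phi \<alpha> k))"
    unfolding f(2) using L P
    by (simp add: L2inner_add_left L2inner_add_right L2_add L2_cmult L2inner_cmult_left L2inner_cmult_right algebra_simps)
  have b: "L2inner (\<lambda>x. hf x + c * Phi \<alpha> k x) g' =
      L2inner hf f' + c' * L2inner hf (Psi \<alpha> k) + d' * L2inner hf (Phi \<alpha> k) +
      cnj c * (L2inner (Phi \<alpha> k) f' + c' * L2inner (Phi \<alpha> k) (Psi \<alpha> k) + d' * L2inner (Phi \<alpha> k) (Phi \<alpha> k))"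
    unfolding f'(2) using L P
    by (simp add: L2inner_add_left L2inner_add_right L2_add L2_cmult L2inner_cmult_left L2inner_cmult_right algebra_simps)
  show ?thesis
    unfolding bform_def 1 2 a b ff fp pf pp N by (simp add: algebra_simps)
qed

text \<open>The value of c/d obtained from b = \<gamma> a with the coefficients of
  \<open>decomp_asym\<close>; the summand \<beta> comes from the second term in the expansion of
  \<Phi>.\<close>

definition slope :: "real \<Rightarrow> real" where "slope \<gamma> = (\<gamma> + \<beta>) * CPhi / CPsi"

lemma slope_surj: "\<exists>\<gamma>. slope \<gamma> = y"
  by (rule exI[of _ "y * CPsi / CPhi - \<beta>"]) (use CPhi CPsi in \<open>simp add: slope_def\<close>)

lemma Dgamma_iff:
  assumes D: "decomp g h c d"
  shows "g \<in> Dgamma \<alpha> k None \<longleftrightarrow> d = 0" "g \<in> Dgamma \<alpha> k (Some \<gamma>) \<longleftrightarrow> c = of_real (slope \<gamma>) * d"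
proof -
  note A = decomp_asym[OF D]
  have dom: "g \<in> opdom (adj (Aop \<alpha> k))" using decomp_adj[OF D] unfolding opdom_def by force
  have CP: "complex_of_real CPhi \<noteq> 0" "complex_of_real CPsi \<noteq> 0" using CPhi CPsi by auto
  have "g \<in> Dgamma \<alpha> k None \<longleftrightarrow> (\<exists>g1. asym g 0 g1)" unfolding Dgamma_def asym_def using dom by simp
  also have "\<dots> \<longleftrightarrow> d = 0"
  proof
    assume "\<exists>g1. asym g 0 g1"
    then obtain g1 where "asym g 0 g1" by blast
    from asym_unique[OF A this] show "d = 0" using CP by simp
  next
    assume "d = 0"
    then show "\<exists>g1. asym g 0 g1" using A by auto
  qed
  finally show "g \<in> Dgamma \<alpha> k None \<longleftrightarrow> d = 0" .
  have "g \<in> Dgamma \<alpha> k (Some \<gamma>) \<longleftrightarrow> (\<exists>g0. asym g g0 (of_real \<gamma> * g0))" unfolding Dgamma_def asym_def using dom by simp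
  also have "\<dots> \<longleftrightarrow> c * of_real CPsi - d * of_real (CPhi * \<beta>) = of_real \<gamma> * (d * of_real CPhi)"
  proof
    assume "\<exists>g0. asym g g0 (of_real \<gamma> * g0)"
    then obtain g0 where "asym g g0 (of_real \<gamma> * g0)" by blast
    from asym_unique[OF A this] show "c * of_real CPsi - d * of_real (CPhi * \<beta>) = of_real \<gamma> * (d * of_real CPhi)" by simp
  next
    assume "c * of_real CPsi - d * of_real (CPhi * \<beta>) = of_real \<gamma> * (d * of_real CPhi)"
    then show "\<exists>g0. asym g g0 (of_real \<gamma> * g0)" using A by (intro exI[of _ "d * of_real CPhi"]) simp
  qed
  also have "\<dots> \<longleftrightarrow> c * of_real CPsi = of_real ((\<gamma> + \<beta>) * CPhi) * d"
    by (auto simp: algebra_simps)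
  also have "\<dots> \<longleftrightarrow> c = of_real (slope \<gamma>) * d"
    unfolding slope_def of_real_divide using CP(2) by (simp add: field_simps del: of_real_mult of_real_add)
  finally show "g \<in> Dgamma \<alpha> k (Some \<gamma>) \<longleftrightarrow> c = of_real (slope \<gamma>) * d" .
qed

lemma Agamma_iff: "(g, h) \<in> Agamma \<alpha> k \<gamma> \<longleftrightarrow> (g, h) \<in> adj (Aop \<alpha> k) \<and> g \<in> Dgamma \<alpha> k \<gamma>"
  by (simp add: Agamma_def)

lemma adj_antimono: "S \<subseteq> T \<Longrightarrow> adj T \<subseteq> adj S"
  unfolding adj_def by blast

text \<open>Within the adjoint of \<open>Aop\<close>, taking adjoints becomes taking annihilators of
  the boundary form, so the study of extensions moves to the (c, d) plane.\<close>

lemma adj_iff_bform: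
  assumes "(g', h') \<in> adj (Aop \<alpha> k)"
  shows "(g', h') \<in> adj S \<longleftrightarrow> (\<forall>(g, h)\<in>S. bform g h g' h' = 0)"
proof -
  have "L2 g'" "L2 h'" using assms by (auto simp: adj_iff)
  then have "(g', h') \<in> adj S \<longleftrightarrow> (\<forall>(g, h)\<in>S. L2inner h g' = L2inner g h')" unfolding adj_def by simp
  also have "\<dots> \<longleftrightarrow> (\<forall>(g, h)\<in>S. bform g h g' h' = 0)"
    by (intro ball_cong refl) (auto simp: bform_def)
  finally show ?thesis .
qed

lemma decomp_Aop:
  assumes "\<phi> \<in> Cc_inf" shows "decomp \<phi> (tau \<alpha> k \<phi>) 0 0"
  unfolding decomp_def using Aop_closure[OF assms] by (intro exI[of _ \<phi>] exI[of _ "tau \<alpha> k \<phi>"]) simp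

lemma zero_closure: "((\<lambda>x. 0), (\<lambda>x. 0)) \<in> opclosure (Aop \<alpha> k)"
  using closure_AE[OF Aop_closure[OF Cc_inf_0], of "\<lambda>x. 0" "\<lambda>x. 0"]
  by (simp add: tau_def cderiv_def complex_eq_iff)

lemma decomp_span: "decomp (\<lambda>x. c * Psi \<alpha> k x + d * Phi \<alpha> k x) (\<lambda>x. c * Phi \<alpha> k x) c d"
  unfolding decomp_def using zero_closure by (intro exI[of _ "\<lambda>x. 0"]) auto

lemma Agamma_selfadjoint: "sa_ext \<alpha> k (Agamma \<alpha> k \<gamma>)"
proof -
  have sub: "Agamma \<alpha> k \<gamma> \<subseteq> adj (Aop \<alpha> k)" by (auto simp: Agamma_def)
  have ext: "Aop \<alpha> k \<subseteq> Agamma \<alpha> k \<gamma>"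
  proof
    fix x assume "x \<in> Aop \<alpha> k"
    then obtain \<phi> where x: "x = (\<phi>, tau \<alpha> k \<phi>)" "\<phi> \<in> Cc_inf" unfolding Aop_def by blast
    then show "x \<in> Agamma \<alpha> k \<gamma>"
      using Dgamma_iff[OF decomp_Aop[OF x(2)]] Aop_adj[OF x(2)] by (cases \<gamma>) (auto simp: Agamma_iff)
  qed
  have "(g', h') \<in> Agamma \<alpha> k \<gamma> \<longleftrightarrow> (g', h') \<in> adj (Agamma \<alpha> k \<gamma>)" for g' h'
  proof
    assume a: "(g', h') \<in> Agamma \<alpha> k \<gamma>"
    then have a': "(g', h') \<in> adj (Aop \<alpha> k)" using sub by blast
    obtain c' d' where D': "decomp g' h' c' d'" by (rule decomp_exists[OF a'])
    have "bform g h g' h' = 0" if gh: "(g, h) \<in> Agamma \<alpha> k \<gamma>" for g h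
    proof -
      obtain c d where D: "decomp g h c d" using decomp_exists gh sub by blast
      show ?thesis
      proof (cases \<gamma>)
        case None
        then have "d = 0" "d' = 0" using gh a Dgamma_iff[OF D] Dgamma_iff[OF D'] by (auto simp: Agamma_iff)
        then show ?thesis using bform_decomp[OF D D'] by simp
      next
        case (Some y)
        then have "c = of_real (slope y) * d" "c' = of_real (slope y) * d'"
          using gh a Dgamma_iff[OF D] Dgamma_iff[OF D'] by (auto simp: Agamma_iff)
        then show ?thesis using bform_decomp[OF D D'] by simp
      qed
    qed
    then show "(g', h') \<in> adj (Agamma \<alpha> k \<gamma>)" using adj_iff_bform[OF a'] by blast
  next
    assume a: "(g', h') \<in> adj (Agamma \<alpha> k \<gamma>)"
    then have a': "(g', h') \<in> adj (Aop \<alpha> k)" using adj_antimono[OF ext] by blast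
    obtain c' d' where D': "decomp g' h' c' d'" by (rule decomp_exists[OF a'])
    have z: "bform g h g' h' = 0" if "(g, h) \<in> Agamma \<alpha> k \<gamma>" for g h
      using adj_iff_bform[OF a'] a that by blast
    have N: "complex_of_real N \<noteq> 0" using N_pos by simp
    show "(g', h') \<in> Agamma \<alpha> k \<gamma>"
    proof (cases \<gamma>)
      case None
      \<comment> \<open>One element spanning the line in the (c, d) plane suffices to force (c', d')
        onto that line.\<close>
      note E = decomp_span[of 1 0]
      have "bform (\<lambda>x. 1 * Psi \<alpha> k x + 0 * Phi \<alpha> k x) (\<lambda>x. 1 * Phi \<alpha> k x) g' h' = 0"
        by (rule z) (use Dgamma_iff(1)[OF E] decomp_adj[OF E] None in \<open>auto simp: Agamma_iff\<close>)
      then have "d' = 0" using bform_decomp[OF E D'] N by simp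
      then show ?thesis using a' Dgamma_iff(1)[OF D'] None by (simp add: Agamma_iff)
    next
      case (Some y)
      note E = decomp_span[of "of_real (slope y)" 1]
      have "bform (\<lambda>x. of_real (slope y) * Psi \<alpha> k x + 1 * Phi \<alpha> k x) (\<lambda>x. of_real (slope y) * Phi \<alpha> k x) g' h' = 0"
        by (rule z) (use Dgamma_iff(2)[OF E] decomp_adj[OF E] Some in \<open>auto simp: Agamma_iff\<close>)
      then have "c' = of_real (slope y) * d'" using bform_decomp[OF E D'] N by simp
      then show ?thesis using a' Dgamma_iff(2)[OF D'] Some by (simp add: Agamma_iff)
    qed
  qed
  then have "Agamma \<alpha> k \<gamma> = adj (Agamma \<alpha> k \<gamma>)" by auto
  with ext show ?thesis by (simp add: sa_ext_def)
qed

lemma selfadjoint_subset_eq: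
  assumes "sa_ext \<alpha> k S" "sa_ext \<alpha> k T" "S \<subseteq> T"
  shows "S = T"
  using assms adj_antimono[of S T] unfolding sa_ext_def by blast

text \<open>Either all elements have d = 0, or one with d0 nonzero fixes the line: the boundary form
  with itself makes its slope real, and with any other element puts that element on the same line.
  Maximality of self-adjoint operators upgrades the inclusion to equality.\<close>

lemma selfadjoint_classification:
  assumes S: "sa_ext \<alpha> k S"
  obtains \<gamma> where "S = Agamma \<alpha> k \<gamma>"
proof -
  have ext: "Aop \<alpha> k \<subseteq> S" and SS: "S = adj S" using S by (auto simp: sa_ext_def)
  have sub: "S \<subseteq> adj (Aop \<alpha> k)" using adj_antimono[OF ext] SS by blast
  have z: "bform g h g' h' = 0" if "(g, h) \<in> S" "(g', h') \<in> S" for g h g' h'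
  proof -
    have "(g', h') \<in> adj (Aop \<alpha> k)" "(g', h') \<in> adj S" using that sub SS by blast+
    then show ?thesis using adj_iff_bform that by blast
  qed
  have N: "complex_of_real N \<noteq> 0" using N_pos by simp
  show ?thesis
  proof (cases "\<forall>(g, h)\<in>S. g \<in> Dgamma \<alpha> k None")
    case True
    then have "S \<subseteq> Agamma \<alpha> k None" using sub by (auto simp: Agamma_def)
    from selfadjoint_subset_eq[OF S Agamma_selfadjoint this] show ?thesis by (rule that)
  next
    case False
    then obtain g0 h0 where gh0: "(g0, h0) \<in> S" "g0 \<notin> Dgamma \<alpha> k None" by blast
    have a0: "(g0, h0) \<in> adj (Aop \<alpha> k)" using gh0(1) sub by blast
    obtain c0 d0 where D0: "decomp g0 h0 c0 d0" by (rule decomp_exists[OF a0])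
    have d0: "d0 \<noteq> 0" using gh0(2) Dgamma_iff(1)[OF D0] by simp
    have "cnj d0 * c0 = cnj c0 * d0" using z[OF gh0(1) gh0(1)] bform_decomp[OF D0 D0] N by simp
    then have "cnj (c0 / d0) = c0 / d0" using d0 by (simp add: field_simps)
    then obtain y where y: "c0 / d0 = of_real y" by (metis Reals_cnj_iff Reals_cases)
    \<comment> \<open>Every real slope belongs to some finite \<gamma>; the vertical line d = 0 is
      the case of infinite \<gamma>.\<close>
    obtain \<gamma> where \<gamma>: "slope \<gamma> = y" using slope_surj by blast
    have c0: "c0 = of_real y * d0" using y d0 by (simp add: field_simps)
    have "S \<subseteq> Agamma \<alpha> k (Some \<gamma>)"
    proof
      fix x assume x: "x \<in> S"
      obtain g h where gh: "x = (g, h)" by (cases x)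
      have a: "(g, h) \<in> adj (Aop \<alpha> k)" using x gh sub by blast
      obtain c d where D: "decomp g h c d" by (rule decomp_exists[OF a])
      have "cnj d0 * c = cnj c0 * d" using z[OF gh0(1)] x gh bform_decomp[OF D0 D] N by auto
      then have "cnj d0 * c = cnj d0 * (of_real y * d)" unfolding c0 by simp
      then have "c = of_real y * d" using d0 by simp
      then show "x \<in> Agamma \<alpha> k (Some \<gamma>)" using Dgamma_iff(2)[OF D] a \<gamma> gh by (simp add: Agamma_iff)
    qed
    from selfadjoint_subset_eq[OF S Agamma_selfadjoint this] show ?thesis by (rule that)
  qed
qed

lemma selfadjoint_Dxinv:
  assumes S: "sa_ext \<alpha> k S" and x: "opdom S \<subseteq> Dxinv"
  shows "S = Agamma \<alpha> k None"
proof (rule selfadjoint_subset_eq[OF S Agamma_selfadjoint])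
  have sub: "S \<subseteq> adj (Aop \<alpha> k)" using S adj_antimono[of "Aop \<alpha> k" S] unfolding sa_ext_def by blast
  show "S \<subseteq> Agamma \<alpha> k None"
  proof
    fix x assume xS: "x \<in> S"
    obtain g h where gh: "x = (g, h)" by (cases x)
    have a: "(g, h) \<in> adj (Aop \<alpha> k)" using xS gh sub by blast
    obtain c d where D: "decomp g h c d" by (rule decomp_exists[OF a])
    have "g \<in> Dxinv" using x xS gh unfolding opdom_def by force
    from decomp_Dxinv[OF D this] show "x \<in> Agamma \<alpha> k None"
      using Dgamma_iff(1)[OF D] a gh by (simp add: Agamma_iff)
  qed
qed

text \<open>One inclusion is \<open>decomp_Dxinv\<close>. For the other, surjectivity solves the
  Friedrichs equation with the same right-hand side; both solutions have d = 0, so their difference,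
  a multiple of \<Phi>, vanishes. Self-adjointness of the Friedrichs extension is a consequence of
  this identity, not an ingredient.\<close>

lemma Agamma_None_eq_Friedrichs: "Agamma \<alpha> k None = Friedrichs \<alpha> k"
proof (intro set_eqI iffI)
  fix x assume "x \<in> Friedrichs \<alpha> k"
  then obtain f h where f: "x = (f, h)" "(f, h) \<in> Friedrichs \<alpha> k" by (cases x) auto
  note a = Friedrichs_adj[OF f(2)]
  obtain c d where D: "decomp f h c d" by (rule decomp_exists[OF a(1)])
  show "x \<in> Agamma \<alpha> k None"
    using decomp_Dxinv[OF D a(2)] Dgamma_iff(1)[OF D] a f by (simp add: Agamma_iff)
next
  fix x assume "x \<in> Agamma \<alpha> k None"
  then obtain g h where g: "x = (g, h)" "(g, h) \<in> adj (Aop \<alpha> k)" "g \<in> Dgamma \<alpha> k None"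
    by (cases x) (auto simp: Agamma_iff)
  have h: "L2 h" using g by (simp add: adj_iff)
  obtain p where p: "(p, h) \<in> Friedrichs \<alpha> k" using Friedrichs_surjective[OF h] by blast
  note pa = Friedrichs_adj[OF p]
  obtain c d where D: "decomp g h c d" by (rule decomp_exists[OF g(2)])
  have d: "d = 0" using Dgamma_iff(1)[OF D] g by simp
  obtain c' d' where D': "decomp p h c' d'" by (rule decomp_exists[OF pa(1)])
  have d': "d' = 0" by (rule decomp_Dxinv[OF D' pa(2)])
  have "((\<lambda>x. p x + (-1) * g x), (\<lambda>x. h x + (-1) * h x)) \<in> adj (Aop \<alpha> k)" by (rule adj_lin[OF pa(1) g(2)])
  then have "((\<lambda>x. p x + (-1) * g x), (\<lambda>x. 0)) \<in> adj (Aop \<alpha> k)" by simp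
  then obtain e where e: "AE x in Mp. p x + (-1) * g x = e * Phi \<alpha> k x" by (rule kernel)
  \<comment> \<open>The difference has no x powr (- \<alpha>/2) term, while a nonzero multiple of
    \<Phi> has one.\<close>
  have "asym (\<lambda>x. p x + (-1) * g x) (0 + (-1) * 0) (c' * of_real CPsi + (-1) * (c * of_real CPsi))"
    using asym_lin[OF decomp_asym[OF D'] decomp_asym[OF D], of "-1"] unfolding d d' by simp
  from asym_AE[OF this e] have "asym (\<lambda>x. e * Phi \<alpha> k x) 0 (c' * of_real CPsi + (-1) * (c * of_real CPsi))" by simp
  moreover have "asym (\<lambda>x. 0 + e * Phi \<alpha> k x) (0 + e * of_real CPhi) (0 + e * of_real (- CPhi * \<beta>))"
  proof (rule asym_lin[OF _ Phi_asym])
    show "asym (\<lambda>x. 0) 0 0" unfolding asym_def asymp_near0_def by (intro exI[of _ "\<lambda>x. 0"]) simp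
  qed
  ultimately have "asym (\<lambda>x. e * Phi \<alpha> k x) 0 (c' * of_real CPsi + (-1) * (c * of_real CPsi))"
    "asym (\<lambda>x. e * Phi \<alpha> k x) (e * of_real CPhi) (e * of_real (- CPhi * \<beta>))" by simp_all
  from asym_unique[OF this] have "e = 0" using CPhi by simp
  have "AE x in Mp. p x = g x" using e by eventually_elim (simp add: \<open>e = 0\<close>)
  from Friedrichs_AE[OF p this] show "x \<in> Friedrichs \<alpha> k" using g by simp
qed

section \<open>Domains and kernel in terms of \<Psi> and \<Phi>\<close>

lemma adj_domain_decomp:
  "opdom (adj (Aop \<alpha> k)) = {(\<lambda>x. f x + c * Psi \<alpha> k x + d * Phi \<alpha> k x) | f c d. f \<in> opdom (opclosure (Aop \<alpha> k))}"
proof (intro set_eqI iffI)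
  fix g assume "g \<in> opdom (adj (Aop \<alpha> k))"
  then obtain h where a: "(g, h) \<in> adj (Aop \<alpha> k)" unfolding opdom_def by auto
  obtain c d where "decomp g h c d" by (rule decomp_exists[OF a])
  then obtain f hf where "(f, hf) \<in> opclosure (Aop \<alpha> k)" "g = (\<lambda>x. f x + c * Psi \<alpha> k x + d * Phi \<alpha> k x)"
    unfolding decomp_def by blast
  then show "g \<in> {(\<lambda>x. f x + c * Psi \<alpha> k x + d * Phi \<alpha> k x) | f c d. f \<in> opdom (opclosure (Aop \<alpha> k))}"
    unfolding opdom_def by force
next
  fix g assume "g \<in> {(\<lambda>x. f x + c * Psi \<alpha> k x + d * Phi \<alpha> k x) | f c d. f \<in> opdom (opclosure (Aop \<alpha> k))}"
  then obtain f c d hf where "g = (\<lambda>x. f x + c * Psi \<alpha> k x + d * Phi \<alpha> k x)" "(f, hf) \<in> opclosure (Aop \<alpha> k)"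
    unfolding opdom_def by auto
  then have "decomp g (\<lambda>x. hf x + c * Phi \<alpha> k x) c d" unfolding decomp_def by blast
  from decomp_adj[OF this] show "g \<in> opdom (adj (Aop \<alpha> k))" unfolding opdom_def by force
qed

lemma Friedrichs_domain: "opdom (Friedrichs \<alpha> k) = Dgamma \<alpha> k None"
proof -
  have "opdom (Agamma \<alpha> k None) = Dgamma \<alpha> k None"
    unfolding opdom_def Agamma_def Dgamma_def by force
  then show ?thesis by (simp add: Agamma_None_eq_Friedrichs)
qed

lemma Friedrichs_domain_decomp:
  "opdom (Friedrichs \<alpha> k) = {(\<lambda>x. f x + c * Psi \<alpha> k x) | f c. f \<in> opdom (opclosure (Aop \<alpha> k))}"
proof (intro set_eqI iffI)
  fix g assume "g \<in> opdom (Friedrichs \<alpha> k)"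
  then obtain h where "(g, h) \<in> Agamma \<alpha> k None" unfolding Agamma_None_eq_Friedrichs opdom_def by auto
  then have a: "(g, h) \<in> adj (Aop \<alpha> k)" "g \<in> Dgamma \<alpha> k None" by (auto simp: Agamma_iff)
  obtain c d where D: "decomp g h c d" by (rule decomp_exists[OF a(1)])
  have "d = 0" using Dgamma_iff(1)[OF D] a by simp
  then obtain f hf where "(f, hf) \<in> opclosure (Aop \<alpha> k)" "g = (\<lambda>x. f x + c * Psi \<alpha> k x)"
    using D unfolding decomp_def by auto
  then show "g \<in> {(\<lambda>x. f x + c * Psi \<alpha> k x) | f c. f \<in> opdom (opclosure (Aop \<alpha> k))}"
    unfolding opdom_def by force
next
  fix g assume "g \<in> {(\<lambda>x. f x + c * Psi \<alpha> k x) | f c. f \<in> opdom (opclosure (Aop \<alpha> k))}"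
  then obtain f c hf where f: "g = (\<lambda>x. f x + c * Psi \<alpha> k x)" "(f, hf) \<in> opclosure (Aop \<alpha> k)"
    unfolding opdom_def by auto
  then have D: "decomp g (\<lambda>x. hf x + c * Phi \<alpha> k x) c 0" unfolding decomp_def by auto
  have "(g, (\<lambda>x. hf x + c * Phi \<alpha> k x)) \<in> Agamma \<alpha> k None"
    using Dgamma_iff(1)[OF D] decomp_adj[OF D] by (simp add: Agamma_iff)
  then show "g \<in> opdom (Friedrichs \<alpha> k)" unfolding Agamma_None_eq_Friedrichs opdom_def by force
qed

lemma kernel_eq: "{g. (g, (\<lambda>x. 0)) \<in> adj (Aop \<alpha> k)} = {g. \<exists>c. AE x in Mp. g x = c * Phi \<alpha> k x}"
proof (intro set_eqI iffI CollectI; elim CollectE)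
  fix g assume "(g, (\<lambda>x. 0)) \<in> adj (Aop \<alpha> k)"
  then show "\<exists>c. AE x in Mp. g x = c * Phi \<alpha> k x" using kernel by metis
next
  fix g assume "\<exists>c. AE x in Mp. g x = c * Phi \<alpha> k x"
  then obtain c where c: "AE x in Mp. g x = c * Phi \<alpha> k x" by blast
  have "decomp (\<lambda>x. 0 * Psi \<alpha> k x + c * Phi \<alpha> k x) (\<lambda>x. 0 * Phi \<alpha> k x) 0 c" by (rule decomp_span)
  from decomp_adj[OF this] have "((\<lambda>x. c * Phi \<alpha> k x), (\<lambda>x. 0)) \<in> adj (Aop \<alpha> k)" by simp
  moreover have "AE x in Mp. c * Phi \<alpha> k x = g x" using c by eventually_elim simp
  ultimately show "(g, (\<lambda>x. 0)) \<in> adj (Aop \<alpha> k)" using adj_AE[OF _ _ AE_I2[OF refl]] by blast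
qed

end

theorem theorem3p1:
  fixes \<alpha> :: real and k :: int
  assumes "0 \<le> \<alpha>" and "\<alpha> < 1" and "k \<noteq> 0"
  shows
   \<comment> \<open>(i)\<close>
   "opdom (opclosure (Aop \<alpha> k)) =
      H2_0 \<inter> {f. wL2 (\<lambda>x. (sqrt (1 + x^2)) powr (4*\<alpha>)) f}
   \<comment> \<open>(ii)\<close>
   \<and> opdom (adj (Aop \<alpha> k)) = Dmax \<alpha> k
   \<and> opdom (adj (Aop \<alpha> k)) =
      {(\<lambda>x. f x + c * Psi \<alpha> k x + d * Phi \<alpha> k x) | f c d.
         f \<in> opdom (opclosure (Aop \<alpha> k))}
   \<and> (\<forall>f c d. f \<in> opdom (opclosure (Aop \<alpha> k)) \<longrightarrow>
        (AE x in Mp. f x + c * Psi \<alpha> k x + d * Phi \<alpha> k x = 0) \<longrightarrow> c = 0 \<and> d = 0)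
   \<and> {g. (g, (\<lambda>x. 0)) \<in> adj (Aop \<alpha> k)} = {g. \<exists>c. AE x in Mp. g x = c * Phi \<alpha> k x}
   \<comment> \<open>(iii)\<close>
   \<and> opdom (Friedrichs \<alpha> k) = Dgamma \<alpha> k None
   \<and> opdom (Friedrichs \<alpha> k) =
      {(\<lambda>x. f x + c * Psi \<alpha> k x) | f c. f \<in> opdom (opclosure (Aop \<alpha> k))}
   \<and> (\<forall>f c. f \<in> opdom (opclosure (Aop \<alpha> k)) \<longrightarrow>
        (AE x in Mp. f x + c * Psi \<alpha> k x = 0) \<longrightarrow> c = 0)
   \<and> form_dom \<alpha> k = H1_0 \<inter> {f. wL2 (\<lambda>x. sqrt (1 + (x powr (2*\<alpha>))^2)) f}
   \<and> sa_ext \<alpha> k (Friedrichs \<alpha> k) \<and> opdom (Friedrichs \<alpha> k) \<subseteq> Dxinv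
   \<and> (\<forall>S. sa_ext \<alpha> k S \<and> opdom S \<subseteq> Dxinv \<longrightarrow> S = Friedrichs \<alpha> k)
   \<comment> \<open>(iv)\<close>
   \<and> {S. sa_ext \<alpha> k S} = range (Agamma \<alpha> k)
   \<and> Agamma \<alpha> k None = Friedrichs \<alpha> k"
proof -
  interpret half_line_operator \<alpha> k by unfold_locales (use assms in auto)
  have "sa_ext \<alpha> k (Friedrichs \<alpha> k)"
    using Agamma_selfadjoint[of None] unfolding Agamma_None_eq_Friedrichs .
  moreover have "opdom (Friedrichs \<alpha> k) \<subseteq> Dxinv" using Friedrichs_adj(2) unfolding opdom_def by auto
  moreover have "\<forall>S. sa_ext \<alpha> k S \<and> opdom S \<subseteq> Dxinv \<longrightarrow> S = Friedrichs \<alpha> k"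
    using selfadjoint_Dxinv unfolding Agamma_None_eq_Friedrichs by blast
  moreover have "{S. sa_ext \<alpha> k S} = range (Agamma \<alpha> k)"
  proof (intro subset_antisym subsetI)
    fix S assume "S \<in> {S. sa_ext \<alpha> k S}"
    then obtain \<gamma> where "S = Agamma \<alpha> k \<gamma>" using selfadjoint_classification[of S] by auto
    then show "S \<in> range (Agamma \<alpha> k)" by simp
  qed (auto intro: Agamma_selfadjoint)
  moreover have "\<forall>f c d. f \<in> opdom (opclosure (Aop \<alpha> k)) \<longrightarrow>
      (AE x in Mp. f x + c * Psi \<alpha> k x + d * Phi \<alpha> k x = 0) \<longrightarrow> c = 0 \<and> d = 0"
    by (intro allI impI conjI) (erule (1) direct_sum)+
  moreover have "\<forall>f c. f \<in> opdom (opclosure (Aop \<alpha> k)) \<longrightarrow>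
      (AE x in Mp. f x + c * Psi \<alpha> k x = 0) \<longrightarrow> c = 0"
  proof (intro allI impI)
    fix f c
    assume f: "f \<in> opdom (opclosure (Aop \<alpha> k))" "AE x in Mp. f x + c * Psi \<alpha> k x = 0"
    show "c = 0" by (rule direct_sum(1)[where d = 0, OF f(1)]) (use f(2) in simp)
  qed
  ultimately show ?thesis
    using closure_domain adj_domain_eq_Dmax adj_domain_decomp kernel_eq Friedrichs_domain
      Friedrichs_domain_decomp form_domain Agamma_None_eq_Friedrichs
    by (intro conjI)
qed

end
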